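(* Let $\mathfrak S$ be a sovereign class of functions on domains in a dominion $\mathfrak D$. Let $R_1,R_2$ be real operator systems, $G\in\mathfrak D$ a domain in $\mathcal S(R_1)$, and $f\in\mathfrak S(G)$ a function with values in $\mathcal S(R_2)$. Then $f$ is real analytic (that is, real analytic at every $X\in G$).
   Context: **Operator systems and matrix universes.** A real operator system is a real linear subspace $R$, containing $1$, of the self-adjoint elements of a unital $C^*$-algebra $\mathcal A$. Put $\mathcal M(R)=\bigcup_n M_n(\mathbb C)\otimes_{\mathbb R}R$ and $\mathcal S(R)=\bigcup_n S_n(\mathbb C)\otimes_{\mathbb R}R$ (disjoint unions), where $S_n(\mathbb C)$ is the space of Hermitian $n\times n$ matrices. Level $n$ is viewed inside $M_n(\mathcal A)$, from which it inherits norm and order; $A\le B$ means $B-A$ is positive semidefinite. For a subset $V$, $V_n$ is its part at level $n$. **Domains and free functions.** A (free) domain in $\mathcal S(R)$ is a subset $G$ such that: $X\oplus Y\in G\iff X,Y\in G$; $X\in G_n$ implies $U^*XU\in G$ for every $n\times n$ unitary $U$; each $G_n$ is open in $S_n(\mathbb C)\otimes R$. A free function $f:G\to\mathcal S(R_2)$ maps level $n$ to level $n$, satisfies $f(X\oplus Y)=f(X)\oplus f(Y)$, and $S^{-1}f(X)S=f(S^{-1}XS)$ whenever $S\in M_n(\mathbb C)$ is invertible and $X,S^{-1}XS\in G_n$. **Balls.** For $X$ at level $n$, $B_{\mathbb R}(X,\varepsilon)=\bigcup_m\{Y\in\mathcal S(R)_{mn}:\|X^{\oplus m}-Y\|<\varepsilon\}$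 and $B_{\mathbb C}(X,\varepsilon)=\bigcup_m\{Y\in\mathcal M(R)_{mn}:\|X^{\oplus m}-Y\|<\varepsilon\}$. **Coordinatization.** $G^{(n)}$ is the sequence $(G_{mn})_{m\ge1}$ regarded as a subset of the matrix universe over $R\otimes M_n(\mathbb C)$ via $M_{mn}(\mathbb C)\otimes R\cong M_m(\mathbb C)\otimes(M_n(\mathbb C)\otimes R)$ (for Hermitian universes, over the real operator system $S_n(\mathbb C)\otimes R$); $f^{(n)}$ is $f$ restricted to the levels $mn$, regarded as a function on $G^{(n)}$, and $X^{(n)}$ is $X$ regarded as a point of $G^{(n)}$. **Dominion.** A dominion $\mathfrak D$ is a class of domains satisfying: - Translation invariance: if $G\in\mathfrak D$ is a domain over $R$ and $r\in R$, then $G+r\in\mathfrak D$. - Closure under intersection: $G,H\in\mathfrak D$ implies $G\cap H\in\mathfrak D$. - Closure under coordinatization: $G\in\mathfrak D$ implies $G^{(n)}\in\mathfrak D$. - Locality: for $G\in\mathfrak D$ and $X\in G_1$ there is $\varepsilon>0$ with $B_{\mathbb R}(X,\varepsilon)\subseteq G$ and $B_{\mathbb R}(X,\varepsilon)\in\mathfrak D$. - Scale invariance: $t>0$ and $G\in\mathfrak D$ imply $tG\in\mathfrak D$. **Sovereign class.** A sovereign class $\mathfrak S$ is a class of functions on domains in a dominion $\mathfrak D$ satisfying, with $\mathfrak S(G)$ the functions of the class on $G$: - Functions: for all $G\in\mathfrak D$, every element of $\mathfrak S(G)$ is a free function on $G$. - Local boundedness: each $f\in\mathfrak S(G)$ is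 locally bounded, and measurable on finite dimensional affine subspaces on each level. - Closure under localization: if $f\in\mathfrak S(G)$ and $H\subseteq G$ (with $H\in\mathfrak D$) then $f|_H\in\mathfrak S(H)$. - Closure under coordinatization: $f\in\mathfrak S(G)$ implies $f^{(n)}\in\mathfrak S(G^{(n)})$. - Closure under convolution: the set of functions in $\mathfrak S(G)$ taking values in $\mathcal S(R)$ is convex and closed under pointwise weak limits. - One-variable knowledge: if $A\le B$ (same size, segment joining them in $G$), then $f_{\overline{AB}}(t):=f\left(\frac{1-t}{2}A+\frac{1+t}{2}B\right)$ analytically continues to the unit disk $\mathbb D$ as a function of $t$. - Control: there is a map $\gamma$ taking each pair $(X,f)$ ($f\in\mathfrak S(G)$, $X\in G$) to a non-negative number such that: (1) for each $\varepsilon>0$ there is a universal constant $c(\varepsilon)$ such that $\inf_{X\in B_{\mathbb R}(X_0,\varepsilon)_1}\gamma(X,f)\le c(\varepsilon)\|f\|_{B_{\mathbb R}(X_0,\varepsilon)_1}$ (sup norm; $X_0$ at level 1 with the ball contained in the domain of $f$); (2) there is a universal positive valued function $e$ on $\mathbb R^+$ such that, writing $f_{\overline{AB}}(t)=\sum_k a_kt^k$ and $X=\frac{A+B}{2}$, $\|a_k\|\le\gamma(X,f)\,e(\|B-A\|)$; (3) if $H\subseteq G$ and $X\in H$ then $\gamma(X,f|_H)=\gamma(X,f)$; (4) $\gamma(X,f)=\gamma(X^{\oplus N},f)$; (5) $\gamma(X^{(n)},f^{(n)})=\gamma(X,f)$. **Real analyticity.** $f$ is real analytic at $X\in G_n$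 if there is $\delta>0$ such that for any choice of finitely many $H_i\in S_n(\mathbb C)\otimes R_1$ the induced free function of noncommuting variables $t_i$ has a power series expansion $f(X+\sum H_it_i)=\sum_\alpha a_\alpha t^\alpha$ (sum over words $\alpha$; $H_it_i$ means $H_i\otimes t_i$) valid for all $\|\sum H_it_i\|<\delta$. Equivalently, $f^{(n)}(X+Y)=\sum_jh_j(Y)$ with the series uniformly convergent for $X+Y\in B_{\mathbb C}(X,\delta)$, for noncommutative generalized homogeneous polynomials $h_j$ (of degree $j$), i.e. free functions whose restriction to any finite dimensional space is a noncommutative homogeneous polynomial of degree $j$ with coefficients from the range space.
   Formalization: The coefficients of the noncommutative homogeneous polynomials are required to lie in the norm closure of M_n(C)⊗R_2; if R_2 is not norm closed they need not lie in M_n(C)⊗R_2 itself, and for closed R_2 the two agree. *)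

theory Defs
  imports "HOL-Analysis.Analysis" "Jordan_Normal_Form.Matrix"
begin

section \<open>Unital C*-algebras\<close>

text \<open>Complex scalar multiplication is a parameter of the class because the library has only
  real normed algebras.  The superclass forces \<open>norm 1 = 1\<close>, so the zero algebra is excluded.\<close>

class cstar_algebra = real_normed_algebra_1 + banach +
  fixes cscale :: "complex \<Rightarrow> 'a \<Rightarrow> 'a" (infixr "*\<^sub>C" 75)
    and star :: "'a \<Rightarrow> 'a"
  assumes cscale_add_right: "c *\<^sub>C (x + y) = c *\<^sub>C x + c *\<^sub>C y"
    and cscale_add_left: "(c + d) *\<^sub>C x = c *\<^sub>C x + d *\<^sub>C x"
    and cscale_cscale: "c *\<^sub>C (d *\<^sub>C x) = (c * d) *\<^sub>C x"
    and cscale_of_real: "complex_of_real r *\<^sub>C x = r *\<^sub>R x"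
    and mult_cscale_left: "(c *\<^sub>C x) * y = c *\<^sub>C (x * y)"
    and mult_cscale_right: "x * (c *\<^sub>C y) = c *\<^sub>C (x * y)"
    and norm_cscale: "norm (c *\<^sub>C x) = cmod c * norm x"
    and star_star: "star (star x) = x"
    and star_add: "star (x + y) = star x + star y"
    and star_cscale: "star (c *\<^sub>C x) = cnj c *\<^sub>C star x"
    and star_mult: "star (x * y) = star y * star x"
    and cstar_identity: "norm (star x * x) = (norm x)\<^sup>2"

instantiation complex :: cstar_algebra
begin

definition cscale_complex :: "complex \<Rightarrow> complex \<Rightarrow> complex" where
  "cscale_complex c z = c * z"

definition star_complex :: "complex \<Rightarrow> complex" where
  "star_complex = cnj"

instance
  by standard
    (auto simp: cscale_complex_def star_complex_def algebra_simps norm_mult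
      power2_eq_square scaleR_conv_of_real)

end

section \<open>Matrices over a C*-algebra\<close>

definition mscale :: "complex \<Rightarrow> 'a::cstar_algebra mat \<Rightarrow> 'a mat" where
  "mscale c X = map_mat (cscale c) X"

definition mstar :: "'a::cstar_algebra mat \<Rightarrow> 'a mat" where
  "mstar X = map_mat star (transpose_mat X)"

text \<open>The library has no summation over matrices of a given size.\<close>

definition msum :: "nat \<Rightarrow> 'i set \<Rightarrow> ('i \<Rightarrow> 'a::cstar_algebra mat) \<Rightarrow> 'a mat" where
  "msum N I u = mat N N (\<lambda>p. \<Sum>i\<in>I. u i $$ p)"

text \<open>\<open>M\<^sub>N(A)\<close> acts on the right Hilbert module of columns \<open>A\<^sup>N\<close>, with \<open>A\<close>-valued inner
  product \<open>\<langle>v, w\<rangle> = v\<^sup>* w\<close>; the C*-norm of \<open>M\<^sub>N(A)\<close> is the operator norm of this action.\<close>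

definition colnorm :: "'a::cstar_algebra mat \<Rightarrow> real" where
  "colnorm v = sqrt (norm ((mstar v * v) $$ (0, 0)))"

definition mnorm :: "'a::cstar_algebra mat \<Rightarrow> real" where
  "mnorm X = Sup {colnorm (X * v) |v. v \<in> carrier_mat (dim_col X) 1 \<and> colnorm v \<le> 1}"

definition mpos :: "nat \<Rightarrow> 'a::cstar_algebra mat \<Rightarrow> bool" where
  "mpos N P \<longleftrightarrow> (\<exists>Y \<in> carrier_mat N N. P = mstar Y * Y)"

definition mle :: "nat \<Rightarrow> 'a::cstar_algebra mat \<Rightarrow> 'a mat \<Rightarrow> bool" where
  "mle N A B \<longleftrightarrow> mpos N (B - A)"

definition mopen :: "nat \<Rightarrow> 'a::cstar_algebra mat set \<Rightarrow> bool" where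
  "mopen N U \<longleftrightarrow> U \<subseteq> carrier_mat N N \<and>
     (\<forall>X\<in>U. \<exists>\<epsilon>>0. \<forall>Y\<in>carrier_mat N N. mnorm (Y - X) < \<epsilon> \<longrightarrow> Y \<in> U)"

definition mclosure :: "nat \<Rightarrow> 'a::cstar_algebra mat set \<Rightarrow> 'a mat set" where
  "mclosure N V = {Z \<in> carrier_mat N N. \<forall>\<epsilon>>0. \<exists>W\<in>V. mnorm (Z - W) < \<epsilon>}"

definition msums :: "nat \<Rightarrow> (nat \<Rightarrow> 'a::cstar_algebra mat) \<Rightarrow> 'a mat \<Rightarrow> bool" where
  "msums N u L \<longleftrightarrow> (\<forall>k. u k \<in> carrier_mat N N) \<and> L \<in> carrier_mat N N \<and>
     (\<forall>\<epsilon>>0. \<exists>K\<^sub>0. \<forall>K\<ge>K\<^sub>0. mnorm (msum N {..<K} u - L) < \<epsilon>)"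

definition kron :: "complex mat \<Rightarrow> 'a::cstar_algebra mat \<Rightarrow> 'a mat" where
  "kron T r = mat (dim_row T * dim_row r) (dim_col T * dim_col r)
     (\<lambda>(i, j). T $$ (i div dim_row r, j div dim_col r) *\<^sub>C r $$ (i mod dim_row r, j mod dim_col r))"

definition dsum :: "'a::cstar_algebra mat \<Rightarrow> 'a mat \<Rightarrow> 'a mat" where
  "dsum X Y = four_block_mat X (0\<^sub>m (dim_row X) (dim_col Y)) (0\<^sub>m (dim_row Y) (dim_col X)) Y"

text \<open>\<open>X\<^sup>\<oplus>\<^sup>m\<close>, the block-diagonal matrix with \<open>m\<close> blocks equal to \<open>X\<close>.\<close>

definition amp :: "nat \<Rightarrow> 'a::cstar_algebra mat \<Rightarrow> 'a mat" where
  "amp m X = kron (1\<^sub>m m) X"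

definition herm :: "nat \<Rightarrow> complex mat set" where
  "herm n = {T \<in> carrier_mat n n. mstar T = T}"

definition unitaries :: "nat \<Rightarrow> complex mat set" where
  "unitaries n = {U \<in> carrier_mat n n. mstar U * U = 1\<^sub>m n \<and> U * mstar U = 1\<^sub>m n}"

section \<open>Real operator systems and matrix universes\<close>

text \<open>The type \<^typ>\<open>'a\<close> serves as a universe: any set of unital C*-algebras embeds unitally and
  isometrically into one algebra (bounded operators on a large Hilbert space), and norm and order
  of matrices do not depend on the ambient C*-algebra.

  \<open>Opsys k R\<close> is a set \<open>R\<close> in the C*-algebra \<open>M\<^sub>k(A)\<close>, where \<open>A\<close> is \<^typ>\<open>'a\<close>
  (so \<open>k = 1\<close> gives subspaces of \<open>A\<close> itself).  Its universe at level \<open>n\<close> consists of \<open>nk \<times> nk\<close>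
  matrices over \<open>A\<close>, with \<open>M\<^sub>n(M\<^sub>k(A))\<close> identified with \<open>M\<^sub>n\<^sub>k(A)\<close> by erasing the block structure.
  Thus \<open>S\<^sub>n(\<complex>) \<otimes> R\<close> is again an operator system over the same type, of size \<open>nk\<close>, and the
  isomorphism \<open>M\<^sub>m\<^sub>n(\<complex>) \<otimes> R \<cong> M\<^sub>m(\<complex>) \<otimes> (M\<^sub>n(\<complex>) \<otimes> R)\<close> is the identity map on matrices.\<close>

datatype 'a opsys = Opsys (osize: nat) (elems: "'a mat set")

definition opsys :: "'a::cstar_algebra opsys \<Rightarrow> bool" where
  "opsys s \<longleftrightarrow> osize s \<ge> 1 \<and>
     elems s \<subseteq> {r \<in> carrier_mat (osize s) (osize s). mstar r = r} \<and>
     1\<^sub>m (osize s) \<in> elems s \<and>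
     (\<forall>r\<in>elems s. \<forall>r'\<in>elems s. r + r' \<in> elems s) \<and>
     (\<forall>r\<in>elems s. \<forall>c::real. mscale (of_real c) r \<in> elems s)"

text \<open>All finite sums of elementary tensors from two sets.  When both sets are real subspaces
  this is the real span, since real coefficients can be absorbed into \<open>T\<close>.\<close>

inductive_set tensor_span ::
    "complex mat set \<Rightarrow> 'a::cstar_algebra mat set \<Rightarrow> nat \<Rightarrow> 'a mat set"
  for C :: "complex mat set" and E :: "'a mat set" and N :: nat
where
  zero: "0\<^sub>m N N \<in> tensor_span C E N"
| add: "\<lbrakk>T \<in> C; r \<in> E; X \<in> tensor_span C E N\<rbrakk> \<Longrightarrow> kron T r + X \<in> tensor_span C E N"

text \<open>\<open>SU s n\<close> is \<open>S\<^sub>n(\<complex>) \<otimes> R\<close> and \<open>MU s n\<close> is \<open>M\<^sub>n(\<complex>) \<otimes>\<^sub>\<real> R\<close>.  Levels are always \<open>n \<ge> 1\<close>;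
  matrices of different levels have different sizes, so the unions over \<open>n\<close> are disjoint.\<close>

definition SU :: "'a::cstar_algebra opsys \<Rightarrow> nat \<Rightarrow> 'a mat set" where
  "SU s n = tensor_span (herm n) (elems s) (n * osize s)"

definition MU :: "'a::cstar_algebra opsys \<Rightarrow> nat \<Rightarrow> 'a mat set" where
  "MU s n = tensor_span (carrier_mat n n) (elems s) (n * osize s)"

definition universe :: "(nat \<Rightarrow> 'a mat set) \<Rightarrow> 'a mat set" where
  "universe V = (\<Union>n\<in>{1..}. V n)"

definition lev :: "'a::cstar_algebra opsys \<Rightarrow> 'a mat set \<Rightarrow> nat \<Rightarrow> 'a mat set" where
  "lev s G n = G \<inter> carrier_mat (n * osize s) (n * osize s)"

text \<open>\<open>matball (SU s) n X \<epsilon>\<close> and \<open>matball (MU s) n X \<epsilon>\<close> are the balls \<open>B\<^sub>\<real>(X, \<epsilon>)\<close> and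
  \<open>B\<^sub>\<complex>(X, \<epsilon>)\<close> around a point \<open>X\<close> of level \<open>n\<close>.\<close>

definition matball ::
    "(nat \<Rightarrow> 'a::cstar_algebra mat set) \<Rightarrow> nat \<Rightarrow> 'a mat \<Rightarrow> real \<Rightarrow> 'a mat set" where
  "matball V n X \<epsilon> = (\<Union>m\<in>{1..}. {Y \<in> V (m * n). mnorm (amp m X - Y) < \<epsilon>})"

text \<open>\<open>S\<^sup>-\<^sup>1 X S\<close> for complex matrices acting on the first tensor factor; \<open>S'\<close> is the left factor.\<close>

definition conj_by :: "'a::cstar_algebra opsys \<Rightarrow> complex mat \<Rightarrow> complex mat \<Rightarrow> 'a mat \<Rightarrow> 'a mat" where
  "conj_by s S' S X = kron S' (1\<^sub>m (osize s)) * X * kron S (1\<^sub>m (osize s))"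

section \<open>Domains and free functions\<close>

datatype 'a fdomain = FDom (dsys: "'a opsys") (pts: "'a mat set")

definition free_domain :: "'a::cstar_algebra fdomain \<Rightarrow> bool" where
  "free_domain D \<longleftrightarrow> (let s = dsys D; G = pts D in
     opsys s \<and> G \<subseteq> universe (SU s) \<and>
     (\<forall>X\<in>universe (SU s). \<forall>Y\<in>universe (SU s). dsum X Y \<in> G \<longleftrightarrow> X \<in> G \<and> Y \<in> G) \<and>
     (\<forall>n\<ge>1. \<forall>X\<in>lev s G n. \<forall>U\<in>unitaries n. conj_by s (mstar U) U X \<in> G) \<and>
     (\<forall>n\<ge>1. \<forall>X\<in>lev s G n. \<exists>\<epsilon>>0. \<forall>Y\<in>SU s n. mnorm (Y - X) < \<epsilon> \<longrightarrow> Y \<in> G))"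

text \<open>Graded maps respecting direct sums and similarities; \<open>V n\<close> is the target at level \<open>n\<close>.\<close>

definition free_map :: "'a::cstar_algebra opsys \<Rightarrow> 'a mat set \<Rightarrow> 'b::cstar_algebra opsys \<Rightarrow>
    (nat \<Rightarrow> 'b mat set) \<Rightarrow> ('a mat \<Rightarrow> 'b mat) \<Rightarrow> bool" where
  "free_map s1 G s2 V f \<longleftrightarrow>
     (\<forall>n\<ge>1. \<forall>X\<in>lev s1 G n. f X \<in> V n) \<and>
     (\<forall>X\<in>G. \<forall>Y\<in>G. f (dsum X Y) = dsum (f X) (f Y)) \<and>
     (\<forall>n\<ge>1. \<forall>X\<in>lev s1 G n. \<forall>S\<in>carrier_mat n n. \<forall>S'\<in>carrier_mat n n.
        inverts_mat S S' \<and> inverts_mat S' S \<and> conj_by s1 S' S X \<in> G \<longrightarrow>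
        conj_by s2 S' S (f X) = f (conj_by s1 S' S X))"

text \<open>A function carries its domain and the operator system of its codomain; off its domain it
  is \<open>undefined\<close>, so that restrictions are determined by their values.\<close>

datatype ('a, 'b) ffun =
  FFun (fdom: "'a fdomain") (fcod: "'b opsys") (fval: "'a mat \<Rightarrow> 'b mat")

definition free_fun :: "('a::cstar_algebra, 'b::cstar_algebra) ffun \<Rightarrow> bool" where
  "free_fun f \<longleftrightarrow> opsys (fcod f) \<and> fval f \<in> extensional (pts (fdom f)) \<and>
     free_map (dsys (fdom f)) (pts (fdom f)) (fcod f) (SU (fcod f)) (fval f)"

definition restr :: "('a, 'b) ffun \<Rightarrow> 'a fdomain \<Rightarrow> ('a, 'b) ffun" where
  "restr f H = FFun H (fcod f) (restrict (fval f) (pts H))"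

definition coord_sys :: "nat \<Rightarrow> 'a::cstar_algebra opsys \<Rightarrow> 'a opsys" where
  "coord_sys n s = Opsys (n * osize s) (SU s n)"

definition coord_dom :: "nat \<Rightarrow> 'a::cstar_algebra fdomain \<Rightarrow> 'a fdomain" where
  "coord_dom n D = FDom (coord_sys n (dsys D)) (\<Union>m\<in>{1..}. lev (dsys D) (pts D) (m * n))"

definition coord_fun :: "nat \<Rightarrow> ('a::cstar_algebra, 'b::cstar_algebra) ffun \<Rightarrow> ('a, 'b) ffun" where
  "coord_fun n f = FFun (coord_dom n (fdom f)) (coord_sys n (fcod f))
     (restrict (fval f) (pts (coord_dom n (fdom f))))"

section \<open>Dominions\<close>

definition translate :: "'a::cstar_algebra mat \<Rightarrow> 'a fdomain \<Rightarrow> 'a fdomain" where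
  "translate r D = FDom (dsys D) (\<Union>n\<in>{1..}. (\<lambda>X. X + amp n r) ` lev (dsys D) (pts D) n)"

definition dominion :: "'a::cstar_algebra fdomain set \<Rightarrow> bool" where
  "dominion \<DD> \<longleftrightarrow>
     (\<forall>D\<in>\<DD>. free_domain D) \<and>
     (\<forall>D\<in>\<DD>. \<forall>r\<in>elems (dsys D). translate r D \<in> \<DD>) \<and>
     (\<forall>s G H. FDom s G \<in> \<DD> \<and> FDom s H \<in> \<DD> \<longrightarrow> FDom s (G \<inter> H) \<in> \<DD>) \<and>
     (\<forall>D\<in>\<DD>. \<forall>n\<ge>1. coord_dom n D \<in> \<DD>) \<and>
     (\<forall>s G. FDom s G \<in> \<DD> \<longrightarrow> (\<forall>X\<in>lev s G 1.
        \<exists>\<epsilon>>0. matball (SU s) 1 X \<epsilon> \<subseteq> G \<and> FDom s (matball (SU s) 1 X \<epsilon>) \<in> \<DD>)) \<and>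
     (\<forall>s G. \<forall>t::real. FDom s G \<in> \<DD> \<and> t > 0 \<longrightarrow> FDom s (mscale (of_real t) ` G) \<in> \<DD>)"

section \<open>Sovereign classes\<close>

definition locally_bounded :: "('a::cstar_algebra, 'b::cstar_algebra) ffun \<Rightarrow> bool" where
  "locally_bounded f \<longleftrightarrow> (let s = dsys (fdom f); G = pts (fdom f) in
     \<forall>n\<ge>1. \<forall>X\<in>lev s G n. \<exists>\<epsilon>>0. \<exists>M. \<forall>Y\<in>lev s G n. mnorm (Y - X) < \<epsilon> \<longrightarrow> mnorm (fval f Y) \<le> M)"

text \<open>Lebesgue measurability with respect to affine coordinates \<open>(x\<^sub>i)\<^sub>i\<^sub><\<^sub>d\<close> on the finite
  dimensional affine subspace \<open>X\<^sub>0 + span {H\<^sub>i | i < d}\<close> of level \<open>n\<close>.\<close>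

definition finite_dim_measurable :: "('a::cstar_algebra, 'b::cstar_algebra) ffun \<Rightarrow> bool" where
  "finite_dim_measurable f \<longleftrightarrow> (let s = dsys (fdom f); G = pts (fdom f) in
     \<forall>n\<ge>1. \<forall>d::nat. \<forall>X\<^sub>0\<in>SU s n. \<forall>H. (\<forall>i<d. H i \<in> SU s n) \<longrightarrow>
       (\<forall>W. mopen (n * osize (fcod f)) W \<longrightarrow>
         {x \<in> {..<d} \<rightarrow>\<^sub>E (UNIV :: real set).
            let Y = X\<^sub>0 + msum (n * osize s) {..<d} (\<lambda>i. mscale (of_real (x i)) (H i))
            in Y \<in> G \<and> fval f Y \<in> W}
         \<in> sets (completion (Pi\<^sub>M {..<d} (\<lambda>_. lborel)))))"

definition bounded_functional :: "'a::cstar_algebra mat set \<Rightarrow> ('a mat \<Rightarrow> real) \<Rightarrow> bool" where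
  "bounded_functional V \<phi> \<longleftrightarrow>
     (\<forall>X\<in>V. \<forall>Y\<in>V. \<phi> (X + Y) = \<phi> X + \<phi> Y) \<and>
     (\<forall>X\<in>V. \<forall>c::real. \<phi> (mscale (of_real c) X) = c * \<phi> X) \<and>
     (\<exists>C. \<forall>X\<in>V. \<bar>\<phi> X\<bar> \<le> C * mnorm X)"

definition convex_class :: "('a::cstar_algebra, 'b::cstar_algebra) ffun set \<Rightarrow> bool" where
  "convex_class \<SS> \<longleftrightarrow> (\<forall>D s2 f g. \<forall>u\<in>{0..1::real}. FFun D s2 f \<in> \<SS> \<and> FFun D s2 g \<in> \<SS> \<longrightarrow>
     FFun D s2 (\<lambda>X\<in>pts D. mscale (of_real u) (f X) + mscale (of_real (1 - u)) (g X)) \<in> \<SS>)"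

text \<open>Limits of nets are expressed by proper filters on the function space.\<close>

definition weakly_closed_class ::
    "'a::cstar_algebra fdomain set \<Rightarrow> ('a, 'b::cstar_algebra) ffun set \<Rightarrow> bool" where
  "weakly_closed_class \<DD> \<SS> \<longleftrightarrow>
     (\<forall>D\<in>\<DD>. \<forall>s2. opsys s2 \<longrightarrow> (\<forall>F g.
        F \<noteq> bot \<and> eventually (\<lambda>f. FFun D s2 f \<in> \<SS>) F \<and>
        g \<in> extensional (pts D) \<and>
        (\<forall>n\<ge>1. \<forall>X\<in>lev (dsys D) (pts D) n. g X \<in> SU s2 n \<and>
           (\<forall>\<phi>. bounded_functional (SU s2 n) \<phi> \<longrightarrow> ((\<lambda>f. \<phi> (f X)) \<longlongrightarrow> \<phi> (g X)) F))
        \<longrightarrow> FFun D s2 g \<in> \<SS>))"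

definition seg :: "'a::cstar_algebra mat \<Rightarrow> 'a mat \<Rightarrow> real \<Rightarrow> 'a mat" where
  "seg A B t = mscale (of_real ((1 - t) / 2)) A + mscale (of_real ((1 + t) / 2)) B"

definition ordered_segment :: "'a::cstar_algebra fdomain \<Rightarrow> nat \<Rightarrow> 'a mat \<Rightarrow> 'a mat \<Rightarrow> bool" where
  "ordered_segment D n A B \<longleftrightarrow>
     A \<in> lev (dsys D) (pts D) n \<and> B \<in> lev (dsys D) (pts D) n \<and>
     mle (n * osize (dsys D)) A B \<and> (\<forall>t\<in>{-1..1}. seg A B t \<in> pts D)"

text \<open>The analytic continuation to the unit disk of a function on \<open>(-1, 1)\<close>, given by its power
  series at the centre.\<close>

definition disk_series :: "nat \<Rightarrow> (real \<Rightarrow> 'b::cstar_algebra mat) \<Rightarrow> (nat \<Rightarrow> 'b mat) \<Rightarrow> bool" where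
  "disk_series N \<phi> a \<longleftrightarrow> (\<forall>k. a k \<in> carrier_mat N N) \<and>
     (\<forall>z::complex. cmod z < 1 \<longrightarrow> (\<exists>L. msums N (\<lambda>k. mscale (z ^ k) (a k)) L)) \<and>
     (\<forall>t\<in>{-1<..<1}. msums N (\<lambda>k. mscale (of_real t ^ k) (a k)) (\<phi> t))"

definition one_variable_knowledge :: "('a::cstar_algebra, 'b::cstar_algebra) ffun \<Rightarrow> bool" where
  "one_variable_knowledge f \<longleftrightarrow>
     (\<forall>n\<ge>1. \<forall>A B. ordered_segment (fdom f) n A B \<longrightarrow>
        (\<exists>a. disk_series (n * osize (fcod f)) (\<lambda>t. fval f (seg A B t)) a))"

definition control ::
    "'a::cstar_algebra fdomain set \<Rightarrow> ('a, 'b::cstar_algebra) ffun set \<Rightarrow>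
     ('a mat \<Rightarrow> ('a, 'b) ffun \<Rightarrow> real) \<Rightarrow> (real \<Rightarrow> real) \<Rightarrow> (real \<Rightarrow> real) \<Rightarrow> bool" where
  "control \<DD> \<SS> \<gamma> c e \<longleftrightarrow>
     (\<forall>f\<in>\<SS>. \<forall>X\<in>pts (fdom f). \<gamma> X f \<ge> 0) \<and>
     (\<forall>\<epsilon>>0. \<forall>f\<in>\<SS>. let s = dsys (fdom f); G = pts (fdom f) in
        \<forall>X\<^sub>0\<in>lev s G 1. let B = matball (SU s) 1 X\<^sub>0 \<epsilon>; B\<^sub>1 = lev s B 1 in
          B \<subseteq> G \<and> bdd_above ((\<lambda>X. mnorm (fval f X)) ` B\<^sub>1) \<longrightarrow>
          (INF X\<in>B\<^sub>1. \<gamma> X f) \<le> c \<epsilon> * (SUP X\<in>B\<^sub>1. mnorm (fval f X))) \<and>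
     (\<forall>x>0. e x > 0) \<and>
     (\<forall>f\<in>\<SS>. \<forall>n\<ge>1. \<forall>A B a. ordered_segment (fdom f) n A B \<and> A \<noteq> B \<and>
        disk_series (n * osize (fcod f)) (\<lambda>t. fval f (seg A B t)) a \<longrightarrow>
        (\<forall>k. mnorm (a k) \<le> \<gamma> (seg A B 0) f * e (mnorm (B - A)))) \<and>
     (\<forall>f\<in>\<SS>. \<forall>H\<in>\<DD>. dsys H = dsys (fdom f) \<and> pts H \<subseteq> pts (fdom f) \<longrightarrow>
        (\<forall>X\<in>pts H. \<gamma> X (restr f H) = \<gamma> X f)) \<and>
     (\<forall>f\<in>\<SS>. \<forall>X\<in>pts (fdom f). \<forall>N\<ge>1. \<gamma> X f = \<gamma> (amp N X) f) \<and>
     (\<forall>f\<in>\<SS>. \<forall>n\<ge>1. \<forall>X\<in>pts (coord_dom n (fdom f)). \<gamma> X (coord_fun n f) = \<gamma> X f)"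

definition sovereign_class ::
    "'a::cstar_algebra fdomain set \<Rightarrow> ('a, 'b::cstar_algebra) ffun set \<Rightarrow> bool" where
  "sovereign_class \<DD> \<SS> \<longleftrightarrow>
     (\<forall>f\<in>\<SS>. fdom f \<in> \<DD> \<and> free_fun f) \<and>
     (\<forall>f\<in>\<SS>. locally_bounded f \<and> finite_dim_measurable f) \<and>
     (\<forall>f\<in>\<SS>. \<forall>H\<in>\<DD>. dsys H = dsys (fdom f) \<and> pts H \<subseteq> pts (fdom f) \<longrightarrow> restr f H \<in> \<SS>) \<and>
     (\<forall>f\<in>\<SS>. \<forall>n\<ge>1. coord_fun n f \<in> \<SS>) \<and>
     convex_class \<SS> \<and> weakly_closed_class \<DD> \<SS> \<and>
     (\<forall>f\<in>\<SS>. one_variable_knowledge f) \<and>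
     (\<exists>\<gamma> c e. control \<DD> \<SS> \<gamma> c e)"

section \<open>Real analyticity\<close>

definition words :: "nat \<Rightarrow> nat \<Rightarrow> nat list set" where
  "words d j = {\<alpha>. length \<alpha> = j \<and> set \<alpha> \<subseteq> {..<d}}"

definition word_pow :: "nat \<Rightarrow> (nat \<Rightarrow> complex mat) \<Rightarrow> nat list \<Rightarrow> complex mat" where
  "word_pow m t \<alpha> = foldr (\<lambda>i P. t i * P) \<alpha> (1\<^sub>m m)"

text \<open>\<open>H t = \<Sum>\<^sub>i H\<^sub>i t\<^sub>i\<close> in the coordinates \<open>M\<^sub>m(\<complex>) \<otimes> R\<close>, where the tensor factor \<open>t\<^sub>i\<close> comes first.\<close>

definition lin_form ::
    "'a::cstar_algebra opsys \<Rightarrow> nat \<Rightarrow> nat \<Rightarrow> (nat \<Rightarrow> 'a mat) \<Rightarrow> (nat \<Rightarrow> complex mat) \<Rightarrow> 'a mat" where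
  "lin_form s m d H t = msum (m * osize s) {..<d} (\<lambda>i. kron (t i) (H i))"

definition word_sum ::
    "'b::cstar_algebra opsys \<Rightarrow> nat \<Rightarrow> nat \<Rightarrow> nat \<Rightarrow> (nat list \<Rightarrow> 'b mat) \<Rightarrow> (nat \<Rightarrow> complex mat) \<Rightarrow> 'b mat" where
  "word_sum s m d j a t = msum (m * osize s) (words d j) (\<lambda>\<alpha>. kron (word_pow m t \<alpha>) (a \<alpha>))"

text \<open>The range space is taken to be norm closed: \<open>R\<close> need not be closed in the C*-algebra, and
  derivatives of an \<open>R\<close>-valued function lie only in the closure of the span of \<open>R\<close>.\<close>

definition range_level :: "'b::cstar_algebra opsys \<Rightarrow> nat \<Rightarrow> 'b mat set" where
  "range_level s m = mclosure (m * osize s) (MU s m)"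

definition nc_homogeneous ::
    "'a::cstar_algebra opsys \<Rightarrow> 'b::cstar_algebra opsys \<Rightarrow> nat \<Rightarrow> ('a mat \<Rightarrow> 'b mat) \<Rightarrow> bool" where
  "nc_homogeneous s1 s2 j h \<longleftrightarrow>
     free_map s1 (universe (MU s1)) s2 (range_level s2) h \<and>
     (\<forall>d H. (\<forall>i<d. H i \<in> elems s1) \<longrightarrow>
        (\<exists>a. (\<forall>\<alpha>. a \<alpha> \<in> range_level s2 1) \<and>
             (\<forall>m\<ge>1. \<forall>t. (\<forall>i<d. t i \<in> carrier_mat m m) \<longrightarrow>
                h (lin_form s1 m d H t) = word_sum s2 m d j a t)))"

text \<open>Real analyticity at a point of level 1: on the real ball, \<open>f (X + Y)\<close> is the sum of
  generalized homogeneous polynomials \<open>h\<^sub>j(Y)\<close>, whose series converges uniformly on the complex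
  ball (to \<open>F\<close>, the extension of \<open>Y \<mapsto> f (X + Y)\<close>).\<close>

definition real_analytic_at_1 :: "('a::cstar_algebra, 'b::cstar_algebra) ffun \<Rightarrow> 'a mat \<Rightarrow> bool" where
  "real_analytic_at_1 f X \<longleftrightarrow> (let s1 = dsys (fdom f); s2 = fcod f in
     \<exists>\<delta>>0. \<exists>h F.
       matball (SU s1) 1 X \<delta> \<subseteq> pts (fdom f) \<and>
       (\<forall>j. nc_homogeneous s1 s2 j (h j)) \<and>
       (\<forall>m\<ge>1. \<forall>Y\<in>MU s1 m. mnorm Y < \<delta> \<longrightarrow> F Y \<in> carrier_mat (m * osize s2) (m * osize s2)) \<and>
       (\<forall>m\<ge>1. \<forall>Y\<in>SU s1 m. mnorm Y < \<delta> \<longrightarrow> F Y = fval f (amp m X + Y)) \<and>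
       (\<forall>\<epsilon>>0. \<exists>J\<^sub>0. \<forall>J\<ge>J\<^sub>0. \<forall>m\<ge>1. \<forall>Y\<in>MU s1 m. mnorm Y < \<delta> \<longrightarrow>
          mnorm (msum (m * osize s2) {..<J} (\<lambda>j. h j Y) - F Y) < \<epsilon>))"

lemma tensor_span_mono: "C \<subseteq> C' \<Longrightarrow> tensor_span C E N \<subseteq> tensor_span C' E N"
proof
  fix X assume "C \<subseteq> C'" and "X \<in> tensor_span C E N"
  from this(2,1) show "X \<in> tensor_span C' E N"
    by (induction rule: tensor_span.induct) (auto intro: tensor_span.intros)
qed

lemma lin_form_in_SU:
  assumes s: "opsys s" and H: "\<And>i. i < d \<Longrightarrow> H i \<in> elems s" and t: "\<And>i. i < d \<Longrightarrow> t i \<in> herm m"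
  shows "lin_form s m d H t \<in> SU s m"
  using H t
proof (induction d)
  case 0
  have "lin_form s m 0 H t = 0\<^sub>m (m * osize s) (m * osize s)"
    by (rule eq_matI) (auto simp: lin_form_def msum_def)
  then show ?case by (simp add: SU_def tensor_span.zero)
next
  case (Suc d)
  have d: "H d \<in> carrier_mat (osize s) (osize s)" "t d \<in> carrier_mat m m"
    using s Suc.prems(1)[of d] Suc.prems(2)[of d] by (auto simp: opsys_def herm_def)
  have "lin_form s m (Suc d) H t = kron (t d) (H d) + lin_form s m d H t"
    by (rule eq_matI) (use d in \<open>auto simp: lin_form_def msum_def kron_def lessThan_Suc\<close>)
  then show ?case
    using Suc.IH Suc.prems(1)[of d] Suc.prems(2)[of d] Suc.prems
    by (auto simp: SU_def intro!: tensor_span.add)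
qed

text \<open>At points of level 1 real analyticity contains the description by noncommutative power series: with \<open>\<delta>\<close>
  independent of \<open>H\<close>, one has \<open>f (X + H t) = \<Sum>\<^sub>\<alpha> a\<^sub>\<alpha> t\<^sup>\<alpha>\<close>, the words being summed by length.\<close>

lemma real_analytic_at_1_power_series:
  assumes s: "opsys (dsys (fdom f))" and an: "real_analytic_at_1 f X"
  shows "\<exists>\<delta>>0. matball (SU (dsys (fdom f))) 1 X \<delta> \<subseteq> pts (fdom f) \<and>
    (\<forall>d H. (\<forall>i<d. H i \<in> elems (dsys (fdom f))) \<longrightarrow>
      (\<exists>a. (\<forall>\<alpha>. a \<alpha> \<in> range_level (fcod f) 1) \<and>
        (\<forall>m\<ge>1. \<forall>t. (\<forall>i<d. t i \<in> herm m) \<and> mnorm (lin_form (dsys (fdom f)) m d H t) < \<delta> \<longrightarrow>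
          msums (m * osize (fcod f)) (\<lambda>j. word_sum (fcod f) m d j a t)
            (fval f (amp m X + lin_form (dsys (fdom f)) m d H t)))))"
proof -
  let ?s1 = "dsys (fdom f)" and ?s2 = "fcod f"
  obtain \<delta> h F where \<delta>: "\<delta> > 0" and ball: "matball (SU ?s1) 1 X \<delta> \<subseteq> pts (fdom f)"
    and h: "\<forall>j. nc_homogeneous ?s1 ?s2 j (h j)"
    and Fc: "\<forall>m\<ge>1. \<forall>Y\<in>MU ?s1 m. mnorm Y < \<delta> \<longrightarrow>
      F Y \<in> carrier_mat (m * osize ?s2) (m * osize ?s2)"
    and Ff: "\<forall>m\<ge>1. \<forall>Y\<in>SU ?s1 m. mnorm Y < \<delta> \<longrightarrow> F Y = fval f (amp m X + Y)"
    and conv: "\<forall>\<epsilon>>0. \<exists>J\<^sub>0. \<forall>J\<ge>J\<^sub>0. \<forall>m\<ge>1. \<forall>Y\<in>MU ?s1 m. mnorm Y < \<delta> \<longrightarrow>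
      mnorm (msum (m * osize ?s2) {..<J} (\<lambda>j. h j Y) - F Y) < \<epsilon>"
    using an unfolding real_analytic_at_1_def Let_def by (elim exE conjE) (rule that)
  have "\<exists>a. (\<forall>\<alpha>. a \<alpha> \<in> range_level ?s2 1) \<and>
        (\<forall>m\<ge>1. \<forall>t. (\<forall>i<d. t i \<in> herm m) \<and> mnorm (lin_form ?s1 m d H t) < \<delta> \<longrightarrow>
          msums (m * osize ?s2) (\<lambda>j. word_sum ?s2 m d j a t)
            (fval f (amp m X + lin_form ?s1 m d H t)))"
    if H: "\<forall>i<d. H i \<in> elems ?s1" for d H
  proof -
    have "\<exists>a. (\<forall>\<alpha>. a \<alpha> \<in> range_level ?s2 1) \<and>
             (\<forall>m\<ge>1. \<forall>t. (\<forall>i<d. t i \<in> carrier_mat m m) \<longrightarrow>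
                h j (lin_form ?s1 m d H t) = word_sum ?s2 m d j a t)" for j
      using h H unfolding nc_homogeneous_def by blast
    then obtain b where b: "\<And>j \<alpha>. b j \<alpha> \<in> range_level ?s2 1"
      "\<And>j m t. m \<ge> 1 \<Longrightarrow> (\<forall>i<d. t i \<in> carrier_mat m m) \<Longrightarrow>
         h j (lin_form ?s1 m d H t) = word_sum ?s2 m d j (b j) t"
      using choice[of "\<lambda>j a. (\<forall>\<alpha>. a \<alpha> \<in> range_level ?s2 1) \<and>
             (\<forall>m\<ge>1. \<forall>t. (\<forall>i<d. t i \<in> carrier_mat m m) \<longrightarrow>
                h j (lin_form ?s1 m d H t) = word_sum ?s2 m d j a t)"] by blast
    define a where "a \<alpha> = b (length \<alpha>) \<alpha>" for \<alpha>
    have ab: "word_sum ?s2 m d j (b j) t = word_sum ?s2 m d j a t" for m j t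
      by (auto simp: word_sum_def msum_def a_def words_def intro!: cong_mat sum.cong)
    have "msums (m * osize ?s2) (\<lambda>j. word_sum ?s2 m d j a t)
            (fval f (amp m X + lin_form ?s1 m d H t))"
      if m: "m \<ge> 1" and t: "\<forall>i<d. t i \<in> herm m" and small: "mnorm (lin_form ?s1 m d H t) < \<delta>" for m t
    proof -
      let ?Y = "lin_form ?s1 m d H t"
      have Y: "?Y \<in> SU ?s1 m" using lin_form_in_SU[OF s] H t by blast
      then have Y': "?Y \<in> MU ?s1 m"
        using tensor_span_mono[of "herm m" "carrier_mat m m"] by (auto simp: SU_def MU_def herm_def)
      have tc: "\<forall>i<d. t i \<in> carrier_mat m m" using t by (auto simp: herm_def)
      have hj: "h j ?Y = word_sum ?s2 m d j a t" for j
        using b(2)[OF m tc, of j] ab by simp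
      have FY: "F ?Y = fval f (amp m X + ?Y)" using Ff m Y small by blast
      have FYc: "fval f (amp m X + ?Y) \<in> carrier_mat (m * osize ?s2) (m * osize ?s2)"
        unfolding FY[symmetric] using Fc m Y' small by blast
      have "word_sum ?s2 m d j a t \<in> carrier_mat (m * osize ?s2) (m * osize ?s2)" for j
        by (simp add: word_sum_def msum_def)
      moreover have "\<exists>K\<^sub>0. \<forall>K\<ge>K\<^sub>0. mnorm (msum (m * osize ?s2) {..<K} (\<lambda>j. word_sum ?s2 m d j a t)
          - fval f (amp m X + ?Y)) < \<epsilon>" if eps: "\<epsilon> > 0" for \<epsilon>
      proof -
        obtain K\<^sub>0 where "\<forall>J\<ge>K\<^sub>0. \<forall>m\<ge>1. \<forall>Y\<in>MU ?s1 m. mnorm Y < \<delta> \<longrightarrow>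
            mnorm (msum (m * osize ?s2) {..<J} (\<lambda>j. h j Y) - F Y) < \<epsilon>"
          using conv eps by blast
        then show ?thesis
          using m Y' small by (auto simp flip: hj FY)
      qed
      ultimately show ?thesis
        using FYc by (auto simp: msums_def)
    qed
    then show ?thesis using b(1) by (intro exI[of _ a]) (auto simp: a_def)
  qed
  then show ?thesis using \<delta> ball by blast
qed

definition real_analytic_at ::
    "nat \<Rightarrow> ('a::cstar_algebra, 'b::cstar_algebra) ffun \<Rightarrow> 'a mat \<Rightarrow> bool" where
  "real_analytic_at n f X \<longleftrightarrow> real_analytic_at_1 (coord_fun n f) X"

end

theory Submission imports Defs "HOL-Computational_Algebra.Computational_Algebra"
begin

text \<open>
  Passing to coordinates, the point may be taken at level \<open>1\<close>.  Write \<open>g m Y\<close> for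
  \<open>f (X\<^sup>\<oplus>\<^sup>m + Y)\<close>.  A sovereign class provides power series only along positive
  directions, but at all matrix levels at once and, at the centre, with bounds that do not depend on
  the level (\<open>sovereign_level_one\<close>).  The proof reconstructs from this the noncommutative homogeneous
  polynomials \<open>h\<^sub>k\<close>.

  The first step is real-variable: a function on a square with a power series in every direction of a
  quadrant, with a bound depending on the base point, has Taylor coefficients at the origin that are
  polynomial in the direction (\<open>coefficients_poly_on\<close>, by Baire's theorem).  So the \<open>k\<close>-th coefficient
  \<open>A k P\<close> of \<open>t \<mapsto> g (tP)\<close> is a polynomial of degree at most \<open>k\<close> along every segment in a cone of
  positive matrices (\<open>A_segment\<close>), and it inherits intertwining from \<open>g\<close>.

  The second step is noncommutative polarization.  For arbitrary \<open>Y\<^sub>0, \<dots>, Y\<^sub>k\<^sub>-\<^sub>1\<close> at level \<open>m\<close> let \<open>W\<close> be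
  the block matrix with the \<open>Y\<^sub>i\<close> above the diagonal.  For large \<open>c\<close> the matrix \<open>c + W + W\<^sup>*\<close> lies in the
  cone, and the corner block \<open>M(Y\<^sub>0, \<dots>, Y\<^sub>k\<^sub>-\<^sub>1)\<close> of its \<open>k\<close>-th coefficient is multilinear: it is
  polynomial along segments, equivariant under phases in each slot, and therefore bounded by a multiple of
  the product of the norms (\<open>M_product_bound\<close>, \<open>M_slot_add\<close>).  Intertwining reduces elementary tensors to
  level \<open>1\<close>: \<open>M(t\<^sub>0 \<otimes> H\<^sub>0, \<dots>) = t\<^sub>0 \<dots> t\<^sub>k\<^sub>-\<^sub>1 \<otimes> M(H\<^sub>0, \<dots>)\<close> (\<open>M_kron\<close>).  Hence \<open>h\<^sub>k Y = M(Y, \<dots>, Y)\<close> is a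
  noncommutative homogeneous polynomial (\<open>hpart_nc_homogeneous\<close>), defined on all of the complex universe,
  and the spectral decomposition of a path graph shows that it extends \<open>A k\<close> (\<open>M_diagonal\<close>).

  Finally the norm of \<open>h\<^sub>k\<close> grows at most geometrically with \<open>k\<close>, uniformly in the level, so that
  \<open>\<Sum>\<^sub>k h\<^sub>k\<close> converges uniformly on a complex ball (\<open>total_tail\<close>).  On the cone its sum is \<open>g\<close>; analytic
  continuation along a line that enters the cone extends this to all Hermitian \<open>Y\<close> in the ball
  (\<open>hpart_sums\<close>).
\<close>

section \<open>C*-algebras\<close>

abbreviation sqmat :: "nat \<Rightarrow> 'a mat set" where "sqmat n \<equiv> carrier_mat n n"

lemma star_scaleR: "star (r *\<^sub>R x) = r *\<^sub>R star (x::'a::cstar_algebra)"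
  by (metis cscale_of_real star_cscale complex_cnj_complex_of_real)

lemma star_zero [simp]: "star (0::'a::cstar_algebra) = 0"
  using star_scaleR[of 0 "0::'a"] by simp

lemma star_minus: "star (- x) = - star (x::'a::cstar_algebra)"
  using star_scaleR[of "-1" x] by simp

lemma star_diff: "star (x - y) = star x - star (y::'a::cstar_algebra)"
  using star_add[of x "-y"] by (simp add: star_minus)

lemma star_one [simp]: "star (1::'a::cstar_algebra) = 1"
  by (metis mult_1 mult_1_right star_mult star_star)

lemma star_of_real [simp]: "star (of_real r :: 'a::cstar_algebra) = of_real r"
  by (simp add: of_real_def star_scaleR)

lemma star_sum: "star (sum f I) = (\<Sum>i\<in>I. star (f i :: 'a::cstar_algebra))"
  by (induction I rule: infinite_finite_induct) (simp_all add: star_add)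

lemma norm_star [simp]: "norm (star x) = norm (x::'a::cstar_algebra)"
proof -
  have le: "norm y \<le> norm (star y)" for y :: 'a
  proof (cases "y = 0")
    case False
    have "norm y * norm y \<le> norm (star y) * norm y"
      using cstar_identity[of y] norm_mult_ineq[of "star y" y] by (simp add: power2_eq_square)
    then show ?thesis using False by simp
  qed simp
  show ?thesis using le[of x] le[of "star x"] by (simp add: star_star)
qed

lemma tendsto_star: "(f \<longlongrightarrow> l) F \<Longrightarrow> ((\<lambda>n. star (f n)) \<longlongrightarrow> star (l::'a::cstar_algebra)) F"
  unfolding tendsto_dist_iff[of _ l] tendsto_dist_iff[of _ "star l"] dist_norm star_diff[symmetric] norm_star .

lemma cscale_zero_left [simp]: "0 *\<^sub>C x = (0::'a::cstar_algebra)"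
  using cscale_of_real[of 0 x] by simp

lemma cscale_zero_right [simp]: "c *\<^sub>C (0::'a::cstar_algebra) = 0"
  using cscale_add_right[of c 0 "0::'a"] by simp

lemma cscale_one [simp]: "1 *\<^sub>C x = (x::'a::cstar_algebra)"
  using cscale_of_real[of 1 x] by simp

lemma cscale_minus_left: "(- c) *\<^sub>C x = - (c *\<^sub>C (x::'a::cstar_algebra))"
  using cscale_add_left[of c "-c" x] by (simp add: eq_neg_iff_add_eq_0 add.commute)

lemma cscale_minus_right: "c *\<^sub>C (- x) = - (c *\<^sub>C (x::'a::cstar_algebra))"
  using cscale_add_right[of c x "-x"] by (simp add: eq_neg_iff_add_eq_0 add.commute)

lemma cscale_diff_right: "c *\<^sub>C (x - y) = c *\<^sub>C x - c *\<^sub>C (y::'a::cstar_algebra)"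
  using cscale_add_right[of c x "-y"] by (simp add: cscale_minus_right)

lemma cscale_sum_right: "c *\<^sub>C sum f I = (\<Sum>i\<in>I. c *\<^sub>C (f i :: 'a::cstar_algebra))"
  by (induction I rule: infinite_finite_induct) (simp_all add: cscale_add_right)

lemma cscale_sum_left: "sum f I *\<^sub>C x = (\<Sum>i\<in>I. f i *\<^sub>C (x :: 'a::cstar_algebra))"
  by (induction I rule: infinite_finite_induct) (simp_all add: cscale_add_left)

lemma cscale_scaleR: "c *\<^sub>C (r *\<^sub>R x) = r *\<^sub>R (c *\<^sub>C (x::'a::cstar_algebra))"
  by (metis cscale_cscale cscale_of_real mult.commute)

lemma sa_cartesian_parts:
  fixes u :: "'a::cstar_algebra"
  obtains p q where "star p = p" "star q = q" "u = p + \<i> *\<^sub>C q"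
proof
  let ?p = "(1/2) *\<^sub>R (u + star u)" and ?q = "(1/2) *\<^sub>R ((-\<i>) *\<^sub>C (u - star u))"
  show "star ?p = ?p" by (simp add: star_scaleR star_add star_star add.commute)
  show "star ?q = ?q"
    by (simp add: star_scaleR star_cscale star_diff star_star cscale_minus_left cscale_diff_right)
  have "\<i> *\<^sub>C ?q = (1/2) *\<^sub>R (u - star u)"
    by (simp add: cscale_scaleR cscale_cscale)
  then show "u = ?p + \<i> *\<^sub>C ?q"
    by (simp add: algebra_simps flip: scaleR_add_left)
qed

section \<open>Square roots in Banach algebras\<close>

primrec sqrt_iter :: "'a::real_normed_algebra_1 \<Rightarrow> nat \<Rightarrow> 'a" where
  "sqrt_iter h 0 = 0"
| "sqrt_iter h (Suc n) = (1/2) *\<^sub>R (h + sqrt_iter h n * sqrt_iter h n)"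

lemma sqrt_iter_one_bounds:
  "0 \<le> sqrt_iter (1::real) n \<and> sqrt_iter 1 n \<le> sqrt_iter (1::real) (Suc n) \<and> sqrt_iter (1::real) n \<le> 1"
proof (induction n)
  case (Suc n)
  let ?t = "sqrt_iter (1::real)"
  have le: "?t (Suc n) \<le> 1" using Suc by (simp add: mult_le_one)
  have "?t n * ?t n \<le> ?t (Suc n) * ?t (Suc n)"
    using Suc by (intro mult_mono) auto
  then show ?case using Suc le by simp
qed simp

lemma convergent_sqrt_iter_one: "convergent (sqrt_iter (1::real))"
proof (rule Bseq_mono_convergent)
  show "Bseq (sqrt_iter (1::real))"
    using sqrt_iter_one_bounds by (intro BseqI'[of _ 1]) (simp add: abs_of_nonneg)
  show "\<forall>m. \<forall>n\<ge>m. sqrt_iter (1::real) m \<le> sqrt_iter 1 n"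
  proof (intro allI impI)
    fix m n :: nat assume "m \<le> n"
    then show "sqrt_iter (1::real) m \<le> sqrt_iter 1 n"
    proof (induction rule: dec_induct)
      case (step n)
      then show ?case using sqrt_iter_one_bounds[of n] by linarith
    qed simp
  qed
qed

text \<open>The iteration has nonnegative coefficients in \<open>h\<close>, so it is dominated by its
  value at the scalar \<open>1\<close>.\<close>

lemma sqrt_iter_increment:
  fixes h :: "'a::real_normed_algebra_1"
  assumes h: "norm h \<le> 1"
  shows "norm (sqrt_iter h n) \<le> sqrt_iter 1 n \<and>
    norm (sqrt_iter h (Suc n) - sqrt_iter h n) \<le> sqrt_iter 1 (Suc n) - sqrt_iter 1 n"
proof (induction n)
  case 0
  then show ?case using h by simp
next
  case (Suc n)
  let ?y = "sqrt_iter h" and ?t = "sqrt_iter (1::real)"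
  have a: "norm (?y (Suc n)) \<le> ?t (Suc n)"
  proof -
    have "norm (?y n * ?y n) \<le> ?t n * ?t n"
      using Suc sqrt_iter_one_bounds[of n] by (intro order_trans[OF norm_mult_ineq] mult_mono) auto
    then have "norm (h + ?y n * ?y n) \<le> 1 + ?t n * ?t n"
      using h norm_triangle_ineq[of h "?y n * ?y n"] by linarith
    then show ?thesis by simp
  qed
  let ?d = "?y (Suc n) - ?y n"
  have "?y (Suc (Suc n)) - ?y (Suc n) = (1/2) *\<^sub>R (?d * ?y (Suc n) + ?y n * ?d)"
    by (subst sqrt_iter.simps(2), subst (2) sqrt_iter.simps(2)) (simp add: algebra_simps del: sqrt_iter.simps)
  also have "norm \<dots> \<le> (1/2) * ((?t (Suc n) - ?t n) * ?t (Suc n) + ?t n * (?t (Suc n) - ?t n))"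
  proof -
    have "norm (?d * ?y (Suc n)) \<le> (?t (Suc n) - ?t n) * ?t (Suc n)"
      using Suc a sqrt_iter_one_bounds[of n]
      by (intro order_trans[OF norm_mult_ineq] mult_mono) auto
    moreover have "norm (?y n * ?d) \<le> ?t n * (?t (Suc n) - ?t n)"
      using Suc sqrt_iter_one_bounds[of n]
      by (intro order_trans[OF norm_mult_ineq] mult_mono) auto
    ultimately show ?thesis
      using norm_triangle_ineq[of "?d * ?y (Suc n)" "?y n * ?d"] by (simp del: sqrt_iter.simps)
  qed
  also have "\<dots> = ?t (Suc (Suc n)) - ?t (Suc n)"
  proof -
    have "?t (Suc (Suc n)) = (1 + ?t (Suc n) * ?t (Suc n)) / 2" "2 * ?t (Suc n) = 1 + ?t n * ?t n"
      by simp_all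
    then show ?thesis by (simp add: algebra_simps del: sqrt_iter.simps)
  qed
  finally show ?case using a by blast
qed

lemma convergent_of_dominated_increments:
  fixes y :: "nat \<Rightarrow> 'a::banach" and t :: "nat \<Rightarrow> real"
  assumes d: "\<And>n. norm (y (Suc n) - y n) \<le> t (Suc n) - t n" and t: "convergent t"
  shows "convergent y"
proof -
  have s: "summable (\<lambda>n. t (Suc n) - t n)"
    using t telescope_summable by (auto simp: convergent_def)
  then have "summable (\<lambda>n. y (Suc n) - y n)"
    using d by (intro summable_comparison_test'[OF s]) auto
  then have "convergent (\<lambda>n. \<Sum>i<n. y (Suc i) - y i)"
    by (simp add: summable_iff_convergent)
  then have "convergent (\<lambda>n. (\<Sum>i<n. y (Suc i) - y i) + y 0)"
    by (intro convergent_add convergent_const)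
  then show ?thesis by (simp add: sum_lessThan_telescope)
qed

text \<open>The limit solves \<open>2y = h + y\<^sup>2\<close>, so \<open>1 - y\<close> is a square root
  of \<open>1 - h\<close>.\<close>

lemma sqrt_iter_limit:
  fixes h :: "'a::{real_normed_algebra_1,banach}"
  assumes h: "norm h \<le> 1"
  obtains y where "sqrt_iter h \<longlonglongrightarrow> y" "(1 - y) * (1 - y) = 1 - h" "norm y \<le> 1"
    "\<And>z. z * h = h * z \<Longrightarrow> z * y = y * z"
proof -
  obtain y where y: "sqrt_iter h \<longlonglongrightarrow> y"
    using convergent_of_dominated_increments[OF conjunct2[OF sqrt_iter_increment[OF h]] convergent_sqrt_iter_one]
    by (auto simp: convergent_def)
  have "(\<lambda>n. sqrt_iter h (Suc n)) \<longlonglongrightarrow> (1/2) *\<^sub>R (h + y * y)"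
    unfolding sqrt_iter.simps by (intro tendsto_intros y)
  then have "y = (1/2) *\<^sub>R (h + y * y)"
    using LIMSEQ_Suc[OF y] LIMSEQ_unique by blast
  then have eq: "2 *\<^sub>R y = h + y * y"
    by (metis scaleR_one scaleR_scaleR nonzero_mult_div_cancel_left times_divide_eq_right mult_1_right zero_neq_numeral)
  have "(1 - y) * (1 - y) = 1 - 2 *\<^sub>R y + y * y" by (simp add: algebra_simps scaleR_2)
  then have sq: "(1 - y) * (1 - y) = 1 - h" using eq by simp
  have ny: "norm y \<le> 1"
  proof (rule LIMSEQ_le_const2[OF tendsto_norm[OF y]], intro exI allI impI)
    show "norm (sqrt_iter h n) \<le> 1" for n
      using sqrt_iter_increment[OF h, of n] sqrt_iter_one_bounds[of n] by linarith
  qed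
  have "z * y = y * z" if "z * h = h * z" for z
  proof -
    have "z * sqrt_iter h n = sqrt_iter h n * z" for n
    proof (induction n)
      case (Suc n)
      have "z * (sqrt_iter h n * sqrt_iter h n) = sqrt_iter h n * sqrt_iter h n * z"
        by (metis Suc mult.assoc)
      then show ?case using that by (simp add: algebra_simps)
    qed simp
    then have "(\<lambda>n. z * sqrt_iter h n) \<longlonglongrightarrow> y * z"
      by (simp add: tendsto_mult_right[OF y])
    moreover have "(\<lambda>n. z * sqrt_iter h n) \<longlonglongrightarrow> z * y" by (rule tendsto_mult_left[OF y])
    ultimately show ?thesis using LIMSEQ_unique by blast
  qed
  then show thesis using that y sq ny by blast
qed

section \<open>Positive elements\<close>

text \<open>Positivity through norms alone: the spectrum of \<open>a\<close> lies in \<open>[0,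
  2c]\<close>.  Closure under sums is then the triangle inequality, and no functional calculus is
  needed.\<close>

definition cpos :: "'a::cstar_algebra \<Rightarrow> bool" where
  "cpos a \<longleftrightarrow> star a = a \<and> (\<exists>c. norm (of_real c - a) \<le> c)"

lemma norm_of_real_diff_mono:
  fixes a :: "'a::cstar_algebra"
  assumes "norm (of_real c - a) \<le> c" "c \<le> d"
  shows "norm (of_real d - a) \<le> d"
proof -
  have "of_real d - a = (of_real c - a) + of_real (d - c)" by simp
  then have "norm (of_real d - a) \<le> norm (of_real c - a) + norm (of_real (d - c) :: 'a)"
    by (metis norm_triangle_ineq)
  then show ?thesis using assms by (simp add: norm_of_real del: of_real_diff)
qed

lemma cpos_star: "cpos a \<Longrightarrow> star a = a" by (simp add: cpos_def)

lemma cpos_add: "cpos a \<Longrightarrow> cpos b \<Longrightarrow> cpos (a + b)"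
proof -
  assume "cpos a" "cpos b"
  then obtain c d where c: "star a = a" "star b = b" "norm (of_real c - a) \<le> c" "norm (of_real d - b) \<le> d"
    by (auto simp: cpos_def)
  have "norm (of_real (c + d) - (a + b)) \<le> norm (of_real c - a) + norm (of_real d - b)"
    by (metis norm_triangle_ineq add_diff_add of_real_add)
  then have "norm (of_real (c + d) - (a + b)) \<le> c + d" using c by linarith
  then show ?thesis unfolding cpos_def using c star_add by metis
qed

lemma cpos_scaleR: "cpos a \<Longrightarrow> 0 \<le> r \<Longrightarrow> cpos (r *\<^sub>R a)"
proof -
  assume "cpos a" "0 \<le> r"
  then obtain c where c: "star a = a" "norm (of_real c - a) \<le> c" by (auto simp: cpos_def)
  have "of_real (r * c) - r *\<^sub>R a = r *\<^sub>R (of_real c - a)"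
    by (simp add: scaleR_conv_of_real right_diff_distrib)
  then have "norm (of_real (r * c) - r *\<^sub>R a) \<le> r * c"
    using c \<open>0 \<le> r\<close> by (simp add: mult_left_mono)
  then show ?thesis unfolding cpos_def using c star_scaleR by metis
qed

lemma cpos_of_real: "0 \<le> r \<Longrightarrow> cpos (of_real r :: 'a::cstar_algebra)"
  unfolding cpos_def by (metis diff_self norm_zero star_of_real)

lemma cpos_zero [simp]: "cpos (0::'a::cstar_algebra)" using cpos_of_real[of 0] by simp

lemma cpos_one [simp]: "cpos (1::'a::cstar_algebra)" using cpos_of_real[of 1] by simp

lemma cpos_sum: "(\<And>i. i \<in> I \<Longrightarrow> cpos (f i)) \<Longrightarrow> cpos (sum f I)"
  by (induction I rule: infinite_finite_induct) (auto intro: cpos_add)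

lemma cpos_norm_diff: "star a = a \<Longrightarrow> norm a \<le> c \<Longrightarrow> cpos (of_real c - (a::'a::cstar_algebra))"
  unfolding cpos_def by (intro conjI exI[of _ c]) (simp_all add: star_diff)

text \<open>With \<open>k = (1 - s\<^sup>2)\<^sup>1\<^sup>/\<^sup>2\<close> the element \<open>s +
  ik\<close> is unitary, so its imaginary part \<open>k\<close> has norm at most
  \<open>1\<close>.\<close>

lemma norm_one_minus_sa_square:
  fixes s :: "'a::cstar_algebra"
  assumes s: "star s = s" "norm s \<le> 1"
  shows "norm (1 - s * s) \<le> 1"
proof -
  have "norm (s * s) \<le> 1" using s by (intro order_trans[OF norm_mult_ineq] mult_le_one) auto
  then obtain y where y: "sqrt_iter (s * s) \<longlonglongrightarrow> y" "(1 - y) * (1 - y) = 1 - s * s"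
    "\<And>z. z * (s * s) = (s * s) * z \<Longrightarrow> z * y = y * z" using sqrt_iter_limit by blast
  define k where "k = 1 - y"
  have "star (sqrt_iter (s * s) n) = sqrt_iter (s * s) n" for n
    by (induction n) (simp_all add: star_scaleR star_add star_mult s)
  then have "star y = y" using tendsto_star[OF y(1)] y(1) LIMSEQ_unique by auto
  then have k: "star k = k" "k * k = 1 - s * s" "s * k = k * s"
    using y(2) y(3)[of s] by (auto simp: k_def star_diff algebra_simps)
  define u where "u = s + \<i> *\<^sub>C k"
  have su: "star u = s - \<i> *\<^sub>C k" by (simp add: u_def star_add star_cscale s k cscale_minus_left)
  have "star u * u = s * s + k * k"
    unfolding su unfolding u_def
    by (simp add: distrib_left left_diff_distrib mult_cscale_left mult_cscale_right cscale_cscale k(3)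
        cscale_minus_left cscale_diff_right)
  then have "(norm u)\<^sup>2 = 1" using cstar_identity[of u] k by simp
  then have nu: "norm u = 1" using norm_ge_zero[of u] by (auto simp: power2_eq_1_iff simp del: norm_ge_zero)
  have "norm (u - star u) \<le> 2" using norm_triangle_ineq4[of u "star u"] nu by simp
  also have "u - star u = 2 *\<^sub>R (\<i> *\<^sub>C k)" unfolding su by (simp add: u_def scaleR_2)
  finally have "norm k \<le> 1" by (simp add: norm_cscale)
  then have "norm (k * k) \<le> 1" by (intro order_trans[OF norm_mult_ineq] mult_le_one) auto
  then show ?thesis by (simp add: k)
qed

lemma norm_of_real_minus_sa_square:
  fixes s :: "'a::cstar_algebra"
  assumes s: "star s = s" "norm (s * s) \<le> c"
  shows "norm (of_real c - s * s) \<le> c"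
proof (cases "c = 0")
  case False
  then have c: "c > 0" using s(2) norm_ge_zero[of "s * s"] by linarith
  define r where "r = (1 / sqrt c) *\<^sub>R s"
  have sr: "star r = r" by (simp add: r_def star_scaleR s)
  have rr: "r * r = (1 / c) *\<^sub>R (s * s)" using c by (simp add: r_def)
  have "(norm r)\<^sup>2 = norm (s * s) / c" using cstar_identity[of r] c by (simp add: sr rr)
  also have "\<dots> \<le> 1\<^sup>2" using c s by simp
  finally have "norm r \<le> 1" by (rule power2_le_imp_le) simp
  then have "norm (1 - r * r) \<le> 1" using norm_one_minus_sa_square sr by blast
  moreover have "of_real c - s * s = c *\<^sub>R (1 - r * r)"
    using c by (simp add: rr scaleR_diff_right of_real_def)
  ultimately show ?thesis using c by (simp add: mult_left_le)
qed (use s in simp)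

lemma cpos_sa_square: "star s = s \<Longrightarrow> cpos (s * s)"
  unfolding cpos_def using norm_of_real_minus_sa_square[OF _ order_refl] by (auto simp: star_mult)

lemma cpos_sqrt:
  fixes a :: "'a::cstar_algebra"
  assumes "cpos a"
  obtains s where "cpos s" "s * s = a" "\<And>z. z * a = a * z \<Longrightarrow> z * s = s * z"
proof -
  obtain c where sa: "star a = a" and c: "norm (of_real c - a) \<le> c" using assms by (auto simp: cpos_def)
  define d where "d = c + 1"
  have "c \<ge> 0" using c norm_ge_zero order_trans by blast
  then have d: "d > 0" by (simp add: d_def)
  have nd: "norm (of_real d - a) \<le> d" using norm_of_real_diff_mono[OF c, of d] by (simp add: d_def)
  define h where "h = 1 - (1/d) *\<^sub>R a"
  have "h = (1/d) *\<^sub>R (of_real d - a)" using d by (simp add: h_def scaleR_diff_right of_real_def)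
  then have "norm h \<le> 1" using nd d by simp
  then obtain y where y: "sqrt_iter h \<longlonglongrightarrow> y" "(1 - y) * (1 - y) = 1 - h" "norm y \<le> 1"
    "\<And>z. z * h = h * z \<Longrightarrow> z * y = y * z" using sqrt_iter_limit by blast
  have sh: "star h = h" by (simp add: h_def star_diff star_scaleR sa)
  have "star (sqrt_iter h n) = sqrt_iter h n" for n
    by (induction n) (simp_all add: star_scaleR star_add star_mult sh)
  then have sy: "star y = y" using tendsto_star[OF y(1)] y(1) LIMSEQ_unique by auto
  define s where "s = sqrt d *\<^sub>R (1 - y)"
  have p1: "cpos (1 - y)" using cpos_norm_diff[OF sy y(3)] by simp
  show thesis
  proof
    show "cpos s" unfolding s_def using p1 d by (intro cpos_scaleR) auto
    show "s * s = a" using d by (simp add: s_def y(2)) (simp add: h_def)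
    show "z * s = s * z" if "z * a = a * z" for z
    proof -
      have "z * h = h * z" using that by (simp add: h_def algebra_simps)
      then show ?thesis using y(4)[of z] by (simp add: s_def algebra_simps)
    qed
  qed
qed

lemma norm_of_real_minus_cpos:
  assumes "cpos a" "norm a \<le> c" shows "norm (of_real c - a) \<le> c"
proof -
  obtain s where "cpos s" "s * s = a" by (rule cpos_sqrt[OF assms(1)]) blast
  then show ?thesis using norm_of_real_minus_sa_square[of s c] assms(2) by (simp add: cpos_star)
qed

lemma cpos_limit:
  fixes a :: "nat \<Rightarrow> 'a::cstar_algebra"
  assumes p: "\<And>n. cpos (a n)" and l: "a \<longlonglongrightarrow> x"
  shows "cpos x"
proof -
  have "Bseq a" by (rule convergent_imp_Bseq[OF convergentI[OF l]])
  then obtain c where c: "\<And>n. norm (a n) \<le> c" by (auto simp: Bseq_def)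
  have "star x = x" using tendsto_star[OF l] l p LIMSEQ_unique by (auto simp: cpos_def)
  moreover have "norm (of_real c - x) \<le> c"
    by (rule LIMSEQ_le_const2[of "\<lambda>n. norm (of_real c - a n)"])
       (use norm_of_real_minus_cpos[OF p c] in \<open>auto intro!: tendsto_intros l\<close>)
  ultimately show ?thesis by (auto simp: cpos_def)
qed

lemma cpos_mult_commuting:
  fixes a b :: "'a::cstar_algebra"
  assumes a: "cpos a" and b: "cpos b" and ab: "a * b = b * a"
  shows "cpos (a * b)"
proof -
  obtain s where s: "cpos s" "s * s = a" "\<And>z. z * a = a * z \<Longrightarrow> z * s = s * z" by (rule cpos_sqrt[OF a]) blast
  obtain t where t: "cpos t" "t * t = b" "\<And>z. z * b = b * z \<Longrightarrow> z * t = t * z" by (rule cpos_sqrt[OF b]) blast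
  have "b * s = s * b" using s(3) ab by metis
  then have st: "s * t = t * s" using t(3) by metis
  then have "star (s * t) = s * t" using s(1) t(1) by (simp add: star_mult cpos_star)
  then have "cpos ((s * t) * (s * t))" by (rule cpos_sa_square)
  moreover have "(s * t) * (s * t) = a * b"
  proof -
    have "(s * t) * (s * t) = s * (t * s) * t" by (simp add: mult.assoc)
    also have "\<dots> = a * b" unfolding st[symmetric] s(2)[symmetric] t(2)[symmetric] by (simp add: mult.assoc)
    finally show ?thesis .
  qed
  ultimately show ?thesis by simp
qed

text \<open>For \<open>c = norm b\<close> both \<open>a\<close> and \<open>c - a\<close> have square
  roots \<open>s\<close> and \<open>t\<close>; since \<open>(s + it)\<^sup>* (s + it) = c\<close>, the
  real part \<open>s\<close> satisfies \<open>norm s ^ 2 \<le> c\<close>.\<close>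

lemma cpos_norm_mono:
  fixes a b :: "'a::cstar_algebra"
  assumes a: "cpos a" and ba: "cpos (b - a)"
  shows "norm a \<le> norm b"
proof -
  have "star ((b - a) + a) = (b - a) + a" by (rule cpos_star[OF cpos_add[OF ba a]])
  then have sb: "star b = b" by simp
  define c where "c = norm b"
  have "cpos ((of_real c - b) + (b - a))"
    using cpos_norm_diff[OF sb] ba unfolding c_def by (intro cpos_add) auto
  then have ca: "cpos (of_real c - a)" by simp
  obtain s where s: "cpos s" "s * s = a" "\<And>z. z * a = a * z \<Longrightarrow> z * s = s * z" by (rule cpos_sqrt[OF a]) blast
  obtain t where t: "cpos t" "t * t = of_real c - a" "\<And>z. z * (of_real c - a) = (of_real c - a) * z \<Longrightarrow> z * t = t * z"
    by (rule cpos_sqrt[OF ca]) blast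
  have "s * (of_real c - a) = (of_real c - a) * s"
  proof -
    have "s * a = a * s" unfolding s(2)[symmetric] by (simp add: mult.assoc)
    then show ?thesis by (simp add: of_real_def left_diff_distrib right_diff_distrib)
  qed
  then have st: "s * t = t * s" using t(3) by blast
  define u where "u = s + \<i> *\<^sub>C t"
  have su: "star u = s - \<i> *\<^sub>C t"
    using s(1) t(1) by (simp add: u_def star_add star_cscale cpos_star cscale_minus_left)
  have "star u * u = of_real c"
    unfolding su unfolding u_def
    by (simp add: distrib_left left_diff_distrib mult_cscale_left mult_cscale_right cscale_cscale st
        cscale_minus_left cscale_diff_right s(2) t(2))
  then have nu: "(norm u)\<^sup>2 = c" using cstar_identity[of u] by (simp add: c_def norm_of_real)
  have "norm (u + star u) \<le> 2 * norm u" using norm_triangle_ineq[of u "star u"] by simp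
  also have "u + star u = 2 *\<^sub>R s" unfolding su by (simp add: u_def scaleR_2)
  finally have "norm s \<le> norm u" by simp
  then have "(norm s)\<^sup>2 \<le> (norm u)\<^sup>2" by (rule power_mono) simp
  moreover have "norm a = (norm s)\<^sup>2" using cstar_identity[of s] s(1,2) by (simp add: cpos_star)
  ultimately show ?thesis using nu c_def by simp
qed

text \<open>For \<open>norm h = 1\<close> the absolute value \<open>r\<close> of \<open>h\<close> is the
  limit of \<open>r\<^sub>n\<^sub>+\<^sub>1 = r\<^sub>n - (r\<^sub>n\<^sup>2 - h\<^sup>2)/2\<close>, the
  iteration for the square root of \<open>h\<^sup>2\<close>, which starts at \<open>1\<close> and keeps
  \<open>r\<^sub>n - h\<close> and \<open>r\<^sub>n + h\<close> positive.\<close>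

lemma sa_abs:
  fixes h :: "'a::cstar_algebra"
  assumes h: "star h = h"
  obtains r where "r * r = h * h" "cpos (r - h)" "cpos (r + h)" "r * h = h * r"
proof (cases "h = 0")
  case False
  define d where "d = norm h"
  have d: "d > 0" using False by (simp add: d_def)
  define k where "k = (1/d) *\<^sub>R h"
  have k: "star k = k" "norm k = 1" using h d by (auto simp: k_def star_scaleR d_def)
  have nkk: "norm (k * k) \<le> 1" using norm_mult_ineq[of k k] k by simp
  define q where "q = 1 - k * k"
  have sq: "star q = q" by (simp add: q_def star_diff star_mult k)
  have nq: "norm q \<le> 1" unfolding q_def using k by (intro norm_one_minus_sa_square) auto
  have pq: "cpos q" using cpos_norm_diff[of "k * k" 1] nkk by (simp add: q_def star_mult k)
  obtain y where y: "sqrt_iter q \<longlonglongrightarrow> y" "(1 - y) * (1 - y) = 1 - q"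
    "\<And>z. z * q = q * z \<Longrightarrow> z * y = y * z" using sqrt_iter_limit[OF nq] by blast
  have yn: "cpos (sqrt_iter q n) \<and> k * sqrt_iter q n = sqrt_iter q n * k" for n
  proof (induction n)
    case (Suc n)
    let ?y = "sqrt_iter q n"
    have "cpos (q + ?y * ?y)" using Suc pq by (intro cpos_add cpos_mult_commuting) auto
    moreover have "k * (q + ?y * ?y) = (q + ?y * ?y) * k"
    proof -
      have "k * (?y * ?y) = ?y * ?y * k" using Suc by (metis mult.assoc)
      moreover have "k * q = q * k" by (simp add: q_def algebra_simps)
      ultimately show ?thesis by (simp add: distrib_left distrib_right)
    qed
    ultimately show ?case by (simp add: cpos_scaleR)
  qed simp
  have pk: "cpos (1 - sqrt_iter q n - k) \<and> cpos (1 - sqrt_iter q n + k)" for n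
  proof (induction n)
    case 0
    show ?case using cpos_norm_diff[of k 1] cpos_norm_diff[of "- k" 1] k by (simp add: star_minus)
  next
    case (Suc n)
    define r where "r = 1 - sqrt_iter q n"
    have ny: "norm (sqrt_iter q n) \<le> 1"
      using sqrt_iter_increment[OF nq, of n] sqrt_iter_one_bounds[of n] by linarith
    have nr: "norm r \<le> 1" using norm_of_real_minus_cpos[of "sqrt_iter q n" 1] yn[of n] ny by (simp add: r_def)
    have sr: "star r = r" using yn[of n] by (simp add: r_def star_diff cpos_star)
    have rk: "r * k = k * r" using yn[of n] by (simp add: r_def algebra_simps)
    have "q + sqrt_iter q n * sqrt_iter q n = 2 *\<^sub>R 1 - 2 *\<^sub>R r + (r * r - k * k)"
      by (simp add: q_def r_def algebra_simps scaleR_2)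
    then have "1 - sqrt_iter q (Suc n) = 1 - (1/2) *\<^sub>R (2 *\<^sub>R 1 - 2 *\<^sub>R r + (r * r - k * k))"
      by simp
    also have "\<dots> = r - (1/2) *\<^sub>R (r * r - k * k)"
      unfolding scaleR_add_right scaleR_diff_right by simp
    finally have next_r: "1 - sqrt_iter q (Suc n) = r - (1/2) *\<^sub>R (r * r - k * k)" .
    have half: "cpos (1 - (1/2) *\<^sub>R (r + e))" if "star e = e" "norm e = 1" for e
      using cpos_norm_diff[of "(1/2) *\<^sub>R (r + e)" 1] norm_triangle_ineq[of r e] nr that sr
      by (simp add: star_scaleR star_add)
    have f: "r * r - k * k = (r - k) * (r + k)" "r * r - k * k = (r + k) * (r - k)"
      using rk by (simp_all add: algebra_simps)
    have "cpos ((r - k) * (1 - (1/2) *\<^sub>R (r + k)))"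
      using Suc half[of k] k rk by (intro cpos_mult_commuting) (auto simp: r_def[symmetric] algebra_simps)
    moreover have "(r - k) * (1 - (1/2) *\<^sub>R (r + k)) = 1 - sqrt_iter q (Suc n) - k"
      unfolding next_r f(1) by (simp add: right_diff_distrib)
    moreover have "cpos ((r + k) * (1 - (1/2) *\<^sub>R (r + (- k))))"
      using Suc half[of "- k"] k rk by (intro cpos_mult_commuting) (auto simp: r_def[symmetric] algebra_simps star_minus)
    moreover have "(r + k) * (1 - (1/2) *\<^sub>R (r + (- k))) = 1 - sqrt_iter q (Suc n) + k"
      unfolding next_r f(2) by (simp add: right_diff_distrib)
    ultimately show ?case by simp
  qed
  define r where "r = 1 - y"
  have l1: "cpos (r - k)" unfolding r_def
    by (rule cpos_limit[of "\<lambda>n. 1 - sqrt_iter q n - k"]) (use pk in blast, intro tendsto_intros y(1))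
  have l2: "cpos (r + k)" unfolding r_def
    by (rule cpos_limit[of "\<lambda>n. 1 - sqrt_iter q n + k"]) (use pk in blast, intro tendsto_intros y(1))
  have rr: "r * r = k * k" using y(2) by (simp add: r_def q_def)
  have rk: "r * k = k * r" using y(3)[of k] by (simp add: r_def q_def algebra_simps)
  have hk: "h = d *\<^sub>R k" using d by (simp add: k_def)
  show thesis
  proof (rule that[of "d *\<^sub>R r"])
    show "d *\<^sub>R r * d *\<^sub>R r = h * h" by (simp add: hk rr)
    show "cpos (d *\<^sub>R r - h)" "cpos (d *\<^sub>R r + h)"
      using cpos_scaleR[OF l1, of d] cpos_scaleR[OF l2, of d] d by (simp_all add: hk scaleR_diff_right scaleR_add_right)
    show "d *\<^sub>R r * h = h * d *\<^sub>R r" by (simp add: hk rk)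
  qed
qed (use that[of 0] in simp)

lemma sa_square_zero:
  fixes a :: "'a::cstar_algebra"
  assumes "star a = a" "a * a = 0" shows "a = 0"
  using cstar_identity[of a] assms by simp

text \<open>Kaplansky's theorem.  With \<open>h = h\<^sub>+ - h\<^sub>-\<close> and \<open>y = x
  h\<^sub>-\<close> one has \<open>y\<^sup>* y = - n\<close> for the positive element \<open>n =
  h\<^sub>-\<^sup>3\<close>.  Then \<open>y y\<^sup>*\<close> is positive because \<open>y\<^sup>* y + y
  y\<^sup>*\<close> is a sum of squares; after normalizing, \<open>(1 + e)\<^sup>m e\<close> stays
  bounded by the positivity of \<open>y y\<^sup>*\<close>, but grows like \<open>m e\<^sup>2\<close> by
  Bernoulli's inequality.  Hence \<open>n = 0\<close>.\<close>

theorem cpos_star_mult: "cpos (star x * (x::'a::cstar_algebra))"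
proof -
  define h where "h = star x * x"
  have sh: "star h = h" by (simp add: h_def star_mult star_star)
  obtain r where r: "r * r = h * h" "cpos (r - h)" "cpos (r + h)" "r * h = h * r"
    by (rule sa_abs[OF sh]) blast
  define hp where "hp = (1/2) *\<^sub>R (r + h)"
  define hm where "hm = (1/2) *\<^sub>R (r - h)"
  have phm: "cpos hm" "cpos hp" using r by (auto simp: hm_def hp_def intro!: cpos_scaleR)
  have hphm: "hp * hm = 0" using r by (simp add: hp_def hm_def algebra_simps)
  have hd: "h = hp - hm" by (simp add: hp_def hm_def flip: scaleR_diff_right)
  define n where "n = hm * hm * hm"
  have pn: "cpos n" unfolding n_def using phm by (intro cpos_mult_commuting) (auto simp: mult.assoc)
  define y where "y = x * hm"
  have "star y * y = hm * h * hm" using phm by (simp add: y_def star_mult cpos_star h_def mult.assoc)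
  also have "\<dots> = hm * (hp * hm) - hm * (hm * hm)" by (simp add: hd algebra_simps)
  finally have yy: "star y * y = - n" by (simp add: hphm n_def mult.assoc)
  have n0: "n = 0"
  proof (cases "y = 0")
    case True then show ?thesis using yy by simp
  next
    case False
    define d where "d = norm y"
    have d: "d > 0" using False by (simp add: d_def)
    define z where "z = (1/d) *\<^sub>R y"
    define e where "e = (1/d\<^sup>2) *\<^sub>R n"
    have pe: "cpos e" unfolding e_def using pn by (intro cpos_scaleR) auto
    have zz: "star z * z = - e" using yy by (simp add: z_def e_def star_scaleR power2_eq_square)
    have nz: "norm z = 1" using d by (simp add: z_def d_def)
    obtain p q where pq: "star p = p" "star q = q" "z = p + \<i> *\<^sub>C q" by (rule sa_cartesian_parts)
    have "star z = p - \<i> *\<^sub>C q" by (simp add: pq star_add star_cscale cscale_minus_left)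
    then have "star z * z + z * star z = 2 *\<^sub>R (p * p + q * q)"
      by (simp add: pq(3) distrib_left distrib_right left_diff_distrib right_diff_distrib mult_cscale_left
          mult_cscale_right cscale_cscale cscale_minus_left cscale_diff_right cscale_add_right scaleR_2)
    then have "z * star z = 2 *\<^sub>R (p * p + q * q) + e" using zz by (simp add: algebra_simps)
    moreover have "cpos (2 *\<^sub>R (p * p + q * q) + e)"
      by (intro cpos_add cpos_scaleR cpos_sa_square pq pe) simp
    ultimately have "cpos (z * star z)" by simp
    then have nzz: "norm (1 - z * star z) \<le> 1"
      using norm_of_real_minus_cpos[of "z * star z" 1] norm_mult_ineq[of z "star z"] nz by simp
    have comm: "star z * (1 - z * star z) ^ m = (1 - star z * z) ^ m * star z" for m
    proof (induction m)
      case (Suc m)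
      have "star z * (1 - z * star z) ^ Suc m = (star z * (1 - z * star z) ^ m) * (1 - z * star z)"
        by (metis mult.assoc power_Suc2)
      also have "\<dots> = (1 - star z * z) ^ m * (star z * (1 - z * star z))" by (simp add: Suc mult.assoc)
      also have "star z * (1 - z * star z) = (1 - star z * z) * star z" by (simp add: algebra_simps)
      finally show ?case by (metis mult.assoc power_Suc2)
    qed simp
    have bound: "norm ((1 + e) ^ m * e) \<le> 1" for m
    proof -
      have "(1 + e) ^ m * e = - ((1 - star z * z) ^ m * (star z * z))" by (simp add: zz)
      also have "\<dots> = - (star z * (1 - z * star z) ^ m * z)" by (simp add: comm mult.assoc)
      finally have "norm ((1 + e) ^ m * e) \<le> norm (star z * (1 - z * star z) ^ m) * norm z"
        by (simp add: norm_mult_ineq)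
      also have "\<dots> \<le> norm (star z) * norm ((1 - z * star z) ^ m)" using norm_mult_ineq[of "star z" "(1 - z * star z) ^ m"] nz by simp
      also have "\<dots> \<le> norm (1 - z * star z) ^ m" using nz norm_power_ineq by simp
      also have "\<dots> \<le> 1" using nzz by (simp add: power_le_one)
      finally show ?thesis .
    qed
    have ce: "e * (1 + e) ^ m = (1 + e) ^ m * e" for m
      by (rule power_commuting_commutes[symmetric]) (simp add: algebra_simps)
    have p1: "cpos ((1 + e) ^ m)" for m
    proof (induction m)
      case (Suc m)
      have "cpos ((1 + e) ^ m + e * (1 + e) ^ m)"
        using Suc pe ce[of m] by (intro cpos_add cpos_mult_commuting)
      then show ?case by (simp add: algebra_simps)
    qed simp
    have p2: "cpos ((1 + e) ^ m - 1)" for m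
    proof (induction m)
      case (Suc m)
      have "cpos (((1 + e) ^ m - 1) + e * (1 + e) ^ m)"
        using Suc pe ce[of m] p1 by (intro cpos_add cpos_mult_commuting)
      then show ?case by (simp add: algebra_simps)
    qed simp
    \<comment> \<open>Bernoulli's inequality for the order given by positive elements.\<close>
    have p3: "cpos ((1 + e) ^ m - real m *\<^sub>R e)" for m
    proof (induction m)
      case (Suc m)
      have "cpos (((1 + e) ^ m - real m *\<^sub>R e) + e * ((1 + e) ^ m - 1))"
        using Suc pe ce[of m] p2 by (intro cpos_add cpos_mult_commuting) (auto simp: algebra_simps)
      then show ?case by (simp add: algebra_simps)
    qed simp
    have "real m * norm (e * e) \<le> 1" for m
    proof -
      have "cpos (((1 + e) ^ m - real m *\<^sub>R e) * e)"
        using p3 pe ce[of m] by (intro cpos_mult_commuting) (auto simp: algebra_simps)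
      then have "cpos ((1 + e) ^ m * e - real m *\<^sub>R (e * e))" by (simp add: algebra_simps)
      moreover have "cpos (real m *\<^sub>R (e * e))" using pe by (intro cpos_scaleR cpos_mult_commuting) auto
      ultimately have "norm (real m *\<^sub>R (e * e)) \<le> norm ((1 + e) ^ m * e)" by (intro cpos_norm_mono)
      then show ?thesis using bound[of m] by simp
    qed
    then have "norm (e * e) = 0"
      by (metis linorder_not_le mult.commute norm_ge_zero order_le_less reals_Archimedean3)
    then have "e = 0" using sa_square_zero[of e] pe by (simp add: cpos_star)
    then show ?thesis using d by (simp add: e_def)
  qed
  have "hm * hm = 0"
  proof (rule sa_square_zero)
    show "star (hm * hm) = hm * hm" using phm by (simp add: star_mult cpos_star)
    show "hm * hm * (hm * hm) = 0" using n0 by (simp add: n_def flip: mult.assoc)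
  qed
  then have "hm = 0" using sa_square_zero[of hm] phm by (simp add: cpos_star)
  then show ?thesis using phm hd by (simp add: h_def)
qed

section \<open>Columns over a C*-algebra\<close>

text \<open>Columns are functions of which the first \<open>N\<close> values matter, so that they need
  no carrier conditions.\<close>

definition ip :: "nat \<Rightarrow> (nat \<Rightarrow> 'a::cstar_algebra) \<Rightarrow> (nat \<Rightarrow> 'a) \<Rightarrow> 'a" where
  "ip N v w = (\<Sum>i<N. star (v i) * w i)"

definition cn :: "nat \<Rightarrow> (nat \<Rightarrow> 'a::cstar_algebra) \<Rightarrow> real" where
  "cn N v = sqrt (norm (ip N v v))"

lemma cpos_ip [simp]: "cpos (ip N v v)"
  unfolding ip_def by (intro cpos_sum cpos_star_mult)

lemma cn_nonneg [simp]: "cn N v \<ge> 0" by (simp add: cn_def)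

lemma cn_power2: "(cn N v)\<^sup>2 = norm (ip N v v)" by (simp add: cn_def)

lemma star_ip: "star (ip N v w) = ip N w v"
  by (simp add: ip_def star_sum star_mult star_star)

lemma ip_cong: "(\<And>i. i < N \<Longrightarrow> v i = v' i) \<Longrightarrow> (\<And>i. i < N \<Longrightarrow> w i = w' i) \<Longrightarrow> ip N v w = ip N v' w'"
  by (simp add: ip_def)

lemma cn_cong: "(\<And>i. i < N \<Longrightarrow> v i = v' i) \<Longrightarrow> cn N v = cn N v'"
  by (simp add: cn_def cong: ip_cong)

lemma ip_add_left: "ip N (\<lambda>i. v i + v' i) w = ip N v w + ip N v' w"
  by (simp add: ip_def star_add algebra_simps sum.distrib)

lemma ip_add_right: "ip N v (\<lambda>i. w i + w' i) = ip N v w + ip N v w'"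
  by (simp add: ip_def algebra_simps sum.distrib)

lemma ip_diff_left: "ip N (\<lambda>i. v i - v' i) w = ip N v w - ip N v' w"
  by (simp add: ip_def star_diff algebra_simps sum_subtractf)

lemma ip_diff_right: "ip N v (\<lambda>i. w i - w' i) = ip N v w - ip N v w'"
  by (simp add: ip_def algebra_simps sum_subtractf)

lemma ip_mult_right: "ip N v (\<lambda>i. w i * a) = ip N v w * a"
  by (simp add: ip_def sum_distrib_right mult.assoc)

lemma ip_mult_left: "ip N (\<lambda>i. v i * a) w = star a * ip N v w"
  by (simp add: ip_def sum_distrib_left star_mult mult.assoc)

lemma cn_cscale: "cn N (\<lambda>i. c *\<^sub>C v i) = cmod c * cn N v"
proof -
  have "ip N (\<lambda>i. c *\<^sub>C v i) (\<lambda>i. c *\<^sub>C v i) = (cnj c * c) *\<^sub>C ip N v v"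
    by (simp add: ip_def star_cscale mult_cscale_left mult_cscale_right cscale_cscale cscale_sum_right mult.commute)
  then show ?thesis by (simp add: cn_def norm_cscale norm_mult real_sqrt_mult)
qed

lemma cpos_conjugate: "cpos a \<Longrightarrow> cpos (star x * a * x)"
proof -
  assume "cpos a"
  then obtain s where s: "cpos s" "s * s = a" by (rule cpos_sqrt) blast
  have "star (s * x) * (s * x) = star x * a * x"
    unfolding s(2)[symmetric] by (simp add: star_mult cpos_star[OF s(1)] mult.assoc)
  then show ?thesis using cpos_star_mult[of "s * x"] by simp
qed

text \<open>Positivity of \<open>\<langle>w - v a/k, w - v a/k\<rangle>\<close> for \<open>a =
  \<langle>v, w\<rangle>\<close> gives \<open>a\<^sup>* a \<le> k \<langle>w, w\<rangle>\<close>, and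
  norms are monotone on positive elements.\<close>

lemma norm_ip_aux:
  assumes k: "k > 0" "norm (ip N v v) \<le> k"
  shows "(norm (ip N v w))\<^sup>2 \<le> k * (cn N w)\<^sup>2"
proof -
  define a where "a = ip N v w"
  define u where "u i = w i - v i * ((1/k) *\<^sub>R a)" for i
  have "ip N u u = ip N w w - (1/k) *\<^sub>R (star a * a) - (1/k) *\<^sub>R (star a * a) + (1/k\<^sup>2) *\<^sub>R (star a * ip N v v * a)"
    unfolding u_def ip_diff_left ip_diff_right ip_mult_left ip_mult_right
    by (simp add: a_def star_scaleR star_ip power2_eq_square algebra_simps)
  moreover have "(1/k\<^sup>2) *\<^sub>R (star a * (of_real k - ip N v v) * a)
      = (1/k) *\<^sub>R (star a * a) - (1/k\<^sup>2) *\<^sub>R (star a * ip N v v * a)"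
    using k by (simp add: of_real_def algebra_simps power2_eq_square)
  ultimately have "ip N w w - (1/k) *\<^sub>R (star a * a)
      = ip N u u + (1/k\<^sup>2) *\<^sub>R (star a * (of_real k - ip N v v) * a)" by simp
  also have "cpos \<dots>"
    using k by (intro cpos_add cpos_scaleR cpos_conjugate cpos_norm_diff cpos_ip) (auto simp: star_ip)
  finally have "norm ((1/k) *\<^sub>R (star a * a)) \<le> norm (ip N w w)"
    using k by (intro cpos_norm_mono cpos_scaleR cpos_star_mult) auto
  then show ?thesis using k by (simp add: cstar_identity cn_power2 a_def field_simps)
qed

text \<open>The Cauchy--Schwarz inequality of Hilbert modules.\<close>

theorem norm_ip_le: "norm (ip N v w) \<le> cn N v * cn N w"
proof -
  have "(norm (ip N v w))\<^sup>2 \<le> norm (ip N v v) * (cn N w)\<^sup>2"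
  proof (cases "norm (ip N v v) > 0")
    case True then show ?thesis using norm_ip_aux by blast
  next
    case False
    then have z: "norm (ip N v v) = 0" by simp
    have "(norm (ip N v w))\<^sup>2 \<le> 0"
    proof (rule field_le_epsilon)
      fix e :: real assume e: "e > 0"
      define c where "c = (cn N w)\<^sup>2 + 1"
      have c: "c > 0" "(cn N w)\<^sup>2 \<le> c" by (auto simp: c_def add_nonneg_pos)
      have "(norm (ip N v w))\<^sup>2 \<le> (e / c) * (cn N w)\<^sup>2"
        using norm_ip_aux[of "e / c" N v w] e c z by simp
      also have "\<dots> \<le> (e / c) * c" using e c by (intro mult_left_mono) auto
      finally show "(norm (ip N v w))\<^sup>2 \<le> 0 + e" using c by simp
    qed
    then show ?thesis by (simp add: z)
  qed
  also have "\<dots> = (cn N v * cn N w)\<^sup>2" by (simp add: cn_power2 power_mult_distrib)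
  finally show ?thesis by (rule power2_le_imp_le) simp
qed

lemma cn_triangle: "cn N (\<lambda>i. v i + w i) \<le> cn N v + cn N w"
proof (rule power2_le_imp_le)
  have "(cn N (\<lambda>i. v i + w i))\<^sup>2 = norm (ip N v v + ip N w v + (ip N v w + ip N w w))"
    unfolding cn_power2 ip_add_left ip_add_right by (simp add: add_ac)
  also have "\<dots> \<le> norm (ip N v v) + norm (ip N w v) + (norm (ip N v w) + norm (ip N w w))"
    by (intro order_trans[OF norm_triangle_ineq] add_mono) auto
  also have "\<dots> \<le> (cn N v)\<^sup>2 + cn N w * cn N v + (cn N v * cn N w + (cn N w)\<^sup>2)"
    by (intro add_mono norm_ip_le) (auto simp: cn_power2)
  also have "\<dots> = (cn N v + cn N w)\<^sup>2" by (simp add: power2_eq_square algebra_simps)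
  finally show "(cn N (\<lambda>i. v i + w i))\<^sup>2 \<le> (cn N v + cn N w)\<^sup>2" .
qed simp

lemma norm_sum_star_mult_mono:
  fixes f :: "'i \<Rightarrow> 'a::cstar_algebra"
  assumes "finite J" "I \<subseteq> J"
  shows "norm (\<Sum>i\<in>I. star (f i) * f i) \<le> norm (\<Sum>i\<in>J. star (f i) * f i)"
proof (rule cpos_norm_mono)
  show "cpos (\<Sum>i\<in>I. star (f i) * f i)" by (intro cpos_sum cpos_star_mult)
  have "(\<Sum>i\<in>J. star (f i) * f i) - (\<Sum>i\<in>I. star (f i) * f i) = (\<Sum>i\<in>J - I. star (f i) * f i)"
    using assms by (simp add: sum_diff)
  then show "cpos ((\<Sum>i\<in>J. star (f i) * f i) - (\<Sum>i\<in>I. star (f i) * f i))"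
    by (simp add: cpos_sum cpos_star_mult)
qed

lemma norm_entry_le_cn: "i < N \<Longrightarrow> norm (v i) \<le> cn N v"
proof (rule power2_le_imp_le)
  assume "i < N"
  then show "(norm (v i))\<^sup>2 \<le> (cn N v)\<^sup>2"
    using norm_sum_star_mult_mono[of "{..<N}" "{i}" v] by (simp add: cn_power2 ip_def cstar_identity)
qed simp

lemma cn_le_sum: "cn N v \<le> (\<Sum>i<N. norm (v i))"
proof -
  have "norm (ip N v v) \<le> (\<Sum>i<N. (norm (v i))\<^sup>2)"
    unfolding ip_def by (rule sum_norm_le) (simp add: cstar_identity)
  then have "cn N v \<le> L2_set (\<lambda>i. norm (v i)) {..<N}" by (simp add: cn_def L2_set_def)
  also have "\<dots> \<le> (\<Sum>i<N. norm (v i))" by (rule L2_set_le_sum) simp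
  finally show ?thesis .
qed

section \<open>The operator norm of matrices\<close>

lemma mult_mat_entry:
  "i < dim_row A \<Longrightarrow> j < dim_col B \<Longrightarrow> dim_col A = dim_row B \<Longrightarrow>
    (A * B) $$ (i, j) = (\<Sum>l<dim_col A. A $$ (i, l) * B $$ (l, j))"
  by (simp add: scalar_prod_def lessThan_atLeast0)

definition mv :: "'a::cstar_algebra mat \<Rightarrow> (nat \<Rightarrow> 'a) \<Rightarrow> nat \<Rightarrow> 'a" where
  "mv X v i = (\<Sum>j<dim_col X. X $$ (i, j) * v j)"

lemma mstar_dim [simp]: "dim_row (mstar X) = dim_col X" "dim_col (mstar X) = dim_row X"
  by (simp_all add: mstar_def)

lemma mstar_carrier [simp]: "mstar X \<in> carrier_mat n m \<longleftrightarrow> X \<in> carrier_mat m n"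
  unfolding carrier_mat_def mem_Collect_eq mstar_dim by blast

lemma mstar_index [simp]: "i < dim_col X \<Longrightarrow> j < dim_row X \<Longrightarrow> mstar X $$ (i, j) = star (X $$ (j, i))"
  by (simp add: mstar_def)

lemma mscale_dim [simp]: "dim_row (mscale c X) = dim_row X" "dim_col (mscale c X) = dim_col X"
  by (simp_all add: mscale_def)

lemma mscale_carrier [simp]: "mscale c X \<in> carrier_mat n m \<longleftrightarrow> X \<in> carrier_mat n m"
  unfolding carrier_mat_def mem_Collect_eq mscale_dim by blast

lemma mscale_index [simp]: "i < dim_row X \<Longrightarrow> j < dim_col X \<Longrightarrow> mscale c X $$ (i, j) = c *\<^sub>C X $$ (i, j)"
  by (simp add: mscale_def)

lemma mnorm_eq: "mnorm X = Sup {cn (dim_row X) (mv X v) |v. cn (dim_col X) v \<le> 1}"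
proof -
  have col: "colnorm V = cn (dim_row V) (\<lambda>i. V $$ (i, 0))" if "dim_col V = 1" for V :: "'a mat"
    unfolding colnorm_def cn_def ip_def using that by (subst mult_mat_entry) auto
  have "{colnorm (X * v) |v. v \<in> carrier_mat (dim_col X) 1 \<and> colnorm v \<le> 1}
      = {cn (dim_row X) (mv X v) |v. cn (dim_col X) v \<le> 1}" (is "?L = ?R")
  proof (intro subset_antisym subsetI)
    fix x assume "x \<in> ?L"
    then obtain V where V: "V \<in> carrier_mat (dim_col X) 1" "colnorm V \<le> 1" "x = colnorm (X * V)" by auto
    then have "x = cn (dim_row X) (mv X (\<lambda>i. V $$ (i, 0)))"
      by (auto simp: col mv_def mult_mat_entry simp del: index_mult_mat(1) intro!: cn_cong)
    then show "x \<in> ?R" using V by (auto simp: col)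
  next
    fix x assume "x \<in> ?R"
    then obtain v where v: "cn (dim_col X) v \<le> 1" "x = cn (dim_row X) (mv X v)" by auto
    let ?V = "mat (dim_col X) 1 (\<lambda>(i, j). v i)"
    have "colnorm ?V = cn (dim_col X) v" by (auto simp: col intro!: cn_cong)
    moreover have "colnorm (X * ?V) = x"
      unfolding v(2) by (auto simp: col mv_def mult_mat_entry simp del: index_mult_mat(1) intro!: cn_cong)
    ultimately show "x \<in> ?L" using v by (intro CollectI exI[of _ ?V]) auto
  qed
  then show ?thesis by (simp add: mnorm_def)
qed

lemma cn_mv_le_sum: "cn (dim_row X) (mv X v) \<le> (\<Sum>i<dim_row X. \<Sum>j<dim_col X. norm (X $$ (i, j))) * cn (dim_col X) v"
proof -
  have "norm (mv X v i) \<le> (\<Sum>j<dim_col X. norm (X $$ (i, j)) * cn (dim_col X) v)" for i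
    unfolding mv_def
    by (rule sum_norm_le, rule order_trans[OF norm_mult_ineq], rule mult_left_mono)
      (auto simp: norm_entry_le_cn)
  then have "(\<Sum>i<dim_row X. norm (mv X v i)) \<le> (\<Sum>i<dim_row X. \<Sum>j<dim_col X. norm (X $$ (i, j)) * cn (dim_col X) v)"
    by (intro sum_mono)
  then show ?thesis using cn_le_sum[of "dim_row X" "mv X v"] by (simp add: sum_distrib_right)
qed

lemma mv_cscale: "mv X (\<lambda>i. c *\<^sub>C v i) = (\<lambda>i. c *\<^sub>C mv X v i)"
  by (rule ext) (simp add: mv_def mult_cscale_right cscale_sum_right)

lemma mv_mscale: "i < dim_row X \<Longrightarrow> mv (mscale c X) v i = c *\<^sub>C mv X v i"
  by (simp add: mv_def mult_cscale_left cscale_sum_right)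

lemma cn_mv_le_mnorm:
  assumes v: "cn (dim_col X) v \<le> 1" shows "cn (dim_row X) (mv X v) \<le> mnorm X"
  unfolding mnorm_eq
proof (rule cSup_upper)
  let ?S = "{cn (dim_row X) (mv X v) |v. cn (dim_col X) v \<le> 1}"
  let ?B = "\<Sum>i<dim_row X. \<Sum>j<dim_col X. norm (X $$ (i, j))"
  show "cn (dim_row X) (mv X v) \<in> ?S" using v by blast
  show "bdd_above ?S"
  proof (rule bdd_aboveI[of _ ?B])
    fix x assume "x \<in> ?S"
    then obtain v where v: "x = cn (dim_row X) (mv X v)" "cn (dim_col X) v \<le> 1" by auto
    have "?B * cn (dim_col X) v \<le> ?B" using v by (intro mult_left_le) (simp_all add: sum_nonneg)
    then show "x \<le> ?B" using cn_mv_le_sum[of X v] v by linarith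
  qed
qed

lemma cn_zero [simp]: "cn N (\<lambda>i. 0) = 0" by (simp add: cn_def ip_def)

lemma mnorm_nonneg [simp]: "mnorm X \<ge> 0"
  by (rule order_trans[OF cn_nonneg cn_mv_le_mnorm[of X "\<lambda>i. 0"]]) simp

lemma cn_mv_le: "cn (dim_row X) (mv X v) \<le> mnorm X * cn (dim_col X) v"
proof (cases "cn (dim_col X) v = 0")
  case True
  then show ?thesis using cn_mv_le_sum[of X v] by simp
next
  case False
  let ?c = "cn (dim_col X) v"
  have c: "?c > 0" using False by (simp add: order_less_le)
  let ?w = "\<lambda>i. complex_of_real (1 / ?c) *\<^sub>C v i"
  have "cn (dim_col X) ?w = 1" using c unfolding cn_cscale by (simp add: norm_divide)
  then have "cn (dim_row X) (mv X ?w) \<le> mnorm X" by (intro cn_mv_le_mnorm) simp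
  then show ?thesis using c unfolding mv_cscale cn_cscale by (simp add: norm_divide field_simps)
qed

lemma mnorm_le:
  assumes "\<And>v. cn (dim_row X) (mv X v) \<le> B * cn (dim_col X) v" "B \<ge> 0"
  shows "mnorm X \<le> B"
  unfolding mnorm_eq
proof (rule cSup_least)
  have "cn (dim_col X) (\<lambda>i. 0::'a) = 0" by (simp add: cn_def ip_def)
  then show "{cn (dim_row X) (mv X v) |v. cn (dim_col X) v \<le> 1} \<noteq> {}" by (auto intro!: exI[of _ "\<lambda>i. 0"])
  fix x assume "x \<in> {cn (dim_row X) (mv X v) |v. cn (dim_col X) v \<le> 1}"
  then obtain v where v: "x = cn (dim_row X) (mv X v)" "cn (dim_col X) v \<le> 1" by auto
  have "B * cn (dim_col X) v \<le> B" using v assms by (intro mult_left_le) auto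
  then show "x \<le> B" using assms(1)[of v] v by linarith
qed

lemma mnorm_le_sum: "mnorm X \<le> (\<Sum>i<dim_row X. \<Sum>j<dim_col X. norm (X $$ (i, j)))"
  by (rule mnorm_le[OF cn_mv_le_sum]) (simp add: sum_nonneg)

lemma cn_unit: "j < N \<Longrightarrow> cn N (\<lambda>i. if i = j then 1 else (0::'a::cstar_algebra)) = 1"
proof -
  assume "j < N"
  have "ip N (\<lambda>i. if i = j then 1 else (0::'a)) (\<lambda>i. if i = j then 1 else 0) = (\<Sum>i<N. if i = j then 1 else 0)"
    unfolding ip_def by (intro sum.cong) auto
  then show ?thesis using \<open>j < N\<close> by (simp add: cn_def)
qed

lemma norm_entry_le_mnorm:
  assumes "i < dim_row X" "j < dim_col X" shows "norm (X $$ (i, j)) \<le> mnorm X"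
proof -
  let ?e = "\<lambda>i. if i = j then 1 else (0::'a)"
  have "mv X ?e i = (\<Sum>l<dim_col X. if l = j then X $$ (i, l) else 0)"
    unfolding mv_def by (intro sum.cong) auto
  then have "mv X ?e i = X $$ (i, j)" using assms by simp
  then show ?thesis
    using norm_entry_le_cn[OF assms(1), of "mv X ?e"] cn_mv_le[of X ?e] cn_unit[OF assms(2), where 'a='a] by simp
qed

lemma mv_add: "X \<in> carrier_mat n m \<Longrightarrow> Y \<in> carrier_mat n m \<Longrightarrow> i < n \<Longrightarrow> mv (X + Y) v i = mv X v i + mv Y v i"
  by (auto simp: mv_def algebra_simps sum.distrib)

lemma mv_mult: "X \<in> carrier_mat n m \<Longrightarrow> Y \<in> carrier_mat m k \<Longrightarrow> i < n \<Longrightarrow> mv (X * Y) v i = mv X (mv Y v) i"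
proof -
  assume a: "X \<in> carrier_mat n m" "Y \<in> carrier_mat m k" "i < n"
  have "mv (X * Y) v i = (\<Sum>j<k. (\<Sum>l<m. X $$ (i, l) * Y $$ (l, j)) * v j)"
    using a by (simp add: mv_def mult_mat_entry del: index_mult_mat(1))
  also have "\<dots> = (\<Sum>l<m. \<Sum>j<k. X $$ (i, l) * (Y $$ (l, j) * v j))"
    by (subst sum.swap) (simp add: sum_distrib_right mult.assoc)
  also have "\<dots> = mv X (mv Y v) i" using a by (simp add: mv_def sum_distrib_left)
  finally show ?thesis .
qed

lemma mnorm_add: "X \<in> carrier_mat n m \<Longrightarrow> Y \<in> carrier_mat n m \<Longrightarrow> mnorm (X + Y) \<le> mnorm X + mnorm Y"
proof (rule mnorm_le)
  fix v assume a: "X \<in> carrier_mat n m" "Y \<in> carrier_mat n m"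
  have "cn n (mv (X + Y) v) = cn n (\<lambda>i. mv X v i + mv Y v i)"
    using a by (intro cn_cong) (simp add: mv_add)
  also have "\<dots> \<le> mnorm X * cn m v + mnorm Y * cn m v"
    using cn_triangle[of n "mv X v" "mv Y v"] cn_mv_le[of X v] cn_mv_le[of Y v] a by auto
  finally show "cn (dim_row (X + Y)) (mv (X + Y) v) \<le> (mnorm X + mnorm Y) * cn (dim_col (X + Y)) v"
    using a by (simp add: algebra_simps)
qed simp

lemma mnorm_mult: "X \<in> carrier_mat n m \<Longrightarrow> Y \<in> carrier_mat m k \<Longrightarrow> mnorm (X * Y) \<le> mnorm X * mnorm Y"
proof (rule mnorm_le)
  fix v assume a: "X \<in> carrier_mat n m" "Y \<in> carrier_mat m k"
  have "cn n (mv (X * Y) v) = cn n (mv X (mv Y v))" using a by (intro cn_cong) (simp add: mv_mult)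
  also have "\<dots> \<le> mnorm X * cn m (mv Y v)" using cn_mv_le[of X "mv Y v"] a by auto
  also have "\<dots> \<le> mnorm X * (mnorm Y * cn k v)" using cn_mv_le[of Y v] a by (intro mult_left_mono) auto
  finally show "cn (dim_row (X * Y)) (mv (X * Y) v) \<le> mnorm X * mnorm Y * cn (dim_col (X * Y)) v"
    using a by simp
qed simp

lemma mnorm_mscale_le: "mnorm (mscale c X) \<le> cmod c * mnorm X"
proof (rule mnorm_le)
  fix v
  have "cn (dim_row X) (mv (mscale c X) v) = cn (dim_row X) (\<lambda>i. c *\<^sub>C mv X v i)"
    by (intro cn_cong) (simp add: mv_def mult_cscale_left cscale_sum_right)
  also have "\<dots> \<le> cmod c * (mnorm X * cn (dim_col X) v)"
    unfolding cn_cscale using cn_mv_le[of X v] by (intro mult_left_mono) auto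
  finally show "cn (dim_row (mscale c X)) (mv (mscale c X) v) \<le> cmod c * mnorm X * cn (dim_col (mscale c X)) v"
    by (simp add: mult.assoc)
qed simp

lemma mscale_mscale: "mscale c (mscale d X) = mscale (c * d) X"
  by (rule eq_matI) (auto simp: cscale_cscale)

lemma mscale_one [simp]: "mscale 1 X = X"
  by (rule eq_matI) auto

lemma mnorm_mscale: "mnorm (mscale c X) = cmod c * mnorm X"
proof (cases "c = 0")
  case True
  then show ?thesis using mnorm_mscale_le[of c X] by (intro antisym) auto
next
  case False
  have "mnorm X = mnorm (mscale (1/c) (mscale c X))" using False by (simp add: mscale_mscale)
  also have "\<dots> \<le> cmod (1/c) * mnorm (mscale c X)" by (rule mnorm_mscale_le)
  finally have "cmod c * mnorm X \<le> mnorm (mscale c X)" using False by (simp add: norm_divide field_simps)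
  then show ?thesis using mnorm_mscale_le[of c X] by simp
qed

lemma mnorm_minus_commute: "X \<in> carrier_mat n m \<Longrightarrow> Y \<in> carrier_mat n m \<Longrightarrow> mnorm (X - Y) = mnorm (Y - X)"
proof -
  assume "X \<in> carrier_mat n m" "Y \<in> carrier_mat n m"
  then have "X - Y = mscale (-1) (Y - X)" by (intro eq_matI) (auto simp: cscale_minus_left)
  then show ?thesis using mnorm_mscale[of "-1" "Y - X"] by simp
qed

lemma mnorm_one_le: "mnorm (1\<^sub>m n :: 'a::cstar_algebra mat) \<le> 1"
proof (rule mnorm_le)
  fix v :: "nat \<Rightarrow> 'a"
  have "mv (1\<^sub>m n) v i = v i" if "i < n" for i
  proof -
    have "mv (1\<^sub>m n) v i = (\<Sum>j<n. if j = i then v j else 0)"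
      unfolding mv_def by (intro sum.cong) (use that in auto)
    then show ?thesis using that by simp
  qed
  then show "cn (dim_row (1\<^sub>m n :: 'a mat)) (mv (1\<^sub>m n) v) \<le> 1 * cn (dim_col (1\<^sub>m n :: 'a mat)) v"
    using cn_cong[of n "mv (1\<^sub>m n) v" v] by simp
qed simp

lemma ip_mv: "X \<in> carrier_mat n m \<Longrightarrow> ip n (mv X v) w = ip m v (mv (mstar X) w)"
proof -
  assume a: "X \<in> carrier_mat n m"
  have "ip n (mv X v) w = (\<Sum>i<n. \<Sum>j<m. star (v j) * star (X $$ (i, j)) * w i)"
    using a by (simp add: ip_def mv_def star_sum star_mult sum_distrib_right)
  also have "\<dots> = (\<Sum>j<m. \<Sum>i<n. star (v j) * (mstar X $$ (j, i) * w i))"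
    using a by (subst sum.swap) (auto simp: mult.assoc intro!: sum.cong)
  also have "\<dots> = ip m v (mv (mstar X) w)"
    using a by (simp add: ip_def mv_def sum_distrib_left)
  finally show ?thesis .
qed

lemma mstar_mstar [simp]: "mstar (mstar X) = X"
  by (rule eq_matI) (auto simp: star_star)

lemma mnorm_mstar_le: "mnorm (mstar X) \<le> mnorm X"
proof (rule mnorm_le)
  fix w
  let ?n = "dim_row X" and ?m = "dim_col X"
  have "(cn ?m (mv (mstar X) w))\<^sup>2 = norm (ip ?n (mv X (mv (mstar X) w)) w)"
    by (subst ip_mv[of X ?n ?m]) (auto simp: cn_power2)
  also have "\<dots> \<le> cn ?n (mv X (mv (mstar X) w)) * cn ?n w" by (rule norm_ip_le)
  also have "\<dots> \<le> mnorm X * cn ?m (mv (mstar X) w) * cn ?n w"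
    by (intro mult_right_mono cn_mv_le) auto
  finally have "cn ?m (mv (mstar X) w) * cn ?m (mv (mstar X) w) \<le> cn ?m (mv (mstar X) w) * (mnorm X * cn ?n w)"
    by (simp add: power2_eq_square mult_ac)
  then have "cn ?m (mv (mstar X) w) \<le> mnorm X * cn ?n w"
    by (cases "cn ?m (mv (mstar X) w) = 0") (auto simp: mult_le_cancel_left order_less_le)
  then show "cn (dim_row (mstar X)) (mv (mstar X) w) \<le> mnorm X * cn (dim_col (mstar X)) w" by simp
qed simp

lemma mnorm_mstar [simp]: "mnorm (mstar X) = mnorm X"
  using mnorm_mstar_le[of X] mnorm_mstar_le[of "mstar X"] by simp

lemma mnorm_submatrix:
  assumes f: "inj_on f {..<n}" "f ` {..<n} \<subseteq> {..<dim_row X}"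
    and g: "inj_on g {..<m}" "g ` {..<m} \<subseteq> {..<dim_col X}"
  shows "mnorm (mat n m (\<lambda>(a, b). X $$ (f a, g b))) \<le> mnorm X"
proof (rule mnorm_le)
  fix v :: "nat \<Rightarrow> 'a"
  let ?B = "mat n m (\<lambda>(a, b). X $$ (f a, g b))"
  define w where "w j = (if j \<in> g ` {..<m} then v (the_inv_into {..<m} g j) else 0)" for j
  have wg: "w (g b) = v b" if "b < m" for b using that g(1) by (simp add: w_def the_inv_into_f_f)
  have red: "(\<Sum>j<dim_col X. F j (w j)) = (\<Sum>b<m. F (g b) (v b))" if "\<And>j. F j 0 = 0" for F :: "nat \<Rightarrow> 'a \<Rightarrow> 'a"
  proof -
    have "(\<Sum>j<dim_col X. F j (w j)) = (\<Sum>j\<in>g ` {..<m}. F j (w j))"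
      by (rule sum.mono_neutral_right) (use g that in \<open>auto simp: w_def\<close>)
    also have "\<dots> = (\<Sum>b<m. F (g b) (w (g b)))" by (simp add: sum.reindex[OF g(1)])
    finally show ?thesis by (simp add: wg)
  qed
  have cw: "cn (dim_col X) w = cn m v"
    using red[of "\<lambda>j x. star x * x"] by (simp add: cn_def ip_def)
  have mvB: "mv ?B v a = mv X w (f a)" if "a < n" for a
    using that red[of "\<lambda>j x. X $$ (f a, j) * x"] by (simp add: mv_def)
  have "(cn n (mv ?B v))\<^sup>2 = norm (\<Sum>a<n. star (mv X w (f a)) * mv X w (f a))"
    unfolding cn_power2 ip_def by (simp add: mvB)
  also have "\<dots> = norm (\<Sum>i\<in>f ` {..<n}. star (mv X w i) * mv X w i)" by (simp add: sum.reindex[OF f(1)])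
  also have "\<dots> \<le> norm (\<Sum>i<dim_row X. star (mv X w i) * mv X w i)"
    using f by (intro norm_sum_star_mult_mono) auto
  also have "\<dots> = (cn (dim_row X) (mv X w))\<^sup>2" by (simp add: cn_power2 ip_def)
  finally have "cn n (mv ?B v) \<le> cn (dim_row X) (mv X w)" by (rule power2_le_imp_le) simp
  also have "\<dots> \<le> mnorm X * cn m v" using cn_mv_le[of X w] by (simp add: cw)
  finally show "cn (dim_row ?B) (mv ?B v) \<le> mnorm X * cn (dim_col ?B) v" by simp
qed simp

section \<open>Square roots of matrices\<close>

primrec msqrt_iter :: "'a::cstar_algebra mat \<Rightarrow> nat \<Rightarrow> 'a mat" where
  "msqrt_iter h 0 = 0\<^sub>m (dim_row h) (dim_row h)"
| "msqrt_iter h (Suc n) = mscale (1/2) (h + msqrt_iter h n * msqrt_iter h n)"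

lemma mnorm_zero [simp]: "mnorm (0\<^sub>m n m :: 'a::cstar_algebra mat) = 0"
  using mnorm_le_sum[of "0\<^sub>m n m :: 'a mat"] mnorm_nonneg[of "0\<^sub>m n m :: 'a mat"] by simp

lemma mstar_mult: "X \<in> carrier_mat n m \<Longrightarrow> Y \<in> carrier_mat m k \<Longrightarrow> mstar (X * Y) = mstar Y * mstar X"
  by (rule eq_matI) (auto simp: mult_mat_entry star_sum star_mult simp del: index_mult_mat(1))

lemma mstar_add: "X \<in> carrier_mat n m \<Longrightarrow> Y \<in> carrier_mat n m \<Longrightarrow> mstar (X + Y) = mstar X + mstar Y"
  by (rule eq_matI) (auto simp: star_add)

lemma mstar_diff: "X \<in> carrier_mat n m \<Longrightarrow> Y \<in> carrier_mat n m \<Longrightarrow> mstar (X - Y) = mstar X - mstar Y"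
  by (rule eq_matI) (auto simp: star_diff)

lemma mstar_mscale: "mstar (mscale c X) = mscale (cnj c) (mstar X)"
  by (rule eq_matI) (auto simp: star_cscale)

lemma mstar_one [simp]: "mstar (1\<^sub>m n :: 'a::cstar_algebra mat) = 1\<^sub>m n"
  by (rule eq_matI) auto

lemma msqrt_iter_increment:
  fixes h :: "'a::cstar_algebra mat"
  assumes h: "h \<in> sqmat N" "mstar h = h" "mnorm h \<le> 1"
  shows "msqrt_iter h n \<in> sqmat N \<and> mstar (msqrt_iter h n) = msqrt_iter h n \<and>
    mnorm (msqrt_iter h n) \<le> sqrt_iter 1 n \<and>
    mnorm (msqrt_iter h (Suc n) - msqrt_iter h n) \<le> sqrt_iter 1 (Suc n) - sqrt_iter 1 n"
proof (induction n)
  case 0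
  have "mstar (0\<^sub>m N N :: 'a mat) = 0\<^sub>m N N" by (rule eq_matI) auto
  moreover have "h + 0\<^sub>m N N * 0\<^sub>m N N = h" using h by (intro eq_matI) auto
  moreover have "mscale (1/2) h - 0\<^sub>m N N = mscale (1/2) h" using h by (intro eq_matI) auto
  ultimately show ?case using h by (auto simp: mnorm_mscale)
next
  case (Suc n)
  let ?y = "msqrt_iter h" and ?t = "sqrt_iter (1::real)"
  have yc: "?y n \<in> sqmat N" using Suc by blast
  then have yyc: "?y n * ?y n \<in> sqmat N" by simp
  have yc': "?y (Suc n) \<in> sqmat N" using h yyc by simp
  have ys: "mstar (?y (Suc n)) = ?y (Suc n)"
    using h Suc yyc by (simp add: mstar_mscale mstar_add[OF h(1) yyc] mstar_mult[OF yc yc])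
  have a: "mnorm (?y (Suc n)) \<le> ?t (Suc n)"
  proof -
    have "mnorm (?y n * ?y n) \<le> ?t n * ?t n"
      using Suc sqrt_iter_one_bounds[of n] by (intro order_trans[OF mnorm_mult[OF yc yc]] mult_mono) auto
    then have "mnorm (h + ?y n * ?y n) \<le> 1 + ?t n * ?t n"
      using h mnorm_add[OF h(1) yyc] by linarith
    then show ?thesis by (simp add: mnorm_mscale)
  qed
  define d where "d = ?y (Suc n) - ?y n"
  have dc: "d \<in> sqmat N" unfolding d_def using yc by (rule minus_carrier_mat)
  have eq: "?y (Suc (Suc n)) - ?y (Suc n) = mscale (1/2) (d * ?y (Suc n) + ?y n * d)"
  proof -
    define p where "p = ?y n"
    define q where "q = ?y (Suc n)"
    have pq: "p \<in> sqmat N" "q \<in> sqmat N" "d = q - p"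
      using yc yc' by (simp_all add: p_def q_def d_def del: msqrt_iter.simps)
    have "?y (Suc (Suc n)) - ?y (Suc n) = mscale (1/2) (h + q * q) - mscale (1/2) (h + p * p)"
      by (simp only: msqrt_iter.simps p_def q_def)
    also have "\<dots> = mscale (1/2) (d * q + p * d)"
      using h pq by (intro eq_matI)
        (auto simp: mult_mat_entry cscale_diff_right[symmetric] algebra_simps sum_subtractf sum.distrib simp del: index_mult_mat(1))
    finally show ?thesis by (simp only: p_def q_def)
  qed
  have "mnorm (d * ?y (Suc n) + ?y n * d) \<le> (?t (Suc n) - ?t n) * ?t (Suc n) + ?t n * (?t (Suc n) - ?t n)"
  proof -
    have nd: "mnorm d \<le> ?t (Suc n) - ?t n" using Suc by (simp only: d_def)
    have "mnorm (d * ?y (Suc n)) \<le> (?t (Suc n) - ?t n) * ?t (Suc n)"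
      using nd a sqrt_iter_one_bounds[of n] by (intro order_trans[OF mnorm_mult[OF dc yc']] mult_mono) auto
    moreover have "mnorm (?y n * d) \<le> ?t n * (?t (Suc n) - ?t n)"
      using nd Suc sqrt_iter_one_bounds[of n] by (intro order_trans[OF mnorm_mult[OF yc dc]] mult_mono) auto
    ultimately show ?thesis
      using mnorm_add[OF mult_carrier_mat[OF dc yc'] mult_carrier_mat[OF yc dc]] by linarith
  qed
  moreover have "?t (Suc (Suc n)) = (1 + ?t (Suc n) * ?t (Suc n)) / 2" "2 * ?t (Suc n) = 1 + ?t n * ?t n"
    by simp_all
  ultimately have "mnorm (?y (Suc (Suc n)) - ?y (Suc n)) \<le> ?t (Suc (Suc n)) - ?t (Suc n)"
    unfolding eq mnorm_mscale by (simp add: algebra_simps del: sqrt_iter.simps)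
  then show ?case using yc' ys a by blast
qed

text \<open>The same iteration as in the algebra; a matrix \<open>1 - h\<close> with a self-adjoint
  contraction \<open>h\<close> is a square.  Convergence is entrywise because entries and operator norm
  control each other.\<close>

lemma msqrt:
  fixes h :: "'a::cstar_algebra mat"
  assumes h: "h \<in> sqmat N" "mstar h = h" "mnorm h \<le> 1"
  obtains k where "k \<in> sqmat N" "mstar k = k" "k * k = 1\<^sub>m N - h"
proof -
  note inc = msqrt_iter_increment[OF h]
  have yc: "msqrt_iter h n \<in> sqmat N" for n using inc by blast
  have "convergent (\<lambda>n. msqrt_iter h n $$ (i, j))" if "i < N" "j < N" for i j
  proof (rule convergent_of_dominated_increments[OF _ convergent_sqrt_iter_one])
    fix n
    have "norm ((msqrt_iter h (Suc n) - msqrt_iter h n) $$ (i, j)) \<le> mnorm (msqrt_iter h (Suc n) - msqrt_iter h n)"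
      using that yc[of n] by (intro norm_entry_le_mnorm) (auto simp del: msqrt_iter.simps)
    also have "(msqrt_iter h (Suc n) - msqrt_iter h n) $$ (i, j) = msqrt_iter h (Suc n) $$ (i, j) - msqrt_iter h n $$ (i, j)"
      using that yc[of n] by (intro index_minus_mat) auto
    finally show "norm (msqrt_iter h (Suc n) $$ (i, j) - msqrt_iter h n $$ (i, j)) \<le> sqrt_iter 1 (Suc n) - sqrt_iter 1 n"
      using inc[of n] by linarith
  qed
  then obtain y where y: "\<And>i j. i < N \<Longrightarrow> j < N \<Longrightarrow> (\<lambda>n. msqrt_iter h n $$ (i, j)) \<longlonglongrightarrow> y i j"
    unfolding convergent_def by metis
  define Y where "Y = mat N N (\<lambda>(i, j). y i j)"
  have Y: "Y \<in> sqmat N" by (simp add: Y_def)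
  have sY: "mstar Y = Y"
  proof (rule eq_matI)
    fix i j assume "i < dim_row Y" "j < dim_col Y"
    then have ij: "i < N" "j < N" by (auto simp: Y_def)
    have "star (msqrt_iter h n $$ (j, i)) = msqrt_iter h n $$ (i, j)" for n
      using inc[of n] ij mstar_index[of i "msqrt_iter h n" j] by auto
    then have "(\<lambda>n. msqrt_iter h n $$ (i, j)) \<longlonglongrightarrow> star (y j i)" using tendsto_star[OF y[of j i]] ij by simp
    then have "star (y j i) = y i j" using y[of i j] ij LIMSEQ_unique by blast
    then show "mstar Y $$ (i, j) = Y $$ (i, j)" using ij by (simp add: Y_def)
  qed (auto simp: Y_def)
  have fix_eq: "2 *\<^sub>R y i j = h $$ (i, j) + (\<Sum>l<N. y i l * y l j)" if ij: "i < N" "j < N" for i j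
  proof -
    have "msqrt_iter h (Suc n) $$ (i, j) = (1/2) *\<^sub>C (h $$ (i, j) + (\<Sum>l<N. msqrt_iter h n $$ (i, l) * msqrt_iter h n $$ (l, j)))" for n
      using ij h yc[of n] by (auto simp: mult_mat_entry simp del: index_mult_mat(1))
    then have "2 *\<^sub>R (msqrt_iter h (Suc n) $$ (i, j)) = h $$ (i, j) + (\<Sum>l<N. msqrt_iter h n $$ (i, l) * msqrt_iter h n $$ (l, j))" for n
      by (simp add: cscale_cscale flip: cscale_of_real)
    moreover have "(\<lambda>n. h $$ (i, j) + (\<Sum>l<N. msqrt_iter h n $$ (i, l) * msqrt_iter h n $$ (l, j))) \<longlonglongrightarrow> h $$ (i, j) + (\<Sum>l<N. y i l * y l j)"
      using ij by (intro tendsto_intros y) auto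
    moreover have "(\<lambda>n. 2 *\<^sub>R (msqrt_iter h (Suc n) $$ (i, j))) \<longlonglongrightarrow> 2 *\<^sub>R y i j"
      using ij by (intro tendsto_intros LIMSEQ_Suc y) auto
    ultimately show ?thesis using LIMSEQ_unique by auto
  qed
  show thesis
  proof (rule that[of "1\<^sub>m N - Y"])
    show "1\<^sub>m N - Y \<in> sqmat N" using Y by (rule minus_carrier_mat)
    show "mstar (1\<^sub>m N - Y) = 1\<^sub>m N - Y" using Y by (simp add: mstar_diff[of _ N N] sY)
    show "(1\<^sub>m N - Y) * (1\<^sub>m N - Y) = 1\<^sub>m N - h"
    proof (rule eq_matI)
      fix i j assume "i < dim_row (1\<^sub>m N - h)" "j < dim_col (1\<^sub>m N - h)"
      then have ij: "i < N" "j < N" using h by auto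
      have "((1\<^sub>m N - Y) * (1\<^sub>m N - Y)) $$ (i, j)
          = (\<Sum>l<N. ((if i = l then 1 else 0) - y i l) * ((if l = j then 1 else 0) - y l j))"
        using ij Y by (subst mult_mat_entry) (auto simp: Y_def)
      also have "\<dots> = (\<Sum>l<N. (if l = i then (if l = j then 1 else 0) else 0) - (if l = i then y l j else 0)
          - (if l = j then y i l else 0) + y i l * y l j)"
        by (intro sum.cong refl) (auto simp: algebra_simps)
      also have "\<dots> = (if i = j then 1 else 0) - y i j - y i j + (\<Sum>l<N. y i l * y l j)"
        using ij by (simp add: sum.distrib sum_subtractf)
      also have "\<dots> = (if i = j then 1 else 0) - h $$ (i, j)"
        using fix_eq[OF ij] by (simp add: scaleR_2 algebra_simps)
      finally show "((1\<^sub>m N - Y) * (1\<^sub>m N - Y)) $$ (i, j) = (1\<^sub>m N - h) $$ (i, j)" using ij h by simp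
    qed (use Y h in auto)
  qed
qed

lemma mscale_mult:
  assumes "X \<in> carrier_mat n m" "Y \<in> carrier_mat m k"
  shows "mscale a X * mscale b Y = mscale (a * b) (X * Y)"
proof (rule eq_matI)
  fix i j assume ij: "i < dim_row (mscale (a * b) (X * Y))" "j < dim_col (mscale (a * b) (X * Y))"
  have "(mscale a X * mscale b Y) $$ (i, j) = (\<Sum>l<m. a *\<^sub>C X $$ (i, l) * b *\<^sub>C Y $$ (l, j))"
    using ij assms by (subst mult_mat_entry) auto
  also have "\<dots> = (a * b) *\<^sub>C (\<Sum>l<m. X $$ (i, l) * Y $$ (l, j))"
    by (simp add: mult_cscale_left mult_cscale_right cscale_cscale cscale_sum_right mult.commute[of a])
  also have "(\<Sum>l<m. X $$ (i, l) * Y $$ (l, j)) = (X * Y) $$ (i, j)"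
    using ij assms by (subst mult_mat_entry) auto
  finally show "(mscale a X * mscale b Y) $$ (i, j) = mscale (a * b) (X * Y) $$ (i, j)"
    using ij by simp
qed (use assms in auto)

lemma mnorm_le_0_iff: "X \<in> carrier_mat n m \<Longrightarrow> mnorm X \<le> 0 \<longleftrightarrow> X = 0\<^sub>m n m"
proof
  assume X: "X \<in> carrier_mat n m" "mnorm X \<le> 0"
  then have "X $$ (i, j) = 0" if "i < n" "j < m" for i j
  proof -
    have "norm (X $$ (i, j)) \<le> 0" using that X by (intro order_trans[OF norm_entry_le_mnorm]) auto
    then show ?thesis by simp
  qed
  then show "X = 0\<^sub>m n m" using X by (intro eq_matI) auto
qed auto

text \<open>Matrices with this norm condition are the positive directions along which a function in a
  sovereign class is known to be analytic.\<close>

lemma mpos_of_norm: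
  fixes P :: "'a::cstar_algebra mat"
  assumes P: "P \<in> sqmat N" "mstar P = P" and c: "mnorm (mscale (of_real c) (1\<^sub>m N) - P) \<le> c"
  shows "mpos N P"
proof (cases "c = 0")
  case True
  then have "mscale (of_real c) (1\<^sub>m N) - P = 0\<^sub>m N N"
    using c mnorm_le_0_iff[of "mscale (of_real c) (1\<^sub>m N) - P" N N] minus_carrier_mat[OF P(1)] by simp
  then have "(mscale (of_real c) (1\<^sub>m N) - P) $$ (i, j) = 0" if "i < N" "j < N" for i j using that by simp
  then have "P $$ (i, j) = 0" if "i < N" "j < N" for i j using that P True by simp
  then have "P = mstar (0\<^sub>m N N) * 0\<^sub>m N N" using P by (intro eq_matI) (auto simp: scalar_prod_def)
  then show ?thesis unfolding mpos_def by (intro bexI[of _ "0\<^sub>m N N"]) auto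
next
  case False
  then have c0: "c > 0" using c mnorm_nonneg[of "mscale (of_real c) (1\<^sub>m N) - P"] by linarith
  define h where "h = mscale (of_real (1/c)) (mscale (of_real c) (1\<^sub>m N) - P)"
  have hc: "h \<in> sqmat N" unfolding h_def mscale_carrier by (rule minus_carrier_mat[OF P(1)])
  have hs: "mstar h = h" using P by (simp add: h_def mstar_mscale mstar_diff[of _ N N])
  have "mnorm h \<le> 1" using c c0 by (simp add: h_def mnorm_mscale norm_divide)
  then obtain k where k: "k \<in> sqmat N" "mstar k = k" "k * k = 1\<^sub>m N - h"
    using msqrt[OF hc hs] by blast
  let ?Y = "mscale (of_real (sqrt c)) k"
  have "P = mscale (of_real c) (1\<^sub>m N - h)"
    using P c0 by (intro eq_matI) (auto simp: h_def cscale_diff_right cscale_cscale)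
  also have "\<dots> = mstar ?Y * ?Y"
  proof -
    have "mstar ?Y * ?Y = mscale (of_real (sqrt c) * of_real (sqrt c)) (k * k)"
      by (simp add: mstar_mscale k(2) mscale_mult[OF k(1) k(1)])
    also have "of_real (sqrt c) * of_real (sqrt c) = complex_of_real c" using c0 by (simp flip: of_real_mult)
    finally have "mstar ?Y * ?Y = mscale (of_real c) (k * k)" .
    then show ?thesis by (simp add: k)
  qed
  finally show ?thesis unfolding mpos_def using k by (intro bexI[of _ ?Y]) auto
qed

lemma cpos_mv_order:
  assumes Y: "Y \<in> sqmat M" "mnorm Y \<le> r" and r: "r > 0"
  shows "cpos (r\<^sup>2 *\<^sub>R ip M w w - ip M (mv Y w) (mv Y w))"
proof -
  define h where "h = mscale (of_real (1/r\<^sup>2)) (mstar Y * Y)"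
  have YY: "mstar Y * Y \<in> sqmat M" using Y by simp
  have hc: "h \<in> sqmat M" using YY by (simp add: h_def)
  have hs: "mstar h = h" using Y by (simp add: h_def mstar_mscale mstar_mult[of _ M M])
  have "mnorm (mstar Y * Y) \<le> r * r"
    using Y r by (intro order_trans[OF mnorm_mult[of _ M M _ M]] mult_mono) auto
  then have "mnorm h \<le> 1" using r by (simp add: h_def mnorm_mscale power2_eq_square norm_mult norm_divide)
  then obtain k where k: "k \<in> sqmat M" "mstar k = k" "k * k = 1\<^sub>m M - h" using msqrt[OF hc hs] by blast
  have id: "mv (1\<^sub>m M) w i = w i" if "i < M" for i
  proof -
    have "mv (1\<^sub>m M) w i = (\<Sum>j<M. if j = i then w j else 0)"
      unfolding mv_def by (intro sum.cong) (use that in auto)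
    then show ?thesis using that by simp
  qed
  have e: "mv (k * k) w i = w i - (1/r\<^sup>2) *\<^sub>R mv (mstar Y * Y) w i" if "i < M" for i
  proof -
    have "mv (k * k) w i = mv (1\<^sub>m M) w i - mv h w i"
      unfolding k(3) using that hc by (simp add: mv_def algebra_simps sum_subtractf)
    also have "mv h w i = (1/r\<^sup>2) *\<^sub>R mv (mstar Y * Y) w i"
      unfolding h_def using that Y by (subst mv_mscale) (auto simp: cscale_of_real simp del: of_real_divide)
    finally show ?thesis using id that by simp
  qed
  have "ip M (mv k w) (mv k w) = ip M w (mv (mstar k) (mv k w))" using ip_mv[OF k(1)] by simp
  also have "\<dots> = ip M w (mv (k * k) w)" unfolding k(2) by (rule ip_cong) (simp_all add: mv_mult[OF k(1) k(1)])
  also have "\<dots> = ip M w (\<lambda>i. w i - (1/r\<^sup>2) *\<^sub>R mv (mstar Y * Y) w i)" by (rule ip_cong) (simp_all add: e)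
  also have "\<dots> = ip M w w - (1/r\<^sup>2) *\<^sub>R ip M w (mv (mstar Y * Y) w)"
    unfolding ip_diff_right by (simp add: ip_def scaleR_sum_right)
  also have "ip M w (mv (mstar Y * Y) w) = ip M w (mv (mstar Y) (mv Y w))"
    using Y by (intro ip_cong) (auto simp: mv_mult[of _ M M _ M])
  also have "\<dots> = ip M (mv Y w) (mv Y w)" using ip_mv[OF Y(1)] by simp
  finally have "r\<^sup>2 *\<^sub>R ip M w w - ip M (mv Y w) (mv Y w) = r\<^sup>2 *\<^sub>R ip M (mv k w) (mv k w)"
    using r by (simp add: scaleR_diff_right)
  then show ?thesis by (simp add: cpos_scaleR)
qed

definition superdiag :: "nat \<Rightarrow> nat \<Rightarrow> (nat \<Rightarrow> 'a::cstar_algebra mat) \<Rightarrow> 'a mat" where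
  "superdiag L M Y = mat (L * M) (L * M)
     (\<lambda>(a, b). if b div M = Suc (a div M) then Y (a div M) $$ (a mod M, b mod M) else 0)"

lemma sum_blocks:
  fixes f :: "nat \<Rightarrow> 'x::comm_monoid_add"
  shows "(\<Sum>a<L * M. f a) = (\<Sum>i<L. \<Sum>c<M. f (i * M + c))"
proof -
  have "(\<Sum>a<L * M. f a) = (\<Sum>i<L. sum f {i * M..<i * M + M})" by (simp add: sum.nat_group)
  also have "\<dots> = (\<Sum>i<L. \<Sum>c<M. f (i * M + c))"
  proof (rule sum.cong[OF refl])
    fix i assume "i \<in> {..<L}"
    show "sum f {i * M..<i * M + M} = (\<Sum>c<M. f (i * M + c))"
      by (rule sum.reindex_bij_witness[of _ "\<lambda>c. i * M + c" "\<lambda>a. a - i * M"]) auto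
  qed
  finally show ?thesis .
qed

lemma block_index_less: "i < L \<Longrightarrow> c < M \<Longrightarrow> i * M + c < L * (M::nat)"
proof -
  assume "i < L" "c < M"
  then have "i * M + c < Suc i * M" by simp
  also have "\<dots> \<le> L * M" using \<open>i < L\<close> by (intro mult_le_mono1) simp
  finally show ?thesis .
qed

text \<open>The blocks act on mutually orthogonal parts of a column, so the norm is at most the largest
  norm of a block.\<close>

lemma mnorm_superdiag:
  assumes Y: "\<And>i. Suc i < L \<Longrightarrow> Y i \<in> sqmat M \<and> mnorm (Y i) \<le> r" and r: "r > 0"
  shows "mnorm (superdiag L M Y) \<le> r"
proof (rule mnorm_le)
  fix v :: "nat \<Rightarrow> 'a"
  let ?W = "superdiag L M Y"
  define u where "u i c = v (i * M + c)" for i c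
  have mvW: "mv ?W v (i * M + c) = (if Suc i < L then mv (Y i) (u (Suc i)) c else 0)" if ic: "i < L" "c < M" for i c
  proof -
    have lt: "i * M + c < L * M" by (rule block_index_less[OF ic])
    have "mv ?W v (i * M + c) = (\<Sum>b<L * M. (if b div M = Suc i then Y i $$ (c, b mod M) else 0) * v b)"
      unfolding mv_def by (intro sum.cong) (use lt ic in \<open>auto simp: superdiag_def\<close>)
    also have "\<dots> = (\<Sum>k<L. \<Sum>e<M. (if k = Suc i then Y i $$ (c, e) * v (k * M + e) else 0))"
      unfolding sum_blocks
    proof (intro sum.cong refl)
      fix k e assume "e \<in> {..<M}"
      then have "(k * M + e) div M = k" "(k * M + e) mod M = e" by auto
      moreover have "(if b div M = Suc i then Y i $$ (c, b mod M) else 0) * v b = (if k = Suc i then Y i $$ (c, e) * v b else 0)"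
        if "b div M = k" "b mod M = e" for b using that by simp
      ultimately show "(if (k * M + e) div M = Suc i then Y i $$ (c, (k * M + e) mod M) else 0) * v (k * M + e)
          = (if k = Suc i then Y i $$ (c, e) * v (k * M + e) else 0)" by blast
    qed
    also have "\<dots> = (\<Sum>k<L. if k = Suc i then \<Sum>e<M. Y i $$ (c, e) * v (k * M + e) else 0)"
      by (intro sum.cong) auto
    also have "\<dots> = (if Suc i < L then \<Sum>e<M. Y i $$ (c, e) * v (Suc i * M + e) else 0)" by simp
    finally show ?thesis using Y[of i] by (auto simp: mv_def u_def)
  qed
  have vv: "ip (L * M) v v = (\<Sum>i<L. ip M (u i) (u i))" by (simp add: ip_def sum_blocks u_def)
  have WW: "ip (L * M) (mv ?W v) (mv ?W v) = (\<Sum>i<L. if Suc i < L then ip M (mv (Y i) (u (Suc i))) (mv (Y i) (u (Suc i))) else 0)"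
    unfolding ip_def sum_blocks by (intro sum.cong refl) (auto simp: mvW)
  have "cpos (r\<^sup>2 *\<^sub>R ip (L * M) v v - ip (L * M) (mv ?W v) (mv ?W v))"
  proof (cases L)
    case 0 then show ?thesis by (simp add: ip_def)
  next
    case (Suc K)
    have WW': "ip (L * M) (mv ?W v) (mv ?W v) = (\<Sum>i<K. ip M (mv (Y i) (u (Suc i))) (mv (Y i) (u (Suc i))))"
      unfolding WW by (auto simp: Suc intro!: sum.cong)
    have vv': "ip (L * M) v v = ip M (u 0) (u 0) + (\<Sum>i<K. ip M (u (Suc i)) (u (Suc i)))"
      unfolding vv unfolding Suc by (rule sum.lessThan_Suc_shift)
    have "r\<^sup>2 *\<^sub>R ip (L * M) v v - ip (L * M) (mv ?W v) (mv ?W v)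
       = r\<^sup>2 *\<^sub>R ip M (u 0) (u 0) + (\<Sum>i<K. r\<^sup>2 *\<^sub>R ip M (u (Suc i)) (u (Suc i)) - ip M (mv (Y i) (u (Suc i))) (mv (Y i) (u (Suc i))))"
      unfolding WW' vv' by (simp add: scaleR_add_right scaleR_sum_right sum_subtractf)
    also have "cpos \<dots>"
      using Y r Suc by (intro cpos_add cpos_sum cpos_scaleR cpos_mv_order cpos_ip) auto
    finally show ?thesis .
  qed
  then have "norm (ip (L * M) (mv ?W v) (mv ?W v)) \<le> norm (r\<^sup>2 *\<^sub>R ip (L * M) v v)"
    by (intro cpos_norm_mono cpos_ip)
  then have "(cn (L * M) (mv ?W v))\<^sup>2 \<le> (r * cn (L * M) v)\<^sup>2" using r by (simp add: cn_power2 power_mult_distrib)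
  then have "cn (L * M) (mv ?W v) \<le> r * cn (L * M) v"
    by (rule power2_le_imp_le) (use r in \<open>simp add: order_less_imp_le\<close>)
  then show "cn (dim_row ?W) (mv ?W v) \<le> r * cn (dim_col ?W) v" by (simp add: superdiag_def)
qed (use r in simp)

section \<open>Lagrange interpolation and coefficient bounds\<close>

definition abs_coeff_sum :: "real poly \<Rightarrow> real" where
  "abs_coeff_sum p = (\<Sum>i\<le>degree p. \<bar>coeff p i\<bar>)"

lemma abs_coeff_sum_ge: "degree p \<le> n \<Longrightarrow> abs_coeff_sum p = (\<Sum>i\<le>n. \<bar>coeff p i\<bar>)"
  unfolding abs_coeff_sum_def
  by (rule sum.mono_neutral_left) (auto simp: coeff_eq_0)

lemma abs_coeff_le: "\<bar>coeff p i\<bar> \<le> abs_coeff_sum p"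
proof -
  have "\<bar>coeff p i\<bar> \<le> (\<Sum>j\<le>max i (degree p). \<bar>coeff p j\<bar>)"
    by (rule member_le_sum) auto
  then show ?thesis using abs_coeff_sum_ge[of p "max i (degree p)"] by simp
qed

lemma abs_coeff_sum_linear_mult: "abs_coeff_sum ([:a, b:] * p) \<le> (\<bar>a\<bar> + \<bar>b\<bar>) * abs_coeff_sum p"
proof -
  let ?n = "Suc (degree p)"
  have d: "degree ([:a, b:] * p) \<le> ?n"
    by (rule order_trans[OF degree_mult_le]) simp
  have "abs_coeff_sum ([:a, b:] * p) = (\<Sum>i\<le>?n. \<bar>coeff ([:a, b:] * p) i\<bar>)"
    by (rule abs_coeff_sum_ge[OF d])
  also have "\<dots> \<le> (\<Sum>i\<le>?n. \<bar>a\<bar> * \<bar>coeff p i\<bar> + \<bar>b\<bar> * (case i of 0 \<Rightarrow> 0 | Suc j \<Rightarrow> \<bar>coeff p j\<bar>))"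
    by (intro sum_mono) (auto simp: coeff_pCons abs_mult split: nat.splits intro: order_trans[OF abs_triangle_ineq])
  also have "\<dots> = \<bar>a\<bar> * (\<Sum>i\<le>?n. \<bar>coeff p i\<bar>) + \<bar>b\<bar> * (\<Sum>i\<le>degree p. \<bar>coeff p i\<bar>)"
    by (simp add: sum.distrib sum_distrib_left sum.atMost_Suc_shift distrib_left del: sum.atMost_Suc)
  also have "\<dots> = (\<bar>a\<bar> + \<bar>b\<bar>) * abs_coeff_sum p"
    using abs_coeff_sum_ge[of p ?n] by (simp add: abs_coeff_sum_def algebra_simps)
  finally show ?thesis .
qed

lemma abs_coeff_sum_prod_linear:
  assumes "finite I" "\<And>i. i \<in> I \<Longrightarrow> \<bar>a i\<bar> \<le> 1"
  shows "abs_coeff_sum (\<Prod>i\<in>I. [:- a i, 1:]) \<le> 2 ^ card I"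
  using assms
proof (induction I rule: finite_induct)
  case empty
  show ?case by (simp add: abs_coeff_sum_def)
next
  case (insert i I)
  have "abs_coeff_sum ([:- a i, 1:] * (\<Prod>i\<in>I. [:- a i, 1:]))
      \<le> (\<bar>a i\<bar> + 1) * abs_coeff_sum (\<Prod>i\<in>I. [:- a i, 1:])"
    using abs_coeff_sum_linear_mult[of "- a i" 1] by simp
  also have "\<dots> \<le> 2 * 2 ^ card I"
    using insert by (intro mult_mono) (auto simp: abs_coeff_sum_def intro: sum_nonneg)
  finally show ?case using insert by simp
qed

definition node :: "nat \<Rightarrow> nat \<Rightarrow> real" where "node k m = real m / real (max k 1)"

definition lagrange :: "nat \<Rightarrow> nat \<Rightarrow> real poly" where
  "lagrange k m = Polynomial.smult (1 / (\<Prod>n\<in>{..k}-{m}. node k m - node k n)) (\<Prod>n\<in>{..k}-{m}. [:- node k n, 1:])"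

lemma node_bounds: "m \<le> k \<Longrightarrow> 0 \<le> node k m \<and> node k m \<le> 1"
  by (auto simp: node_def)

lemma inj_node: "node k m = node k n \<longleftrightarrow> m = n"
  by (auto simp: node_def field_simps)

lemma poly_lagrange_node: "m \<le> k \<Longrightarrow> n \<le> k \<Longrightarrow> poly (lagrange k m) (node k n) = (if m = n then 1 else 0)"
proof -
  assume mn: "m \<le> k" "n \<le> k"
  have "(\<Prod>n\<in>{..k}-{m}. node k m - node k n) \<noteq> 0" by (auto simp: inj_node)
  moreover have "(\<Prod>i\<in>{..k}-{m}. node k n - node k i) = 0" if "m \<noteq> n"
    using that mn by (intro prod_zero) auto
  ultimately show ?thesis by (auto simp: lagrange_def poly_prod)
qed

lemma degree_lagrange: "m \<le> k \<Longrightarrow> degree (lagrange k m) \<le> k"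
proof -
  assume "m \<le> k"
  have "degree (\<Prod>n\<in>{..k}-{m}. [:- node k n, 1:]) \<le> (\<Sum>n\<in>{..k}-{m}. degree [:- node k n, 1:])"
    using degree_prod_sum_le[of "{..k}-{m}" "\<lambda>n. [:- node k n, 1:]"] by (simp add: comp_def)
  also have "\<dots> \<le> k" using \<open>m \<le> k\<close> by simp
  finally show ?thesis by (simp add: lagrange_def)
qed

lemma prod_distance_fact: "m \<le> k \<Longrightarrow> (\<Prod>n\<in>{..k}-{m}. \<bar>real m - real n\<bar>) = fact m * fact (k - m)"
proof -
  assume mk: "m \<le> k"
  have "{..k}-{m} = {..<m} \<union> {Suc m..k}" using mk by auto
  then have "(\<Prod>n\<in>{..k}-{m}. \<bar>real m - real n\<bar>)
      = (\<Prod>n\<in>{..<m} \<union> {Suc m..k}. \<bar>real m - real n\<bar>)" by (simp only:)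
  also have "\<dots> = (\<Prod>n\<in>{..<m}. \<bar>real m - real n\<bar>) * (\<Prod>n\<in>{Suc m..k}. \<bar>real m - real n\<bar>)"
    by (rule prod.union_disjoint) auto
  also have "(\<Prod>n\<in>{..<m}. \<bar>real m - real n\<bar>) = fact m"
  proof -
    have "(\<Prod>n\<in>{..<m}. \<bar>real m - real n\<bar>) = (\<Prod>n\<in>{1..m}. real n)"
      by (rule prod.reindex_bij_witness[of _ "\<lambda>n. m - n" "\<lambda>n. m - n"]) (auto simp: of_nat_diff)
    then show ?thesis by (simp add: fact_prod)
  qed
  also have "(\<Prod>n\<in>{Suc m..k}. \<bar>real m - real n\<bar>) = fact (k - m)"
  proof -
    have "(\<Prod>n\<in>{Suc m..k}. \<bar>real m - real n\<bar>) = (\<Prod>n\<in>{1..k-m}. real n)"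
      by (rule prod.reindex_bij_witness[of _ "\<lambda>n. n + m" "\<lambda>n. n - m"]) auto
    then show ?thesis by (simp add: fact_prod)
  qed
  finally show ?thesis .
qed

definition KK :: real where "KK = 8 * exp 1"

lemma KK_ge: "KK \<ge> 8" by (simp add: KK_def)

text \<open>Numerators have coefficient sum at most \<open>2\<^sup>k\<close>; denominators are at least
  \<open>m! (k - m)! / k\<^sup>k\<close>, and \<open>k\<^sup>k / (m! (k - m)!)\<close> is a binomial
  coefficient times \<open>k\<^sup>k / k! \<le> e\<^sup>k\<close>.\<close>

lemma lagrange_coeff_bound:
  assumes "m \<le> k"
  shows "\<bar>coeff (lagrange k m) j\<bar> \<le> (4 * exp 1) ^ k"
proof -
  let ?q = "max k 1"
  let ?P = "(\<Prod>n\<in>{..k}-{m}. node k m - node k n)"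
  have card: "card ({..k}-{m}) = k" using assms by simp
  have P: "\<bar>?P\<bar> = fact m * fact (k - m) / real ?q ^ k"
  proof -
    have "\<bar>?P\<bar> = (\<Prod>n\<in>{..k}-{m}. \<bar>real m - real n\<bar> / real ?q)"
      unfolding abs_prod by (intro prod.cong) (auto simp: node_def simp flip: diff_divide_distrib)
    then show ?thesis using card by (simp add: prod_dividef prod_distance_fact[OF assms])
  qed
  have "\<bar>coeff (lagrange k m) j\<bar> = (1 / \<bar>?P\<bar>) * \<bar>coeff (\<Prod>n\<in>{..k}-{m}. [:- node k n, 1:]) j\<bar>"
    by (simp add: lagrange_def abs_mult)
  also have "\<dots> \<le> (1 / \<bar>?P\<bar>) * 2 ^ k"
  proof (intro mult_left_mono)
    show "\<bar>coeff (\<Prod>n\<in>{..k}-{m}. [:- node k n, 1:]) j\<bar> \<le> 2 ^ k"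
      using abs_coeff_sum_prod_linear[of "{..k}-{m}" "node k"] node_bounds[of _ k] card
        abs_coeff_le[of "\<Prod>n\<in>{..k}-{m}. [:- node k n, 1:]" j] by fastforce
  qed simp
  also have "1 / \<bar>?P\<bar> = real ?q ^ k / fact k * real (k choose m)"
    using assms by (simp add: P binomial_fact)
  also have "\<dots> * 2 ^ k \<le> (exp 1 ^ k * 2 ^ k) * 2 ^ k"
  proof (intro mult_right_mono mult_mono)
    show "real ?q ^ k / fact k \<le> exp 1 ^ k"
    proof (cases "k = 0")
      case False
      have "real k ^ k / fact k \<le> exp (real k)"
        using sum_le_suminf[OF summable_exp_generic[of "real k"], of "{k}"]
        by (auto simp: exp_def divide_inverse mult.commute)
      moreover have "max k 1 = k" using False by simp
      ultimately show ?thesis by (simp add: exp_of_nat_mult[symmetric] del: max.absorb_iff1)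
    qed simp
    show "real (k choose m) \<le> 2 ^ k"
      using binomial_le_pow2[of k m] by (metis of_nat_le_iff of_nat_numeral of_nat_power)
  qed auto
  also have "\<dots> = (exp 1 * 2 * 2) ^ k" by (simp only: power_mult_distrib)
  also have "exp 1 * 2 * 2 = 4 * exp (1::real)" by simp
  finally show ?thesis .
qed

lemma lagrange_dual:
  assumes "i \<le> k" "j \<le> k"
  shows "(\<Sum>m\<le>k. node k m ^ i * coeff (lagrange k m) j) = (if i = j then 1 else 0)"
proof -
  let ?p = "\<Sum>m\<le>k. Polynomial.smult (node k m ^ i) (lagrange k m)"
  have "?p = monom 1 i"
  proof (rule ccontr)
    assume ne: "?p \<noteq> monom 1 i"
    let ?d = "?p - monom 1 i"
    have d0: "?d \<noteq> 0" using ne by simp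
    have "degree ?d \<le> k"
      using assms degree_lagrange
      by (intro degree_diff_le degree_sum_le) (auto simp: degree_monom_eq intro: order_trans[OF degree_smult_le])
    then have le: "card {x. poly ?d x = 0} \<le> k" by (rule order_trans[OF card_poly_roots_bound[OF d0]])
    have sub: "node k ` {..k} \<subseteq> {x. poly ?d x = 0}"
    proof
      fix x assume "x \<in> node k ` {..k}"
      then obtain n where n: "n \<le> k" "x = node k n" by auto
      have "poly ?p x = (\<Sum>m\<le>k. node k m ^ i * (if m = n then 1 else 0))"
        unfolding poly_sum poly_smult n(2)
        by (intro sum.cong refl) (use n in \<open>simp add: poly_lagrange_node\<close>)
      also have "\<dots> = (\<Sum>m\<le>k. if m = n then node k m ^ i else 0)" by (intro sum.cong) auto
      also have "\<dots> = node k n ^ i" using n by (subst sum.delta) auto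
      finally show "x \<in> {x. poly ?d x = 0}" using n by (simp add: poly_monom)
    qed
    have "card (node k ` {..k}) = Suc k" by (subst card_image) (auto simp: inj_on_def inj_node)
    then show False
      using card_mono[OF poly_roots_finite[OF d0] sub] le by linarith
  qed
  then have "coeff ?p j = (if i = j then 1 else 0)" by simp
  then show ?thesis by (simp add: coeff_sum)
qed

lemma coeff_from_nodes:
  fixes c :: "nat \<Rightarrow> 'b::real_vector"
  assumes "j \<le> k"
  shows "(\<Sum>m\<le>k. coeff (lagrange k m) j *\<^sub>R (\<Sum>i\<le>k. node k m ^ i *\<^sub>R c i)) = c j"
proof -
  have "(\<Sum>m\<le>k. coeff (lagrange k m) j *\<^sub>R (\<Sum>i\<le>k. node k m ^ i *\<^sub>R c i))
      = (\<Sum>m\<le>k. \<Sum>i\<le>k. (node k m ^ i * coeff (lagrange k m) j) *\<^sub>R c i)"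
    by (simp add: scaleR_sum_right mult.commute)
  also have "\<dots> = (\<Sum>i\<le>k. (\<Sum>m\<le>k. node k m ^ i * coeff (lagrange k m) j) *\<^sub>R c i)"
    by (subst sum.swap) (simp add: scaleR_sum_left)
  also have "\<dots> = (\<Sum>i\<le>k. if i = j then c i else 0)"
    by (intro sum.cong refl) (use assms in \<open>simp add: lagrange_dual\<close>)
  finally show ?thesis using assms by simp
qed

text \<open>The growth rate of the coefficients of a polynomial of degree \<open>k\<close> in terms of
  its supremum is only exponential in \<open>k\<close>.  All radii below are chosen so that a geometric
  series with ratio proportional to \<open>KK\<close> converges.\<close>

lemma coeff_bound:
  fixes c :: "nat \<Rightarrow> 'b::real_normed_vector"
  assumes b: "\<And>u. 0 \<le> u \<Longrightarrow> u \<le> 1 \<Longrightarrow> norm (\<Sum>i\<le>k. u ^ i *\<^sub>R c i) \<le> B" and j: "j \<le> k"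
  shows "norm (c j) \<le> KK ^ k * B"
proof -
  have B: "B \<ge> 0" using order_trans[OF norm_ge_zero b[of 0]] by simp
  have "norm (c j) \<le> (\<Sum>m\<le>k. (4 * exp 1) ^ k * B)"
    unfolding coeff_from_nodes[OF j, of c, symmetric]
  proof (rule sum_norm_le)
    fix m assume "m \<in> {..k}"
    then show "norm (coeff (lagrange k m) j *\<^sub>R (\<Sum>i\<le>k. node k m ^ i *\<^sub>R c i)) \<le> (4 * exp 1) ^ k * B"
      using node_bounds[of m k] b[of "node k m"] lagrange_coeff_bound[of m k j] B
      by (auto intro!: mult_mono)
  qed
  also have "\<dots> = real (Suc k) * ((4 * exp 1) ^ k * B)" by simp
  also have "\<dots> \<le> 2 ^ k * ((4 * exp 1) ^ k * B)"
  proof (rule mult_right_mono)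
    have "Suc k \<le> 2 ^ k" by (induction k) auto
    then show "real (Suc k) \<le> 2 ^ k" by (metis of_nat_le_iff of_nat_numeral of_nat_power)
  qed (use B in simp)
  also have "\<dots> = (2 * (4 * exp 1)) ^ k * B" by (simp only: power_mult_distrib mult.assoc)
  also have "2 * (4 * exp (1::real)) = KK" by (simp add: KK_def)
  finally show ?thesis .
qed

definition poly_on :: "nat \<Rightarrow> (real \<Rightarrow> 'b::real_vector) \<Rightarrow> bool" where
  "poly_on k \<phi> \<longleftrightarrow> (\<exists>c. \<forall>u\<in>{0..1}. \<phi> u = (\<Sum>i\<le>k. u ^ i *\<^sub>R c i))"

text \<open>Interpolation at fixed nodes makes the coefficients depend linearly on finitely many values,
  so they converge with the values.\<close>

lemma poly_on_limit:
  fixes \<phi> :: "real \<Rightarrow> 'b::real_normed_vector"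
  assumes p: "\<And>n. poly_on k (\<psi> n)" and l: "\<And>u. u \<in> {0..1} \<Longrightarrow> (\<lambda>n. \<psi> n u) \<longlonglongrightarrow> \<phi> u"
  shows "poly_on k \<phi>"
proof -
  obtain c where c: "\<And>n u. u \<in> {0..1} \<Longrightarrow> \<psi> n u = (\<Sum>i\<le>k. u ^ i *\<^sub>R c n i)"
    using p unfolding poly_on_def by metis
  define d where "d j = (\<Sum>m\<le>k. coeff (lagrange k m) j *\<^sub>R \<phi> (node k m))" for j
  have cn: "c n j = (\<Sum>m\<le>k. coeff (lagrange k m) j *\<^sub>R \<psi> n (node k m))" if "j \<le> k" for n j
    using coeff_from_nodes[OF that, of "c n"] c node_bounds[of _ k] by simp
  have "(\<lambda>n. c n j) \<longlonglongrightarrow> d j" if "j \<le> k" for j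
    unfolding cn[OF that] d_def using node_bounds[of _ k] by (intro tendsto_intros l) auto
  then have "(\<lambda>n. \<Sum>i\<le>k. u ^ i *\<^sub>R c n i) \<longlonglongrightarrow> (\<Sum>i\<le>k. u ^ i *\<^sub>R d i)" for u
    by (intro tendsto_intros) auto
  then have "\<phi> u = (\<Sum>i\<le>k. u ^ i *\<^sub>R d i)" if "u \<in> {0..1}" for u
    using LIMSEQ_unique[OF l[OF that]] c[OF that] by simp
  then show ?thesis unfolding poly_on_def by blast
qed

lemma poly_on_mono: "poly_on j \<phi> \<Longrightarrow> j \<le> k \<Longrightarrow> poly_on k \<phi>"
proof -
  assume "poly_on j \<phi>" and jk: "j \<le> k"
  then obtain c where c: "\<And>u. u \<in> {0..1} \<Longrightarrow> \<phi> u = (\<Sum>i\<le>j. u ^ i *\<^sub>R c i)" unfolding poly_on_def by blast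
  have "(\<Sum>i\<le>j. u ^ i *\<^sub>R c i) = (\<Sum>i\<le>k. u ^ i *\<^sub>R (if i \<le> j then c i else 0))" for u
    using jk by (intro sum.mono_neutral_cong_left) auto
  then show ?thesis unfolding poly_on_def using c by (intro exI[of _ "\<lambda>i. if i \<le> j then c i else 0"]) auto
qed

lemma poly_on_add: "poly_on k \<phi> \<Longrightarrow> poly_on k \<psi> \<Longrightarrow> poly_on k (\<lambda>u. \<phi> u + \<psi> u)"
proof -
  assume "poly_on k \<phi>" "poly_on k \<psi>"
  then obtain c d where "\<And>u. u \<in> {0..1} \<Longrightarrow> \<phi> u = (\<Sum>i\<le>k. u ^ i *\<^sub>R c i)" "\<And>u. u \<in> {0..1} \<Longrightarrow> \<psi> u = (\<Sum>i\<le>k. u ^ i *\<^sub>R d i)"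
    unfolding poly_on_def by blast
  then show ?thesis unfolding poly_on_def
    by (intro exI[of _ "\<lambda>i. c i + d i"]) (auto simp: scaleR_add_right sum.distrib)
qed

lemma poly_on_scaleR: "poly_on k \<phi> \<Longrightarrow> poly_on k (\<lambda>u. r *\<^sub>R \<phi> u)"
proof -
  assume "poly_on k \<phi>"
  then obtain c where "\<And>u. u \<in> {0..1} \<Longrightarrow> \<phi> u = (\<Sum>i\<le>k. u ^ i *\<^sub>R c i)"
    unfolding poly_on_def by blast
  then show ?thesis unfolding poly_on_def
    by (intro exI[of _ "\<lambda>i. r *\<^sub>R c i"]) (auto simp: scaleR_sum_right mult.commute)
qed

lemma poly_on_diff: "poly_on k \<phi> \<Longrightarrow> poly_on k \<psi> \<Longrightarrow> poly_on k (\<lambda>u. \<phi> u - \<psi> u)"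
  using poly_on_add[of k \<phi> "\<lambda>u. (-1) *\<^sub>R \<psi> u"] poly_on_scaleR[of k \<psi> "-1"] by simp

lemma poly_on_zero: "poly_on k (\<lambda>u. 0)"
  unfolding poly_on_def by (intro exI[of _ "\<lambda>i. 0"]) simp

lemma poly_on_sum: "(\<And>i. i \<in> I \<Longrightarrow> poly_on k (\<phi> i)) \<Longrightarrow> poly_on k (\<lambda>u. \<Sum>i\<in>I. \<phi> i u)"
  by (induction I rule: infinite_finite_induct) (auto intro: poly_on_add poly_on_zero)

lemma poly_on_monom: "i \<le> k \<Longrightarrow> poly_on k (\<lambda>u. u ^ i *\<^sub>R c)"
proof -
  assume i: "i \<le> k"
  have "u ^ i *\<^sub>R c = (\<Sum>j\<le>k. u ^ j *\<^sub>R (if j = i then c else 0))" for u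
  proof -
    have "(\<Sum>j\<le>k. u ^ j *\<^sub>R (if j = i then c else 0)) = (\<Sum>j\<le>k. if j = i then u ^ j *\<^sub>R c else 0)"
      by (intro sum.cong) auto
    then show ?thesis using i by simp
  qed
  then show ?thesis unfolding poly_on_def by (intro exI[of _ "\<lambda>j. if j = i then c else 0"]) blast
qed

lemma poly_on_poly: "degree P \<le> k \<Longrightarrow> poly_on k (\<lambda>u. poly P u *\<^sub>R c)"
proof -
  assume d: "degree P \<le> k"
  have "poly P u *\<^sub>R c = (\<Sum>i\<le>degree P. u ^ i *\<^sub>R (coeff P i *\<^sub>R c))" for u
    by (simp add: poly_altdef scaleR_sum_left mult.commute)
  moreover have "poly_on k (\<lambda>u. \<Sum>i\<le>degree P. u ^ i *\<^sub>R (coeff P i *\<^sub>R c))"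
    using d by (intro poly_on_sum poly_on_monom) simp
  ultimately show ?thesis by (simp only:)
qed

section \<open>Power series with values in a Banach space\<close>

lemma power_tail_bound:
  fixes a :: "nat \<Rightarrow> 'b::banach"
  assumes s: "(\<lambda>k. t ^ k *\<^sub>R a k) sums S" and N: "\<And>k. norm (a k) \<le> N" and t: "\<bar>t\<bar> \<le> 1/2"
  shows "norm (S - (\<Sum>k<n. t ^ k *\<^sub>R a k)) \<le> 2 * N * \<bar>t\<bar> ^ n"
proof -
  have N0: "N \<ge> 0" using order_trans[OF norm_ge_zero N] .
  have tail: "(\<lambda>i. t ^ (i + n) *\<^sub>R a (i + n)) sums (S - (\<Sum>k<n. t ^ k *\<^sub>R a k))"
    by (rule sums_split_initial_segment[OF s])
  have geo: "(\<lambda>i. N * \<bar>t\<bar> ^ n * \<bar>t\<bar> ^ i) sums (N * \<bar>t\<bar> ^ n * (1 / (1 - \<bar>t\<bar>)))"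
    using t by (intro sums_mult geometric_sums) auto
  have "norm (S - (\<Sum>k<n. t ^ k *\<^sub>R a k)) \<le> N * \<bar>t\<bar> ^ n * (1 / (1 - \<bar>t\<bar>))"
  proof -
    have "norm (\<Sum>i. t ^ (i + n) *\<^sub>R a (i + n)) \<le> (\<Sum>i. N * \<bar>t\<bar> ^ n * \<bar>t\<bar> ^ i)"
    proof (rule norm_suminf_le[OF _ sums_summable[OF geo]])
      fix i
      have "norm (t ^ (i + n) *\<^sub>R a (i + n)) = (\<bar>t\<bar> ^ n * \<bar>t\<bar> ^ i) * norm (a (i + n))"
        by (simp add: power_add abs_mult power_abs)
      also have "\<dots> \<le> (\<bar>t\<bar> ^ n * \<bar>t\<bar> ^ i) * N" by (intro mult_left_mono N) simp
      finally show "norm (t ^ (i + n) *\<^sub>R a (i + n)) \<le> N * \<bar>t\<bar> ^ n * \<bar>t\<bar> ^ i" by (simp add: mult_ac)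
    qed
    then show ?thesis using sums_unique[OF tail] sums_unique[OF geo] by simp
  qed
  also have "\<dots> \<le> N * \<bar>t\<bar> ^ n * 2"
    using t N0 by (intro mult_left_mono) (auto simp: field_simps)
  finally show ?thesis by (simp add: mult_ac)
qed

lemma power_series_zero:
  fixes a :: "nat \<Rightarrow> 'b::banach"
  assumes r: "r > 0" and s: "\<And>t. 0 < t \<Longrightarrow> t < r \<Longrightarrow> (\<lambda>k. t ^ k *\<^sub>R a k) sums 0"
  shows "a k = 0"
proof (induction k rule: less_induct)
  case (less k)
  define q where "q = r / 2"
  have q: "0 < q" "q < r" using r by (auto simp: q_def)
  have "(\<lambda>k. q ^ k *\<^sub>R a k) \<longlonglongrightarrow> 0" using s[OF q] by (intro summable_LIMSEQ_zero sums_summable)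
  then have "Bseq (\<lambda>k. q ^ k *\<^sub>R a k)" by (intro convergent_imp_Bseq convergentI)
  then obtain M where M: "\<And>k. norm (q ^ k *\<^sub>R a k) \<le> M" by (auto simp: Bseq_def)
  have "norm (q ^ k *\<^sub>R a k) \<le> 0 + e" if e: "e > 0" for e
  proof -
    have M0: "M \<ge> 0" using order_trans[OF norm_ge_zero M] .
    define t where "t = min (1/2) (e / (2 * M + 1))"
    have t: "0 < t" "t \<le> 1/2" "t * (2 * M) \<le> e"
    proof -
      show "0 < t" using e M0 by (simp add: t_def)
      show "t \<le> 1/2" unfolding t_def by (rule min.cobounded1)
      have "t * (2 * M) \<le> e / (2 * M + 1) * (2 * M + 1)"
        using e M0 by (intro mult_mono) (auto simp: t_def)
      also have "\<dots> = e" using M0 by (auto simp: add_nonneg_eq_0_iff)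
      finally show "t * (2 * M) \<le> e" .
    qed
    have ss: "(\<lambda>k. t ^ k *\<^sub>R (q ^ k *\<^sub>R a k)) sums 0"
      using s[of "t * q"] t q by (simp add: power_mult_distrib mult_less_cancel_right2 order_le_less_trans[of "t * q" q r])
    have "norm (0 - (\<Sum>i<Suc k. t ^ i *\<^sub>R (q ^ i *\<^sub>R a i))) \<le> 2 * M * \<bar>t\<bar> ^ Suc k"
      by (rule power_tail_bound[OF ss M]) (use t in auto)
    moreover have "(\<Sum>i<Suc k. t ^ i *\<^sub>R (q ^ i *\<^sub>R a i)) = t ^ k *\<^sub>R (q ^ k *\<^sub>R a k)"
      using less by (simp add: sum.neutral)
    ultimately have "norm (t ^ k *\<^sub>R (q ^ k *\<^sub>R a k)) \<le> 2 * M * \<bar>t\<bar> ^ Suc k" by (simp only: diff_0 norm_minus_cancel)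
    then have "t ^ k * norm (q ^ k *\<^sub>R a k) \<le> t ^ k * (t * (2 * M))"
      unfolding norm_scaleR[of "t ^ k"] using t by (simp add: mult_ac)
    then have "norm (q ^ k *\<^sub>R a k) \<le> t * (2 * M)" by (rule mult_left_le_imp_le) (use t in simp)
    then show ?thesis using t by linarith
  qed
  then have "norm (q ^ k *\<^sub>R a k) \<le> 0" by (rule field_le_epsilon)
  then have "q ^ k *\<^sub>R a k = 0" unfolding norm_le_zero_iff .
  then show ?case using q by simp
qed

lemma power_series_unique:
  fixes a b :: "nat \<Rightarrow> 'b::banach"
  assumes r: "r > 0" and a: "\<And>t. 0 < t \<Longrightarrow> t < r \<Longrightarrow> (\<lambda>k. t ^ k *\<^sub>R a k) sums \<phi> t"
    and b: "\<And>t. 0 < t \<Longrightarrow> t < r \<Longrightarrow> (\<lambda>k. t ^ k *\<^sub>R b k) sums \<phi> t"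
  shows "a k = b k"
proof -
  have "(\<lambda>k. a k - b k) k = 0"
  proof (rule power_series_zero[OF r])
    fix t assume "0 < t" "t < r"
    then show "(\<lambda>k. t ^ k *\<^sub>R (a k - b k)) sums 0"
      using sums_diff[OF a[of t] b[of t]] by (simp add: scaleR_diff_right)
  qed
  then show ?thesis by simp
qed

text \<open>If the \<open>k\<close>-th polynomial has degree at most \<open>k\<close> and is
  exponentially small, then the double series may be rearranged by powers of \<open>u\<close>.  The
  resulting power series agrees with the one of \<open>\<phi>\<close> on \<open>[0, 1)\<close>, hence on
  \<open>(-1, 1)\<close>: this transports an expansion from positive to negative
  \<open>u\<close>.\<close>

lemma sum_of_polys_is_power_series:
  fixes m :: "nat \<Rightarrow> nat \<Rightarrow> 'b::banach"
  assumes p: "\<And>k u. 0 \<le> u \<Longrightarrow> u \<le> 1 \<Longrightarrow> norm (\<Sum>j\<le>k. u ^ j *\<^sub>R m k j) \<le> C * \<theta> ^ k"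
    and \<theta>: "0 \<le> \<theta>" "\<theta> * KK \<le> 1/4"
    and b: "\<And>u. \<bar>u\<bar> < 1 \<Longrightarrow> (\<lambda>j. u ^ j *\<^sub>R b j) sums \<phi> u"
    and eq: "\<And>u. 0 \<le> u \<Longrightarrow> u < 1 \<Longrightarrow> (\<lambda>k. \<Sum>j\<le>k. u ^ j *\<^sub>R m k j) sums \<phi> u"
  shows "(\<lambda>k. if j \<le> k then m k j else 0) sums b j"
    and "\<bar>u\<bar> < 1 \<Longrightarrow> (\<lambda>k. \<Sum>j\<le>k. u ^ j *\<^sub>R m k j) sums \<phi> u"
proof -
  have C0: "C \<ge> 0" using order_trans[OF norm_ge_zero p[of 0 0]] by simp
  define M where "M k j = (if j \<le> k then m k j else 0)" for k j
  have Mb: "norm (4 ^ k *\<^sub>R M k j) \<le> C" for k j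
  proof (cases "j \<le> k")
    case True
    have "norm (m k j) \<le> KK ^ k * (C * \<theta> ^ k)" using coeff_bound[OF p[of _ k] True] by blast
    also have "\<dots> = C * (\<theta> * KK) ^ k" by (simp add: power_mult_distrib mult_ac)
    also have "\<dots> \<le> C * (1/4) ^ k" using \<theta> C0 KK_ge by (intro mult_left_mono power_mono) auto
    finally have "norm (m k j) \<le> C * (1/4) ^ k" .
    then have "4 ^ k * norm (m k j) \<le> 4 ^ k * (C * (1/4) ^ k)" by (rule mult_left_mono) simp
    also have "\<dots> = C" by (simp add: power_one_over)
    finally show ?thesis using True by (simp add: M_def)
  qed (use C0 in \<open>simp add: M_def\<close>)
  have Me: "(1/4) ^ k *\<^sub>R (4 ^ k *\<^sub>R M k j) = M k j" for k j by (simp add: power_one_over)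
  have sumM: "summable (\<lambda>k. M k j)" for j
  proof (rule summable_comparison_test'[of "\<lambda>k. C * (1/4) ^ k" 0])
    show "summable (\<lambda>k. C * (1/4) ^ k)" by (intro summable_mult summable_geometric) simp
    show "norm (M k j) \<le> C * (1/4) ^ k" for k
      using Mb[of k j] by (simp add: power_one_over field_simps)
  qed
  define \<beta> where "\<beta> j = (\<Sum>k. M k j)" for j
  have tail: "norm (\<beta> j - (\<Sum>k<J. M k j)) \<le> 2 * C * (1/4) ^ J" for j J
  proof -
    have "(\<lambda>k. (1/4) ^ k *\<^sub>R (4 ^ k *\<^sub>R M k j)) sums \<beta> j"
      unfolding Me \<beta>_def by (rule summable_sums[OF sumM])
    from power_tail_bound[OF this Mb] show ?thesis unfolding Me by simp
  qed
  have \<beta>b: "norm (\<beta> j) \<le> 2 * C * (1/4) ^ j" for j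
  proof -
    have "(\<Sum>k<j. M k j) = 0" by (intro sum.neutral) (auto simp: M_def)
    then show ?thesis using tail[of j j] by simp
  qed
  define \<Phi> where "\<Phi> u = (\<Sum>j. u ^ j *\<^sub>R \<beta> j)" for u :: real
  have sum\<beta>: "(\<lambda>j. u ^ j *\<^sub>R \<beta> j) sums \<Phi> u" if "\<bar>u\<bar> \<le> 1" for u
    unfolding \<Phi>_def
  proof (rule summable_sums, rule summable_comparison_test'[of "\<lambda>k. 2 * C * (1/4) ^ k" 0])
    show "summable (\<lambda>k. 2 * C * (1/4) ^ k)" by (intro summable_mult summable_geometric) simp
    show "norm (u ^ k *\<^sub>R \<beta> k) \<le> 2 * C * (1/4) ^ k" for k
    proof -
      have "\<bar>u\<bar> ^ k * norm (\<beta> k) \<le> 1 * norm (\<beta> k)"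
        using that by (intro mult_right_mono power_le_one) auto
      then show ?thesis using \<beta>b[of k] by (simp add: power_abs)
    qed
  qed
  have main: "(\<lambda>k. \<Sum>j\<le>k. u ^ j *\<^sub>R m k j) sums \<Phi> u" if u: "\<bar>u\<bar> \<le> 1" for u
  proof -
    have PJ: "(\<Sum>k<J. \<Sum>j\<le>k. u ^ j *\<^sub>R m k j) = (\<Sum>j<J. u ^ j *\<^sub>R (\<Sum>k<J. M k j))" for J
    proof -
      have "(\<Sum>j\<le>k. u ^ j *\<^sub>R m k j) = (\<Sum>j<J. u ^ j *\<^sub>R M k j)" if "k < J" for k
        using that by (intro sum.mono_neutral_cong_left) (auto simp: M_def)
      then have "(\<Sum>k<J. \<Sum>j\<le>k. u ^ j *\<^sub>R m k j) = (\<Sum>k<J. \<Sum>j<J. u ^ j *\<^sub>R M k j)" by simp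
      then show ?thesis by (subst (asm) sum.swap) (simp add: scaleR_sum_right)
    qed
    have "(\<lambda>J. (\<Sum>j<J. u ^ j *\<^sub>R \<beta> j) - (\<Sum>k<J. \<Sum>j\<le>k. u ^ j *\<^sub>R m k j)) \<longlonglongrightarrow> 0"
    proof (rule Lim_null_comparison)
      show "\<forall>\<^sub>F J in sequentially. norm ((\<Sum>j<J. u ^ j *\<^sub>R \<beta> j) - (\<Sum>k<J. \<Sum>j\<le>k. u ^ j *\<^sub>R m k j)) \<le> 2 * C * (real J * (1/4) ^ J)"
      proof (intro always_eventually allI)
        fix J
        have "(\<Sum>j<J. u ^ j *\<^sub>R \<beta> j) - (\<Sum>k<J. \<Sum>j\<le>k. u ^ j *\<^sub>R m k j) = (\<Sum>j<J. u ^ j *\<^sub>R (\<beta> j - (\<Sum>k<J. M k j)))"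
          unfolding PJ by (simp add: scaleR_diff_right sum_subtractf)
        also have "norm \<dots> \<le> (\<Sum>j<J. 2 * C * (1/4) ^ J)"
        proof (rule sum_norm_le)
          fix j
          have "\<bar>u\<bar> ^ j * norm (\<beta> j - (\<Sum>k<J. M k j)) \<le> 1 * norm (\<beta> j - (\<Sum>k<J. M k j))"
            using u by (intro mult_right_mono power_le_one) auto
          then show "norm (u ^ j *\<^sub>R (\<beta> j - (\<Sum>k<J. M k j))) \<le> 2 * C * (1/4) ^ J"
            using tail[of j J] by (simp add: power_abs)
        qed
        finally show "norm ((\<Sum>j<J. u ^ j *\<^sub>R \<beta> j) - (\<Sum>k<J. \<Sum>j\<le>k. u ^ j *\<^sub>R m k j)) \<le> 2 * C * (real J * (1/4) ^ J)"
          by (simp add: mult_ac)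
      qed
      have "(\<lambda>J. real J * (1/4) ^ J) \<longlonglongrightarrow> 0" using powser_times_n_limit_0[of "1/4::real"] by simp
      then show "(\<lambda>J. 2 * C * (real J * (1/4) ^ J)) \<longlonglongrightarrow> 0" by (rule tendsto_mult_right_zero)
    qed
    from tendsto_diff[OF sum\<beta>[OF u, unfolded sums_def] this] show ?thesis by (simp add: sums_def)
  qed
  have \<beta>eq: "\<beta> j = b j" for j
  proof (rule power_series_unique[of 1 \<beta> \<Phi> b])
    fix t :: real assume t: "0 < t" "t < 1"
    show "(\<lambda>k. t ^ k *\<^sub>R \<beta> k) sums \<Phi> t" using sum\<beta> t by simp
    have "\<phi> t = \<Phi> t" using main[of t] eq[of t] t sums_unique2 by fastforce
    then show "(\<lambda>k. t ^ k *\<^sub>R b k) sums \<Phi> t" using b[of t] t by simp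
  qed simp
  show "(\<lambda>k. if j \<le> k then m k j else 0) sums b j"
    unfolding \<beta>eq[symmetric] \<beta>_def M_def[symmetric] by (rule summable_sums[OF sumM])
  show "(\<lambda>k. \<Sum>j\<le>k. u ^ j *\<^sub>R m k j) sums \<phi> u" if u: "\<bar>u\<bar> < 1"
  proof -
    have "\<phi> u = \<Phi> u" using b[OF u] sum\<beta>[of u] u unfolding \<beta>eq by (simp add: sums_unique2)
    then show ?thesis using main[of u] u by simp
  qed
qed

section \<open>Analyticity along the lines of a quadrant\<close>

definition quad :: "(real \<times> real) set" where "quad = {v. 0 \<le> fst v \<and> fst v \<le> 1 \<and> 0 \<le> snd v \<and> snd v \<le> 1}"
definition sq :: "(real \<times> real) set" where "sq = {z. \<bar>fst z\<bar> \<le> 1 \<and> \<bar>snd z\<bar> \<le> 1}"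

text \<open>At every point of a square a power series is available in all directions of one quadrant,
  but the bound \<open>N z\<close> depends on the point in an unknown way.  The sets \<open>{N \<le>
  n}\<close> play the role of the closed sets in Baire's theorem.\<close>

locale quadrant_analytic =
  fixes g :: "real \<times> real \<Rightarrow> 'b::banach" and a :: "real \<times> real \<Rightarrow> real \<times> real \<Rightarrow> nat \<Rightarrow> 'b"
    and N :: "real \<times> real \<Rightarrow> real"
  assumes bound: "\<And>z v k. z \<in> sq \<Longrightarrow> v \<in> quad \<Longrightarrow> norm (a z v k) \<le> N z"
    and series: "\<And>z v t. z \<in> sq \<Longrightarrow> v \<in> quad \<Longrightarrow> \<bar>t\<bar> < 1 \<Longrightarrow> (\<lambda>k. t ^ k *\<^sub>R a z v k) sums g (z + t *\<^sub>R v)"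
begin

lemma quad_scale: "v \<in> quad \<Longrightarrow> 0 \<le> c \<Longrightarrow> c \<le> 1 \<Longrightarrow> c *\<^sub>R v \<in> quad"
  by (auto simp: quad_def mult_le_one)

lemma a_scale:
  assumes z: "z \<in> sq" and v: "v \<in> quad" and c: "0 \<le> c" "c \<le> 1"
  shows "a z (c *\<^sub>R v) k = c ^ k *\<^sub>R a z v k"
proof (rule power_series_unique[of 1 "a z (c *\<^sub>R v)" "\<lambda>t. g (z + t *\<^sub>R (c *\<^sub>R v))" "\<lambda>k. c ^ k *\<^sub>R a z v k"])
  fix t :: real assume t: "0 < t" "t < 1"
  show "(\<lambda>k. t ^ k *\<^sub>R a z (c *\<^sub>R v) k) sums g (z + t *\<^sub>R (c *\<^sub>R v))"
    using t by (intro series z quad_scale v c) auto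
  have "t * c < 1" using t c by (metis mult_left_le order_less_le order_le_less_trans)
  then have "\<bar>t * c\<bar> < 1" using t c by simp
  from series[OF z v this] show "(\<lambda>k. t ^ k *\<^sub>R c ^ k *\<^sub>R a z v k) sums g (z + t *\<^sub>R (c *\<^sub>R v))"
    by (simp add: power_mult_distrib)
qed simp

lemma a_zero: "z \<in> sq \<Longrightarrow> v \<in> quad \<Longrightarrow> a z v 0 = g z"
proof -
  assume z: "z \<in> sq" "v \<in> quad"
  have "(\<lambda>k. 0 ^ k *\<^sub>R a z v k) sums g (z + 0 *\<^sub>R v)" by (intro series z) simp
  moreover have "(\<lambda>k. 0 ^ k *\<^sub>R a z v k) sums (\<Sum>k\<in>{0}. 0 ^ k *\<^sub>R a z v k)"
    by (rule sums_finite) auto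
  ultimately show ?thesis using sums_unique2 by fastforce
qed

text \<open>By Baire's theorem some set \<open>{N \<le> n}\<close> is dense in a ball.  Any two points
  of the ball are dominated by a common point \<open>Y\<close> of this set, up to a multiple of their
  distance, and going back from \<open>Y\<close> along the two directions bounds the difference of the
  values: \<open>g\<close> is Lipschitz there.\<close>

lemma generic_point:
  assumes pq: "fst p < fst q" "snd p < snd q" and sub: "cbox p q \<subseteq> sq"
  obtains X \<eta> L n where "X \<in> box p q" "\<eta> > 0" "L \<ge> 0" "n \<ge> 0"
    "\<And>z z'. z \<in> ball X \<eta> \<Longrightarrow> z' \<in> ball X \<eta> \<Longrightarrow> norm (g z - g z') \<le> L * dist z z'"
    "\<And>z e. z \<in> ball X \<eta> \<Longrightarrow> e > 0 \<Longrightarrow> \<exists>Y\<in>sq. N Y \<le> n \<and> dist Y z < e"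
proof -
  define E where "E n = {z \<in> sq. N z \<le> real n}" for n :: nat
  let ?S = "cbox p q"
  have bne: "box p q \<noteq> {}" using pq by (auto simp: box_ne_empty Basis_prod_def inner_prod_def)
  define GG where "GG = range (\<lambda>n. ?S - closure (E n))"
  have "\<exists>n. \<not> ?S \<subseteq> closure (?S - closure (E n))"
  proof (rule ccontr)
    assume "\<not> ?thesis"
    then have d: "?S \<subseteq> closure (?S - closure (E n))" for n by blast
    have "?S \<subseteq> closure (\<Inter>GG)"
    proof (rule Baire)
      show "closed ?S" by (rule closed_cbox)
      show "countable GG" by (simp add: GG_def)
      fix T assume "T \<in> GG"
      then obtain n where n: "T = ?S - closure (E n)" by (auto simp: GG_def)
      have "openin (top_of_set ?S) (?S \<inter> (- closure (E n)))" by (intro openin_open_Int open_Compl closed_closure)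
      then show "openin (top_of_set ?S) T \<and> ?S \<subseteq> closure T" using d n by (simp add: Diff_eq)
    qed
    moreover have "\<Inter>GG = {}"
    proof (rule ccontr)
      assume "\<Inter>GG \<noteq> {}"
      then obtain z where "z \<in> \<Inter>GG" by blast
      then have z: "z \<in> ?S - closure (E n)" for n by (auto simp: GG_def)
      obtain n where "N z \<le> real n" using real_arch_simple by blast
      then have "z \<in> E n" using z sub by (auto simp: E_def)
      then show False using z[of n] closure_subset by blast
    qed
    ultimately have "?S = {}" by simp
    then show False using bne box_subset_cbox by blast
  qed
  then obtain n z0 where z0: "z0 \<in> ?S" "z0 \<notin> closure (?S - closure (E n))" by blast
  then obtain e where e: "e > 0" "ball z0 e \<inter> (?S - closure (E n)) = {}"
    by (metis (no_types, lifting) closure_approachable dist_commute disjoint_iff mem_ball)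
  have "z0 \<in> closure (box p q)" using z0 closure_box[OF bne] by simp
  then obtain X where X: "X \<in> box p q" "dist X z0 < e" using e closure_approachable by blast
  have "open (ball z0 e \<inter> box p q)" by (intro open_Int open_ball open_box)
  moreover have "X \<in> ball z0 e \<inter> box p q" using X by (simp add: dist_commute)
  ultimately obtain \<rho> where \<rho>: "\<rho> > 0" "ball X \<rho> \<subseteq> ball z0 e \<inter> box p q" using open_contains_ball by blast
  have dense: "\<exists>Y\<in>sq. N Y \<le> real n \<and> dist Y z < e'" if "z \<in> ball X \<rho>" "e' > 0" for z e'
  proof -
    have "z \<in> closure (E n)" using that \<rho> e box_subset_cbox by blast
    then show ?thesis using that by (auto simp: closure_approachable E_def)
  qed
  define \<eta> where "\<eta> = min (\<rho> / 16) (1 / 16)"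
  have \<eta>: "\<eta> > 0" "\<eta> \<le> \<rho> / 16" "\<eta> \<le> 1/16" using \<rho> by (auto simp: \<eta>_def)
  have near: "norm (g z - g Y) \<le> 2 * real n * (4 * d)"
    if Y: "Y \<in> sq" "N Y \<le> real n" and d: "d > 0" "4 * d \<le> 1/2"
      and c: "0 \<le> fst Y - fst z" "fst Y - fst z \<le> 4 * d" "0 \<le> snd Y - snd z" "snd Y - snd z \<le> 4 * d" for z Y d
  proof -
    define v where "v = (1 / (4 * d)) *\<^sub>R (Y - z)"
    have v: "v \<in> quad" using c d by (auto simp: v_def quad_def field_simps)
    have zY: "Y + (- (4 * d)) *\<^sub>R v = z" using d by (simp add: v_def)
    have "(\<lambda>k. (- (4 * d)) ^ k *\<^sub>R a Y v k) sums g (Y + (- (4 * d)) *\<^sub>R v)"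
      using d by (intro series Y v) simp
    then have "norm (g z - (\<Sum>k<1. (- (4 * d)) ^ k *\<^sub>R a Y v k)) \<le> 2 * real n * \<bar>- (4 * d)\<bar> ^ 1"
      unfolding zY by (rule power_tail_bound) (use d order_trans[OF bound[OF Y(1) v] Y(2)] in auto)
    then show ?thesis using a_zero[OF Y(1) v] d by simp
  qed
  have lip: "norm (g z - g z') \<le> (16 * real n) * dist z z'" if z: "z \<in> ball X \<eta>" "z' \<in> ball X \<eta>" for z z'
  proof (cases "z = z'")
    case False
    define d where "d = dist z z'"
    have d0: "d > 0" using False by (simp add: d_def)
    have "d \<le> 2 * \<eta>" using dist_triangle2[of z z' X] z by (simp add: d_def dist_commute)
    then have d1: "d \<le> \<rho> / 8" "d \<le> 1/8" using \<eta> by auto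
    have fs: "\<bar>fst x - fst y\<bar> \<le> dist x y" "\<bar>snd x - snd y\<bar> \<le> dist x y" for x y :: "real \<times> real"
      using dist_fst_le[of x y] dist_snd_le[of x y] by (auto simp: dist_real_def)
    \<comment> \<open>A point above both \<open>z\<close> and \<open>z'\<close>, with room for moving it by \<open>d\<close> into the dense set.\<close>
    define T where "T = (max (fst z) (fst z') + d, max (snd z) (snd z') + d)"
    have Tz: "\<bar>fst T - fst z\<bar> \<le> 2 * d" "\<bar>snd T - snd z\<bar> \<le> 2 * d"
      using fs[of z z'] d0 by (auto simp: T_def d_def[symmetric])
    have "dist T z \<le> \<bar>fst T - fst z\<bar> + \<bar>snd T - snd z\<bar>"
      using sqrt_sum_squares_le_sum_abs[of "fst T - fst z" "snd T - snd z"]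
      by (simp add: dist_prod_def dist_real_def)
    then have "dist T z \<le> 4 * d" using Tz by linarith
    then have "dist X T < \<rho>"
      using dist_triangle[of X T z] z d1 \<eta> by (simp add: dist_commute)
    then obtain Y where Y: "Y \<in> sq" "N Y \<le> real n" "dist Y T < d" using dense[of T d] d0 by auto
    have c: "0 \<le> fst Y - fst w" "fst Y - fst w \<le> 4 * d" "0 \<le> snd Y - snd w" "snd Y - snd w \<le> 4 * d" if "w = z \<or> w = z'" for w
    proof -
      have "d \<le> fst T - fst w" "fst T - fst w \<le> 2 * d" "d \<le> snd T - snd w" "snd T - snd w \<le> 2 * d"
        using fs[of z z'] that by (auto simp: T_def d_def[symmetric] max_def)
      then show "0 \<le> fst Y - fst w" "fst Y - fst w \<le> 4 * d" "0 \<le> snd Y - snd w" "snd Y - snd w \<le> 4 * d"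
        using fs[of Y T] Y(3) by linarith+
    qed
    have "norm (g z - g Y) \<le> 2 * real n * (4 * d)" "norm (g z' - g Y) \<le> 2 * real n * (4 * d)"
      using near[OF Y(1,2) d0 _ c[of z]] near[OF Y(1,2) d0 _ c[of z']] d1 by auto
    moreover have "norm (g z - g z') \<le> norm (g z - g Y) + norm (g z' - g Y)"
      using norm_triangle_ineq4[of "g z - g Y" "g z' - g Y"] by simp
    ultimately show ?thesis by (simp add: d_def)
  qed simp
  show thesis
  proof (rule that[of X \<eta> "16 * real n" "real n"])
    show "X \<in> box p q" "\<eta> > 0" "16 * real n \<ge> 0" "real n \<ge> 0" using X \<eta> by auto
    show "norm (g z - g z') \<le> (16 * real n) * dist z z'" if "z \<in> ball X \<eta>" "z' \<in> ball X \<eta>" for z z'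
      by (rule lip[OF that])
    show "\<exists>Y\<in>sq. N Y \<le> real n \<and> dist Y z < e" if "z \<in> ball X \<eta>" "e > 0" for z e
      by (rule dense) (use that \<eta> in auto)
  qed
qed

text \<open>Near a generic point, \<open>g (X + t (1, s))\<close> is computed in two ways: by the series
  at \<open>X\<close> in direction \<open>(1, s)\<close>, and by the series in direction \<open>(0,
  1)\<close> at a point \<open>Y\<close> with \<open>N Y \<le> n\<close> close to \<open>X + t (1,
  0)\<close>.  The second one depends on \<open>s\<close> through powers of \<open>ts\<close>.
  Comparing terms of order \<open>t\<^sup>k\<close> exhibits the coefficient as a limit of polynomials
  of degree at most \<open>k\<close>.\<close>

lemma generic_poly:
  assumes X: "X \<in> sq" and \<eta>: "\<eta> > 0" and L: "L \<ge> 0" and n: "n \<ge> 0"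
    and lip: "\<And>z z'. z \<in> ball X \<eta> \<Longrightarrow> z' \<in> ball X \<eta> \<Longrightarrow> norm (g z - g z') \<le> L * dist z z'"
    and dense: "\<And>z e. z \<in> ball X \<eta> \<Longrightarrow> e > 0 \<Longrightarrow> \<exists>Y\<in>sq. N Y \<le> n \<and> dist Y z < e"
  shows "poly_on k (\<lambda>s. a X (1, s) k)"
proof (induction k rule: less_induct)
  case (less k)
  let ?v = "(0, 1) :: real \<times> real"
  have v: "?v \<in> quad" by (simp add: quad_def)
  have w: "(1, s) \<in> quad" if "s \<in> {0..1}" for s using that by (simp add: quad_def)
  define c where "c = min (1/2) (\<eta> / 4)"
  have c: "c > 0" "c \<le> 1/2" "c \<le> \<eta> / 4" using \<eta> unfolding c_def by (simp, intro min.cobounded1, intro min.cobounded2)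
  define t where "t m = c / real (Suc m)" for m
  have t: "0 < t m" "t m \<le> 1/2" "4 * t m \<le> \<eta>" for m
  proof -
    show "0 < t m" using c by (simp add: t_def)
    have "t m \<le> c" using c by (simp add: t_def divide_le_eq mult_le_cancel_left1)
    then show "t m \<le> 1/2" "4 * t m \<le> \<eta>" using c by auto
  qed
  have nt: "norm (t m *\<^sub>R (1, s) :: real \<times> real) \<le> 2 * t m" if "s \<in> {0..1}" for s m
  proof -
    have "norm (1 :: real, s) \<le> 2" using sqrt_sum_squares_le_sum_abs[of 1 s] that by (simp add: norm_prod_def)
    then show ?thesis unfolding norm_scaleR using t(1)[of m] by simp
  qed
  have dX: "dist X (X + t m *\<^sub>R (1, s)) \<le> 2 * t m" if "s \<in> {0..1}" for s m
  proof -
    have "dist X (X + Z) = norm Z" for Z by (metis add_diff_cancel_left' dist_commute dist_norm)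
    then show ?thesis using nt[OF that, of m] by (simp only:)
  qed
  have tX: "X + t m *\<^sub>R (1, s) \<in> ball X \<eta>" if "s \<in> {0..1}" for s m
    unfolding mem_ball using dX[OF that, of m] t[of m] by linarith
  have "\<exists>Y\<in>sq. N Y \<le> n \<and> dist Y (X + t m *\<^sub>R (1, 0)) < t m ^ Suc k" for m
    using t[of m] by (intro dense tX) auto
  then obtain Y where Y: "\<And>m. Y m \<in> sq" "\<And>m. N (Y m) \<le> n" "\<And>m. dist (Y m) (X + t m *\<^sub>R (1, 0)) < t m ^ Suc k"
    by metis
  have ts: "t m ^ Suc k \<le> t m" for m
    using t[of m] power_decreasing[of 1 "Suc k" "t m"] by simp
  define R where "R m s = (1 / t m ^ k) *\<^sub>R ((\<Sum>i\<le>k. (t m * s) ^ i *\<^sub>R a (Y m) ?v i) - (\<Sum>j<k. t m ^ j *\<^sub>R a X (1, s) j))" for m s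
  show ?case
  proof (rule poly_on_limit[of k R])
    fix m
    have "poly_on k (\<lambda>s. \<Sum>i\<le>k. (t m * s) ^ i *\<^sub>R a (Y m) ?v i)"
    proof (rule poly_on_sum)
      fix i assume "i \<in> {..k}"
      then have "poly_on k (\<lambda>s. s ^ i *\<^sub>R (t m ^ i *\<^sub>R a (Y m) ?v i))" by (intro poly_on_monom) simp
      then show "poly_on k (\<lambda>s. (t m * s) ^ i *\<^sub>R a (Y m) ?v i)" by (simp add: power_mult_distrib mult.commute)
    qed
    moreover have "poly_on k (\<lambda>s. \<Sum>j<k. t m ^ j *\<^sub>R a X (1, s) j)"
      by (intro poly_on_sum poly_on_scaleR, rule poly_on_mono[OF less]) auto
    ultimately show "poly_on k (R m)" unfolding R_def by (intro poly_on_scaleR poly_on_diff)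
  next
    fix s :: real assume s: "s \<in> {0..1}"
    have est: "norm (R m s - a X (1, s) k) \<le> (2 * N X + 2 * n + L) * t m" for m
    proof -
      let ?t = "t m"
      have A: "norm (g (X + ?t *\<^sub>R (1, s)) - (\<Sum>j<Suc k. ?t ^ j *\<^sub>R a X (1, s) j)) \<le> 2 * N X * \<bar>?t\<bar> ^ Suc k"
      proof (rule power_tail_bound)
        show "(\<lambda>j. ?t ^ j *\<^sub>R a X (1, s) j) sums g (X + ?t *\<^sub>R (1, s))"
          using t[of m] by (intro series X w s) linarith
        show "norm (a X (1, s) j) \<le> N X" for j by (rule bound[OF X w[OF s]])
        show "\<bar>?t\<bar> \<le> 1/2" using t[of m] by linarith
      qed
      have tsm: "\<bar>?t * s\<bar> \<le> ?t" using t[of m] s by (simp add: mult_left_le abs_mult)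
      have "norm (g (Y m + (?t * s) *\<^sub>R ?v) - (\<Sum>i<Suc k. (?t * s) ^ i *\<^sub>R a (Y m) ?v i)) \<le> 2 * n * \<bar>?t * s\<bar> ^ Suc k"
      proof (rule power_tail_bound)
        show "(\<lambda>j. (?t * s) ^ j *\<^sub>R a (Y m) ?v j) sums g (Y m + (?t * s) *\<^sub>R ?v)"
          using t[of m] tsm by (intro series Y v) linarith
        show "norm (a (Y m) ?v j) \<le> n" for j by (rule order_trans[OF bound[OF Y(1) v] Y(2)])
        show "\<bar>?t * s\<bar> \<le> 1/2" using t[of m] tsm by linarith
      qed
      also have "\<dots> \<le> 2 * n * ?t ^ Suc k" using tsm n by (intro mult_left_mono power_mono) auto
      finally have B: "norm (g (Y m + (?t * s) *\<^sub>R ?v) - (\<Sum>i<Suc k. (?t * s) ^ i *\<^sub>R a (Y m) ?v i)) \<le> 2 * n * ?t ^ Suc k" .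
      have split: "X + ?t *\<^sub>R (1, s) = (X + ?t *\<^sub>R (1, 0)) + (?t * s) *\<^sub>R ?v" by (cases X) simp
      have dd: "dist (Y m + (?t * s) *\<^sub>R ?v) (X + ?t *\<^sub>R (1, s)) < ?t ^ Suc k"
        unfolding split dist_add_cancel2 by (rule Y(3))
      have "dist X (Y m + (?t * s) *\<^sub>R ?v) < \<eta>"
        using dist_triangle2[of X "Y m + (?t * s) *\<^sub>R ?v" "X + ?t *\<^sub>R (1, s)"] dd ts[of m] dX[OF s, of m] t[of m]
        by linarith
      then have "norm (g (Y m + (?t * s) *\<^sub>R ?v) - g (X + ?t *\<^sub>R (1, s))) \<le> L * ?t ^ Suc k"
        using dd L by (intro order_trans[OF lip[OF _ tX[OF s]]] mult_left_mono) auto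
      then have Cc: "norm (g (X + ?t *\<^sub>R (1, s)) - g (Y m + (?t * s) *\<^sub>R ?v)) \<le> L * ?t ^ Suc k"
        by (simp add: norm_minus_commute)
      let ?D = "(\<Sum>i<Suc k. (?t * s) ^ i *\<^sub>R a (Y m) ?v i) - (\<Sum>j<Suc k. ?t ^ j *\<^sub>R a X (1, s) j)"
      have tri: "norm (p - q) \<le> norm (x - q) + norm (y - p) + norm (x - y)" for p q x y :: 'b
      proof -
        have "norm (p - q) = norm ((x - q) - (y - p) - (x - y))" by simp
        also have "\<dots> \<le> norm ((x - q) - (y - p)) + norm (x - y)" by (rule norm_triangle_ineq4)
        also have "\<dots> \<le> norm (x - q) + norm (y - p) + norm (x - y)"
          by (intro add_right_mono norm_triangle_ineq4)
        finally show ?thesis .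
      qed
      have "norm ?D \<le> 2 * N X * \<bar>?t\<bar> ^ Suc k + 2 * n * ?t ^ Suc k + L * ?t ^ Suc k"
        by (rule order_trans[OF tri add_mono[OF add_mono[OF A B] Cc]])
      then have nD: "norm ?D \<le> (2 * N X + 2 * n + L) * ?t * ?t ^ k" using t[of m] by (simp add: algebra_simps)
      have "R m s - a X (1, s) k = (1 / ?t ^ k) *\<^sub>R ?D"
        using t(1)[of m] by (simp add: R_def lessThan_Suc_atMost[symmetric] scaleR_diff_right scaleR_add_right)
      then have "norm (R m s - a X (1, s) k) = norm ?D / ?t ^ k" using t(1)[of m] by simp
      also have "\<dots> \<le> (2 * N X + 2 * n + L) * ?t" using nD t(1)[of m] by (simp add: divide_le_eq)
      finally show ?thesis .
    qed
    have "t \<longlonglongrightarrow> 0" unfolding t_def using LIMSEQ_Suc[OF lim_const_over_n[of c]] by simp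
    then have "(\<lambda>m. (2 * N X + 2 * n + L) * t m) \<longlonglongrightarrow> 0" by (rule tendsto_mult_right_zero)
    then have "(\<lambda>m. R m s - a X (1, s) k) \<longlonglongrightarrow> 0"
      by (rule Lim_null_comparison[rotated]) (use est in \<open>auto intro!: always_eventually\<close>)
    then show "(\<lambda>m. R m s) \<longlonglongrightarrow> a X (1, s) k" by (rule LIM_zero_cancel)
  qed
qed

text \<open>From a generic point \<open>X\<close> inside the quadrant the origin neighbourhood is
  reached in the direction \<open>v = X - u (1 - s, s)\<close>, with the opposite sign of the parameter.
  So \<open>g (u (1 - s, s))\<close> is a sum over \<open>k\<close> of polynomials \<open>(-1)\<^sup>k a
  X v k\<close> in \<open>u\<close> and \<open>s\<close>; collecting powers of \<open>u\<close> gives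
  the coefficients at the origin as limits of polynomials in \<open>s\<close>.\<close>

theorem coefficients_poly_on: "poly_on j (\<lambda>s. a (0, 0) (1 - s, s) j)"
proof -
  define \<theta> where "\<theta> = 1 / (4 * KK)"
  have \<theta>: "0 < \<theta>" "\<theta> * KK \<le> 1/4" "\<theta> \<le> 1/32" using KK_ge by (auto simp: \<theta>_def field_simps)
  \<comment> \<open>The box lies below the diagonal, so that all directions used from \<open>X\<close> have the form \<open>x (1, y/x)\<close> with \<open>y \<le> x\<close>.\<close>
  define p where "p = (\<theta> / 4, \<theta> / 16)"
  define q where "q = (\<theta> / 2, \<theta> / 8)"
  have pq: "fst p < fst q" "snd p < snd q" using \<theta> by (auto simp: p_def q_def)
  have sub: "cbox p q \<subseteq> sq"
  proof
    fix z assume "z \<in> cbox p q"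
    then have "fst p \<le> fst z" "fst z \<le> fst q" "snd p \<le> snd z" "snd z \<le> snd q"
      by (cases z; auto simp: p_def q_def cbox_Pair_eq)+
    then show "z \<in> sq" using \<theta> by (auto simp: sq_def p_def q_def)
  qed
  obtain X \<eta> L n where X: "X \<in> box p q" "\<eta> > 0" "L \<ge> 0" "n \<ge> 0"
    and lip: "\<And>z z'. z \<in> ball X \<eta> \<Longrightarrow> z' \<in> ball X \<eta> \<Longrightarrow> norm (g z - g z') \<le> L * dist z z'"
    and dense: "\<And>z e. z \<in> ball X \<eta> \<Longrightarrow> e > 0 \<Longrightarrow> \<exists>Y\<in>sq. N Y \<le> n \<and> dist Y z < e"
    by (rule generic_point[OF pq sub]) blast
  have Xsq: "X \<in> sq" using X(1) box_subset_cbox sub by blast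
  obtain X1 X2 where X12: "X = (X1, X2)" by (cases X)
  have Xc: "X \<in> cbox p q" using X(1) box_subset_cbox by blast
  then have Xb: "\<theta> / 4 \<le> X1" "X1 \<le> \<theta> / 2" "\<theta> / 16 \<le> X2" "X2 \<le> \<theta> / 8"
    by (auto simp: X12 p_def q_def cbox_Pair_eq)
  have "\<exists>c. \<forall>s\<in>{0..1}. a X (1, s) k = (\<Sum>i\<le>k. s ^ i *\<^sub>R c i)" for k
    using generic_poly[OF Xsq X(2-4) lip dense, of k] unfolding poly_on_def by blast
  then obtain c where c: "\<And>k s. s \<in> {0..1} \<Longrightarrow> a X (1, s) k = (\<Sum>i\<le>k. s ^ i *\<^sub>R c k i)" by metis
  have aX: "a X (x, y) k = (\<Sum>i\<le>k. (x ^ (k - i) * y ^ i) *\<^sub>R c k i)" if xy: "0 \<le> y" "y \<le> x" "0 < x" "x \<le> 1" for x y k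
  proof -
    have "a X (x *\<^sub>R (1, y / x)) k = x ^ k *\<^sub>R a X (1, y / x) k"
      using xy by (intro a_scale Xsq) (auto simp: quad_def)
    also have "a X (1, y / x) k = (\<Sum>i\<le>k. (y / x) ^ i *\<^sub>R c k i)" using xy by (intro c) auto
    also have "x ^ k *\<^sub>R \<dots> = (\<Sum>i\<le>k. (x ^ (k - i) * y ^ i) *\<^sub>R c k i)"
      unfolding scaleR_sum_right scaleR_scaleR
    proof (intro sum.cong refl arg_cong2[where f = scaleR])
      fix i assume "i \<in> {..k}"
      then have "x ^ k = x ^ (k - i) * x ^ i" by (simp flip: power_add)
      then show "x ^ k * (y / x) ^ i = x ^ (k - i) * y ^ i" using xy by (simp add: power_divide)
    qed
    finally show ?thesis using xy by simp
  qed
  have small: "norm (a X v k) \<le> N X * \<theta> ^ k" if v: "0 \<le> fst v" "fst v \<le> \<theta>" "0 \<le> snd v" "snd v \<le> \<theta>" for v k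
  proof -
    have q: "(1 / \<theta>) *\<^sub>R v \<in> quad" using v \<theta> by (auto simp: quad_def)
    have "a X (\<theta> *\<^sub>R ((1 / \<theta>) *\<^sub>R v)) k = \<theta> ^ k *\<^sub>R a X ((1 / \<theta>) *\<^sub>R v) k"
      using \<theta> by (intro a_scale Xsq q) auto
    then have "norm (a X v k) = norm (a X ((1 / \<theta>) *\<^sub>R v) k) * \<theta> ^ k" using \<theta> by simp
    also have "\<dots> \<le> N X * \<theta> ^ k" using \<theta> by (intro mult_right_mono bound Xsq q) auto
    finally show ?thesis .
  qed
  define r where "r = \<theta> / 16"
  have r: "r > 0" using \<theta> by (simp add: r_def)
  \<comment> \<open>Polynomials in \<open>u\<close> whose coefficients are polynomials in \<open>s\<close>; the coefficient of \<open>u\<^sup>j\<close> has degree at most \<open>j\<close> in \<open>s\<close>.\<close>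
  define F :: "nat \<Rightarrow> nat \<Rightarrow> real poly poly" where
    "F k i = [: [:X1:], [:- r, r:] :] ^ (k - i) * [: [:X2:], [:0, - r:] :] ^ i" for k i
  have Fdeg: "degree (F k i) \<le> k" if "i \<le> k" for k i
  proof -
    have "degree ([: [:X1:], [:- r, r:] :] ^ (k - i)) \<le> k - i" "degree ([: [:X2:], [:0, - r:] :] ^ i) \<le> i"
      by (rule order_trans[OF degree_power_le], simp)+
    then show ?thesis unfolding F_def using that by (intro order_trans[OF degree_mult_le]) linarith
  qed
  have Fcoeff: "degree (coeff (F k i) j) \<le> j" for k i j
  proof -
    define D where "D P \<longleftrightarrow> (\<forall>j. degree (coeff P j) \<le> j)" for P :: "real poly poly"
    have Dm: "D (P * Q)" if "D P" "D Q" for P Q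
      unfolding D_def coeff_mult
    proof (intro allI degree_sum_le)
      fix j i :: nat assume i: "i \<in> {..j}"
      have "degree (coeff P i * coeff Q (j - i)) \<le> degree (coeff P i) + degree (coeff Q (j - i))" by (rule degree_mult_le)
      also have "\<dots> \<le> i + (j - i)" using that unfolding D_def by (intro add_mono) auto
      finally show "degree (coeff P i * coeff Q (j - i)) \<le> j" using i by simp
    qed simp
    have D1: "D 1" unfolding D_def by (simp add: coeff_1)
    have Dp: "D (P ^ k)" if "D P" for P k by (induction k) (use that D1 Dm in auto)
    have "D [: [:X1:], [:- r, r:] :]" "D [: [:X2:], [:0, - r:] :]"
      unfolding D_def by (auto simp: coeff_pCons split: nat.splits)
    then have "D (F k i)" unfolding F_def by (intro Dm Dp)
    then show ?thesis by (simp add: D_def)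
  qed
  define m where "m s k j = (- 1) ^ k *\<^sub>R (\<Sum>i\<le>k. poly (coeff (F k i) j) s *\<^sub>R c k i)" for s k j
  have msum: "(\<Sum>j\<le>k. u ^ j *\<^sub>R m s k j) = (- 1) ^ k *\<^sub>R a X (X - (u * r) *\<^sub>R (1 - s, s)) k"
    if u: "0 \<le> u" "u \<le> 1" and s: "s \<in> {0..1}" for u s k
  proof -
    define x where "x = X1 - u * r * (1 - s)"
    define y where "y = X2 - u * r * s"
    have Feval: "(\<Sum>j\<le>k. u ^ j * poly (coeff (F k i) j) s) = x ^ (k - i) * y ^ i" if "i \<le> k" for i
    proof -
      have "x ^ (k - i) * y ^ i = poly (poly (F k i) [:u:]) s"
        by (simp add: F_def poly_power poly_mult x_def y_def algebra_simps)
      also have "\<dots> = (\<Sum>j\<le>k. poly (coeff (F k i) j) s * u ^ j)"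
      proof -
        have "(\<Sum>j\<le>degree (F k i). poly (coeff (F k i) j) s * u ^ j) = (\<Sum>j\<le>k. poly (coeff (F k i) j) s * u ^ j)"
          using Fdeg[OF that] by (intro sum.mono_neutral_left) (auto simp: coeff_eq_0)
        then show ?thesis by (subst poly_altdef) (simp add: poly_sum poly_mult poly_power)
      qed
      finally show ?thesis by (simp add: mult.commute)
    qed
    have ur: "u * r * (1 - s) \<le> r" "0 \<le> u * r * (1 - s)" "u * r * s \<le> r" "0 \<le> u * r * s"
      using u s r by (auto intro!: mult_le_one mult_left_le simp: mult.assoc mult.left_commute[of u])
    have "(\<Sum>j\<le>k. u ^ j *\<^sub>R m s k j) = (- 1) ^ k *\<^sub>R (\<Sum>j\<le>k. \<Sum>i\<le>k. (u ^ j * poly (coeff (F k i) j) s) *\<^sub>R c k i)"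
      by (simp add: m_def scaleR_sum_right mult_ac)
    also have "\<dots> = (- 1) ^ k *\<^sub>R (\<Sum>i\<le>k. (\<Sum>j\<le>k. u ^ j * poly (coeff (F k i) j) s) *\<^sub>R c k i)"
      by (subst sum.swap) (simp add: scaleR_sum_left)
    also have "\<dots> = (- 1) ^ k *\<^sub>R (\<Sum>i\<le>k. (x ^ (k - i) * y ^ i) *\<^sub>R c k i)"
      by (intro arg_cong[where f = "scaleR _"] sum.cong refl) (simp add: Feval)
    also have "(\<Sum>i\<le>k. (x ^ (k - i) * y ^ i) *\<^sub>R c k i) = a X (x, y) k"
    proof (rule aX[symmetric])
      show "0 \<le> y" "y \<le> x" "0 < x" "x \<le> 1"
        using ur Xb \<theta> r_def unfolding x_def y_def by linarith+
    qed
    also have "(x, y) = X - (u * r) *\<^sub>R (1 - s, s)" by (simp add: X12 x_def y_def)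
    finally show ?thesis .
  qed
  have inq: "X - (u * r) *\<^sub>R (1 - s, s) \<in> {v. 0 \<le> fst v \<and> fst v \<le> \<theta> / 2 \<and> 0 \<le> snd v \<and> snd v \<le> \<theta> / 2}"
    if u: "0 \<le> u" "u \<le> 1" and s: "s \<in> {0..1}" for u s
  proof -
    have "u * r * (1 - s) \<le> r" "0 \<le> u * r * (1 - s)" "u * r * s \<le> r" "0 \<le> u * r * s"
      using u s r by (auto intro!: mult_le_one mult_left_le simp: mult.assoc mult.left_commute[of u])
    then have "0 \<le> X1 - u * r * (1 - s)" "X1 - u * r * (1 - s) \<le> \<theta> / 2" "0 \<le> X2 - u * r * s" "X2 - u * r * s \<le> \<theta> / 2"
      using Xb \<theta> r_def by linarith+
    then show ?thesis by (simp add: X12)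
  qed
  have conv: "(\<lambda>k. if j \<le> k then m s k j else 0) sums (r ^ j *\<^sub>R a (0, 0) (1 - s, s) j)" if s: "s \<in> {0..1}" for s
  proof (rule sum_of_polys_is_power_series(1)[where \<theta> = \<theta> and C = "N X" and \<phi> = "\<lambda>u. g ((u * r) *\<^sub>R (1 - s, s))" and m = "m s"
        and b = "\<lambda>j. r ^ j *\<^sub>R a (0, 0) (1 - s, s) j"])
    fix k and u :: real assume u: "0 \<le> u" "u \<le> 1"
    show "norm (\<Sum>j\<le>k. u ^ j *\<^sub>R m s k j) \<le> N X * \<theta> ^ k"
      unfolding msum[OF u s] using inq[OF u s] \<theta> small by simp
  next
    fix u :: real assume u: "\<bar>u\<bar> < 1"
    have "\<bar>u * r\<bar> < 1"
    proof -
      have "\<bar>u * r\<bar> \<le> \<bar>u\<bar> * 1" unfolding abs_mult using r \<theta> by (intro mult_left_mono) (auto simp: r_def)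
      then show ?thesis using u by simp
    qed
    then have "(\<lambda>j. (u * r) ^ j *\<^sub>R a (0, 0) (1 - s, s) j) sums g ((0, 0) + (u * r) *\<^sub>R (1 - s, s))"
      using s by (intro series) (auto simp: sq_def quad_def)
    then show "(\<lambda>j. u ^ j *\<^sub>R r ^ j *\<^sub>R a (0, 0) (1 - s, s) j) sums g ((u * r) *\<^sub>R (1 - s, s))"
      by (simp add: power_mult_distrib flip: zero_prod_def)
  next
    fix u :: real assume u: "0 \<le> u" "u < 1"
    define v where "v = X - (u * r) *\<^sub>R (1 - s, s)"
    have v: "0 \<le> fst v" "fst v \<le> \<theta> / 2" "0 \<le> snd v" "snd v \<le> \<theta> / 2" using inq[of u s] u s by (auto simp: v_def)
    have v2: "2 *\<^sub>R v \<in> quad" using v \<theta> by (auto simp: quad_def)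
    have "(\<lambda>k. (- 1/2) ^ k *\<^sub>R a X (2 *\<^sub>R v) k) sums g (X + (- 1/2) *\<^sub>R (2 *\<^sub>R v))"
      by (intro series Xsq v2) simp
    moreover have "(- 1/2) ^ k *\<^sub>R a X (2 *\<^sub>R v) k = (\<Sum>j\<le>k. u ^ j *\<^sub>R m s k j)" for k
    proof -
      have "a X ((1/2) *\<^sub>R (2 *\<^sub>R v)) k = (1/2) ^ k *\<^sub>R a X (2 *\<^sub>R v) k" by (intro a_scale Xsq v2) auto
      then have "(- 1) ^ k *\<^sub>R a X v k = (- 1) ^ k *\<^sub>R (1/2) ^ k *\<^sub>R a X (2 *\<^sub>R v) k" by simp
      also have "\<dots> = (- 1/2) ^ k *\<^sub>R a X (2 *\<^sub>R v) k" by (simp flip: power_mult_distrib)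
      finally show ?thesis using msum[of u s k] u s by (simp add: v_def)
    qed
    moreover have "X + (- 1/2) *\<^sub>R (2 *\<^sub>R v) = (u * r) *\<^sub>R (1 - s, s)" by (simp add: v_def)
    ultimately show "(\<lambda>k. \<Sum>j\<le>k. u ^ j *\<^sub>R m s k j) sums g ((u * r) *\<^sub>R (1 - s, s))" by simp
  qed (use \<theta> in auto)
  have "poly_on j (\<lambda>s. r ^ j *\<^sub>R a (0, 0) (1 - s, s) j)"
  proof (rule poly_on_limit[of j "\<lambda>n s. \<Sum>k<n. if j \<le> k then m s k j else 0"])
    fix n
    have "poly_on j (\<lambda>s. if j \<le> k then m s k j else 0)" for k
    proof (cases "j \<le> k")
      case True
      have "poly_on j (\<lambda>s. m s k j)"
        unfolding m_def by (intro poly_on_scaleR poly_on_sum poly_on_poly Fcoeff)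
      then show ?thesis using True by simp
    qed (simp add: poly_on_zero)
    then show "poly_on j (\<lambda>s. \<Sum>k<n. if j \<le> k then m s k j else 0)" by (intro poly_on_sum)
  next
    fix s :: real assume "s \<in> {0..1}"
    from conv[OF this] show "(\<lambda>n. \<Sum>k<n. if j \<le> k then m s k j else 0) \<longlonglongrightarrow> r ^ j *\<^sub>R a (0, 0) (1 - s, s) j"
      by (simp add: sums_def)
  qed
  from poly_on_scaleR[OF this, of "1 / r ^ j"] show ?thesis using r by simp
qed

end

section \<open>Block matrices\<close>

lemma mat_eq_blocksI:
  assumes X: "X \<in> carrier_mat (L * M) (L' * M')" and Z: "Z \<in> carrier_mat (L * M) (L' * M')"
    and e: "\<And>i j a b. i < L \<Longrightarrow> j < L' \<Longrightarrow> a < M \<Longrightarrow> b < M' \<Longrightarrow> X $$ (i * M + a, j * M' + b) = Z $$ (i * M + a, j * M' + b)"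
  shows "X = Z"
proof (rule eq_matI)
  fix x y assume "x < dim_row Z" "y < dim_col Z"
  then have xy: "x < L * M" "y < L' * M'" using Z by auto
  then have "M > 0" "M' > 0" by (auto intro: Nat.gr0I)
  moreover have "x div M < L" "y div M' < L'" using xy by (simp_all add: less_mult_imp_div_less)
  ultimately have "X $$ (x div M * M + x mod M, y div M' * M' + y mod M') = Z $$ (x div M * M + x mod M, y div M' * M' + y mod M')"
    by (intro e) auto
  then show "X $$ (x, y) = Z $$ (x, y)" by simp
qed (use X Z in auto)

lemma mult_block_entry:
  assumes X: "X \<in> carrier_mat (L * M) (K * P)" and Z: "Z \<in> carrier_mat (K * P) (J * Q)"
    and i: "i < L" "a < M" and j: "j < J" "b < Q"
  shows "(X * Z) $$ (i * M + a, j * Q + b) = (\<Sum>l<K. \<Sum>c<P. X $$ (i * M + a, l * P + c) * Z $$ (l * P + c, j * Q + b))"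
proof -
  have "i * M + a < L * M" "j * Q + b < J * Q" using i j by (auto intro: block_index_less)
  then have "(X * Z) $$ (i * M + a, j * Q + b) = (\<Sum>c<K * P. X $$ (i * M + a, c) * Z $$ (c, j * Q + b))"
    using X Z by (subst mult_mat_entry) auto
  then show ?thesis by (simp add: sum_blocks)
qed

definition blk :: "nat \<Rightarrow> nat \<Rightarrow> nat \<Rightarrow> nat \<Rightarrow> 'a mat \<Rightarrow> 'a mat" where
  "blk M M' i j X = mat M M' (\<lambda>(a, b). X $$ (i * M + a, j * M' + b))"

lemma blk_carrier [simp]: "blk M M' i j X \<in> carrier_mat M M'" by (simp add: blk_def)

lemma blk_dim [simp]: "dim_row (blk M M' i j X) = M" "dim_col (blk M M' i j X) = M'" by (simp_all add: blk_def)

lemma blk_index [simp]: "a < M \<Longrightarrow> b < M' \<Longrightarrow> blk M M' i j X $$ (a, b) = X $$ (i * M + a, j * M' + b)"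
  by (simp add: blk_def)

lemma mnorm_blk: "X \<in> sqmat (L * M) \<Longrightarrow> i < L \<Longrightarrow> j < L \<Longrightarrow> mnorm (blk M M i j X) \<le> mnorm X"
  unfolding blk_def
  by (rule mnorm_submatrix) (auto simp: inj_on_def block_index_less)

definition bdiag :: "nat \<Rightarrow> nat \<Rightarrow> nat \<Rightarrow> (nat \<Rightarrow> 'a::zero mat) \<Rightarrow> 'a mat" where
  "bdiag L M M' D = mat (L * M) (L * M') (\<lambda>(a, b). if a div M = b div M' then D (a div M) $$ (a mod M, b mod M') else 0)"

lemma bdiag_carrier [simp]: "bdiag L M M' D \<in> carrier_mat (L * M) (L * M')" by (simp add: bdiag_def)

lemma superdiag_carrier [simp]: "superdiag L M Y \<in> sqmat (L * M)" by (simp add: superdiag_def)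

lemma bdiag_entry:
  "i < L \<Longrightarrow> j < L \<Longrightarrow> a < M \<Longrightarrow> b < M' \<Longrightarrow> bdiag L M M' D $$ (i * M + a, j * M' + b) = (if i = j then D i $$ (a, b) else 0)"
proof -
  assume ij: "i < L" "j < L" "a < M" "b < M'"
  have ind: "bdiag L M M' D $$ (x, y) = (if x div M = y div M' then D (x div M) $$ (x mod M, y mod M') else 0)"
    if "x < L * M" "y < L * M'" for x y using that by (simp add: bdiag_def)
  have "(i * M + a) div M = i" "(i * M + a) mod M = a" "(j * M' + b) div M' = j" "(j * M' + b) mod M' = b"
    using ij by auto
  then show ?thesis using ind[OF block_index_less block_index_less, OF ij(1,3,2,4)] by (simp only:)
qed

lemma superdiag_entry:
  "i < L \<Longrightarrow> j < L \<Longrightarrow> a < M \<Longrightarrow> b < M \<Longrightarrow> superdiag L M Y $$ (i * M + a, j * M + b) = (if j = Suc i then Y i $$ (a, b) else 0)"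
proof -
  assume ij: "i < L" "j < L" "a < M" "b < M"
  have ind: "superdiag L M Y $$ (x, y) = (if y div M = Suc (x div M) then Y (x div M) $$ (x mod M, y mod M) else 0)"
    if "x < L * M" "y < L * M" for x y using that by (simp add: superdiag_def)
  have "(i * M + a) div M = i" "(i * M + a) mod M = a" "(j * M + b) div M = j" "(j * M + b) mod M = b"
    using ij by auto
  then show ?thesis using ind[OF block_index_less block_index_less, OF ij(1,3,2,4)] by (simp only:)
qed

lemma superdiag_dim [simp]: "dim_row (superdiag L M Y) = L * M" "dim_col (superdiag L M Y) = L * M"
  by (simp_all add: superdiag_def)

lemma superdiag_add:
  assumes "\<And>i. Suc i < L \<Longrightarrow> Y i \<in> sqmat M" "\<And>i. Suc i < L \<Longrightarrow> Y' i \<in> sqmat M"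
  shows "superdiag L M (\<lambda>i. Y i + Y' i) = superdiag L M Y + superdiag L M Y'"
proof (rule mat_eq_blocksI[of _ L M L M])
  fix i j a b assume ij: "i < L" "j < L" "a < M" "b < M"
  have lt: "i * M + a < L * M" "j * M + b < L * M" using ij by (auto intro!: block_index_less)
  have "(superdiag L M Y + superdiag L M Y') $$ (i * M + a, j * M + b)
      = superdiag L M Y $$ (i * M + a, j * M + b) + superdiag L M Y' $$ (i * M + a, j * M + b)"
    using lt by (intro index_add_mat(1)) auto
  also have "\<dots> = superdiag L M (\<lambda>i. Y i + Y' i) $$ (i * M + a, j * M + b)"
  proof (cases "j = Suc i")
    case True
    then have "Y i \<in> sqmat M" "Y' i \<in> sqmat M" using assms[of i] ij by auto
    then show ?thesis using ij unfolding superdiag_entry[OF ij] by auto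
  qed (simp add: superdiag_entry[OF ij])
  finally show "superdiag L M (\<lambda>i. Y i + Y' i) $$ (i * M + a, j * M + b) = (superdiag L M Y + superdiag L M Y') $$ (i * M + a, j * M + b)" ..
qed auto

lemma superdiag_cong: "(\<And>i. Suc i < L \<Longrightarrow> Y i = Y' i) \<Longrightarrow> superdiag L M Y = superdiag L M Y'"
  by (rule mat_eq_blocksI[of _ L M L M]) (auto simp: superdiag_entry simp del: mult_Suc)

lemma mult_bdiag_entry:
  assumes X: "X \<in> carrier_mat (L * M) (L * P)" and D: "\<And>l. l < L \<Longrightarrow> D l \<in> carrier_mat P Q"
    and i: "i < L" "a < M" and j: "j < L" "b < Q"
  shows "(X * bdiag L P Q D) $$ (i * M + a, j * Q + b) = (blk M P i j X * D j) $$ (a, b)"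
proof -
  have "(X * bdiag L P Q D) $$ (i * M + a, j * Q + b)
      = (\<Sum>l<L. \<Sum>c<P. X $$ (i * M + a, l * P + c) * bdiag L P Q D $$ (l * P + c, j * Q + b))"
    by (rule mult_block_entry[OF X _ i j]) simp
  also have "\<dots> = (\<Sum>l<L. if l = j then \<Sum>c<P. X $$ (i * M + a, l * P + c) * D l $$ (c, b) else 0)"
    by (intro sum.cong refl) (use j in \<open>auto simp: bdiag_entry\<close>)
  also have "\<dots> = (\<Sum>c<P. X $$ (i * M + a, j * P + c) * D j $$ (c, b))" using j by simp
  also have "\<dots> = (blk M P i j X * D j) $$ (a, b)"
    using i j D[OF j(1)] by (subst mult_mat_entry) auto
  finally show ?thesis .
qed

lemma bdiag_mult_entry:
  assumes X: "X \<in> carrier_mat (L * P) (L * Q)" and D: "\<And>l. l < L \<Longrightarrow> D l \<in> carrier_mat M P"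
    and i: "i < L" "a < M" and j: "j < L" "b < Q"
  shows "(bdiag L M P D * X) $$ (i * M + a, j * Q + b) = (D i * blk P Q i j X) $$ (a, b)"
proof -
  have "(bdiag L M P D * X) $$ (i * M + a, j * Q + b)
      = (\<Sum>l<L. \<Sum>c<P. bdiag L M P D $$ (i * M + a, l * P + c) * X $$ (l * P + c, j * Q + b))"
    by (rule mult_block_entry[OF _ X i j]) simp
  also have "\<dots> = (\<Sum>l<L. if l = i then \<Sum>c<P. D l $$ (a, c) * X $$ (l * P + c, j * Q + b) else 0)"
    by (intro sum.cong refl) (use i in \<open>auto simp: bdiag_entry\<close>)
  also have "\<dots> = (\<Sum>c<P. D i $$ (a, c) * X $$ (i * P + c, j * Q + b))" using i by simp
  also have "\<dots> = (D i * blk P Q i j X) $$ (a, b)"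
    using i j D[OF i(1)] by (subst mult_mat_entry) auto
  finally show ?thesis .
qed

lemma blk_superdiag:
  assumes "i < L" "j < L" "\<And>l. Suc l < L \<Longrightarrow> Y l \<in> sqmat M"
  shows "blk M M i j (superdiag L M Y) = (if j = Suc i then Y i else 0\<^sub>m M M)"
proof (cases "j = Suc i")
  case True
  then have "Y i \<in> sqmat M" using assms by auto
  then show ?thesis using assms(1,2) True by (intro eq_matI) (auto simp: superdiag_entry simp del: mult_Suc)
qed (use assms in \<open>auto simp: superdiag_entry intro!: eq_matI\<close>)

lemma blk_mstar_superdiag:
  assumes "i < L" "j < L" "\<And>l. Suc l < L \<Longrightarrow> Y l \<in> sqmat M"
  shows "blk M M i j (mstar (superdiag L M Y)) = (if i = Suc j then mstar (Y j) else 0\<^sub>m M M)"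
proof -
  have e: "blk M M i j (mstar (superdiag L M Y)) $$ (a, b) = star (superdiag L M Y $$ (j * M + b, i * M + a))"
    if "a < M" "b < M" for a b
  proof -
    have "i * M + a < L * M" "j * M + b < L * M" using that assms by (auto intro: block_index_less)
    then show ?thesis using that by simp
  qed
  show ?thesis
  proof (cases "i = Suc j")
    case True
    then have "Y j \<in> sqmat M" using assms by auto
    then have Yj: "dim_row (Y j) = M" "dim_col (Y j) = M" by auto
    show ?thesis
    proof (rule eq_matI)
      fix a b assume "a < dim_row (if i = Suc j then mstar (Y j) else 0\<^sub>m M M)" "b < dim_col (if i = Suc j then mstar (Y j) else 0\<^sub>m M M)"
      then have ab: "a < M" "b < M" using True Yj by auto
      show "blk M M i j (mstar (superdiag L M Y)) $$ (a, b) = (if i = Suc j then mstar (Y j) else 0\<^sub>m M M) $$ (a, b)"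
        unfolding e[OF ab] superdiag_entry[OF assms(2,1) ab(2,1)] using True Yj ab by simp
    qed (use True Yj in auto)
  qed (use assms in \<open>auto simp: e superdiag_entry intro!: eq_matI simp del: blk_index\<close>)
qed

text \<open>A chain of intertwiners \<open>D\<^sub>l\<close> between two sequences of matrices is one
  intertwiner of the block matrices that they form.\<close>

lemma superdiag_intertwine:
  assumes W: "\<And>l. Suc l < L \<Longrightarrow> W l \<in> sqmat M" and Y: "\<And>l. Suc l < L \<Longrightarrow> Y l \<in> sqmat M'"
    and D: "\<And>l. l < L \<Longrightarrow> D l \<in> carrier_mat M M'"
    and e: "\<And>l. Suc l < L \<Longrightarrow> W l * D (Suc l) = D l * Y l"
  shows "superdiag L M W * bdiag L M M' D = bdiag L M M' D * superdiag L M' Y"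
proof (rule mat_eq_blocksI[of _ L M L M'])
  fix i j a b assume ij: "i < L" "j < L" "a < M" "b < M'"
  have "(superdiag L M W * bdiag L M M' D) $$ (i * M + a, j * M' + b) = (blk M M i j (superdiag L M W) * D j) $$ (a, b)"
    by (rule mult_bdiag_entry[OF _ D]) (use ij in auto)
  also have "blk M M i j (superdiag L M W) * D j = D i * blk M' M' i j (superdiag L M' Y)"
    using ij e[of i] D[OF ij(1)] D[OF ij(2)] by (simp add: blk_superdiag W Y)
  also have "(D i * blk M' M' i j (superdiag L M' Y)) $$ (a, b) = (bdiag L M M' D * superdiag L M' Y) $$ (i * M + a, j * M' + b)"
    by (rule bdiag_mult_entry[OF _ D, symmetric]) (use ij in auto)
  finally show "(superdiag L M W * bdiag L M M' D) $$ (i * M + a, j * M' + b) = (bdiag L M M' D * superdiag L M' Y) $$ (i * M + a, j * M' + b)" .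
qed (auto intro: mult_carrier_mat[of _ _ "L * M"] mult_carrier_mat[of _ _ "L * M'"])

lemma mstar_superdiag_intertwine:
  assumes W: "\<And>l. Suc l < L \<Longrightarrow> W l \<in> sqmat M" and Y: "\<And>l. Suc l < L \<Longrightarrow> Y l \<in> sqmat M'"
    and D: "\<And>l. l < L \<Longrightarrow> D l \<in> carrier_mat M M'"
    and e: "\<And>l. Suc l < L \<Longrightarrow> mstar (W l) * D l = D (Suc l) * mstar (Y l)"
  shows "mstar (superdiag L M W) * bdiag L M M' D = bdiag L M M' D * mstar (superdiag L M' Y)"
proof (rule mat_eq_blocksI[of _ L M L M'])
  fix i j a b assume ij: "i < L" "j < L" "a < M" "b < M'"
  have "(mstar (superdiag L M W) * bdiag L M M' D) $$ (i * M + a, j * M' + b) = (blk M M i j (mstar (superdiag L M W)) * D j) $$ (a, b)"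
    by (rule mult_bdiag_entry[OF _ D]) (use ij in auto)
  also have "blk M M i j (mstar (superdiag L M W)) * D j = D i * blk M' M' i j (mstar (superdiag L M' Y))"
    using ij e[of j] D[OF ij(1)] D[OF ij(2)] by (simp add: blk_mstar_superdiag W Y)
  also have "(D i * blk M' M' i j (mstar (superdiag L M' Y))) $$ (a, b) = (bdiag L M M' D * mstar (superdiag L M' Y)) $$ (i * M + a, j * M' + b)"
    by (rule bdiag_mult_entry[OF _ D, symmetric]) (use ij in auto)
  finally show "(mstar (superdiag L M W) * bdiag L M M' D) $$ (i * M + a, j * M' + b) = (bdiag L M M' D * mstar (superdiag L M' Y)) $$ (i * M + a, j * M' + b)" .
qed (auto intro: mult_carrier_mat[of _ _ "L * M"] mult_carrier_mat[of _ _ "L * M'"])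

section \<open>Kronecker products\<close>

lemma mscale_add: "X \<in> carrier_mat n m \<Longrightarrow> Y \<in> carrier_mat n m \<Longrightarrow> mscale c (X + Y) = mscale c X + mscale c Y"
  by (rule eq_matI) (auto simp: cscale_add_right)

lemma real_part_add:
  "X \<in> sqmat n \<Longrightarrow> Y \<in> sqmat n \<Longrightarrow> X + Y + mstar (X + Y) = (X + mstar X) + (Y + mstar Y)"
  by (rule eq_matI) (auto simp: star_add)

lemma kron_dim [simp]: "dim_row (kron T r) = dim_row T * dim_row r" "dim_col (kron T r) = dim_col T * dim_col r"
  by (simp_all add: kron_def)

lemma kron_carrier [simp]: "T \<in> carrier_mat n m \<Longrightarrow> r \<in> carrier_mat p q \<Longrightarrow> kron T r \<in> carrier_mat (n * p) (m * q)"
  by (auto simp: kron_def)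

lemma kron_entry:
  assumes "T \<in> carrier_mat n m" "r \<in> carrier_mat p q" "i < n" "j < m" "a < p" "b < q"
  shows "kron T r $$ (i * p + a, j * q + b) = T $$ (i, j) *\<^sub>C r $$ (a, b)"
  using assms block_index_less[of i n a p] block_index_less[of j m b q] by (simp add: kron_def)

lemma kron_mult:
  assumes A: "A \<in> carrier_mat n m" "a \<in> carrier_mat p q" and B: "B \<in> carrier_mat m k" "b \<in> carrier_mat q l"
  shows "kron A a * kron B b = kron (A * B) (a * b)"
proof (rule mat_eq_blocksI[of _ n p k l])
  show "kron A a * kron B b \<in> carrier_mat (n * p) (k * l)" using A B by (intro mult_carrier_mat[of _ _ "m * q"]) auto
  show "kron (A * B) (a * b) \<in> carrier_mat (n * p) (k * l)" using A B by (intro kron_carrier) auto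
  fix i j x y assume ij: "i < n" "j < k" "x < p" "y < l"
  have "(kron A a * kron B b) $$ (i * p + x, j * l + y)
      = (\<Sum>u<m. \<Sum>c<q. kron A a $$ (i * p + x, u * q + c) * kron B b $$ (u * q + c, j * l + y))"
    by (rule mult_block_entry) (use A B ij in auto)
  also have "\<dots> = (\<Sum>u<m. \<Sum>c<q. (A $$ (i, u) * B $$ (u, j)) *\<^sub>C (a $$ (x, c) * b $$ (c, y)))"
    by (intro sum.cong refl) (use A B ij in \<open>simp add: kron_entry mult_cscale_left mult_cscale_right cscale_cscale mult.commute\<close>)
  also have "\<dots> = (\<Sum>u<m. A $$ (i, u) * B $$ (u, j)) *\<^sub>C (\<Sum>c<q. a $$ (x, c) * b $$ (c, y))"
    by (subst cscale_sum_left) (simp add: cscale_sum_right)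
  also have "\<dots> = (A * B) $$ (i, j) *\<^sub>C (a * b) $$ (x, y)"
    using A B ij by (subst (1 2) mult_mat_entry) auto
  also have "\<dots> = kron (A * B) (a * b) $$ (i * p + x, j * l + y)"
    using A B ij by (subst kron_entry[of _ n k _ p l]) auto
  finally show "(kron A a * kron B b) $$ (i * p + x, j * l + y) = kron (A * B) (a * b) $$ (i * p + x, j * l + y)" .
qed

lemma kron_eqI:
  assumes "X \<in> carrier_mat (n * p) (m * q)" "T \<in> carrier_mat n m" "r \<in> carrier_mat p q"
    and "\<And>i j a b. i < n \<Longrightarrow> j < m \<Longrightarrow> a < p \<Longrightarrow> b < q \<Longrightarrow> X $$ (i * p + a, j * q + b) = T $$ (i, j) *\<^sub>C r $$ (a, b)"
  shows "X = kron T r"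
  by (rule mat_eq_blocksI[of _ n p m q]) (use assms in \<open>auto simp: kron_entry\<close>)

lemma mscale_kron:
  assumes "T \<in> carrier_mat n m" "r \<in> carrier_mat p q"
  shows "mscale c (kron T r) = kron (mscale c T) r"
proof (rule kron_eqI[of _ n p m q])
  fix i j a b assume ij: "i < n" "j < m" "a < p" "b < q"
  have "i * p + a < n * p" "j * q + b < m * q" using ij by (auto intro: block_index_less)
  then show "mscale c (kron T r) $$ (i * p + a, j * q + b) = mscale c T $$ (i, j) *\<^sub>C r $$ (a, b)"
    using assms ij by (simp add: kron_entry cscale_cscale cscale_complex_def)
qed (use assms in auto)

lemma mstar_kron:
  assumes "T \<in> carrier_mat n m" "r \<in> carrier_mat p q"
  shows "mstar (kron T r) = kron (mstar T) (mstar r)"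
proof (rule kron_eqI[of _ m q n p])
  fix i j a b assume ij: "i < m" "j < n" "a < q" "b < p"
  have "i * q + a < m * q" "j * p + b < n * p" using ij by (auto intro: block_index_less)
  then show "mstar (kron T r) $$ (i * q + a, j * p + b) = mstar T $$ (i, j) *\<^sub>C mstar r $$ (a, b)"
    using assms ij by (simp add: kron_entry star_cscale star_complex_def)
qed (use assms in auto)

lemma kron_add_left:
  assumes "T \<in> carrier_mat n m" "T' \<in> carrier_mat n m" "r \<in> carrier_mat p q"
  shows "kron (T + T') r = kron T r + kron T' r"
proof (rule kron_eqI[of _ n p m q, symmetric])
  fix i j a b assume ij: "i < n" "j < m" "a < p" "b < q"
  have "i * p + a < n * p" "j * q + b < m * q" using ij by (auto intro: block_index_less)
  then show "(kron T r + kron T' r) $$ (i * p + a, j * q + b) = (T + T') $$ (i, j) *\<^sub>C r $$ (a, b)"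
    using assms ij by (simp add: kron_entry cscale_add_left)
qed (use assms in auto)

lemma kron_one: "kron (1\<^sub>m n) (1\<^sub>m p) = (1\<^sub>m (n * p) :: 'a::cstar_algebra mat)"
proof (rule kron_eqI[of _ n p n p, symmetric])
  fix i j a b assume ij: "i < n" "j < n" "a < p" "b < p"
  have "i * p + a < n * p" "j * p + b < n * p" using ij by (auto intro: block_index_less)
  moreover have "i * p + a = j * p + b \<longleftrightarrow> i = j \<and> a = b"
    using ij by (metis add_less_cancel_left mult_less_cancel2 div_mult_self3 div_less add.right_neutral mod_mult_self3 mod_less not_less_zero)
  ultimately show "(1\<^sub>m (n * p) :: 'a mat) $$ (i * p + a, j * p + b) = 1\<^sub>m n $$ (i, j) *\<^sub>C 1\<^sub>m p $$ (a, b)"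
    using ij by simp
qed auto

lemma kron_zero_left: "r \<in> carrier_mat p q \<Longrightarrow> kron (0\<^sub>m n m) r = 0\<^sub>m (n * p) (m * q)"
proof (rule kron_eqI[of _ n p m q, symmetric])
  fix i j a b assume r: "r \<in> carrier_mat p q" and ij: "i < n" "j < m" "a < p" "b < q"
  have "i * p + a < n * p" "j * q + b < m * q" using ij by (auto intro: block_index_less)
  then show "0\<^sub>m (n * p) (m * q) $$ (i * p + a, j * q + b) = 0\<^sub>m n m $$ (i, j) *\<^sub>C r $$ (a, b)" using ij by simp
qed auto

lemma kron_bdiag:
  assumes S: "\<And>l. l < L \<Longrightarrow> S l \<in> carrier_mat m m'" and r: "r \<in> carrier_mat p q"
  shows "kron (bdiag L m m' S) r = bdiag L (m * p) (m' * q) (\<lambda>l. kron (S l) r)"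
proof (rule kron_eqI[of _ "L * m" p "L * m'" q, symmetric])
  show "bdiag L (m * p) (m' * q) (\<lambda>l. kron (S l) r) \<in> carrier_mat (L * m * p) (L * m' * q)"
    by (simp add: bdiag_def mult.assoc)
  fix i j a b assume ij: "i < L * m" "j < L * m'" "a < p" "b < q"
  define l where "l = i div m" define x where "x = i mod m"
  define l' where "l' = j div m'" define y where "y = j mod m'"
  have "m > 0" "m' > 0" using ij by (auto intro: Nat.gr0I)
  then have lx: "l < L" "x < m" "l' < L" "y < m'" "i = l * m + x" "j = l' * m' + y"
    using ij by (auto simp: l_def x_def l'_def y_def less_mult_imp_div_less)
  have xa: "x * p + a < m * p" "y * q + b < m' * q" using lx ij by (auto intro: block_index_less)
  have "bdiag L (m * p) (m' * q) (\<lambda>l. kron (S l) r) $$ (l * (m * p) + (x * p + a), l' * (m' * q) + (y * q + b))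
      = (if l = l' then kron (S l) r $$ (x * p + a, y * q + b) else 0)"
    by (rule bdiag_entry) (use lx xa in auto)
  also have "\<dots> = bdiag L m m' S $$ (l * m + x, l' * m' + y) *\<^sub>C r $$ (a, b)"
    unfolding bdiag_entry[OF lx(1,3,2,4)] kron_entry[OF S[OF lx(1)] r lx(2,4) ij(3,4)] by simp
  also have "l * (m * p) + (x * p + a) = i * p + a" using lx by (simp add: algebra_simps)
  also have "l' * (m' * q) + (y * q + b) = j * q + b" using lx by (simp add: algebra_simps)
  finally show "bdiag L (m * p) (m' * q) (\<lambda>l. kron (S l) r) $$ (i * p + a, j * q + b) = bdiag L m m' S $$ (i, j) *\<^sub>C r $$ (a, b)"
    using lx by simp
qed (use r in auto)

lemma kron_superdiag:
  assumes S: "\<And>l. Suc l < L \<Longrightarrow> S l \<in> sqmat m" and r: "r \<in> sqmat p"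
  shows "kron (superdiag L m S) r = superdiag L (m * p) (\<lambda>l. kron (S l) r)"
proof (rule kron_eqI[of _ "L * m" p "L * m" p, symmetric])
  show "superdiag L (m * p) (\<lambda>l. kron (S l) r) \<in> sqmat (L * m * p)"
    by (simp add: superdiag_def mult.assoc)
  fix i j a b assume ij: "i < L * m" "j < L * m" "a < p" "b < p"
  define l where "l = i div m" define x where "x = i mod m"
  define l' where "l' = j div m" define y where "y = j mod m"
  have "m > 0" using ij by (auto intro: Nat.gr0I)
  then have lx: "l < L" "x < m" "l' < L" "y < m" "i = l * m + x" "j = l' * m + y"
    using ij by (auto simp: l_def x_def l'_def y_def less_mult_imp_div_less)
  have xa: "x * p + a < m * p" "y * p + b < m * p" using lx ij by (auto intro: block_index_less)
  have "superdiag L (m * p) (\<lambda>l. kron (S l) r) $$ (l * (m * p) + (x * p + a), l' * (m * p) + (y * p + b))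
      = (if l' = Suc l then kron (S l) r $$ (x * p + a, y * p + b) else 0)"
    by (rule superdiag_entry) (use lx xa in auto)
  also have "\<dots> = superdiag L m S $$ (l * m + x, l' * m + y) *\<^sub>C r $$ (a, b)"
  proof (cases "l' = Suc l")
    case True
    then have "S l \<in> sqmat m" using lx S by auto
    then have "kron (S l) r $$ (x * p + a, y * p + b) = S l $$ (x, y) *\<^sub>C r $$ (a, b)"
      by (rule kron_entry[OF _ r lx(2,4) ij(3,4)])
    then show ?thesis unfolding superdiag_entry[OF lx(1,3,2,4)] using True by simp
  qed (simp add: superdiag_entry[OF lx(1,3,2,4)])
  also have "l * (m * p) + (x * p + a) = i * p + a" using lx by (simp add: algebra_simps)
  also have "l' * (m * p) + (y * p + b) = j * p + b" using lx by (simp add: algebra_simps)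
  finally show "superdiag L (m * p) (\<lambda>l. kron (S l) r) $$ (i * p + a, j * p + b) = superdiag L m S $$ (i, j) *\<^sub>C r $$ (a, b)"
    using lx by simp
qed (use r in auto)

lemma blk_kron:
  assumes T: "T \<in> sqmat (L * m)" and r: "r \<in> sqmat p" and ij: "i < L" "j < L"
  shows "blk (m * p) (m * p) i j (kron T r) = kron (blk m m i j T) r"
proof (rule kron_eqI[of _ m p m p])
  fix x y a b assume xy: "x < m" "y < m" "a < p" "b < p"
  have xa: "x * p + a < m * p" "y * p + b < m * p" using xy by (auto intro: block_index_less)
  have im: "i * m + x < L * m" "j * m + y < L * m" using xy ij by (auto intro: block_index_less)
  have "blk (m * p) (m * p) i j (kron T r) $$ (x * p + a, y * p + b)
      = kron T r $$ (i * (m * p) + (x * p + a), j * (m * p) + (y * p + b))"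
    using xa by simp
  also have "i * (m * p) + (x * p + a) = (i * m + x) * p + a" by (simp add: algebra_simps)
  also have "j * (m * p) + (y * p + b) = (j * m + y) * p + b" by (simp add: algebra_simps)
  also have "kron T r $$ ((i * m + x) * p + a, (j * m + y) * p + b) = T $$ (i * m + x, j * m + y) *\<^sub>C r $$ (a, b)"
    by (rule kron_entry[OF T r im xy(3,4)])
  finally show "blk (m * p) (m * p) i j (kron T r) $$ (x * p + a, y * p + b) = blk m m i j T $$ (x, y) *\<^sub>C r $$ (a, b)"
    using xy by simp
qed (use r in auto)

lemma kron_column_mult:
  assumes V: "V \<in> carrier_mat n 1" and X: "X \<in> carrier_mat p q"
  shows "kron V (1\<^sub>m p) * X = kron V X"
proof -
  have "kron V (1\<^sub>m p) * X = kron V (1\<^sub>m p) * kron (1\<^sub>m 1) X"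
    using kron_eqI[of X 1 p 1 q "1\<^sub>m 1" X] X by simp
  also have "\<dots> = kron (V * 1\<^sub>m 1) (1\<^sub>m p * X)" by (rule kron_mult[OF V one_carrier_mat one_carrier_mat X])
  finally show ?thesis using right_mult_one_mat[OF V] left_mult_one_mat[OF X] by simp
qed

lemma kron_column_entry:
  fixes X :: "'c::cstar_algebra mat"
  assumes X: "X \<in> sqmat (L * P)" and V: "V \<in> carrier_mat L 1" and ab: "x < L * P" "b < P"
  shows "(X * kron V (1\<^sub>m P)) $$ (x, b) = (\<Sum>l<L. V $$ (l, 0) *\<^sub>C X $$ (x, l * P + b))"
proof -
  have P: "P > 0" using ab by simp
  define i a where "i = x div P" and "a = x mod P"
  have x: "x = i * P + a" "i < L" "a < P" using ab P by (auto simp: i_def a_def less_mult_imp_div_less)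
  have "(X * kron V (1\<^sub>m P)) $$ (i * P + a, 0 * P + b) = (\<Sum>l<L. \<Sum>c<P. X $$ (i * P + a, l * P + c) * kron V (1\<^sub>m P) $$ (l * P + c, 0 * P + b))"
    by (rule mult_block_entry[OF X kron_carrier[OF V one_carrier_mat] x(2,3) _ ab(2)]) simp
  also have "\<dots> = (\<Sum>l<L. \<Sum>c<P. if c = b then V $$ (l, 0) *\<^sub>C X $$ (x, l * P + b) else 0)"
  proof (intro sum.cong refl)
    fix l c assume lc: "l \<in> {..<L}" "c \<in> {..<P}"
    have "kron V (1\<^sub>m P) $$ (l * P + c, 0 * P + b) = V $$ (l, 0) *\<^sub>C (1\<^sub>m P :: 'c mat) $$ (c, b)"
      by (rule kron_entry[OF V one_carrier_mat]) (use lc ab in auto)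
    then show "X $$ (i * P + a, l * P + c) * kron V (1\<^sub>m P) $$ (l * P + c, 0 * P + b) = (if c = b then V $$ (l, 0) *\<^sub>C X $$ (x, l * P + b) else 0)"
      using lc ab x(1) by (simp add: mult_cscale_right)
  qed
  also have "\<dots> = (\<Sum>l<L. V $$ (l, 0) *\<^sub>C X $$ (x, l * P + b))"
    using ab by (intro sum.cong refl) simp
  finally show ?thesis using x(1) by simp
qed

section \<open>The matrix universes\<close>

lemma elemsD:
  assumes "opsys s" "r \<in> elems s"
  shows "r \<in> sqmat (osize s)" "mstar r = r"
  using assms by (auto simp: opsys_def)

lemma span_carrier:
  assumes s: "opsys s" and C: "C \<subseteq> sqmat n" and X: "X \<in> tensor_span C (elems s) (n * osize s)"
  shows "X \<in> sqmat (n * osize s)"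
  using X
proof induction
  case (add T r X)
  then show ?case using C elemsD[OF s] by (intro add_carrier_mat) auto
qed simp

lemma span_add:
  assumes s: "opsys s" and C: "C \<subseteq> sqmat n"
    and X: "X \<in> tensor_span C (elems s) (n * osize s)" and Y: "Y \<in> tensor_span C (elems s) (n * osize s)"
  shows "X + Y \<in> tensor_span C (elems s) (n * osize s)"
  using X
proof induction
  case zero
  then show ?case using Y span_carrier[OF s C Y] by simp
next
  case (add T r X)
  have "kron T r + X + Y = kron T r + (X + Y)"
    using add C elemsD[OF s add(2)] span_carrier[OF s C add(3)] span_carrier[OF s C Y]
    by (intro assoc_add_mat[of _ "n * osize s" "n * osize s"]) auto
  then show ?case using add by (auto intro: tensor_span.add)
qed

lemma span_mscale:
  assumes s: "opsys s" and C: "C \<subseteq> sqmat n" and Cc: "\<And>T. T \<in> C \<Longrightarrow> mscale c T \<in> C"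
    and X: "X \<in> tensor_span C (elems s) (n * osize s)"
  shows "mscale c X \<in> tensor_span C (elems s) (n * osize s)"
  using X
proof induction
  case zero
  have "mscale c (0\<^sub>m (n * osize s) (n * osize s)) = (0\<^sub>m (n * osize s) (n * osize s) :: 'a mat)" by (rule eq_matI) auto
  then show ?case by (simp add: tensor_span.zero)
next
  case (add T r X)
  have k: "kron T r \<in> sqmat (n * osize s)" using add C elemsD[OF s add(2)] by auto
  have "mscale c (kron T r + X) = mscale c (kron T r) + mscale c X"
    by (rule mscale_add[OF k span_carrier[OF s C add(3)]])
  also have "mscale c (kron T r) = kron (mscale c T) r"
    using add C elemsD[OF s add(2)] by (intro mscale_kron) auto
  finally show ?case using add Cc by (auto intro: tensor_span.add)
qed

lemma herm_subset: "herm n \<subseteq> sqmat n" by (auto simp: herm_def)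

context
  fixes s :: "'a::cstar_algebra opsys"
  assumes s: "opsys s"
begin

lemma MU_carrier: "X \<in> MU s n \<Longrightarrow> X \<in> sqmat (n * osize s)"
  unfolding MU_def using span_carrier[OF s order_refl] .

lemma SU_carrier: "X \<in> SU s n \<Longrightarrow> X \<in> sqmat (n * osize s)"
  unfolding SU_def using span_carrier[OF s herm_subset] .

lemma SU_MU: "X \<in> SU s n \<Longrightarrow> X \<in> MU s n"
  unfolding SU_def MU_def using tensor_span_mono[OF herm_subset] by blast

lemma MU_add: "X \<in> MU s n \<Longrightarrow> Y \<in> MU s n \<Longrightarrow> X + Y \<in> MU s n"
  unfolding MU_def using span_add[OF s order_refl] .

lemma SU_add: "X \<in> SU s n \<Longrightarrow> Y \<in> SU s n \<Longrightarrow> X + Y \<in> SU s n"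
  unfolding SU_def using span_add[OF s herm_subset] .

lemma MU_mscale: "X \<in> MU s n \<Longrightarrow> mscale c X \<in> MU s n"
  unfolding MU_def by (rule span_mscale[OF s order_refl]) auto

lemma SU_mscale: "X \<in> SU s n \<Longrightarrow> mscale (of_real c) X \<in> SU s n"
  unfolding SU_def by (rule span_mscale[OF s herm_subset]) (auto simp: herm_def mstar_mscale)

lemma MU_zero: "0\<^sub>m (n * osize s) (n * osize s) \<in> MU s n" unfolding MU_def by (rule tensor_span.zero)

lemma SU_zero: "0\<^sub>m (n * osize s) (n * osize s) \<in> SU s n" unfolding SU_def by (rule tensor_span.zero)

lemma kron_MU: "T \<in> sqmat n \<Longrightarrow> r \<in> elems s \<Longrightarrow> kron T r \<in> MU s n"
  using tensor_span.add[of T "sqmat n" r "elems s" _ "n * osize s", OF _ _ tensor_span.zero]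
    elemsD[OF s, of r] by (auto simp: MU_def)

lemma kron_SU: "T \<in> herm n \<Longrightarrow> r \<in> elems s \<Longrightarrow> kron T r \<in> SU s n"
  using tensor_span.add[of T "herm n" r "elems s" _ "n * osize s", OF _ _ tensor_span.zero]
    elemsD[OF s, of r] herm_subset[of n] by (auto simp: SU_def)

lemma SU_one: "1\<^sub>m (n * osize s) \<in> SU s n"
  using kron_SU[of "1\<^sub>m n" n "1\<^sub>m (osize s)"] s by (auto simp: kron_one opsys_def herm_def)

lemma SU_mstar: "X \<in> SU s n \<Longrightarrow> mstar X = X"
  unfolding SU_def
proof (induction rule: tensor_span.induct)
  case zero show ?case by (rule eq_matI) auto
next
  case (add T r X)
  have k: "kron T r \<in> sqmat (n * osize s)" using add herm_subset[of n] elemsD[OF s add(2)] by auto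
  have "mstar (kron T r) = kron T r"
    using add elemsD[OF s add(2)] by (subst mstar_kron[of _ n n _ "osize s" "osize s"]) (auto simp: herm_def)
  then show ?case using add mstar_add[OF k span_carrier[OF s herm_subset add(3)]] by simp
qed

lemma MU_real_part: "X \<in> MU s n \<Longrightarrow> X + mstar X \<in> SU s n"
  unfolding MU_def
proof (induction rule: tensor_span.induct)
  case zero
  have "mstar (0\<^sub>m (n * osize s) (n * osize s)) = (0\<^sub>m (n * osize s) (n * osize s) :: 'a mat)" by (rule eq_matI) auto
  then show ?case using SU_zero by simp
next
  case (add T r X)
  note r = elemsD[OF s add(2)]
  have k: "kron T r \<in> sqmat (n * osize s)" using add r by auto
  have X: "X \<in> sqmat (n * osize s)" by (rule span_carrier[OF s order_refl add(3)])
  have "kron T r + X + mstar (kron T r + X) = (kron T r + mstar (kron T r)) + (X + mstar X)"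
    by (rule real_part_add[OF k X])
  also have "kron T r + mstar (kron T r) = kron (T + mstar T) r"
    using add r by (simp add: mstar_kron[of _ n n _ "osize s" "osize s"] kron_add_left[of _ n n _ _ "osize s" "osize s"])
  finally show ?case using add r
    by (auto intro!: SU_add kron_SU simp: herm_def mstar_add[of _ n n] comm_add_mat[of _ n n])
qed

lemma MU_blk:
  assumes X: "X \<in> MU s (L * m)" and ij: "i < L" "j < L"
  shows "blk (m * osize s) (m * osize s) i j X \<in> MU s m"
  using X unfolding MU_def
proof (induction rule: tensor_span.induct)
  case zero
  have "blk (m * osize s) (m * osize s) i j (0\<^sub>m (L * m * osize s) (L * m * osize s)) = (0\<^sub>m (m * osize s) (m * osize s) :: 'a mat)"
  proof (rule eq_matI)
    fix a b assume "a < dim_row (0\<^sub>m (m * osize s) (m * osize s))" "b < dim_col (0\<^sub>m (m * osize s) (m * osize s))"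
    then have "i * (m * osize s) + a < L * (m * osize s)" "j * (m * osize s) + b < L * (m * osize s)"
      using ij by (auto intro!: block_index_less)
    then show "blk (m * osize s) (m * osize s) i j (0\<^sub>m (L * m * osize s) (L * m * osize s)) $$ (a, b) = (0\<^sub>m (m * osize s) (m * osize s) :: 'a mat) $$ (a, b)"
      using \<open>a < _\<close> \<open>b < _\<close> by (simp add: mult.assoc)
  qed auto
  then show ?case by (simp add: tensor_span.zero)
next
  case (add T r X)
  note r = elemsD[OF s add(2)]
  have X: "X \<in> sqmat (L * (m * osize s))"
    using span_carrier[OF s order_refl add(3)] by (simp add: mult.assoc)
  have k: "kron T r \<in> sqmat (L * (m * osize s))"
    using kron_carrier[of T "L * m" "L * m" r "osize s" "osize s"] add r by (simp add: mult.assoc)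
  have "blk (m * osize s) (m * osize s) i j (kron T r + X)
      = blk (m * osize s) (m * osize s) i j (kron T r) + blk (m * osize s) (m * osize s) i j X"
    using ij k X by (intro eq_matI) (auto simp: block_index_less)
  also have "blk (m * osize s) (m * osize s) i j (kron T r) = kron (blk m m i j T) r"
    using add r ij by (intro blk_kron) auto
  finally show ?case using add by (auto intro: tensor_span.add)
qed

lemma MU_superdiag_single:
  assumes Y: "Y \<in> MU s m"
  shows "superdiag L (m * osize s) (\<lambda>i. if i = i0 then Y else 0\<^sub>m (m * osize s) (m * osize s)) \<in> MU s (L * m)"
  using Y unfolding MU_def
proof (induction rule: tensor_span.induct)
  case zero
  have "superdiag L (m * osize s) (\<lambda>i. if i = i0 then 0\<^sub>m (m * osize s) (m * osize s) else 0\<^sub>m (m * osize s) (m * osize s))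
      = (0\<^sub>m (L * m * osize s) (L * m * osize s) :: 'a mat)"
    by (rule mat_eq_blocksI[of _ L "m * osize s" L "m * osize s"])
      (auto simp: superdiag_entry block_index_less mult.assoc simp del: if_cancel cong: if_cong)
  then show ?case by (simp add: tensor_span.zero)
next
  case (add T r X)
  note r = elemsD[OF s add(2)]
  have X: "X \<in> sqmat (m * osize s)"
    by (rule span_carrier[OF s order_refl add(3)])
  let ?Z = "0\<^sub>m (m * osize s) (m * osize s) :: 'a mat"
  have k: "kron T r \<in> sqmat (m * osize s)" using add r by auto
  have "(\<lambda>i. if i = i0 then kron T r + X else ?Z) = (\<lambda>i. (if i = i0 then kron T r else ?Z) + (if i = i0 then X else ?Z))"
    by auto
  then have "superdiag L (m * osize s) (\<lambda>i. if i = i0 then kron T r + X else ?Z)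
     = superdiag L (m * osize s) (\<lambda>i. if i = i0 then kron T r else ?Z) + superdiag L (m * osize s) (\<lambda>i. if i = i0 then X else ?Z)"
    using k X by (simp only:) (rule superdiag_add, auto)
  also have "superdiag L (m * osize s) (\<lambda>i. if i = i0 then kron T r else ?Z)
      = superdiag L (m * osize s) (\<lambda>i. kron (if i = i0 then T else 0\<^sub>m m m) r)"
    using r by (intro arg_cong[where f = "superdiag L (m * osize s)"] ext) (auto simp: kron_zero_left)
  also have "\<dots> = kron (superdiag L m (\<lambda>i. if i = i0 then T else 0\<^sub>m m m)) r"
    using add r by (intro kron_superdiag[symmetric]) auto
  finally show ?case using add by (auto intro: tensor_span.add)
qed

lemma MU_superdiag:
  assumes Y: "\<And>i. Suc i < L \<Longrightarrow> Y i \<in> MU s m"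
  shows "superdiag L (m * osize s) Y \<in> MU s (L * m)"
proof -
  let ?M = "m * osize s" let ?Z = "0\<^sub>m ?M ?M :: 'a mat"
  have "superdiag L ?M (\<lambda>i. if i < K then Y i else ?Z) \<in> MU s (L * m)" if "K \<le> L - 1" for K
    using that
  proof (induction K)
    case 0
    have "superdiag L ?M (\<lambda>i. ?Z) = (0\<^sub>m (L * m * osize s) (L * m * osize s) :: 'a mat)"
      by (rule mat_eq_blocksI[of _ L ?M L ?M]) (auto simp: superdiag_entry block_index_less mult.assoc)
    then show ?case using MU_zero[of "L * m"] by simp
  next
    case (Suc K)
    have YK: "Y K \<in> MU s m" using Suc Y[of K] by auto
    have "superdiag L ?M (\<lambda>i. if i < Suc K then Y i else ?Z)
      = superdiag L ?M (\<lambda>i. if i < K then Y i else ?Z) + superdiag L ?M (\<lambda>i. if i = K then Y K else ?Z)"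
    proof -
      have "superdiag L ?M (\<lambda>i. if i < Suc K then Y i else ?Z)
        = superdiag L ?M (\<lambda>i. (if i < K then Y i else ?Z) + (if i = K then Y K else ?Z))"
        using Y MU_carrier by (intro superdiag_cong) (auto simp: less_Suc_eq)
      also have "\<dots> = superdiag L ?M (\<lambda>i. if i < K then Y i else ?Z) + superdiag L ?M (\<lambda>i. if i = K then Y K else ?Z)"
        using Y MU_carrier[OF YK] MU_carrier by (intro superdiag_add) auto
      finally show ?thesis .
    qed
    then show ?case using Suc MU_superdiag_single[OF YK] by (auto intro: MU_add)
  qed
  from this[of "L - 1"] have "superdiag L ?M (\<lambda>i. if i < L - 1 then Y i else ?Z) \<in> MU s (L * m)" by simp
  moreover have "superdiag L ?M (\<lambda>i. if i < L - 1 then Y i else ?Z) = superdiag L ?M Y"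
    by (rule mat_eq_blocksI[of _ L ?M L ?M]) (auto simp: superdiag_entry)
  ultimately show ?thesis by simp
qed

text \<open>Every point of the complex universe has finitely many coordinates, which is what allows
  statements about words to be transferred to arbitrary points.\<close>

lemma MU_lin_form:
  assumes "Y \<in> MU s m"
  obtains d H t where "\<And>i. i < d \<Longrightarrow> H i \<in> elems s" "\<And>i. i < d \<Longrightarrow> t i \<in> sqmat m" "Y = lin_form s m d H t"
proof -
  have "\<exists>d H t. (\<forall>i<d. H i \<in> elems s \<and> t i \<in> sqmat m) \<and> Y = lin_form s m d H t"
    using assms unfolding MU_def
  proof (induction rule: tensor_span.induct)
    case zero
    have "lin_form s m 0 H t = 0\<^sub>m (m * osize s) (m * osize s)" for H t
      by (rule eq_matI) (auto simp: lin_form_def msum_def)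
    then show ?case by (intro exI[of _ 0]) auto
  next
    case (add T r X)
    then obtain d H t where d: "\<forall>i<d. H i \<in> elems s \<and> t i \<in> sqmat m" "X = lin_form s m d H t" by blast
    have "kron T r + X = lin_form s m (Suc d) (H(d := r)) (t(d := T))"
      unfolding d(2) by (rule eq_matI) (use add elemsD[OF s add(2)] in \<open>auto simp: lin_form_def msum_def intro!: sum.cong\<close>)
    moreover have "\<forall>i<Suc d. (H(d := r)) i \<in> elems s \<and> (t(d := T)) i \<in> sqmat m"
      using d(1) add(1,2) by (auto simp: less_Suc_eq)
    ultimately show ?case by blast
  qed
  then show thesis using that by blast
qed

end

section \<open>Germs of free functions along positive directions\<close>

text \<open>Real multiples are used far more often than complex ones, and their entries are plain real
  multiples.\<close>

definition rs :: "real \<Rightarrow> 'a::cstar_algebra mat \<Rightarrow> 'a mat" where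
  "rs t X = mscale (complex_of_real t) X"

lemma rs_dim [simp]: "dim_row (rs t X) = dim_row X" "dim_col (rs t X) = dim_col X"
  by (simp_all add: rs_def)

lemma rs_carrier [simp]: "rs t X \<in> carrier_mat n m \<longleftrightarrow> X \<in> carrier_mat n m"
  by (simp add: rs_def)

lemma rs_entry [simp]: "i < dim_row X \<Longrightarrow> j < dim_col X \<Longrightarrow> rs t X $$ (i, j) = t *\<^sub>R X $$ (i, j)"
  by (simp add: rs_def cscale_of_real)

lemma rs_rs [simp]: "rs a (rs b X) = rs (a * b) X"
  by (rule eq_matI) auto

lemma rs_one_left [simp]: "rs 1 X = X"
  by (rule eq_matI) auto

lemma mnorm_rs: "mnorm (rs t X) = \<bar>t\<bar> * mnorm X"
  by (simp add: rs_def mnorm_mscale)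

lemma rs_zero_left: "X \<in> carrier_mat n m \<Longrightarrow> rs 0 X = 0\<^sub>m n m"
  by (rule eq_matI) auto

lemma mstar_rs: "mstar (rs t X) = rs t (mstar X)"
  by (simp add: rs_def mstar_mscale)

lemma rs_mult_left: "X \<in> carrier_mat n m \<Longrightarrow> Y \<in> carrier_mat m k \<Longrightarrow> rs t X * Y = rs t (X * Y)"
  unfolding rs_def using mscale_mult[of X n m Y k "of_real t" 1] by simp

lemma rs_mult_right: "X \<in> carrier_mat n m \<Longrightarrow> Y \<in> carrier_mat m k \<Longrightarrow> X * rs t Y = rs t (X * Y)"
  unfolding rs_def using mscale_mult[of X n m Y k 1 "of_real t"] by simp

lemma SU_rs: "opsys s \<Longrightarrow> X \<in> SU s n \<Longrightarrow> rs t X \<in> SU s n"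
  unfolding rs_def by (rule SU_mscale)

lemma MU_rs: "opsys s \<Longrightarrow> X \<in> MU s n \<Longrightarrow> rs t X \<in> MU s n"
  unfolding rs_def by (rule MU_mscale)

lemma mnorm_one: "n \<ge> 1 \<Longrightarrow> mnorm (1\<^sub>m n :: 'a::cstar_algebra mat) = 1"
  using norm_entry_le_mnorm[of 0 "1\<^sub>m n :: 'a mat" 0] mnorm_one_le[of n, where 'a='a] by simp

lemma msums_entry:
  assumes "msums n u L" "i < n" "j < n"
  shows "(\<lambda>k. u k $$ (i, j)) sums L $$ (i, j)"
  unfolding sums_def
proof (rule LIMSEQ_I)
  fix e :: real assume "e > 0"
  then obtain K0 where K0: "\<And>K. K \<ge> K0 \<Longrightarrow> mnorm (msum n {..<K} u - L) < e"
    using assms(1) unfolding msums_def by blast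
  have L: "L \<in> sqmat n" using assms by (auto simp: msums_def)
  have "norm ((\<Sum>k<K. u k $$ (i, j)) - L $$ (i, j)) < e" if "K \<ge> K0" for K
  proof -
    have "norm ((msum n {..<K} u - L) $$ (i, j)) \<le> mnorm (msum n {..<K} u - L)"
      using L assms by (intro norm_entry_le_mnorm) (auto simp: msum_def)
    also have "(msum n {..<K} u - L) $$ (i, j) = (\<Sum>k<K. u k $$ (i, j)) - L $$ (i, j)"
      using L assms by (auto simp: msum_def)
    finally show ?thesis using K0[OF that] by simp
  qed
  then show "\<exists>no. \<forall>K\<ge>no. norm ((\<Sum>k<K. u k $$ (i, j)) - L $$ (i, j)) < e" by blast
qed

text \<open>Taylor coefficients from one side, so that they can be used on rays inside a cone.\<close>

definition taylor :: "(real \<Rightarrow> 'b::banach) \<Rightarrow> nat \<Rightarrow> 'b" where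
  "taylor \<phi> = (SOME a. \<exists>r>0. \<forall>t. 0 < t \<and> t < r \<longrightarrow> (\<lambda>k. t ^ k *\<^sub>R a k) sums \<phi> t)"

lemma taylor_eq:
  assumes "r > 0" "\<And>t. 0 < t \<Longrightarrow> t < r \<Longrightarrow> (\<lambda>k. t ^ k *\<^sub>R a k) sums \<phi> t"
  shows "taylor \<phi> = a"
proof -
  let ?P = "\<lambda>a. \<exists>r>0. \<forall>t. 0 < t \<and> t < r \<longrightarrow> (\<lambda>k. t ^ k *\<^sub>R a k) sums \<phi> t"
  have "?P a" using assms by blast
  then have "?P (taylor \<phi>)" unfolding taylor_def by (rule someI[of ?P])
  then obtain r' where r': "r' > 0" "\<And>t. 0 < t \<and> t < r' \<Longrightarrow> (\<lambda>k. t ^ k *\<^sub>R taylor \<phi> k) sums \<phi> t" by blast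
  have "taylor \<phi> k = a k" for k
    by (rule power_series_unique[of "min r r'" _ \<phi>]) (use assms r' in auto)
  then show ?thesis by blast
qed

text \<open>The situation that a function \<open>f\<close> of a sovereign class leaves at a point
  \<open>X\<close> of level \<open>1\<close>, with \<open>g m Y = f (X\<^sup>\<oplus>\<^sup>m +
  Y)\<close>.  The constant \<open>C\<close> in \<open>g_series0\<close> is the same at all levels
  \<open>m\<close>, because the control of \<open>f\<close> at \<open>X\<^sup>\<oplus>\<^sup>m\<close>
  does not depend on \<open>m\<close>; away from the centre the bound \<open>N\<close> may depend on the
  point.  Intertwining with rectangular \<open>S\<close> combines the direct sum and similarity
  properties.\<close>

locale germ =
  fixes s1 :: "'a::cstar_algebra opsys" and s2 :: "'b::cstar_algebra opsys"
    and g :: "nat \<Rightarrow> 'a mat \<Rightarrow> 'b mat" and p C :: real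
  assumes s1: "opsys s1" and s2: "opsys s2" and p: "p > 0"
    and g_in: "\<And>m Y. m \<ge> 1 \<Longrightarrow> Y \<in> SU s1 m \<Longrightarrow> mnorm Y < 4 * p \<Longrightarrow> g m Y \<in> SU s2 m"
    and g_inter: "\<And>n n' Y Z S. \<lbrakk>n \<ge> 1; n' \<ge> 1; Y \<in> SU s1 n; Z \<in> SU s1 n'; mnorm Y < 4 * p; mnorm Z < 4 * p;
      S \<in> carrier_mat n n'; Y * kron S (1\<^sub>m (osize s1)) = kron S (1\<^sub>m (osize s1)) * Z\<rbrakk> \<Longrightarrow>
      g n Y * kron S (1\<^sub>m (osize s2)) = kron S (1\<^sub>m (osize s2)) * g n' Z"
    and g_series: "\<And>m Z. m \<ge> 1 \<Longrightarrow> Z \<in> SU s1 m \<Longrightarrow> mnorm Z \<le> 2 * p \<Longrightarrow>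
      \<exists>N. \<forall>P\<in>SU s1 m. mpos (m * osize s1) P \<longrightarrow> mnorm P = p \<longrightarrow>
        (\<exists>a. (\<forall>k. mnorm (a k) \<le> N) \<and>
          (\<forall>t. \<bar>t\<bar> < 1 \<longrightarrow> msums (m * osize s2) (\<lambda>k. mscale (of_real t ^ k) (a k)) (g m (Z + rs t P))))"
    and g_series0: "\<And>m P. m \<ge> 1 \<Longrightarrow> P \<in> SU s1 m \<Longrightarrow> mpos (m * osize s1) P \<Longrightarrow> mnorm P = p \<Longrightarrow>
      (\<exists>a. (\<forall>k. mnorm (a k) \<le> C) \<and>
        (\<forall>t. \<bar>t\<bar> < 1 \<longrightarrow> msums (m * osize s2) (\<lambda>k. mscale (of_real t ^ k) (a k)) (g m (rs t P))))"
begin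

abbreviation "N1 \<equiv> osize s1"
abbreviation "N2 \<equiv> osize s2"

lemma N_pos: "N1 \<ge> 1" "N2 \<ge> 1" using s1 s2 by (auto simp: opsys_def)

text \<open>A cone of positive matrices that is closed under sums and contains \<open>c + P\<close> for
  every Hermitian \<open>P\<close> of norm at most \<open>c\<close>.\<close>

definition cone :: "nat \<Rightarrow> 'a mat \<Rightarrow> bool" where
  "cone m P \<longleftrightarrow> P \<in> SU s1 m \<and> (\<exists>c. mnorm (rs c (1\<^sub>m (m * N1)) - P) \<le> c)"

lemma cone_SU: "cone m P \<Longrightarrow> P \<in> SU s1 m" by (simp add: cone_def)

lemma cone_carrier: "cone m P \<Longrightarrow> P \<in> sqmat (m * N1)"
  using SU_carrier[OF s1] cone_SU by blast

lemma cone_mpos: "cone m P \<Longrightarrow> mpos (m * N1) P"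
  using mpos_of_norm[of P "m * N1"] cone_carrier[of m P] SU_mstar[OF s1, of P m]
  by (auto simp: cone_def rs_def)

lemma cone_add: "cone m P \<Longrightarrow> cone m Q \<Longrightarrow> cone m (P + Q)"
proof -
  assume PQ: "cone m P" "cone m Q"
  then obtain c d where c: "mnorm (rs c (1\<^sub>m (m * N1)) - P) \<le> c" "mnorm (rs d (1\<^sub>m (m * N1)) - Q) \<le> d"
    by (auto simp: cone_def)
  have P: "P \<in> sqmat (m * N1)" "Q \<in> sqmat (m * N1)" using PQ cone_carrier by auto
  have "rs (c + d) (1\<^sub>m (m * N1)) - (P + Q) = (rs c (1\<^sub>m (m * N1)) - P) + (rs d (1\<^sub>m (m * N1)) - Q)"
    using P by (intro eq_matI) (auto simp: scaleR_add_left)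
  then have "mnorm (rs (c + d) (1\<^sub>m (m * N1)) - (P + Q)) \<le> c + d"
    using mnorm_add[OF minus_carrier_mat[OF P(1)] minus_carrier_mat[OF P(2)]] c by (simp only:) (meson add_mono order_trans)
  then show ?thesis using PQ SU_add[OF s1] unfolding cone_def by blast
qed

lemma cone_rs: "cone m P \<Longrightarrow> t \<ge> 0 \<Longrightarrow> cone m (rs t P)"
proof -
  assume P: "cone m P" and t: "t \<ge> 0"
  then obtain c where c: "mnorm (rs c (1\<^sub>m (m * N1)) - P) \<le> c" by (auto simp: cone_def)
  have "rs (t * c) (1\<^sub>m (m * N1)) - rs t P = rs t (rs c (1\<^sub>m (m * N1)) - P)"
    using cone_carrier[OF P] by (intro eq_matI) (auto simp: scaleR_diff_right)
  then have "mnorm (rs (t * c) (1\<^sub>m (m * N1)) - rs t P) \<le> t * c"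
    using c t by (simp add: mnorm_rs mult_left_mono)
  then show ?thesis using P SU_rs[OF s1] unfolding cone_def by blast
qed

lemma cone_of_norm: "P \<in> SU s1 m \<Longrightarrow> mnorm P \<le> c \<Longrightarrow> cone m (rs c (1\<^sub>m (m * N1)) + P)"
proof -
  assume P: "P \<in> SU s1 m" "mnorm P \<le> c"
  have "rs c (1\<^sub>m (m * N1)) - (rs c (1\<^sub>m (m * N1)) + P) = rs (-1) P"
    using SU_carrier[OF s1 P(1)] by (intro eq_matI) auto
  then have "mnorm (rs c (1\<^sub>m (m * N1)) - (rs c (1\<^sub>m (m * N1)) + P)) \<le> c" using P by (simp add: mnorm_rs)
  then show ?thesis using P SU_add[OF s1 SU_rs[OF s1 SU_one[OF s1]]] unfolding cone_def by blast
qed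

lemma zero_SU: "0\<^sub>m (m * N1) (m * N1) \<in> SU s1 m" by (rule SU_zero[OF s1])

lemma cone_one:
  assumes "c \<ge> 0" shows "cone m (rs c (1\<^sub>m (m * N1)))"
  using cone_of_norm[OF zero_SU[of m], of c] assms by simp

lemma g_carrier: "m \<ge> 1 \<Longrightarrow> Y \<in> SU s1 m \<Longrightarrow> mnorm Y < 4 * p \<Longrightarrow> g m Y \<in> sqmat (m * N2)"
  using g_in SU_carrier[OF s2] by blast

lemma series_entries:
  assumes P: "cone m P" "mnorm P > 0" and Z: "Z \<in> sqmat (m * N1)"
    and a: "\<And>t. \<bar>t\<bar> < 1 \<Longrightarrow> msums (m * N2) (\<lambda>k. mscale (of_real t ^ k) (a k)) (g m (Z + rs t (rs (p / mnorm P) P)))"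
  shows "\<And>k. a k \<in> sqmat (m * N2)"
    and "\<And>t i j. \<bar>t\<bar> * mnorm P < p \<Longrightarrow> i < m * N2 \<Longrightarrow> j < m * N2 \<Longrightarrow>
      (\<lambda>k. t ^ k *\<^sub>R rs ((mnorm P / p) ^ k) (a k) $$ (i, j)) sums g m (Z + rs t P) $$ (i, j)"
proof -
  show ac: "a k \<in> sqmat (m * N2)" for k
    using a[of 0] by (simp add: msums_def)
  fix t :: real and i j assume t: "\<bar>t\<bar> * mnorm P < p" and ij: "i < m * N2" "j < m * N2"
  define u where "u = t * mnorm P / p"
  have "\<bar>u\<bar> < 1" using t p P by (simp add: u_def abs_mult)
  have "rs u (rs (p / mnorm P) P) = rs t P" using p P by (simp add: u_def)
  then have "(\<lambda>k. mscale (of_real u ^ k) (a k) $$ (i, j)) sums g m (Z + rs t P) $$ (i, j)"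
    using msums_entry[OF a[OF \<open>\<bar>u\<bar> < 1\<close>] ij] by simp
  moreover have "mscale (of_real u ^ k) (a k) $$ (i, j) = t ^ k *\<^sub>R rs ((mnorm P / p) ^ k) (a k) $$ (i, j)" for k
  proof -
    have "mscale (of_real u ^ k) (a k) $$ (i, j) = rs (u ^ k) (a k) $$ (i, j)" by (simp add: rs_def)
    also have "\<dots> = u ^ k *\<^sub>R a k $$ (i, j)" using ac[of k] ij by (intro rs_entry) auto
    also have "\<dots> = t ^ k *\<^sub>R (mnorm P / p) ^ k *\<^sub>R a k $$ (i, j)"
      by (simp add: u_def flip: power_mult_distrib)
    also have "(mnorm P / p) ^ k *\<^sub>R a k $$ (i, j) = rs ((mnorm P / p) ^ k) (a k) $$ (i, j)"
      using ac[of k] ij by (intro rs_entry[symmetric]) auto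
    finally show ?thesis .
  qed
  ultimately show "(\<lambda>k. t ^ k *\<^sub>R rs ((mnorm P / p) ^ k) (a k) $$ (i, j)) sums g m (Z + rs t P) $$ (i, j)" by simp
qed

lemma mnorm_zero_eq: "X \<in> sqmat n \<Longrightarrow> \<not> mnorm X > 0 \<Longrightarrow> X = 0\<^sub>m n n"
  using mnorm_le_0_iff[of X n n] by simp

lemma base_bound:
  assumes m: "m \<ge> 1" and Z: "Z \<in> sqmat (m * N1)"
    and N: "\<And>P. P \<in> SU s1 m \<Longrightarrow> mpos (m * N1) P \<Longrightarrow> mnorm P = p \<Longrightarrow> \<exists>a. (\<forall>k. mnorm (a k) \<le> N) \<and>
      (\<forall>t. \<bar>t\<bar> < 1 \<longrightarrow> msums (m * N2) (\<lambda>k. mscale (of_real t ^ k) (a k)) (g m (Z + rs t P)))"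
  shows "mnorm (g m Z) \<le> N" "g m Z \<in> sqmat (m * N2)"
proof -
  let ?P = "rs p (1\<^sub>m (m * N1) :: 'a mat)"
  have n: "mnorm ?P = p" using p m N_pos mnorm_one[of "m * N1", where 'a='a] by (simp add: mnorm_rs)
  have P: "cone m ?P" using p by (intro cone_one) simp
  obtain a where a: "\<And>k. mnorm (a k) \<le> N"
    "\<And>t. \<bar>t\<bar> < 1 \<Longrightarrow> msums (m * N2) (\<lambda>k. mscale (of_real t ^ k) (a k)) (g m (Z + rs t ?P))"
    using N[OF cone_SU[OF P] cone_mpos[OF P] n] by blast
  have z: "Z + rs 0 ?P = Z" using Z by (intro eq_matI) auto
  note s0 = a(2)[of 0, unfolded z, simplified]
  have ac: "a k \<in> sqmat (m * N2)" for k using a(2)[of 0] by (simp add: msums_def)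
  show gc: "g m Z \<in> sqmat (m * N2)" using s0 by (simp add: msums_def)
  have "g m Z = a 0"
  proof (rule eq_matI)
    fix i j assume "i < dim_row (a 0)" "j < dim_col (a 0)"
    then have ij: "i < m * N2" "j < m * N2" using ac[of 0] by auto
    have "(\<lambda>k. mscale (0 ^ k) (a k) $$ (i, j)) sums g m Z $$ (i, j)" by (rule msums_entry[OF s0 ij])
    moreover have "(\<lambda>k. mscale (0 ^ k) (a k) $$ (i, j)) sums (\<Sum>k\<in>{0}. mscale (0 ^ k) (a k) $$ (i, j))"
    proof (rule sums_finite)
      fix k :: nat assume "k \<notin> {0}"
      then show "mscale (0 ^ k) (a k) $$ (i, j) = 0" using ac[of k] ij by (simp add: power_0_left)
    qed simp
    ultimately show "g m Z $$ (i, j) = a 0 $$ (i, j)" using sums_unique2 by fastforce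
  qed (use ac[of 0] gc in \<open>simp_all only: carrier_matD\<close>)
  then show "mnorm (g m Z) \<le> N" using a(1)[of 0] by simp
qed

text \<open>The hypotheses speak of directions of norm exactly \<open>p\<close> and of matrix sums;
  rescaling turns them into entrywise series for all directions of the cone.\<close>

lemma expand:
  assumes m: "m \<ge> 1" and Z: "Z \<in> sqmat (m * N1)" and V: "cone m V"
    and N: "\<And>P. P \<in> SU s1 m \<Longrightarrow> mpos (m * N1) P \<Longrightarrow> mnorm P = p \<Longrightarrow> \<exists>a. (\<forall>k. mnorm (a k) \<le> N) \<and>
      (\<forall>t. \<bar>t\<bar> < 1 \<longrightarrow> msums (m * N2) (\<lambda>k. mscale (of_real t ^ k) (a k)) (g m (Z + rs t P)))"
  shows "\<exists>a. (\<forall>k. a k \<in> sqmat (m * N2) \<and> mnorm (a k) \<le> N * (mnorm V / p) ^ k) \<and>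
    (\<forall>t i j. \<bar>t\<bar> * mnorm V < p \<longrightarrow> i < m * N2 \<longrightarrow> j < m * N2 \<longrightarrow>
      (\<lambda>k. t ^ k *\<^sub>R a k $$ (i, j)) sums g m (Z + rs t V) $$ (i, j))"
proof (cases "mnorm V > 0")
  case True
  define Q where "Q = rs (p / mnorm V) V"
  have Q: "cone m Q" "mnorm Q = p" using V True p by (auto simp: Q_def mnorm_rs intro!: cone_rs)
  obtain a where a: "\<And>k. mnorm (a k) \<le> N"
    "\<And>t. \<bar>t\<bar> < 1 \<Longrightarrow> msums (m * N2) (\<lambda>k. mscale (of_real t ^ k) (a k)) (g m (Z + rs t Q))"
    using N[OF cone_SU[OF Q(1)] cone_mpos[OF Q(1)] Q(2)] by blast
  note s = series_entries[OF V True Z a(2)[unfolded Q_def]]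
  have "mnorm (rs ((mnorm V / p) ^ k) (a k)) \<le> N * (mnorm V / p) ^ k" for k
    using a(1)[of k] True p by (simp add: mnorm_rs power_abs mult.commute mult_left_mono)
  then show ?thesis using s by (intro exI[of _ "\<lambda>k. rs ((mnorm V / p) ^ k) (a k)"]) auto
next
  case False
  then have z: "V = 0\<^sub>m (m * N1) (m * N1)" using mnorm_zero_eq[OF cone_carrier[OF V]] by blast
  have rz: "Z + rs t V = Z" for t unfolding z using Z by (intro eq_matI) auto
  have b: "mnorm (g m Z) \<le> N" "g m Z \<in> sqmat (m * N2)" by (rule base_bound[OF m Z N]; assumption)+
  let ?a = "\<lambda>k. if k = (0::nat) then g m Z else 0\<^sub>m (m * N2) (m * N2)"
  have "(\<lambda>k. t ^ k *\<^sub>R ?a k $$ (i, j)) sums g m (Z + rs t V) $$ (i, j)" if "i < m * N2" "j < m * N2" for t i j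
  proof -
    have "(\<lambda>k. t ^ k *\<^sub>R ?a k $$ (i, j)) sums (\<Sum>k\<in>{0}. t ^ k *\<^sub>R ?a k $$ (i, j))"
      by (rule sums_finite) (use that in auto)
    then show ?thesis by (simp add: rz)
  qed
  moreover have "mnorm (?a k) \<le> N * (mnorm V / p) ^ k" for k
  proof -
    have "mnorm V = 0" unfolding z by simp
    then show ?thesis using b(1) by (simp add: power_0_left)
  qed
  moreover have "?a k \<in> sqmat (m * N2)" for k using b(2) by simp
  ultimately show ?thesis by (intro exI[of _ ?a]) blast
qed

lemma expand0:
  assumes m: "m \<ge> 1" and P: "cone m P"
  shows "\<exists>a. (\<forall>k. a k \<in> sqmat (m * N2) \<and> mnorm (a k) \<le> C * (mnorm P / p) ^ k) \<and>
    (\<forall>t i j. \<bar>t\<bar> * mnorm P < p \<longrightarrow> i < m * N2 \<longrightarrow> j < m * N2 \<longrightarrow>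
      (\<lambda>k. t ^ k *\<^sub>R a k $$ (i, j)) sums g m (rs t P) $$ (i, j))"
    and C_bound: "mnorm (g m (0\<^sub>m (m * N1) (m * N1))) \<le> C"
proof -
  have z: "0\<^sub>m (m * N1) (m * N1) + rs t X = rs t X" if "X \<in> sqmat (m * N1)" for X :: "'a mat" and t
    using that by auto
  have N: "\<exists>a. (\<forall>k. mnorm (a k) \<le> C) \<and>
      (\<forall>t. \<bar>t\<bar> < 1 \<longrightarrow> msums (m * N2) (\<lambda>k. mscale (of_real t ^ k) (a k)) (g m (0\<^sub>m (m * N1) (m * N1) + rs t P)))"
    if "P \<in> SU s1 m" "mpos (m * N1) P" "mnorm P = p" for P
    unfolding z[OF SU_carrier[OF s1 that(1)]] by (rule g_series0[OF m that])
  show "mnorm (g m (0\<^sub>m (m * N1) (m * N1))) \<le> C" by (rule base_bound(1)[OF m zero_carrier_mat N])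
  show "\<exists>a. (\<forall>k. a k \<in> sqmat (m * N2) \<and> mnorm (a k) \<le> C * (mnorm P / p) ^ k) \<and>
    (\<forall>t i j. \<bar>t\<bar> * mnorm P < p \<longrightarrow> i < m * N2 \<longrightarrow> j < m * N2 \<longrightarrow>
      (\<lambda>k. t ^ k *\<^sub>R a k $$ (i, j)) sums g m (rs t P) $$ (i, j))"
    using expand[OF m zero_carrier_mat P N] unfolding z[OF cone_carrier[OF P]] .
qed

lemma C_nonneg: "C \<ge> 0"
  using order_trans[OF mnorm_nonneg C_bound[OF order_refl cone_one[OF order_refl]]] .

lemma expandZ:
  assumes m: "m \<ge> 1" and Z: "Z \<in> SU s1 m" "mnorm Z \<le> 2 * p"
  shows "\<exists>N. \<forall>V. cone m V \<longrightarrow> mnorm V \<le> p \<longrightarrow> (\<exists>a. \<forall>i j. i < m * N2 \<longrightarrow> j < m * N2 \<longrightarrow>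
      (\<forall>k. norm (a k $$ (i, j)) \<le> N) \<and>
      (\<forall>t. \<bar>t\<bar> < 1 \<longrightarrow> (\<lambda>k. t ^ k *\<^sub>R a k $$ (i, j)) sums g m (Z + rs t V) $$ (i, j)))"
proof -
  have Zc: "Z \<in> sqmat (m * N1)" by (rule SU_carrier[OF s1 Z(1)])
  obtain N where N: "\<And>P. P \<in> SU s1 m \<Longrightarrow> mpos (m * N1) P \<Longrightarrow> mnorm P = p \<Longrightarrow> \<exists>a. (\<forall>k. mnorm (a k) \<le> N) \<and>
      (\<forall>t. \<bar>t\<bar> < 1 \<longrightarrow> msums (m * N2) (\<lambda>k. mscale (of_real t ^ k) (a k)) (g m (Z + rs t P)))"
    using g_series[OF m Z] by blast
  have N0: "N \<ge> 0" by (rule order_trans[OF mnorm_nonneg base_bound(1)[OF m Zc N]])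
  have "\<exists>a. \<forall>i j. i < m * N2 \<longrightarrow> j < m * N2 \<longrightarrow> (\<forall>k. norm (a k $$ (i, j)) \<le> N) \<and>
      (\<forall>t. \<bar>t\<bar> < 1 \<longrightarrow> (\<lambda>k. t ^ k *\<^sub>R a k $$ (i, j)) sums g m (Z + rs t V) $$ (i, j))"
    if V: "cone m V" "mnorm V \<le> p" for V
  proof -
    obtain a where a: "\<And>k. a k \<in> sqmat (m * N2)" "\<And>k. mnorm (a k) \<le> N * (mnorm V / p) ^ k"
      "\<And>t i j. \<bar>t\<bar> * mnorm V < p \<Longrightarrow> i < m * N2 \<Longrightarrow> j < m * N2 \<Longrightarrow>
        (\<lambda>k. t ^ k *\<^sub>R a k $$ (i, j)) sums g m (Z + rs t V) $$ (i, j)"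
      using expand[OF m Zc V(1) N] by blast
    have "norm (a k $$ (i, j)) \<le> N" if "i < m * N2" "j < m * N2" for k i j
    proof -
      have "norm (a k $$ (i, j)) \<le> mnorm (a k)" using a(1)[of k] that by (intro norm_entry_le_mnorm) auto
      also have "\<dots> \<le> N * (mnorm V / p) ^ k" by (rule a(2))
      also have "\<dots> \<le> N" using V(2) p N0 mnorm_nonneg[of V] by (intro mult_left_le power_le_one) auto
      finally show ?thesis .
    qed
    moreover have "\<bar>t\<bar> * mnorm V < p" if "\<bar>t\<bar> < 1" for t
      by (rule le_less_trans[OF mult_left_mono[OF V(2) abs_ge_zero]]) (use mult_strict_right_mono[OF that p] in simp)
    ultimately show ?thesis using a(3) by (intro exI[of _ a]) blast
  qed
  then show ?thesis by blast
qed

text \<open>The \<open>k\<close>-th Taylor coefficient of \<open>g\<close> at the centre in the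
  direction \<open>P\<close>.\<close>

definition A :: "nat \<Rightarrow> nat \<Rightarrow> 'a mat \<Rightarrow> 'b mat" where
  "A m k P = mat (m * N2) (m * N2) (\<lambda>(i, j). taylor (\<lambda>t. g m (rs t P) $$ (i, j)) k)"

lemma A_carrier [simp]: "A m k P \<in> sqmat (m * N2)" by (simp add: A_def)

lemma A_dim [simp]: "dim_row (A m k P) = m * N2" "dim_col (A m k P) = m * N2" by (simp_all add: A_def)

lemma A_entry: "i < m * N2 \<Longrightarrow> j < m * N2 \<Longrightarrow> A m k P $$ (i, j) = taylor (\<lambda>t. g m (rs t P) $$ (i, j)) k"
  by (simp add: A_def)

lemma A_series_bound:
  assumes m: "m \<ge> 1" and P: "cone m P"
  shows A_bound: "mnorm (A m k P) \<le> C * (mnorm P / p) ^ k"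
    and A_series: "\<And>t i j. \<bar>t\<bar> * mnorm P < p \<Longrightarrow> i < m * N2 \<Longrightarrow> j < m * N2 \<Longrightarrow>
      (\<lambda>k. t ^ k *\<^sub>R A m k P $$ (i, j)) sums g m (rs t P) $$ (i, j)"
proof -
  obtain a where a: "\<And>k. a k \<in> sqmat (m * N2)" "\<And>k. mnorm (a k) \<le> C * (mnorm P / p) ^ k"
    "\<And>t i j. \<bar>t\<bar> * mnorm P < p \<Longrightarrow> i < m * N2 \<Longrightarrow> j < m * N2 \<Longrightarrow>
      (\<lambda>k. t ^ k *\<^sub>R a k $$ (i, j)) sums g m (rs t P) $$ (i, j)"
    using expand0[OF m P] by blast
  define r where "r = p / (mnorm P + 1)"
  have r: "r > 0" using p mnorm_nonneg[of P] by (simp add: r_def add_nonneg_pos)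
  have "taylor (\<lambda>t. g m (rs t P) $$ (i, j)) = (\<lambda>k. a k $$ (i, j))" if ij: "i < m * N2" "j < m * N2" for i j
  proof (rule taylor_eq[OF r])
    fix t assume t: "0 < t" "t < r"
    have "t * mnorm P \<le> t * (mnorm P + 1)" using t by simp
    also have "\<dots> < r * (mnorm P + 1)" using t mnorm_nonneg[of P] by (intro mult_strict_right_mono) linarith+
    also have "\<dots> = p" using mnorm_nonneg[of P] by (simp add: r_def add_nonneg_eq_0_iff)
    finally have "\<bar>t\<bar> * mnorm P < p" using t by simp
    then show "(\<lambda>k. t ^ k *\<^sub>R a k $$ (i, j)) sums g m (rs t P) $$ (i, j)" using a(3) ij by blast
  qed
  then have e: "A m k P = a k" for k
    using a(1)[of k] by (intro eq_matI) (auto simp: A_entry)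
  show "mnorm (A m k P) \<le> C * (mnorm P / p) ^ k" unfolding e by (rule a)
  show "(\<lambda>k. t ^ k *\<^sub>R A m k P $$ (i, j)) sums g m (rs t P) $$ (i, j)"
    if "\<bar>t\<bar> * mnorm P < p" "i < m * N2" "j < m * N2" for t i j unfolding e using that by (rule a(3))
qed

lemma small_radius:
  fixes x :: real
  assumes "x \<ge> 0" obtains r where "r > 0" "\<And>t. 0 < t \<Longrightarrow> t < r \<Longrightarrow> \<bar>t\<bar> * x < p"
proof
  show "p / (x + 1) > 0" using p assms by simp
  fix t assume t: "0 < t" "t < p / (x + 1)"
  have "t * x \<le> t * (x + 1)" using t by simp
  also have "\<dots> < (p / (x + 1)) * (x + 1)" using t assms by (intro mult_strict_right_mono) linarith+
  also have "\<dots> = p" using assms by simp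
  finally show "\<bar>t\<bar> * x < p" using t by simp
qed

lemma A_rs:
  assumes m: "m \<ge> 1" and P: "cone m P" and c: "c \<ge> 0"
  shows "A m k (rs c P) = rs (c ^ k) (A m k P)"
proof (rule eq_matI)
  fix i j assume "i < dim_row (rs (c ^ k) (A m k P))" "j < dim_col (rs (c ^ k) (A m k P))"
  then have ij: "i < m * N2" "j < m * N2" by auto
  obtain r where r: "r > 0" "\<And>t. 0 < t \<Longrightarrow> t < r \<Longrightarrow> \<bar>t\<bar> * (c * mnorm P) < p"
    using small_radius[of "c * mnorm P"] c by auto
  have "taylor (\<lambda>t. g m (rs t (rs c P)) $$ (i, j)) = (\<lambda>k. c ^ k *\<^sub>R A m k P $$ (i, j))"
  proof (rule taylor_eq[OF r(1)])
    fix t assume t: "0 < t" "t < r"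
    have "\<bar>t * c\<bar> * mnorm P < p" using r(2)[OF t] c by (simp add: abs_mult mult.assoc)
    from A_series[OF m P this ij]
    show "(\<lambda>k. t ^ k *\<^sub>R c ^ k *\<^sub>R A m k P $$ (i, j)) sums g m (rs t (rs c P)) $$ (i, j)"
      by (simp add: rs_rs power_mult_distrib)
  qed
  then show "A m k (rs c P) $$ (i, j) = rs (c ^ k) (A m k P) $$ (i, j)"
    using ij by (simp add: A_entry)
qed auto

text \<open>Uniqueness of power series turns intertwining of values into intertwining of Taylor
  coefficients.\<close>

lemma A_inter:
  assumes n: "n \<ge> 1" "n' \<ge> 1" and P: "cone n P" and Q: "cone n' Q" and S: "S \<in> carrier_mat n n'"
    and e: "P * kron S (1\<^sub>m N1) = kron S (1\<^sub>m N1) * Q"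
  shows "A n k P * kron S (1\<^sub>m N2) = kron S (1\<^sub>m N2) * A n' k Q"
proof (rule eq_matI)
  let ?S = "kron S (1\<^sub>m N2) :: 'b mat" and ?S1 = "kron S (1\<^sub>m N1) :: 'a mat"
  have Sc: "?S \<in> carrier_mat (n * N2) (n' * N2)" "?S1 \<in> carrier_mat (n * N1) (n' * N1)" using S by auto
  note Pc = cone_carrier[OF P] and Qc = cone_carrier[OF Q]
  fix i j assume "i < dim_row (?S * A n' k Q)" "j < dim_col (?S * A n' k Q)"
  then have ij: "i < n * N2" "j < n' * N2" using S by auto
  obtain r where r: "r > 0" "\<And>t. 0 < t \<Longrightarrow> t < r \<Longrightarrow> \<bar>t\<bar> * (max (mnorm P) (mnorm Q)) < p"
    using small_radius[of "max (mnorm P) (mnorm Q)"] by (metis le_max_iff_disj mnorm_nonneg)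
  have small: "\<bar>t\<bar> * mnorm P < p" "\<bar>t\<bar> * mnorm Q < p" if "0 < t" "t < r" for t
  proof -
    have "\<bar>t\<bar> * mnorm P \<le> \<bar>t\<bar> * max (mnorm P) (mnorm Q)" "\<bar>t\<bar> * mnorm Q \<le> \<bar>t\<bar> * max (mnorm P) (mnorm Q)"
      by (intro mult_left_mono max.cobounded1 max.cobounded2 abs_ge_zero)+
    then show "\<bar>t\<bar> * mnorm P < p" "\<bar>t\<bar> * mnorm Q < p" using r(2)[OF that] by linarith+
  qed
  have AP: "(A n k P * ?S) $$ (i, j) = (\<Sum>l<n * N2. A n k P $$ (i, l) * ?S $$ (l, j))" for k
    using ij S by (subst mult_mat_entry) auto
  have AQ: "(?S * A n' k Q) $$ (i, j) = (\<Sum>l<n' * N2. ?S $$ (i, l) * A n' k Q $$ (l, j))" for k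
    using ij S by (subst mult_mat_entry) auto
  show "(A n k P * ?S) $$ (i, j) = (?S * A n' k Q) $$ (i, j)"
  proof (rule power_series_unique[OF r(1), where a = "\<lambda>k. (A n k P * ?S) $$ (i, j)" and b = "\<lambda>k. (?S * A n' k Q) $$ (i, j)"
      and \<phi> = "\<lambda>t. (g n (rs t P) * ?S) $$ (i, j)"])
    fix t assume t: "0 < t" "t < r"
    have gP: "g n (rs t P) \<in> sqmat (n * N2)"
      using small[OF t] p by (intro g_carrier n SU_rs[OF s1] cone_SU[OF P]) (simp add: mnorm_rs)
    have gQ: "g n' (rs t Q) \<in> sqmat (n' * N2)"
      using small[OF t] p by (intro g_carrier n SU_rs[OF s1] cone_SU[OF Q]) (simp add: mnorm_rs)
    have "(\<lambda>k. \<Sum>l<n * N2. (t ^ k *\<^sub>R A n k P $$ (i, l)) * ?S $$ (l, j)) sums (\<Sum>l<n * N2. g n (rs t P) $$ (i, l) * ?S $$ (l, j))"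
      using small[OF t] ij by (intro sums_sum sums_mult2 A_series n P) auto
    then show "(\<lambda>k. t ^ k *\<^sub>R (A n k P * ?S) $$ (i, j)) sums (g n (rs t P) * ?S) $$ (i, j)"
      unfolding AP using ij S gP by (subst mult_mat_entry) (auto simp: scaleR_sum_right)
    have "(\<lambda>k. \<Sum>l<n' * N2. ?S $$ (i, l) * (t ^ k *\<^sub>R A n' k Q $$ (l, j))) sums (\<Sum>l<n' * N2. ?S $$ (i, l) * g n' (rs t Q) $$ (l, j))"
      using small[OF t] ij by (intro sums_sum sums_mult A_series n Q) auto
    then have "(\<lambda>k. t ^ k *\<^sub>R (?S * A n' k Q) $$ (i, j)) sums (?S * g n' (rs t Q)) $$ (i, j)"
      unfolding AQ using ij S gQ by (subst mult_mat_entry) (auto simp: scaleR_sum_right)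
    also have "?S * g n' (rs t Q) = g n (rs t P) * ?S"
    proof (rule g_inter[symmetric])
      have "rs t P * ?S1 = rs t (P * ?S1)" by (rule rs_mult_left[OF Pc Sc(2)])
      also have "\<dots> = ?S1 * rs t Q" unfolding e by (rule rs_mult_right[OF Sc(2) Qc, symmetric])
      finally show "rs t P * ?S1 = ?S1 * rs t Q" .
    qed (use small[OF t] p n S SU_rs[OF s1] cone_SU[OF P] cone_SU[OF Q] in \<open>auto simp: mnorm_rs\<close>)
    finally show "(\<lambda>k. t ^ k *\<^sub>R (?S * A n' k Q) $$ (i, j)) sums (g n (rs t P) * ?S) $$ (i, j)" .
  qed
qed (use S in auto)

lemma mnorm_rs_add_le:
  assumes "X \<in> sqmat n" "Y \<in> sqmat n"
  shows "mnorm (rs a X + rs b Y) \<le> \<bar>a\<bar> * mnorm X + \<bar>b\<bar> * mnorm Y"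
  using mnorm_add[of "rs a X" n n "rs b Y"] assms by (simp add: mnorm_rs)

text \<open>Two directions \<open>P, Q\<close> of the cone span a quadrant on which each entry of
  \<open>g\<close> satisfies the hypotheses of the real-variable theorem.\<close>

lemma A_segment:
  assumes m: "m \<ge> 1" and P: "cone m P" and Q: "cone m Q" and ij: "i < m * N2" "j < m * N2"
  shows "poly_on k (\<lambda>s. A m k (rs (1 - s) P + rs s Q) $$ (i, j))"
proof -
  define \<mu> where "\<mu> = mnorm P + mnorm Q + 1"
  have \<mu>: "\<mu> > 0" "mnorm P \<le> \<mu>" "mnorm Q \<le> \<mu>"
    using mnorm_nonneg[of P] mnorm_nonneg[of Q] unfolding \<mu>_def by linarith+
  define c where "c = p / (2 * \<mu>)"
  have c: "c > 0" using p \<mu> by (simp add: c_def)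
  define P' where "P' = rs c P" define Q' where "Q' = rs c Q"
  have P': "cone m P'" "cone m Q'" using P Q c by (auto simp: P'_def Q'_def intro!: cone_rs)
  note P'c = cone_carrier[OF P'(1)] cone_carrier[OF P'(2)]
  have nP': "mnorm P' \<le> p / 2" "mnorm Q' \<le> p / 2"
  proof -
    have "c * mnorm P \<le> c * \<mu>" "c * mnorm Q \<le> c * \<mu>" using c \<mu> by (auto intro!: mult_left_mono)
    moreover have "c * \<mu> = p / 2" using \<mu> by (simp add: c_def)
    ultimately show "mnorm P' \<le> p / 2" "mnorm Q' \<le> p / 2" using c by (auto simp: P'_def Q'_def mnorm_rs)
  qed
  define lin where "lin z = rs (fst z) P' + rs (snd z) Q'" for z :: "real \<times> real"
  have linSU: "lin z \<in> SU s1 m" for z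
    unfolding lin_def by (intro SU_add[OF s1] SU_rs[OF s1] cone_SU P')
  have linc: "lin z \<in> sqmat (m * N1)" for z using SU_carrier[OF s1 linSU] .
  have linn: "mnorm (lin z) \<le> p" if "z \<in> sq" for z
  proof -
    have "mnorm (lin z) \<le> \<bar>fst z\<bar> * mnorm P' + \<bar>snd z\<bar> * mnorm Q'" unfolding lin_def by (rule mnorm_rs_add_le[OF P'c])
    also have "\<dots> \<le> 1 * (p / 2) + 1 * (p / 2)" using that nP' by (intro add_mono mult_mono) (auto simp: sq_def)
    finally show ?thesis by simp
  qed
  have linq: "cone m (lin v)" "mnorm (lin v) \<le> p" if "v \<in> quad" for v
  proof -
    show "cone m (lin v)" unfolding lin_def using that P' by (intro cone_add cone_rs) (auto simp: quad_def)
    show "mnorm (lin v) \<le> p" using that by (intro linn) (auto simp: quad_def sq_def)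
  qed
  have lin_add: "lin (z + t *\<^sub>R v) = lin z + rs t (lin v)" for z v t
    unfolding lin_def using P'c
    by (intro eq_matI) (auto simp: scaleR_add_left scaleR_add_right)
  let ?g = "\<lambda>z. g m (lin z) $$ (i, j)"
  have "\<exists>N. \<forall>v\<in>quad. \<exists>a. (\<forall>k. norm (a k) \<le> N) \<and> (\<forall>t. \<bar>t\<bar> < 1 \<longrightarrow> (\<lambda>k. t ^ k *\<^sub>R a k) sums ?g (z + t *\<^sub>R v))"
    if "z \<in> sq" for z
  proof -
    have "mnorm (lin z) \<le> 2 * p" using linn[OF that] p by simp
    from expandZ[OF m linSU this] obtain N where N: "\<And>V. cone m V \<Longrightarrow> mnorm V \<le> p \<Longrightarrow> (\<exists>a. \<forall>i j. i < m * N2 \<longrightarrow> j < m * N2 \<longrightarrow>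
      (\<forall>k. norm (a k $$ (i, j)) \<le> N) \<and>
      (\<forall>t. \<bar>t\<bar> < 1 \<longrightarrow> (\<lambda>k. t ^ k *\<^sub>R a k $$ (i, j)) sums g m (lin z + rs t V) $$ (i, j)))" by blast
    have "\<exists>a. (\<forall>k. norm (a k) \<le> N) \<and> (\<forall>t. \<bar>t\<bar> < 1 \<longrightarrow> (\<lambda>k. t ^ k *\<^sub>R a k) sums ?g (z + t *\<^sub>R v))"
      if v: "v \<in> quad" for v
    proof -
      obtain a where "\<forall>i j. i < m * N2 \<longrightarrow> j < m * N2 \<longrightarrow>
        (\<forall>k. norm (a k $$ (i, j)) \<le> N) \<and>
        (\<forall>t. \<bar>t\<bar> < 1 \<longrightarrow> (\<lambda>k. t ^ k *\<^sub>R a k $$ (i, j)) sums g m (lin z + rs t (lin v)) $$ (i, j))"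
        using N[OF linq[OF v]] by blast
      then show ?thesis using ij unfolding lin_add by (intro exI[of _ "\<lambda>k. a k $$ (i, j)"]) blast
    qed
    then show ?thesis by blast
  qed
  then obtain N where N: "\<And>z v. z \<in> sq \<Longrightarrow> v \<in> quad \<Longrightarrow>
      \<exists>a. (\<forall>k. norm (a k) \<le> N z) \<and> (\<forall>t. \<bar>t\<bar> < 1 \<longrightarrow> (\<lambda>k. t ^ k *\<^sub>R a k) sums ?g (z + t *\<^sub>R v))"
    by metis
  define a where "a z v = (SOME a. (\<forall>k. norm (a k) \<le> N z) \<and> (\<forall>t. \<bar>t\<bar> < 1 \<longrightarrow> (\<lambda>k. t ^ k *\<^sub>R a k) sums ?g (z + t *\<^sub>R v)))" for z v
  have a: "(\<forall>k. norm (a z v k) \<le> N z) \<and> (\<forall>t. \<bar>t\<bar> < 1 \<longrightarrow> (\<lambda>k. t ^ k *\<^sub>R a z v k) sums ?g (z + t *\<^sub>R v))"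
    if "z \<in> sq" "v \<in> quad" for z v
    unfolding a_def by (rule someI_ex[OF N[OF that]])
  interpret quadrant_analytic ?g a N
    by unfold_locales (use a in blast)+
  have lin0: "lin (0, 0) = 0\<^sub>m (m * N1) (m * N1)"
    unfolding lin_def using P'c by (intro eq_matI) auto
  have eq: "a (0, 0) (1 - s, s) k = c ^ k *\<^sub>R A m k (rs (1 - s) P + rs s Q) $$ (i, j)" if s: "s \<in> {0..1}" for s k
  proof -
    have q: "(1 - s, s) \<in> quad" using s by (auto simp: quad_def)
    have "taylor (\<lambda>t. g m (rs t (lin (1 - s, s))) $$ (i, j)) = a (0, 0) (1 - s, s)"
    proof (rule taylor_eq[of 1])
      fix t :: real assume t: "0 < t" "t < 1"
      have "(\<lambda>k. t ^ k *\<^sub>R a (0, 0) (1 - s, s) k) sums ?g ((0, 0) + t *\<^sub>R (1 - s, s))"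
        using t q by (intro series) (auto simp: sq_def)
      also have "lin ((0, 0) + t *\<^sub>R (1 - s, s)) = rs t (lin (1 - s, s))"
        unfolding lin_add lin0 using linc[of "(1 - s, s)"] by simp
      finally show "(\<lambda>k. t ^ k *\<^sub>R a (0, 0) (1 - s, s) k) sums g m (rs t (lin (1 - s, s))) $$ (i, j)" .
    qed simp
    then have "a (0, 0) (1 - s, s) k = A m k (lin (1 - s, s)) $$ (i, j)" using ij by (simp add: A_entry)
    also have "lin (1 - s, s) = rs c (rs (1 - s) P + rs s Q)"
      unfolding lin_def P'_def Q'_def using cone_carrier[OF P] cone_carrier[OF Q]
      by (intro eq_matI) (auto simp: scaleR_add_right mult.commute)
    also have "A m k \<dots> = rs (c ^ k) (A m k (rs (1 - s) P + rs s Q))"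
      using s c P Q by (intro A_rs m cone_add cone_rs) auto
    also have "\<dots> $$ (i, j) = c ^ k *\<^sub>R A m k (rs (1 - s) P + rs s Q) $$ (i, j)"
      using ij by (intro rs_entry) auto
    finally show ?thesis .
  qed
  from coefficients_poly_on[of k] have "poly_on k (\<lambda>s. c ^ k *\<^sub>R A m k (rs (1 - s) P + rs s Q) $$ (i, j))"
    unfolding poly_on_def using eq by simp
  from poly_on_scaleR[OF this, of "1 / c ^ k"] show ?thesis using c by simp
qed

end

section \<open>Polynomial functions of restricted growth\<close>

lemma poly_on_vanishing_bound:
  fixes \<phi> :: "real \<Rightarrow> 'b::real_normed_vector"
  assumes p: "poly_on k \<phi>" and z: "\<phi> 0 = 0" and b: "\<And>u. u \<in> {0..1} \<Longrightarrow> norm (\<phi> u) \<le> B" and u: "u \<in> {0..1}"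
  shows "norm (\<phi> u) \<le> real (Suc k) * KK ^ k * B * u"
proof -
  obtain c where c: "\<And>u. u \<in> {0..1} \<Longrightarrow> \<phi> u = (\<Sum>i\<le>k. u ^ i *\<^sub>R c i)" using p unfolding poly_on_def by blast
  have cb: "norm (c i) \<le> KK ^ k * B" if "i \<le> k" for i
    by (rule coeff_bound[OF _ that]) (use c b in auto)
  have B: "KK ^ k * B \<ge> 0" using order_trans[OF norm_ge_zero cb[of 0]] by simp
  have c0: "c 0 = 0"
  proof -
    have "(\<Sum>i\<le>k. (0::real) ^ i *\<^sub>R c i) = (\<Sum>i\<le>k. if i = 0 then c i else 0)"
      by (intro sum.cong) (auto simp: power_0_left)
    also have "\<dots> = c 0" by simp
    finally show ?thesis using c[of 0] z by simp
  qed
  have "norm (\<phi> u) \<le> (\<Sum>i\<le>k. KK ^ k * B * u)"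
    unfolding c[OF u]
  proof (rule sum_norm_le)
    fix i assume i: "i \<in> {..k}"
    show "norm (u ^ i *\<^sub>R c i) \<le> KK ^ k * B * u"
    proof (cases i)
      case 0
      then show ?thesis using c0 B u by simp
    next
      case (Suc j)
      have "u ^ i * norm (c i) \<le> u * (KK ^ k * B)"
        using u cb[of i] i Suc by (intro mult_mono) (auto simp: mult_left_le power_le_one)
      then show ?thesis using u by (simp add: mult_ac)
    qed
  qed
  also have "\<dots> = real (Suc k) * KK ^ k * B * u" by (simp add: algebra_simps)
  finally show ?thesis .
qed

text \<open>Rescaling to \<open>[0, R]\<close> bounds the coefficient of degree \<open>i < k\<close> by
  a multiple of \<open>R\<^sup>k\<^sup>-\<^sup>i\<close>, which tends to \<open>0\<close> with
  \<open>R\<close>.\<close>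

lemma poly_on_pure:
  fixes \<phi> :: "real \<Rightarrow> 'b::real_normed_vector"
  assumes p: "poly_on k \<phi>" and b: "\<And>u. u \<in> {0..1} \<Longrightarrow> norm (\<phi> u) \<le> B * u ^ k" and u: "u \<in> {0..1}"
  shows "\<phi> u = u ^ k *\<^sub>R \<phi> 1"
proof -
  obtain c where c: "\<And>u. u \<in> {0..1} \<Longrightarrow> \<phi> u = (\<Sum>i\<le>k. u ^ i *\<^sub>R c i)" using p unfolding poly_on_def by blast
  have B: "B \<ge> 0" using order_trans[OF norm_ge_zero b[of 1]] by simp
  have c0: "c i = 0" if i: "i < k" for i
  proof -
    have e: "norm (c i) \<le> 0 + e" if e: "e > 0" for e
    proof -
      define K where "K = KK ^ k * B + 1"
      have K: "K > 0" "KK ^ k * B \<le> K" using B KK_ge by (auto simp: K_def add_nonneg_pos)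
      define R where "R = min 1 (e / K)"
      have R: "0 < R" "R \<le> 1" "R * K \<le> e"
      proof -
        show "0 < R" using e K by (simp add: R_def)
        show "R \<le> 1" unfolding R_def by (rule min.cobounded1)
        have "R \<le> e / K" unfolding R_def by (rule min.cobounded2)
        then show "R * K \<le> e" using K by (simp add: le_divide_eq)
      qed
      have "norm (R ^ i *\<^sub>R c i) \<le> KK ^ k * (B * R ^ k)"
      proof (rule coeff_bound[where c = "\<lambda>i. R ^ i *\<^sub>R c i"])
        fix v :: real assume v: "0 \<le> v" "v \<le> 1"
        then have Rv: "R * v \<in> {0..1}" using R by (auto intro: mult_le_one)
        have "(\<Sum>i\<le>k. v ^ i *\<^sub>R R ^ i *\<^sub>R c i) = \<phi> (R * v)"
          unfolding c[OF Rv] by (simp add: power_mult_distrib mult.commute)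
        then have "norm (\<Sum>i\<le>k. v ^ i *\<^sub>R R ^ i *\<^sub>R c i) \<le> B * (R * v) ^ k" using b[OF Rv] by simp
        also have "\<dots> \<le> B * R ^ k"
          using B v R by (intro mult_left_mono power_mono) (auto simp: mult_left_le)
        finally show "norm (\<Sum>i\<le>k. v ^ i *\<^sub>R R ^ i *\<^sub>R c i) \<le> B * R ^ k" .
      qed (use i in simp)
      then have "R ^ i * norm (c i) \<le> KK ^ k * B * R ^ k" using R by (simp add: mult.assoc)
      also have "R ^ k = R ^ i * R ^ (k - i)" using i by (simp flip: power_add)
      also have "KK ^ k * B * (R ^ i * R ^ (k - i)) = R ^ i * (KK ^ k * B * R ^ (k - i))" by simp
      finally have "norm (c i) \<le> KK ^ k * B * R ^ (k - i)" by (rule mult_left_le_imp_le) (use R in simp)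
      also have "\<dots> \<le> K * R ^ 1"
        using K B R i KK_ge by (intro mult_mono power_decreasing) auto
      finally show ?thesis using R by (simp add: mult.commute)
    qed
    then have "norm (c i) \<le> 0" by (rule field_le_epsilon)
    then show ?thesis by simp
  qed
  have "\<phi> v = v ^ k *\<^sub>R c k" if v: "v \<in> {0..1}" for v
  proof -
    have "\<phi> v = (\<Sum>i\<le>k. if i = k then v ^ i *\<^sub>R c i else 0)"
      unfolding c[OF v] by (intro sum.cong) (use c0 in auto)
    then show ?thesis by simp
  qed
  from this[OF u] this[of 1] show ?thesis by simp
qed

lemma poly_on_extend:
  fixes q :: "real \<Rightarrow> 'b::real_normed_vector"
  assumes p: "\<And>R. R \<ge> 1 \<Longrightarrow> poly_on k (\<lambda>u. q (R * u))"
  obtains c where "\<And>x. x \<ge> 0 \<Longrightarrow> q x = (\<Sum>i\<le>k. x ^ i *\<^sub>R c i)"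
proof -
  obtain c where c: "\<And>u. u \<in> {0..1} \<Longrightarrow> q u = (\<Sum>i\<le>k. u ^ i *\<^sub>R c i)"
    using p[of 1] unfolding poly_on_def by auto
  have cR: "q (R * u) = (\<Sum>i\<le>k. (R * u) ^ i *\<^sub>R c i)" if R: "R \<ge> 1" and u: "u \<in> {0..1}" for R u
  proof -
    obtain d where d: "\<And>u. u \<in> {0..1} \<Longrightarrow> q (R * u) = (\<Sum>i\<le>k. u ^ i *\<^sub>R d i)"
      using p[OF R] unfolding poly_on_def by auto
    have "norm (c i - (1 / R ^ i) *\<^sub>R d i) \<le> KK ^ k * 0" if i: "i \<le> k" for i
    proof (rule coeff_bound[OF _ i])
      fix v :: real assume v: "0 \<le> v" "v \<le> 1"
      have vR: "v / R \<in> {0..1}" using v R by (auto simp: divide_le_eq)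
      have "(\<Sum>i\<le>k. v ^ i *\<^sub>R (c i - (1 / R ^ i) *\<^sub>R d i)) = (\<Sum>i\<le>k. v ^ i *\<^sub>R c i) - (\<Sum>i\<le>k. (v / R) ^ i *\<^sub>R d i)"
        by (simp add: scaleR_diff_right sum_subtractf power_divide)
      also have "\<dots> = 0" using c[of v] d[OF vR] v R by simp
      finally show "norm (\<Sum>i\<le>k. v ^ i *\<^sub>R (c i - (1 / R ^ i) *\<^sub>R d i)) \<le> 0" by simp
    qed
    then have "d i = R ^ i *\<^sub>R c i" if "i \<le> k" for i
      using that R by (force simp: eq_divide_eq)
    then show ?thesis unfolding d[OF u] by (intro sum.cong refl) (auto simp: power_mult_distrib mult.commute)
  qed
  have "q x = (\<Sum>i\<le>k. x ^ i *\<^sub>R c i)" if x: "x \<ge> 0" for x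
  proof -
    define R where "R = max 1 x"
    have R: "R \<ge> 1" "x / R \<in> {0..1}" "R * (x / R) = x" using x by (auto simp: R_def divide_le_eq)
    show ?thesis using cR[OF R(1,2)] unfolding R(3) .
  qed
  then show thesis by (rule that)
qed

lemma poly_linear_growth:
  fixes q :: "real \<Rightarrow> 'b::real_normed_vector"
  assumes p: "\<And>R. R \<ge> 1 \<Longrightarrow> poly_on k (\<lambda>u. q (R * u))"
    and b: "\<And>x. x \<ge> 0 \<Longrightarrow> norm (q x) \<le> \<alpha> + \<beta> * x" and ab: "\<alpha> \<ge> 0" "\<beta> \<ge> 0"
  obtains q0 q1 where "\<And>x. x \<ge> 0 \<Longrightarrow> q x = q0 + x *\<^sub>R q1"
proof -
  obtain c where cR: "\<And>x. x \<ge> 0 \<Longrightarrow> q x = (\<Sum>i\<le>k. x ^ i *\<^sub>R c i)"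
    using poly_on_extend[OF p] by blast
  have c0: "c i = 0" if i: "2 \<le> i" "i \<le> k" for i
  proof -
    have "norm (c i) \<le> 0 + e" if e: "e > 0" for e
    proof -
      define K where "K = KK ^ k * (\<alpha> + \<beta>)"
      have K: "K \<ge> 0" using ab KK_ge by (auto simp: K_def)
      define R where "R = max 1 (K / e)"
      have R: "R \<ge> 1" "K / e \<le> R" by (auto simp: R_def)
      have "norm (R ^ i *\<^sub>R c i) \<le> KK ^ k * (\<alpha> + \<beta> * R)"
      proof (rule coeff_bound[where c = "\<lambda>i. R ^ i *\<^sub>R c i"])
        fix v :: real assume v: "0 \<le> v" "v \<le> 1"
        have "(\<Sum>i\<le>k. v ^ i *\<^sub>R R ^ i *\<^sub>R c i) = q (R * v)"
          using v R by (subst cR) (auto simp: power_mult_distrib mult.commute)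
        also have "norm \<dots> \<le> \<alpha> + \<beta> * (R * v)" using v R by (intro b) auto
        also have "\<dots> \<le> \<alpha> + \<beta> * R" using v R ab by (intro add_left_mono mult_left_mono) (auto simp: mult_left_le)
        finally show "norm (\<Sum>i\<le>k. v ^ i *\<^sub>R R ^ i *\<^sub>R c i) \<le> \<alpha> + \<beta> * R" .
      qed (use i in simp)
      also have "\<dots> \<le> KK ^ k * ((\<alpha> + \<beta>) * R)"
      proof (intro mult_left_mono)
        have "\<alpha> * 1 \<le> \<alpha> * R" using ab R by (intro mult_left_mono) auto
        then show "\<alpha> + \<beta> * R \<le> (\<alpha> + \<beta>) * R" by (simp add: algebra_simps)
      qed (use KK_ge in simp)
      finally have "R ^ i * norm (c i) \<le> R * K" using R by (simp add: K_def mult_ac)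
      moreover have "R * (R * norm (c i)) \<le> R ^ i * norm (c i)"
        using power_increasing[OF i(1) R(1)] by (simp add: power2_eq_square mult.assoc[symmetric] mult_right_mono)
      ultimately have "R * (R * norm (c i)) \<le> R * K" by linarith
      then have "R * norm (c i) \<le> K" by (rule mult_left_le_imp_le) (use R in simp)
      also have "K \<le> R * e" using R e by (simp add: divide_le_eq)
      finally have "norm (c i) \<le> e" by (rule mult_left_le_imp_le) (use R in simp)
      then show ?thesis by simp
    qed
    then have "norm (c i) \<le> 0" by (rule field_le_epsilon)
    then show ?thesis by simp
  qed
  have "q x = c 0 + x *\<^sub>R (if k = 0 then 0 else c 1)" if x: "x \<ge> 0" for x
  proof -
    have "q x = (\<Sum>i\<le>k. x ^ i *\<^sub>R c i)" by (rule cR[OF x])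
    also have "\<dots> = (\<Sum>i\<le>k. (if i = 0 then c 0 else 0) + (if i = 1 then x *\<^sub>R c 1 else 0))"
    proof (intro sum.cong refl)
      fix i assume "i \<in> {..k}"
      then consider "i = 0" | "i = 1" | "2 \<le> i" "i \<le> k" by force
      then show "x ^ i *\<^sub>R c i = (if i = 0 then c 0 else 0) + (if i = 1 then x *\<^sub>R c 1 else 0)"
        using c0 by cases auto
    qed
    also have "\<dots> = c 0 + x *\<^sub>R (if k = 0 then 0 else c 1)" by (simp add: sum.distrib)
    finally show ?thesis .
  qed
  then show thesis by (rule that)
qed

section \<open>The multilinear forms of a germ\<close>

lemma superdiag_rs: "(\<And>i. Suc i < L \<Longrightarrow> Y i \<in> sqmat M) \<Longrightarrow> superdiag L M (\<lambda>i. rs t (Y i)) = rs t (superdiag L M Y)"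
proof (rule mat_eq_blocksI[of _ L M L M])
  fix i j a b assume Y: "\<And>i. Suc i < L \<Longrightarrow> Y i \<in> sqmat M" and ij: "i < L" "j < L" "a < M" "b < M"
  have lt: "i * M + a < L * M" "j * M + b < L * M" using ij by (auto intro!: block_index_less)
  have "rs t (superdiag L M Y) $$ (i * M + a, j * M + b) = t *\<^sub>R superdiag L M Y $$ (i * M + a, j * M + b)"
    using lt by (intro rs_entry) auto
  also have "\<dots> = superdiag L M (\<lambda>i. rs t (Y i)) $$ (i * M + a, j * M + b)"
  proof (cases "j = Suc i")
    case True
    then have "Y i \<in> sqmat M" using Y ij by auto
    then show ?thesis using ij unfolding superdiag_entry[OF ij] by auto
  qed (simp add: superdiag_entry[OF ij])
  finally show "superdiag L M (\<lambda>i. rs t (Y i)) $$ (i * M + a, j * M + b) = rs t (superdiag L M Y) $$ (i * M + a, j * M + b)" ..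
qed auto

lemma mult_mscale_one_right: "X \<in> carrier_mat n m \<Longrightarrow> X * mscale a (1\<^sub>m m) = mscale a X"
  using mscale_mult[of X n m "1\<^sub>m m" m 1 a] by simp

lemma mult_mscale_one_left: "X \<in> carrier_mat n m \<Longrightarrow> mscale a (1\<^sub>m n) * X = mscale a X"
  using mscale_mult[of "1\<^sub>m n" n n X m a 1] by simp

lemma kron_scalar: "kron (mscale a (1\<^sub>m m)) (1\<^sub>m N :: 'a::cstar_algebra mat) = mscale a (1\<^sub>m (m * N))"
  using mscale_kron[of "1\<^sub>m m" m m "1\<^sub>m N :: 'a mat" N N a] by (simp add: kron_one)

context germ
begin

text \<open>A positive direction that carries \<open>k\<close> arbitrary matrices
  \<open>Y\<^sub>i\<close> when \<open>L = k + 1\<close>: the term \<open>c\<close> makes the Hermitian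
  matrix \<open>W + W\<^sup>*\<close> positive, where \<open>W\<close> has the \<open>Y\<^sub>i\<close>
  above the diagonal.\<close>

definition T :: "nat \<Rightarrow> nat \<Rightarrow> real \<Rightarrow> (nat \<Rightarrow> 'a mat) \<Rightarrow> 'a mat" where
  "T L m c Y = rs c (1\<^sub>m (L * (m * N1))) + (superdiag L (m * N1) Y + mstar (superdiag L (m * N1) Y))"

definition valid :: "nat \<Rightarrow> nat \<Rightarrow> real \<Rightarrow> (nat \<Rightarrow> 'a mat) \<Rightarrow> bool" where
  "valid m k c Y \<longleftrightarrow> (\<exists>r>0. 2 * r \<le> c \<and> (\<forall>i<k. Y i \<in> MU s1 m \<and> mnorm (Y i) \<le> r))"

lemma MUc: "Y \<in> MU s1 m \<Longrightarrow> Y \<in> sqmat (m * N1)" by (rule MU_carrier[OF s1])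

lemma T_cone:
  assumes r: "r > 0" "2 * r \<le> c" and Y: "\<And>i. i < k \<Longrightarrow> Y i \<in> MU s1 m \<and> mnorm (Y i) \<le> r"
  shows "cone (Suc k * m) (T (Suc k) m c Y)" and "mnorm (T (Suc k) m c Y) \<le> c + 2 * r"
proof -
  define L where "L = Suc k"
  have Y': "Y i \<in> MU s1 m" "mnorm (Y i) \<le> r" if "Suc i < L" for i using Y[of i] that by (auto simp: L_def)
  let ?W = "superdiag L (m * N1) Y"
  have W: "?W \<in> MU s1 (L * m)" by (rule MU_superdiag[OF s1 Y'(1)])
  have nW: "mnorm ?W \<le> r" using Y' MUc r by (intro mnorm_superdiag) auto
  have "mnorm (?W + mstar ?W) \<le> mnorm ?W + mnorm (mstar ?W)"
    by (rule mnorm_add[of _ "L * (m * N1)" "L * (m * N1)"]) auto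
  then have nR: "mnorm (?W + mstar ?W) \<le> 2 * r" using nW by simp
  have e: "L * (m * N1) = L * m * N1" by simp
  show "cone (Suc k * m) (T (Suc k) m c Y)"
    unfolding T_def L_def[symmetric] unfolding e
    by (rule cone_of_norm[OF MU_real_part[OF s1 W[unfolded e]]]) (use nR r in simp)
  have "mnorm (T L m c Y) \<le> mnorm (rs c (1\<^sub>m (L * (m * N1)) :: 'a mat)) + mnorm (?W + mstar ?W)"
    unfolding T_def by (rule mnorm_add[of _ "L * (m * N1)" "L * (m * N1)"]) auto
  moreover have "mnorm (rs c (1\<^sub>m (L * (m * N1)) :: 'a mat)) \<le> c * 1"
    unfolding mnorm_rs using r mnorm_one_le[of "L * (m * N1)", where 'a='a] by (intro mult_mono) auto
  ultimately show "mnorm (T (Suc k) m c Y) \<le> c + 2 * r" using nR unfolding L_def by linarith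
qed

lemma valid_cone: "valid m k c Y \<Longrightarrow> cone (Suc k * m) (T (Suc k) m c Y)"
  unfolding valid_def using T_cone(1) by blast

text \<open>A word that leads from block \<open>0\<close> to block \<open>k\<close> in \<open>k\<close>
  steps uses each \<open>Y\<^sub>i\<close> once, in this order; so the corner block of the coefficient
  of degree \<open>k\<close> isolates the part that is multilinear in the
  \<open>Y\<^sub>i\<close>.\<close>

definition Psi :: "nat \<Rightarrow> nat \<Rightarrow> real \<Rightarrow> (nat \<Rightarrow> 'a mat) \<Rightarrow> 'b mat" where
  "Psi m k c Y = blk (m * N2) (m * N2) 0 k (A (Suc k * m) k (T (Suc k) m c Y))"

lemma Psi_carrier [simp]: "Psi m k c Y \<in> sqmat (m * N2)" by (simp add: Psi_def)

lemma Psi_dim [simp]: "dim_row (Psi m k c Y) = m * N2" "dim_col (Psi m k c Y) = m * N2" by (simp_all add: Psi_def)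

lemma Psi_cong: "(\<And>i. i < k \<Longrightarrow> Y i = Y' i) \<Longrightarrow> Psi m k c Y = Psi m k c Y'"
  unfolding Psi_def T_def using superdiag_cong[of "Suc k" Y Y' "m * N1"] by simp

lemma A_blk_carrier: "A (Suc k * m) j X \<in> sqmat (Suc k * (m * N2))"
  using A_carrier[of "Suc k * m" j X] by (simp only: mult.assoc)

lemma Psi_bound:
  assumes m: "m \<ge> 1" and r: "r > 0" "2 * r \<le> c" and Y: "\<And>i. i < k \<Longrightarrow> Y i \<in> MU s1 m \<and> mnorm (Y i) \<le> r"
  shows "mnorm (Psi m k c Y) \<le> C * ((c + 2 * r) / p) ^ k"
proof -
  have m': "Suc k * m \<ge> 1" using m by simp
  have "mnorm (Psi m k c Y) \<le> mnorm (A (Suc k * m) k (T (Suc k) m c Y))"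
    unfolding Psi_def by (rule mnorm_blk[OF A_blk_carrier]) auto
  also have "\<dots> \<le> C * (mnorm (T (Suc k) m c Y) / p) ^ k"
    by (rule A_bound[OF m' T_cone(1)[OF r Y]])
  also have "\<dots> \<le> C * ((c + 2 * r) / p) ^ k"
    using T_cone(2)[OF r Y] p C_nonneg
    by (intro mult_left_mono power_mono divide_right_mono) auto
  finally show ?thesis .
qed

lemma T_inter:
  assumes W: "\<And>l. Suc l < L \<Longrightarrow> W l \<in> sqmat (m * N1)" and Y: "\<And>l. Suc l < L \<Longrightarrow> Y l \<in> sqmat (m' * N1)"
    and D: "\<And>l. l < L \<Longrightarrow> D l \<in> carrier_mat (m * N1) (m' * N1)"
    and e1: "\<And>l. Suc l < L \<Longrightarrow> W l * D (Suc l) = D l * Y l"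
    and e2: "\<And>l. Suc l < L \<Longrightarrow> mstar (W l) * D l = D (Suc l) * mstar (Y l)"
  shows "T L m c W * bdiag L (m * N1) (m' * N1) D = bdiag L (m * N1) (m' * N1) D * T L m' c Y"
proof -
  let ?M = "L * (m * N1)" let ?M' = "L * (m' * N1)" let ?B = "bdiag L (m * N1) (m' * N1) D"
  let ?W = "superdiag L (m * N1) W" let ?Y = "superdiag L (m' * N1) Y"
  have B: "?B \<in> carrier_mat ?M ?M'" by simp
  have "T L m c W * ?B = rs c (1\<^sub>m ?M) * ?B + (?W * ?B + mstar ?W * ?B)"
    unfolding T_def by (subst add_mult_distrib_mat[OF _ _ B], auto, subst add_mult_distrib_mat[OF _ _ B], auto)
  also have "rs c (1\<^sub>m ?M) * ?B = ?B * rs c (1\<^sub>m ?M')"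
    unfolding rs_def mult_mscale_one_left[OF B] mult_mscale_one_right[OF B] ..
  also have "?W * ?B = ?B * ?Y" by (rule superdiag_intertwine; (rule W Y D e1; assumption))
  also have "mstar ?W * ?B = ?B * mstar ?Y" by (rule mstar_superdiag_intertwine; (rule W Y D e2; assumption))
  also have "?B * rs c (1\<^sub>m ?M') + (?B * ?Y + ?B * mstar ?Y) = ?B * T L m' c Y"
    unfolding T_def by (subst mult_add_distrib_mat[OF B], auto, subst mult_add_distrib_mat[OF B], auto)
  finally show ?thesis .
qed

lemma Psi_inter:
  assumes m: "m \<ge> 1" "m' \<ge> 1" and W: "valid m k c W" and Y: "valid m' k c Y"
    and S: "\<And>l. l \<le> k \<Longrightarrow> S l \<in> carrier_mat m m'"
    and e1: "\<And>l. l < k \<Longrightarrow> W l * kron (S (Suc l)) (1\<^sub>m N1) = kron (S l) (1\<^sub>m N1) * Y l"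
    and e2: "\<And>l. l < k \<Longrightarrow> mstar (W l) * kron (S l) (1\<^sub>m N1) = kron (S (Suc l)) (1\<^sub>m N1) * mstar (Y l)"
  shows "Psi m k c W * kron (S k) (1\<^sub>m N2) = kron (S 0) (1\<^sub>m N2) * Psi m' k c Y"
proof -
  define L where "L = Suc k"
  have S': "S l \<in> carrier_mat m m'" if "l < L" for l using S that by (simp add: L_def)
  let ?D = "\<lambda>l. kron (S l) (1\<^sub>m N1) :: 'a mat" let ?E = "\<lambda>l. kron (S l) (1\<^sub>m N2) :: 'b mat"
  have D: "?D l \<in> carrier_mat (m * N1) (m' * N1)" if "l < L" for l using S'[OF that] by simp
  have E: "?E l \<in> carrier_mat (m * N2) (m' * N2)" if "l < L" for l using S'[OF that] by simp
  have Wc: "W l \<in> sqmat (m * N1)" "Y l \<in> sqmat (m' * N1)" if "Suc l < L" for l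
    using W Y that MUc by (auto simp: valid_def L_def)
  let ?BS = "bdiag L m m' S"
  have kb1: "kron ?BS (1\<^sub>m N1 :: 'a mat) = bdiag L (m * N1) (m' * N1) ?D" by (rule kron_bdiag[OF _ one_carrier_mat]) (rule S')
  have kb2: "kron ?BS (1\<^sub>m N2 :: 'b mat) = bdiag L (m * N2) (m' * N2) ?E" by (rule kron_bdiag[OF _ one_carrier_mat]) (rule S')
  have "T L m c W * kron ?BS (1\<^sub>m N1) = kron ?BS (1\<^sub>m N1) * T L m' c Y"
    unfolding kb1
    by (rule T_inter; (rule Wc D e1 e2; simp add: L_def)?)
  then have "A (L * m) k (T L m c W) * kron ?BS (1\<^sub>m N2) = kron ?BS (1\<^sub>m N2) * A (L * m') k (T L m' c Y)"
    using valid_cone[OF W] valid_cone[OF Y] m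
    by (intro A_inter) (auto simp: L_def simp del: mult_Suc)
  then have eq: "A (L * m) k (T L m c W) * bdiag L (m * N2) (m' * N2) ?E = bdiag L (m * N2) (m' * N2) ?E * A (L * m') k (T L m' c Y)"
    unfolding kb2 .
  note Ac = A_blk_carrier[of k _ k, folded L_def]
  show ?thesis
  proof (rule eq_matI)
    fix a b assume "a < dim_row (?E 0 * Psi m' k c Y)" "b < dim_col (?E 0 * Psi m' k c Y)"
    then have ab: "a < m * N2" "b < m' * N2" using S[of 0] by auto
    have k: "0 < L" "k < L" by (auto simp: L_def)
    have "(Psi m k c W * ?E k) $$ (a, b) = (A (L * m) k (T L m c W) * bdiag L (m * N2) (m' * N2) ?E) $$ (0 * (m * N2) + a, k * (m' * N2) + b)"
      unfolding Psi_def L_def[symmetric] by (rule mult_bdiag_entry[OF Ac _ k(1) ab(1) k(2) ab(2), symmetric]) (rule E)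
    also have "\<dots> = (?E 0 * Psi m' k c Y) $$ (a, b)"
      unfolding eq Psi_def L_def[symmetric] by (rule bdiag_mult_entry[OF Ac _ k(1) ab(1) k(2) ab(2)]) (rule E)
    finally show "(Psi m k c W * ?E k) $$ (a, b) = (?E 0 * Psi m' k c Y) $$ (a, b)" .
  qed (use S[of 0] S[of k] in auto)
qed

lemma valid_update: "valid m k c Y \<Longrightarrow> U \<in> MU s1 m \<Longrightarrow> mnorm U \<le> mnorm (Y i) \<Longrightarrow> valid m k c (Y(i := U))"
  unfolding valid_def by (metis (no_types, lifting) fun_upd_apply order_trans)

text \<open>Multiplying \<open>Y\<^sub>i\<close> by a phase conjugates \<open>T\<close> by a diagonal
  unitary.  In particular the form is odd in each slot and vanishes when some \<open>Y\<^sub>i\<close>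
  does.\<close>

lemma Psi_phase:
  assumes m: "m \<ge> 1" and Y: "valid m k c Y" and i: "i < k" and z: "cmod z = 1"
  shows "Psi m k c (Y(i := mscale z (Y i))) = mscale z (Psi m k c Y)"
proof -
  let ?W = "Y(i := mscale z (Y i))"
  have MY: "Y l \<in> MU s1 m" if "l < k" for l using Y that by (auto simp: valid_def)
  have W: "valid m k c ?W"
    using MU_mscale[OF s1 MY[OF i]] by (intro valid_update Y) (simp_all add: mnorm_mscale z)
  have zz: "cnj z * z = 1" "z * cnj z = 1" using z complex_norm_square[of z] by (simp_all add: mult.commute)
  \<comment> \<open>The diagonal unitary changes its phase between the blocks \<open>i\<close> and \<open>i + 1\<close>.\<close>
  define a where "a l = (if l \<le> i then 1 else cnj z)" for l
  let ?S = "\<lambda>l. mscale (a l) (1\<^sub>m m) :: complex mat"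
  have "Psi m k c ?W * kron (?S k) (1\<^sub>m N2) = kron (?S 0) (1\<^sub>m N2) * Psi m k c Y"
  proof (rule Psi_inter[OF m m W Y])
    fix l assume l: "l < k"
    have c: "Y l \<in> sqmat (m * N1)" using MUc[OF MY[OF l]] .
    have c': "?W l \<in> sqmat (m * N1)" using c by auto
    show "?W l * kron (?S (Suc l)) (1\<^sub>m N1) = kron (?S l) (1\<^sub>m N1) * Y l"
      unfolding kron_scalar mult_mscale_one_right[OF c'] mult_mscale_one_left[OF c]
      using zz by (auto simp: a_def mscale_mscale)
    have cs: "mstar (?W l) \<in> sqmat (m * N1)" "mstar (Y l) \<in> sqmat (m * N1)" using c c' by auto
    show "mstar (?W l) * kron (?S l) (1\<^sub>m N1) = kron (?S (Suc l)) (1\<^sub>m N1) * mstar (Y l)"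
      unfolding kron_scalar mult_mscale_one_right[OF cs(1)] mult_mscale_one_left[OF cs(2)]
      by (cases "l = i") (auto simp: a_def mscale_mscale mstar_mscale)
  qed auto
  then have "mscale (a k) (Psi m k c ?W) = mscale (a 0) (Psi m k c Y)"
    unfolding kron_scalar mult_mscale_one_right[OF Psi_carrier] mult_mscale_one_left[OF Psi_carrier] .
  then have "mscale (cnj z) (Psi m k c ?W) = Psi m k c Y" using i by (simp add: a_def)
  then have "mscale z (mscale (cnj z) (Psi m k c ?W)) = mscale z (Psi m k c Y)" by simp
  then show ?thesis by (simp add: mscale_mscale zz)
qed

lemma Psi_zero_slot:
  assumes m: "m \<ge> 1" and Y: "valid m k c Y" and i: "i < k" and z: "Y i = 0\<^sub>m (m * N1) (m * N1)" and ab: "a < m * N2" "b < m * N2"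
  shows "Psi m k c Y $$ (a, b) = 0"
proof -
  have "mscale (-1) (Y i) = Y i" unfolding z by (rule eq_matI) auto
  then have "Psi m k c Y = mscale (-1) (Psi m k c Y)" using Psi_phase[OF m Y i, of "-1"] by simp
  then have "Psi m k c Y $$ (a, b) = mscale (-1) (Psi m k c Y) $$ (a, b)" by simp
  also have "\<dots> = - Psi m k c Y $$ (a, b)" using ab by (simp add: cscale_minus_left)
  finally have "2 *\<^sub>R Psi m k c Y $$ (a, b) = 0" by (simp add: scaleR_2 eq_neg_iff_add_eq_0)
  then show ?thesis by simp
qed

lemma T_segment:
  assumes U: "\<And>i. Suc i < L \<Longrightarrow> U i \<in> sqmat (m * N1)" and V: "\<And>i. Suc i < L \<Longrightarrow> V i \<in> sqmat (m * N1)"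
  shows "T L m c (\<lambda>i. rs (1 - s) (U i) + rs s (V i)) = rs (1 - s) (T L m c U) + rs s (T L m c V)"
proof -
  let ?M = "L * (m * N1)" let ?U = "superdiag L (m * N1) U" let ?V = "superdiag L (m * N1) V"
  have e: "superdiag L (m * N1) (\<lambda>i. rs (1 - s) (U i) + rs s (V i)) = rs (1 - s) ?U + rs s ?V"
    using superdiag_add[of L "\<lambda>i. rs (1 - s) (U i)" "m * N1" "\<lambda>i. rs s (V i)"] U V superdiag_rs[of L U "m * N1"] superdiag_rs[of L V "m * N1"]
    by simp
  show ?thesis unfolding T_def e
    by (intro eq_matI) (auto simp: star_add star_diff star_scaleR algebra_simps simp flip: scaleR_add_left)
qed

lemma Psi_segment:
  assumes m: "m \<ge> 1" and U: "valid m k c U" and V: "valid m k c V" and ab: "a < m * N2" "b < m * N2"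
  shows "poly_on k (\<lambda>s. Psi m k c (\<lambda>i. rs (1 - s) (U i) + rs s (V i)) $$ (a, b))"
proof -
  have m': "Suc k * m \<ge> 1" using m by simp
  have lt: "0 * (m * N2) + a < Suc k * (m * N2)" "k * (m * N2) + b < Suc k * (m * N2)"
    by (rule block_index_less; use ab in simp)+
  have UV: "U i \<in> sqmat (m * N1)" "V i \<in> sqmat (m * N1)" if "Suc i < Suc k" for i
    using U V that MUc by (auto simp: valid_def)
  have "Psi m k c (\<lambda>i. rs (1 - s) (U i) + rs s (V i)) $$ (a, b)
      = A (Suc k * m) k (rs (1 - s) (T (Suc k) m c U) + rs s (T (Suc k) m c V)) $$ (0 * (m * N2) + a, k * (m * N2) + b)" for s
  proof -
    have e: "T (Suc k) m c (\<lambda>i. rs (1 - s) (U i) + rs s (V i)) = rs (1 - s) (T (Suc k) m c U) + rs s (T (Suc k) m c V)"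
      by (rule T_segment; (rule UV; assumption))
    show ?thesis unfolding Psi_def e using ab by (simp del: mult_Suc)
  qed
  moreover have "poly_on k (\<lambda>s. A (Suc k * m) k (rs (1 - s) (T (Suc k) m c U) + rs s (T (Suc k) m c V)) $$ (0 * (m * N2) + a, k * (m * N2) + b))"
    by (rule A_segment[OF m' valid_cone[OF U] valid_cone[OF V]]) (use lt in \<open>simp_all only: mult.assoc\<close>)
  ultimately show ?thesis by (simp only:)
qed

lemma Psi_rs:
  assumes m: "m \<ge> 1" and Y: "valid m k c Y" and l: "l \<ge> 0"
  shows "Psi m k (l * c) (\<lambda>i. rs l (Y i)) = rs (l ^ k) (Psi m k c Y)"
proof -
  have m': "Suc k * m \<ge> 1" using m by simp
  have Yc: "Y i \<in> sqmat (m * N1)" if "Suc i < Suc k" for i using Y that MUc by (auto simp: valid_def)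
  have "T (Suc k) m (l * c) (\<lambda>i. rs l (Y i)) = rs l (T (Suc k) m c Y)"
  proof -
    have e: "superdiag (Suc k) (m * N1) (\<lambda>i. rs l (Y i)) = rs l (superdiag (Suc k) (m * N1) Y)"
      by (rule superdiag_rs) (rule Yc)
    show ?thesis unfolding T_def e by (rule eq_matI) (auto simp: star_scaleR scaleR_add_right simp del: mult_Suc)
  qed
  then have "Psi m k (l * c) (\<lambda>i. rs l (Y i)) = blk (m * N2) (m * N2) 0 k (rs (l ^ k) (A (Suc k * m) k (T (Suc k) m c Y)))"
    unfolding Psi_def using A_rs[OF m' valid_cone[OF Y] l] by simp
  also have "\<dots> = rs (l ^ k) (Psi m k c Y)"
  proof (rule eq_matI)
    fix a b assume "a < dim_row (rs (l ^ k) (Psi m k c Y))" "b < dim_col (rs (l ^ k) (Psi m k c Y))"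
    then have ab: "a < m * N2" "b < m * N2" by auto
    have lt: "0 * (m * N2) + a < Suc k * (m * N2)" "k * (m * N2) + b < Suc k * (m * N2)"
      by (rule block_index_less; use ab in simp)+
    have "rs (l ^ k) (A (Suc k * m) k (T (Suc k) m c Y)) $$ (0 * (m * N2) + a, k * (m * N2) + b)
        = l ^ k *\<^sub>R A (Suc k * m) k (T (Suc k) m c Y) $$ (0 * (m * N2) + a, k * (m * N2) + b)"
      using lt by (intro rs_entry) (simp_all only: A_dim mult.assoc)
    then show "blk (m * N2) (m * N2) 0 k (rs (l ^ k) (A (Suc k * m) k (T (Suc k) m c Y))) $$ (a, b) = rs (l ^ k) (Psi m k c Y) $$ (a, b)"
      using ab by (simp add: Psi_def del: mult_Suc)
  qed auto
  finally show ?thesis .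
qed

text \<open>Along the ray through one slot the form is a polynomial that vanishes at \<open>0\<close>,
  which costs a constant and gains the factor \<open>x\<^sub>i\<close>; do this slot by slot.\<close>

lemma Psi_product_bound:
  assumes m: "m \<ge> 1" and r: "r > 0" "2 * r \<le> c" and n: "n \<le> k"
    and Y: "\<And>i. i < k \<Longrightarrow> Y i \<in> MU s1 m \<and> mnorm (Y i) \<le> r" and x: "\<And>i. 0 \<le> x i \<and> x i \<le> 1" and ab: "a < m * N2" "b < m * N2"
  shows "norm (Psi m k c (\<lambda>i. if i < n then rs (x i) (Y i) else Y i) $$ (a, b))
    \<le> C * ((c + 2 * r) / p) ^ k * (real (Suc k) * KK ^ k) ^ n * (\<Prod>i<n. x i)"
  using n Y
proof (induction n arbitrary: Y)
  case 0
  have "norm (Psi m k c Y $$ (a, b)) \<le> mnorm (Psi m k c Y)" using ab by (intro norm_entry_le_mnorm) auto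
  also have "\<dots> \<le> C * ((c + 2 * r) / p) ^ k" by (rule Psi_bound[OF m r]) (use 0 in blast)
  finally show ?case by simp
next
  case (Suc n)
  let ?D = "real (Suc k) * KK ^ k" let ?B = "C * ((c + 2 * r) / p) ^ k * ?D ^ n * (\<Prod>i<n. x i)"
  define F where "F u i = (if i < n then rs (x i) (Y i) else if i = n then rs u (Y i) else Y i)" for u i
  define \<phi> where "\<phi> u = Psi m k c (F u) $$ (a, b)" for u
  have FM: "F u i \<in> MU s1 m \<and> mnorm (F u i) \<le> r" if "u \<in> {0..1}" "i < k" for u i
  proof -
    have "t * mnorm (Y i) \<le> r" if "0 \<le> t" "t \<le> 1" for t
      using Suc.prems(2)[OF \<open>i < k\<close>] that mult_left_le_one_le[of "mnorm (Y i)" t] by simp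
    then show ?thesis using Suc.prems(2)[OF that(2)] x that MU_rs[OF s1] by (auto simp: F_def mnorm_rs)
  qed
  have vF: "valid m k c (F u)" if "u \<in> {0..1}" for u
    unfolding valid_def using FM[OF that] r by blast
  have bnd: "norm (\<phi> u) \<le> ?B" if u: "u \<in> {0..1}" for u
  proof -
    have "(\<lambda>i. if i < n then rs (x i) ((Y(n := rs u (Y n))) i) else (Y(n := rs u (Y n))) i) = F u"
      by (auto simp: F_def)
    moreover have "(Y(n := rs u (Y n))) i \<in> MU s1 m \<and> mnorm ((Y(n := rs u (Y n))) i) \<le> r" if "i < k" for i
      using FM[OF u that] Suc.prems(2)[OF that] by (auto simp: F_def)
    ultimately show ?thesis using Suc.IH[of "Y(n := rs u (Y n))"] Suc.prems by (simp add: \<phi>_def)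
  qed
  have seg: "poly_on k \<phi>"
  proof -
    have "(\<lambda>i. rs (1 - s) (F 0 i) + rs s (F 1 i)) = F s" for s
    proof
      fix i show "rs (1 - s) (F 0 i) + rs s (F 1 i) = F s i"
        by (rule eq_matI) (auto simp: F_def algebra_simps)
    qed
    then show ?thesis using Psi_segment[OF m vF[of 0] vF[of 1] ab] by (simp add: \<phi>_def[abs_def])
  qed
  have "\<phi> 0 = 0"
    unfolding \<phi>_def
  proof (rule Psi_zero_slot[OF m vF _ _ ab])
    show "n < k" using Suc by simp
    then show "F 0 n = 0\<^sub>m (m * N1) (m * N1)"
      using rs_zero_left[OF MUc[of "Y n" m]] Suc.prems(2)[of n] by (simp add: F_def)
  qed simp
  from poly_on_vanishing_bound[OF seg this bnd, of "x n"] x[of n]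
  have "norm (\<phi> (x n)) \<le> ?D * ?B * x n" by simp
  moreover have "F (x n) = (\<lambda>i. if i < Suc n then rs (x i) (Y i) else Y i)" by (auto simp: F_def less_Suc_eq)
  ultimately show ?case by (simp add: \<phi>_def mult_ac)
qed

lemma Psi_scale_down:
  assumes m: "m \<ge> 1" and Y: "valid m k c Y" and l: "0 \<le> l" "l \<le> 1"
  shows "Psi m k c (\<lambda>i. rs l (Y i)) = rs (l ^ k) (Psi m k c Y)"
proof (rule eq_matI)
  fix a b assume "a < dim_row (rs (l ^ k) (Psi m k c Y))" "b < dim_col (rs (l ^ k) (Psi m k c Y))"
  then have ab: "a < m * N2" "b < m * N2" by auto
  obtain r where r: "r > 0" "2 * r \<le> c" "\<And>i. i < k \<Longrightarrow> Y i \<in> MU s1 m \<and> mnorm (Y i) \<le> r" using Y by (auto simp: valid_def)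
  define \<phi> where "\<phi> u = Psi m k c (\<lambda>i. rs u (Y i)) $$ (a, b)" for u
  let ?B = "C * ((c + 2 * r) / p) ^ k * (real (Suc k) * KK ^ k) ^ k"
  have "norm (\<phi> u) \<le> ?B * u ^ k" if u: "u \<in> {0..1}" for u
  proof -
    have "\<phi> u = Psi m k c (\<lambda>i. if i < k then rs u (Y i) else Y i) $$ (a, b)"
      unfolding \<phi>_def by (intro arg_cong[where f = "\<lambda>M. M $$ (a, b)"] Psi_cong) simp
    then show ?thesis using Psi_product_bound[OF m r(1,2) order_refl, where Y = Y and x = "\<lambda>i. u" and a = a and b = b and k = k] r(3) ab u by simp
  qed
  moreover have "poly_on k \<phi>"
  proof -
    have vz: "valid m k c (\<lambda>i. rs 0 (Y i))"
      unfolding valid_def using r MU_rs[OF s1] by (intro exI[of _ r]) (auto simp: mnorm_rs)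
    have "(\<lambda>i. rs (1 - s) (rs 0 (Y i)) + rs s (Y i)) = (\<lambda>i. rs s (Y i))" for s
      by (rule ext, rule eq_matI) auto
    then show ?thesis using Psi_segment[OF m vz Y ab] by (simp add: \<phi>_def[abs_def])
  qed
  ultimately have "\<phi> l = l ^ k *\<^sub>R \<phi> 1" using l by (intro poly_on_pure) auto
  then show "Psi m k c (\<lambda>i. rs l (Y i)) $$ (a, b) = rs (l ^ k) (Psi m k c Y) $$ (a, b)"
    using ab by (simp add: \<phi>_def)
qed auto

text \<open>By homogeneity in all slots together, the auxiliary constant \<open>c\<close> is immaterial
  as long as it is large enough.\<close>

lemma Psi_c_mono:
  assumes m: "m \<ge> 1" and Y: "valid m k c Y" and c: "c \<le> c'"
  shows "Psi m k c' Y = Psi m k c Y"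
proof -
  obtain r where r: "r > 0" "2 * r \<le> c" "\<And>i. i < k \<Longrightarrow> Y i \<in> MU s1 m \<and> mnorm (Y i) \<le> r" using Y by (auto simp: valid_def)
  define l where "l = c / c'"
  have l: "0 < l" "l \<le> 1" "l * c' = c" using r c by (auto simp: l_def)
  let ?Y = "\<lambda>i. rs (1 / l) (Y i)"
  have v: "valid m k c' ?Y"
    unfolding valid_def
  proof (intro exI[of _ "r / l"] conjI allI impI)
    show "r / l > 0" using r l by simp
    show "2 * (r / l) \<le> c'" using r(2) l by (simp add: divide_le_eq mult.commute)
    fix i assume "i < k"
    then show "?Y i \<in> MU s1 m" "mnorm (?Y i) \<le> r / l"
      using r(3)[of i] l MU_rs[OF s1] by (auto simp: mnorm_rs divide_right_mono)
  qed
  have Yl: "(\<lambda>i. rs l (?Y i)) = Y" using l by simp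
  have "Psi m k c' (\<lambda>i. rs l (?Y i)) = rs (l ^ k) (Psi m k c' ?Y)"
    using l by (intro Psi_scale_down m v) auto
  also have "\<dots> = Psi m k (l * c') (\<lambda>i. rs l (?Y i))"
    using l by (intro Psi_rs[symmetric] m v) auto
  finally show ?thesis unfolding Yl l(3) .
qed

definition M :: "nat \<Rightarrow> nat \<Rightarrow> (nat \<Rightarrow> 'a mat) \<Rightarrow> 'b mat" where
  "M m k Y = Psi m k (2 * (1 + (\<Sum>i<k. mnorm (Y i)))) Y"

lemma valid_default:
  assumes "\<And>i. i < k \<Longrightarrow> Y i \<in> MU s1 m"
  shows "valid m k (2 * (1 + (\<Sum>i<k. mnorm (Y i)))) Y"
  unfolding valid_def
proof (intro exI[of _ "1 + (\<Sum>i<k. mnorm (Y i))"] conjI allI impI)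
  show "0 < 1 + (\<Sum>i<k. mnorm (Y i))" by (simp add: add_pos_nonneg sum_nonneg)
  fix i assume i: "i < k"
  show "Y i \<in> MU s1 m" using assms i .
  have "mnorm (Y i) \<le> (\<Sum>i<k. mnorm (Y i))" by (rule member_le_sum) (use i in auto)
  then show "mnorm (Y i) \<le> 1 + (\<Sum>i<k. mnorm (Y i))" by simp
qed simp

lemma M_eq:
  assumes m: "m \<ge> 1" and Y: "valid m k c Y" shows "M m k Y = Psi m k c Y"
proof -
  let ?c = "2 * (1 + (\<Sum>i<k. mnorm (Y i)))"
  have d: "valid m k ?c Y" using Y by (intro valid_default) (auto simp: valid_def)
  have "Psi m k (max c ?c) Y = Psi m k c Y" by (rule Psi_c_mono[OF m Y]) simp
  moreover have "Psi m k (max c ?c) Y = Psi m k ?c Y" by (rule Psi_c_mono[OF m d]) simp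
  ultimately show ?thesis by (simp add: M_def)
qed

lemma M_carrier [simp]: "M m k Y \<in> sqmat (m * N2)" by (simp add: M_def)

lemma M_dim [simp]: "dim_row (M m k Y) = m * N2" "dim_col (M m k Y) = m * N2" by (simp_all add: M_def)

lemma M_cong: "(\<And>i. i < k \<Longrightarrow> Y i = Y' i) \<Longrightarrow> M m k Y = M m k Y'"
  unfolding M_def using Psi_cong[of k Y Y' m] by simp

lemma ex_valid2:
  assumes "\<And>i. i < k \<Longrightarrow> Y i \<in> MU s1 m" "\<And>i. i < k \<Longrightarrow> W i \<in> MU s1 m'"
  obtains c where "valid m k c Y" "valid m' k c W"
proof -
  let ?r = "1 + (\<Sum>i<k. mnorm (Y i)) + (\<Sum>i<k. mnorm (W i))"
  have r: "?r > 0" by (simp add: add_pos_nonneg sum_nonneg)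
  have "mnorm (Y i) \<le> ?r" "mnorm (W i) \<le> ?r" if i: "i < k" for i
  proof -
    have "mnorm (Y i) \<le> (\<Sum>i<k. mnorm (Y i))" "mnorm (W i) \<le> (\<Sum>i<k. mnorm (W i))"
      by (rule member_le_sum; use i in simp)+
    moreover have "0 \<le> (\<Sum>i<k. mnorm (Y i))" "0 \<le> (\<Sum>i<k. mnorm (W i))" by (simp_all add: sum_nonneg)
    ultimately show "mnorm (Y i) \<le> ?r" "mnorm (W i) \<le> ?r" by linarith+
  qed
  then have "valid m k (2 * ?r) Y" "valid m' k (2 * ?r) W"
    unfolding valid_def using r assms by blast+
  then show thesis by (rule that)
qed

lemma M_inter:
  assumes m: "m \<ge> 1" "m' \<ge> 1" and W: "\<And>i. i < k \<Longrightarrow> W i \<in> MU s1 m" and Y: "\<And>i. i < k \<Longrightarrow> Y i \<in> MU s1 m'"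
    and S: "\<And>l. l \<le> k \<Longrightarrow> S l \<in> carrier_mat m m'"
    and e1: "\<And>l. l < k \<Longrightarrow> W l * kron (S (Suc l)) (1\<^sub>m N1) = kron (S l) (1\<^sub>m N1) * Y l"
    and e2: "\<And>l. l < k \<Longrightarrow> mstar (W l) * kron (S l) (1\<^sub>m N1) = kron (S (Suc l)) (1\<^sub>m N1) * mstar (Y l)"
  shows "M m k W * kron (S k) (1\<^sub>m N2) = kron (S 0) (1\<^sub>m N2) * M m' k Y"
proof -
  obtain c where c: "valid m k c W" "valid m' k c Y" using ex_valid2[of k W m Y m'] W Y by blast
  show ?thesis unfolding M_eq[OF m(1) c(1)] M_eq[OF m(2) c(2)] by (rule Psi_inter[OF m c S e1 e2])
qed

lemma M_phase:
  assumes m: "m \<ge> 1" and Y: "\<And>i. i < k \<Longrightarrow> Y i \<in> MU s1 m" and i: "i < k" and z: "cmod z = 1"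
  shows "M m k (Y(i := mscale z (Y i))) = mscale z (M m k Y)"
proof -
  have W: "(Y(i := mscale z (Y i))) l \<in> MU s1 m" if "l < k" for l using Y that MU_mscale[OF s1] by auto
  obtain c where c: "valid m k c Y" "valid m k c (Y(i := mscale z (Y i)))" using ex_valid2[of k Y m "Y(i := mscale z (Y i))" m] W Y by blast
  show ?thesis unfolding M_eq[OF m c(1)] M_eq[OF m c(2)] by (rule Psi_phase[OF m c(1) i z])
qed

lemma M_zero_slot:
  assumes m: "m \<ge> 1" and Y: "\<And>i. i < k \<Longrightarrow> Y i \<in> MU s1 m" and i: "i < k" and z: "Y i = 0\<^sub>m (m * N1) (m * N1)" and ab: "a < m * N2" "b < m * N2"
  shows "M m k Y $$ (a, b) = 0"
  unfolding M_def by (rule Psi_zero_slot[OF m _ i, where c = "2 * (1 + (\<Sum>i<k. mnorm (Y i)))"]) (use valid_default[of k Y m] Y z ab in auto)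

lemma M_segment:
  assumes m: "m \<ge> 1" and U: "\<And>i. i < k \<Longrightarrow> U i \<in> MU s1 m" and V: "\<And>i. i < k \<Longrightarrow> V i \<in> MU s1 m" and ab: "a < m * N2" "b < m * N2"
  shows "poly_on k (\<lambda>s. M m k (\<lambda>i. rs (1 - s) (U i) + rs s (V i)) $$ (a, b))"
proof -
  obtain c where c: "valid m k c U" "valid m k c V" using ex_valid2[of k U m V m] U V by blast
  then obtain r r' where r: "r > 0" "2 * r \<le> c" "\<And>i. i < k \<Longrightarrow> U i \<in> MU s1 m \<and> mnorm (U i) \<le> r"
    "r' > 0" "2 * r' \<le> c" "\<And>i. i < k \<Longrightarrow> V i \<in> MU s1 m \<and> mnorm (V i) \<le> r'" by (auto simp: valid_def)
  have "valid m k c (\<lambda>i. rs (1 - s) (U i) + rs s (V i))" if s: "s \<in> {0..1}" for s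
    unfolding valid_def
  proof (intro exI[of _ "max r r'"] conjI allI impI)
    show "0 < max r r'" "2 * max r r' \<le> c" using r by auto
    fix i assume i: "i < k"
    show "rs (1 - s) (U i) + rs s (V i) \<in> MU s1 m" using U[OF i] V[OF i] by (intro MU_add[OF s1] MU_rs[OF s1])
    have "mnorm (rs (1 - s) (U i) + rs s (V i)) \<le> \<bar>1 - s\<bar> * mnorm (U i) + \<bar>s\<bar> * mnorm (V i)"
      by (rule mnorm_rs_add_le[OF MUc[OF U[OF i]] MUc[OF V[OF i]]])
    also have "\<dots> \<le> (1 - s) * max r r' + s * max r r'"
      using s r(3)[OF i] r(6)[OF i] by (intro add_mono mult_mono) auto
    also have "\<dots> = max r r'" by (simp add: algebra_simps)
    finally show "mnorm (rs (1 - s) (U i) + rs s (V i)) \<le> max r r'" .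
  qed
  then have "M m k (\<lambda>i. rs (1 - s) (U i) + rs s (V i)) = Psi m k c (\<lambda>i. rs (1 - s) (U i) + rs s (V i))" if "s \<in> {0..1}" for s
    using M_eq[OF m] that by blast
  with Psi_segment[OF m c ab] show ?thesis unfolding poly_on_def by auto
qed

lemma M_bound:
  assumes m: "m \<ge> 1" and r: "r > 0" and Y: "\<And>i. i < k \<Longrightarrow> Y i \<in> MU s1 m \<and> mnorm (Y i) \<le> r"
  shows "mnorm (M m k Y) \<le> C * (4 * r / p) ^ k"
proof -
  have "valid m k (2 * r) Y" unfolding valid_def using r Y by blast
  from M_eq[OF m this] show ?thesis using Psi_bound[OF m r order_refl Y] by simp
qed

lemma M_rs:
  assumes m: "m \<ge> 1" and Y: "\<And>i. i < k \<Longrightarrow> Y i \<in> MU s1 m" and l: "l > 0"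
  shows "M m k (\<lambda>i. rs l (Y i)) = rs (l ^ k) (M m k Y)"
proof -
  let ?c = "2 * (1 + (\<Sum>i<k. mnorm (Y i)))"
  have v: "valid m k ?c Y" by (rule valid_default[OF Y])
  obtain r where r: "r > 0" "2 * r \<le> ?c" "\<And>i. i < k \<Longrightarrow> Y i \<in> MU s1 m \<and> mnorm (Y i) \<le> r"
    using v unfolding valid_def by blast
  have "valid m k (l * ?c) (\<lambda>i. rs l (Y i))"
    unfolding valid_def
  proof (intro exI[of _ "l * r"] conjI allI impI)
    show "l * r > 0" using l r by simp
    show "2 * (l * r) \<le> l * ?c" using mult_left_mono[OF r(2), of l] l by (simp add: mult_ac)
    fix i assume "i < k"
    then show "rs l (Y i) \<in> MU s1 m" "mnorm (rs l (Y i)) \<le> l * r"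
      using r(3)[of i] l MU_rs[OF s1] by (auto simp: mnorm_rs)
  qed
  from M_eq[OF m this] show ?thesis using Psi_rs[OF m v, of l] l by (simp add: M_def)
qed

lemma M_product_bound:
  assumes m: "m \<ge> 1" and ab: "a < m * N2" "b < m * N2"
  obtains D where "D \<ge> 0" "\<And>Y. (\<And>i. i < k \<Longrightarrow> Y i \<in> MU s1 m) \<Longrightarrow> norm (M m k Y $$ (a, b)) \<le> D * (\<Prod>i<k. mnorm (Y i))"
proof -
  define D where "D = C * ((2 + 2 * 1) / p) ^ k * (real (Suc k) * KK ^ k) ^ k"
  have D: "D \<ge> 0" using C_nonneg p KK_ge by (simp add: D_def)
  have "norm (M m k Y $$ (a, b)) \<le> D * (\<Prod>i<k. mnorm (Y i))" if Y: "\<And>i. i < k \<Longrightarrow> Y i \<in> MU s1 m" for Y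
  proof (cases "\<exists>i<k. \<not> mnorm (Y i) > 0")
    case True
    then obtain i where i: "i < k" "\<not> mnorm (Y i) > 0" by blast
    have "M m k Y $$ (a, b) = 0"
      by (rule M_zero_slot[where Y = Y, OF m _ i(1) mnorm_zero_eq[OF MUc[OF Y[OF i(1)]] i(2)] ab]) (rule Y)
    then show ?thesis using D by (simp add: prod_nonneg)
  next
    case False
    define \<mu> where "\<mu> = 1 + (\<Sum>i<k. mnorm (Y i))"
    have \<mu>: "\<mu> > 0" by (simp add: \<mu>_def add_pos_nonneg sum_nonneg)
    have le: "mnorm (Y i) \<le> \<mu>" if "i < k" for i
    proof -
      have "mnorm (Y i) \<le> (\<Sum>i<k. mnorm (Y i))" by (rule member_le_sum) (use that in auto)
      then show ?thesis by (simp add: \<mu>_def)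
    qed
    define x where "x i = (if i < k then mnorm (Y i) / \<mu> else 0)" for i
    let ?U = "\<lambda>i. rs (1 / mnorm (Y i)) (Y i)"
    have U: "?U i \<in> MU s1 m \<and> mnorm (?U i) \<le> 1" if "i < k" for i
      using Y[OF that] False that MU_rs[OF s1] by (auto simp: mnorm_rs)
    have e: "rs (1 / \<mu>) (Y i) = (if i < k then rs (x i) (?U i) else ?U i)" if "i < k" for i
    proof -
      have "mnorm (Y i) \<noteq> 0" using that False by force
      then show ?thesis using that by (simp add: x_def)
    qed
    have xU: "(if i < k then rs (x i) (?U i) else ?U i) \<in> MU s1 m \<and> mnorm (if i < k then rs (x i) (?U i) else ?U i) \<le> 1" if "i < k" for i
      unfolding e[OF that, symmetric] using Y[OF that] le[OF that] \<mu> MU_rs[OF s1] by (auto simp: mnorm_rs)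
    have "norm (Psi m k 2 (\<lambda>i. if i < k then rs (x i) (?U i) else ?U i) $$ (a, b)) \<le> D * (\<Prod>i<k. x i)"
      unfolding D_def
      by (rule Psi_product_bound[OF m _ _ order_refl U _ ab]) (use le \<mu> in \<open>auto simp: x_def\<close>)
    also have "Psi m k 2 (\<lambda>i. if i < k then rs (x i) (?U i) else ?U i) = M m k (\<lambda>i. if i < k then rs (x i) (?U i) else ?U i)"
    proof (rule M_eq[OF m, symmetric])
      show "valid m k 2 (\<lambda>i. if i < k then rs (x i) (?U i) else ?U i)"
        unfolding valid_def using xU by (intro exI[of _ 1]) auto
    qed
    also have "\<dots> = M m k (\<lambda>i. rs (1 / \<mu>) (Y i))" by (rule M_cong) (use e in simp)
    also have "\<dots> = rs ((1 / \<mu>) ^ k) (M m k Y)" using \<mu> by (intro M_rs m Y) auto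
    finally have "norm (rs ((1 / \<mu>) ^ k) (M m k Y) $$ (a, b)) \<le> D * (\<Prod>i<k. x i)" .
    moreover have "rs ((1 / \<mu>) ^ k) (M m k Y) $$ (a, b) = (1 / \<mu>) ^ k *\<^sub>R M m k Y $$ (a, b)" using ab by simp
    moreover have "(\<Prod>i<k. x i) = (1 / \<mu>) ^ k * (\<Prod>i<k. mnorm (Y i))"
      by (simp add: x_def prod.distrib power_inverse divide_inverse mult.commute)
    ultimately have "(1 / \<mu>) ^ k * norm (M m k Y $$ (a, b)) \<le> (1 / \<mu>) ^ k * (D * (\<Prod>i<k. mnorm (Y i)))"
      using \<mu> by (simp add: mult_ac)
    then show ?thesis by (rule mult_left_le_imp_le) (use \<mu> in simp)
  qed
  with D show thesis by (rule that)
qed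

end

section \<open>Words\<close>

lemma word_pow_simps [simp]: "word_pow m t [] = 1\<^sub>m m" "word_pow m t (i # \<alpha>) = t i * word_pow m t \<alpha>"
  by (simp_all add: word_pow_def)

lemma word_pow_carrier: "(\<And>i. i \<in> set \<alpha> \<Longrightarrow> t i \<in> sqmat m) \<Longrightarrow> word_pow m t \<alpha> \<in> sqmat m"
  by (induction \<alpha>) (auto intro!: mult_carrier_mat)

lemma word_pow_append:
  assumes "\<And>i. i \<in> set (\<alpha> @ \<beta>) \<Longrightarrow> t i \<in> sqmat m"
  shows "word_pow m t (\<alpha> @ \<beta>) = word_pow m t \<alpha> * word_pow m t \<beta>"
  using assms
proof (induction \<alpha>)
  case Nil
  then show ?case using left_mult_one_mat[OF word_pow_carrier[of \<beta> t m]] by simp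
next
  case (Cons i \<alpha>)
  have c: "t i \<in> sqmat m" "word_pow m t \<alpha> \<in> sqmat m" "word_pow m t \<beta> \<in> sqmat m"
    using Cons.prems by (auto intro!: word_pow_carrier)
  show ?case using Cons.IH Cons.prems assoc_mult_mat[OF c] by simp
qed

lemma word_pow_cong: "(\<And>i. i \<in> set \<alpha> \<Longrightarrow> t i = t' i) \<Longrightarrow> word_pow m t \<alpha> = word_pow m t' \<alpha>"
  by (induction \<alpha>) auto

lemma word_pow_map: "word_pow m t (map f \<alpha>) = word_pow m (\<lambda>i. t (f i)) \<alpha>"
  by (induction \<alpha>) auto

lemma word_pow_slot:
  assumes t: "\<And>i. i < k \<Longrightarrow> t i \<in> sqmat m" and n: "n < k" and T: "T \<in> sqmat m"
  shows "word_pow m (t(n := T)) [0..<k] = word_pow m t [0..<n] * (T * word_pow m t [Suc n..<k])"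
proof -
  have "[0..<k] = [0..<n] @ n # [Suc n..<k]" using n by (metis upt_conv_Cons upt_add_eq_append le_add_diff_inverse less_imp_le zero_le)
  then have "word_pow m (t(n := T)) [0..<k] = word_pow m (t(n := T)) [0..<n] * word_pow m (t(n := T)) (n # [Suc n..<k])"
    using t n T by (simp only:) (rule word_pow_append, auto)
  also have "word_pow m (t(n := T)) [0..<n] = word_pow m t [0..<n]" by (rule word_pow_cong) auto
  also have "word_pow m (t(n := T)) (n # [Suc n..<k]) = T * word_pow m t [Suc n..<k]"
    using word_pow_cong[of "[Suc n..<k]" "t(n := T)" t m] by auto
  finally show ?thesis .
qed

lemma words_0 [simp]: "words d 0 = {[]}" by (auto simp: words_def)

lemma words_Suc: "words d (Suc n) = (\<lambda>(\<alpha>, i). \<alpha> @ [i]) ` (words d n \<times> {..<d})"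
proof (rule subset_antisym)
  show "words d (Suc n) \<subseteq> (\<lambda>(\<alpha>, i). \<alpha> @ [i]) ` (words d n \<times> {..<d})"
  proof
    fix \<alpha> assume a: "\<alpha> \<in> words d (Suc n)"
    then have ne: "\<alpha> \<noteq> []" by (auto simp: words_def)
    have "set (butlast \<alpha>) \<subseteq> set \<alpha>" "last \<alpha> \<in> set \<alpha>" using ne by (auto dest: in_set_butlastD)
    then have "(butlast \<alpha>, last \<alpha>) \<in> words d n \<times> {..<d}" using a by (auto simp: words_def)
    then show "\<alpha> \<in> (\<lambda>(\<alpha>, i). \<alpha> @ [i]) ` (words d n \<times> {..<d})" using ne by (intro image_eqI) auto
  qed
qed (auto simp: words_def)

lemma finite_words [simp]: "finite (words d n)" by (induction n) (simp_all add: words_Suc)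

lemma sum_words_Suc: "sum F (words d (Suc n)) = (\<Sum>i<d. \<Sum>\<alpha>\<in>words d n. F (\<alpha> @ [i]))"
proof -
  have "inj_on (\<lambda>(\<alpha>, i). \<alpha> @ [i]) (words d n \<times> {..<d})" by (auto simp: inj_on_def)
  then have "sum F (words d (Suc n)) = (\<Sum>(\<alpha>, i)\<in>words d n \<times> {..<d}. F (\<alpha> @ [i]))"
    unfolding words_Suc by (subst sum.reindex) (auto simp: case_prod_unfold)
  also have "\<dots> = (\<Sum>\<alpha>\<in>words d n. \<Sum>i<d. F (\<alpha> @ [i]))" by (simp add: sum.cartesian_product)
  also have "\<dots> = (\<Sum>i<d. \<Sum>\<alpha>\<in>words d n. F (\<alpha> @ [i]))" by (rule sum.swap)
  finally show ?thesis .
qed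

section \<open>Unitary matrices span all matrices\<close>

definition sperm :: "nat \<Rightarrow> (nat \<Rightarrow> nat) \<Rightarrow> (nat \<Rightarrow> complex) \<Rightarrow> complex mat" where
  "sperm m \<sigma> s = mat m m (\<lambda>(i, j). if i = \<sigma> j then s j else 0)"

lemma sperm_unitary:
  assumes \<sigma>: "\<And>i. i < m \<Longrightarrow> \<sigma> i < m" "\<And>i. i < m \<Longrightarrow> \<sigma> (\<sigma> i) = i" and s: "\<And>i. cnj (s i) * s i = 1"
  shows "sperm m \<sigma> s \<in> unitaries m"
proof -
  have c: "sperm m \<sigma> s \<in> sqmat m" by (simp add: sperm_def)
  have e: "sperm m \<sigma> s $$ (i, j) = (if i = \<sigma> j then s j else 0)" if "i < m" "j < m" for i j
    using that by (simp add: sperm_def)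
  have eq: "\<sigma> i = \<sigma> j \<longleftrightarrow> i = j" "i = \<sigma> j \<longleftrightarrow> j = \<sigma> i" if "i < m" "j < m" for i j using \<sigma> that by metis+
  have 1: "mstar (sperm m \<sigma> s) * sperm m \<sigma> s = 1\<^sub>m m"
  proof (rule eq_matI)
    fix i j assume "i < dim_row (1\<^sub>m m :: complex mat)" "j < dim_col (1\<^sub>m m :: complex mat)"
    then have ij: "i < m" "j < m" by auto
    have "(mstar (sperm m \<sigma> s) * sperm m \<sigma> s) $$ (i, j) = (\<Sum>l<m. mstar (sperm m \<sigma> s) $$ (i, l) * sperm m \<sigma> s $$ (l, j))"
      using ij c by (subst mult_mat_entry) auto
    also have "\<dots> = (\<Sum>l<m. if l = \<sigma> i then (if i = j then 1 else 0) else 0)"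
      using ij c by (intro sum.cong refl) (auto simp: e star_complex_def eq(1) s)
    also have "\<dots> = (1\<^sub>m m :: complex mat) $$ (i, j)" using ij \<sigma> by simp
    finally show "(mstar (sperm m \<sigma> s) * sperm m \<sigma> s) $$ (i, j) = (1\<^sub>m m :: complex mat) $$ (i, j)" .
  qed (use c in auto)
  have 2: "sperm m \<sigma> s * mstar (sperm m \<sigma> s) = 1\<^sub>m m"
  proof (rule eq_matI)
    fix i j assume "i < dim_row (1\<^sub>m m :: complex mat)" "j < dim_col (1\<^sub>m m :: complex mat)"
    then have ij: "i < m" "j < m" by auto
    have "(sperm m \<sigma> s * mstar (sperm m \<sigma> s)) $$ (i, j) = (\<Sum>l<m. sperm m \<sigma> s $$ (i, l) * mstar (sperm m \<sigma> s) $$ (l, j))"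
      using ij c by (subst mult_mat_entry) auto
    also have "\<dots> = (\<Sum>l<m. if l = \<sigma> i then (if i = j then 1 else 0) else 0)"
      using ij c \<sigma> s by (intro sum.cong refl) (auto simp: e star_complex_def mult.commute eq(2)[of i])
    also have "\<dots> = (1\<^sub>m m :: complex mat) $$ (i, j)" using ij \<sigma> by simp
    finally show "(sperm m \<sigma> s * mstar (sperm m \<sigma> s)) $$ (i, j) = (1\<^sub>m m :: complex mat) $$ (i, j)" .
  qed (use c in auto)
  show ?thesis using c 1 2 by (simp add: unitaries_def)
qed

lemma unitaries_span:
  assumes add: "\<And>X Y. X \<in> sqmat m \<Longrightarrow> Y \<in> sqmat m \<Longrightarrow> Q X \<Longrightarrow> Q Y \<Longrightarrow> Q (X + Y)"
    and scale: "\<And>c X. X \<in> sqmat m \<Longrightarrow> Q X \<Longrightarrow> Q (mscale c X)"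
    and unit: "\<And>U. U \<in> unitaries m \<Longrightarrow> Q U" and T: "T \<in> sqmat m"
  shows "Q T"
proof -
  have uc: "U \<in> sqmat m" if "U \<in> unitaries m" for U using that by (simp add: unitaries_def)
  have E: "Q (mat m m (\<lambda>x. if x = (p, q) then 1 else 0))" if pq: "p < m" "q < m" for p q
  proof -
    define \<sigma> where "\<sigma> i = (if i = p then q else if i = q then p else i)" for i
    \<comment> \<open>Two signed permutation matrices that differ only in the entry \<open>(p, q)\<close>.\<close>
    let ?U = "sperm m \<sigma> (\<lambda>_. 1)" and ?V = "sperm m \<sigma> (\<lambda>j. if j = q then -1 else 1)"
    have u: "?U \<in> unitaries m" "?V \<in> unitaries m"
      by (rule sperm_unitary; use pq in \<open>auto simp: \<sigma>_def\<close>)+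
    have "Q (mscale (1/2) ?U + mscale (-1/2) ?V)"
      using u by (intro add scale unit) (auto simp: uc)
    also have "mscale (1/2) ?U + mscale (-1/2) ?V = mat m m (\<lambda>x. if x = (p, q) then 1 else 0)"
    proof -
      have "\<sigma> q = p" by (simp add: \<sigma>_def)
      then show ?thesis using pq by (intro eq_matI) (auto simp: sperm_def cscale_complex_def)
    qed
    finally show ?thesis .
  qed
  have "Q (mat m m (\<lambda>x. if x \<in> F then T $$ x else 0))" if "finite F" "F \<subseteq> {..<m} \<times> {..<m}" for F
    using that
  proof (induction F rule: finite_induct)
    case empty
    have "sperm m id (\<lambda>_. 1) \<in> unitaries m" by (rule sperm_unitary) auto
    then have "Q (mscale 0 (sperm m id (\<lambda>_. 1)))" by (intro scale unit uc)
    also have "mscale 0 (sperm m id (\<lambda>_. 1)) = mat m m (\<lambda>x. if x \<in> {} then T $$ x else 0)"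
      by (rule eq_matI) (auto simp: sperm_def)
    finally show ?case .
  next
    case (insert x F)
    obtain p q where x: "x = (p, q)" "p < m" "q < m" using insert.prems by auto
    have "Q (mat m m (\<lambda>x. if x \<in> F then T $$ x else 0) + mscale (T $$ x) (mat m m (\<lambda>y. if y = (p, q) then 1 else 0)))"
      using insert x by (intro add scale E) auto
    also have "mat m m (\<lambda>x. if x \<in> F then T $$ x else 0) + mscale (T $$ x) (mat m m (\<lambda>y. if y = (p, q) then 1 else 0))
        = mat m m (\<lambda>y. if y \<in> insert x F then T $$ y else 0)"
      using insert.hyps x by (intro eq_matI) (auto simp: cscale_complex_def)
    finally show ?case .
  qed
  from this[of "{..<m} \<times> {..<m}"] have "Q (mat m m (\<lambda>x. if x \<in> {..<m} \<times> {..<m} then T $$ x else 0))" by simp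
  also have "mat m m (\<lambda>x. if x \<in> {..<m} \<times> {..<m} then T $$ x else 0) = T" using T by (intro eq_matI) auto
  finally show ?thesis .
qed

section \<open>Multilinearity\<close>

context germ
begin

text \<open>A polynomial with at most linear growth is affine; the growth bound is the product
  bound.\<close>

lemma M_slot_affine:
  assumes m: "m \<ge> 1" and Y: "\<And>l. l < k \<Longrightarrow> Y l \<in> MU s1 m" and i: "i < k" and U: "U \<in> MU s1 m" and V: "V \<in> MU s1 m"
    and ab: "a < m * N2" "b < m * N2"
  shows "\<exists>q0 q1. \<forall>x\<ge>0. M m k (Y(i := U + rs x V)) $$ (a, b) = q0 + x *\<^sub>R q1"
proof -
  obtain D where D: "D \<ge> 0" "\<And>Y. (\<And>i. i < k \<Longrightarrow> Y i \<in> MU s1 m) \<Longrightarrow> norm (M m k Y $$ (a, b)) \<le> D * (\<Prod>i<k. mnorm (Y i))"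
    using M_product_bound[OF m ab] by blast
  let ?q = "\<lambda>x. M m k (Y(i := U + rs x V)) $$ (a, b)"
  have UV: "U + rs x V \<in> MU s1 m" for x by (intro MU_add[OF s1] U MU_rs[OF s1] V)
  have YUV: "(Y(i := U + rs x V)) l \<in> MU s1 m" if "l < k" for x l using Y that UV by auto
  let ?E = "D * (\<Prod>l\<in>{..<k} - {i}. mnorm (Y l))"
  have E: "?E \<ge> 0" using D by (simp add: prod_nonneg mnorm_nonneg)
  show ?thesis
  proof (rule poly_linear_growth[of k ?q "?E * mnorm U" "?E * mnorm V"])
    fix R :: real
    have Uc: "U \<in> sqmat (m * N1)" "V \<in> sqmat (m * N1)" using U V MUc by auto
    have e: "(\<lambda>l. rs (1 - s) ((Y(i := U + rs 0 V)) l) + rs s ((Y(i := U + rs R V)) l)) = Y(i := U + rs (R * s) V)" for s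
    proof
      fix l
      show "rs (1 - s) ((Y(i := U + rs 0 V)) l) + rs s ((Y(i := U + rs R V)) l) = (Y(i := U + rs (R * s) V)) l"
        using Uc by (intro eq_matI) (auto simp: scaleR_add_right mult.commute simp flip: scaleR_add_left)
    qed
    show "poly_on k (\<lambda>u. ?q (R * u))"
      using M_segment[OF m, where U = "Y(i := U + rs 0 V)" and V = "Y(i := U + rs R V)", OF YUV YUV ab] unfolding e by simp
  next
    fix x :: real assume x: "x \<ge> 0"
    have "norm (?q x) \<le> D * (\<Prod>l<k. mnorm ((Y(i := U + rs x V)) l))" by (rule D(2)[of "Y(i := U + rs x V)", OF YUV])
    also have "(\<Prod>l<k. mnorm ((Y(i := U + rs x V)) l)) = mnorm (U + rs x V) * (\<Prod>l\<in>{..<k} - {i}. mnorm (Y l))"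
      using i by (subst prod.remove[of _ i]) auto
    also have "D * \<dots> = ?E * mnorm (U + rs x V)" by simp
    also have "\<dots> \<le> ?E * (mnorm U + x * mnorm V)"
      using mnorm_rs_add_le[OF MUc[OF U] MUc[OF V], of 1 x] x by (intro mult_left_mono E) simp
    also have "\<dots> = ?E * mnorm U + ?E * mnorm V * x" by (simp add: algebra_simps)
    finally show "norm (?q x) \<le> ?E * mnorm U + ?E * mnorm V * x" .
  next
    fix q0 q1 assume "\<And>x. 0 \<le> x \<Longrightarrow> ?q x = q0 + x *\<^sub>R q1"
    then show ?thesis by blast
  qed (use E in \<open>auto simp: mnorm_nonneg\<close>)
qed

lemma rs_zero_add: "U \<in> sqmat n \<Longrightarrow> V \<in> sqmat n \<Longrightarrow> U + rs 0 V = U"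
  by (rule eq_matI) auto

lemma M_slot_rs:
  assumes m: "m \<ge> 1" and Y: "\<And>l. l < k \<Longrightarrow> Y l \<in> MU s1 m" and i: "i < k" and V: "V \<in> MU s1 m" and x: "x \<ge> 0"
  shows "M m k (Y(i := rs x V)) = rs x (M m k (Y(i := V)))"
proof (rule eq_matI)
  fix a b assume "a < dim_row (rs x (M m k (Y(i := V))))" "b < dim_col (rs x (M m k (Y(i := V))))"
  then have ab: "a < m * N2" "b < m * N2" by auto
  let ?Z = "0\<^sub>m (m * N1) (m * N1) :: 'a mat"
  obtain q0 q1 where q: "\<And>x. x \<ge> 0 \<Longrightarrow> M m k (Y(i := ?Z + rs x V)) $$ (a, b) = q0 + x *\<^sub>R q1"
    using M_slot_affine[where Y = Y, OF m Y i MU_zero[OF s1] V ab] by blast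
  have z: "?Z + rs x V = rs x V" for x using MUc[OF V] by (intro eq_matI) auto
  have Yz: "(Y(i := rs 0 V)) l \<in> MU s1 m" if "l < k" for l using Y that MU_rs[OF s1 V] by auto
  have "q0 = 0" using q[of 0] M_zero_slot[where Y = "Y(i := rs 0 V)" and i = i, OF m Yz i _ ab] rs_zero_left[OF MUc[OF V]] unfolding z by simp
  then show "M m k (Y(i := rs x V)) $$ (a, b) = rs x (M m k (Y(i := V))) $$ (a, b)"
    using q[of x] q[of 1] x ab unfolding z by simp
qed auto

lemma M_slot_mscale:
  assumes m: "m \<ge> 1" and Y: "\<And>l. l < k \<Longrightarrow> Y l \<in> MU s1 m" and i: "i < k" and V: "V \<in> MU s1 m"
  shows "M m k (Y(i := mscale z V)) = mscale z (M m k (Y(i := V)))"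
proof -
  \<comment> \<open>Positive multiples and phases have been treated separately.\<close>
  define w where "w = (if z = 0 then 1 else z / cmod z)"
  have w: "cmod w = 1" "z = w * of_real (cmod z)" by (auto simp: w_def norm_divide)
  have e: "mscale z X = mscale w (rs (cmod z) X)" for X :: "'c::cstar_algebra mat"
    by (simp add: rs_def mscale_mscale flip: w(2))
  have Yr: "(Y(i := rs (cmod z) V)) l \<in> MU s1 m" if "l < k" for l using Y that MU_rs[OF s1 V] by auto
  have "M m k (Y(i := mscale z V)) = M m k ((Y(i := rs (cmod z) V))(i := mscale w ((Y(i := rs (cmod z) V)) i)))"
    by (simp add: e)
  also have "\<dots> = mscale w (M m k (Y(i := rs (cmod z) V)))" by (rule M_phase[OF m Yr i w(1)])
  also have "\<dots> = mscale z (M m k (Y(i := V)))" by (simp add: M_slot_rs[where Y = Y, OF m Y i V] e)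
  finally show ?thesis .
qed

text \<open>The two affine functions \<open>x \<mapsto> M(U + xV)\<close> and \<open>x \<mapsto> M(V +
  xU)\<close> are exchanged by \<open>x \<mapsto> 1/x\<close> and
  homogeneity, so the slope of each is the value at \<open>0\<close> of the other.\<close>

lemma M_slot_add:
  assumes m: "m \<ge> 1" and Y: "\<And>l. l < k \<Longrightarrow> Y l \<in> MU s1 m" and i: "i < k" and U: "U \<in> MU s1 m" and V: "V \<in> MU s1 m"
  shows "M m k (Y(i := U + V)) = M m k (Y(i := U)) + M m k (Y(i := V))"
proof (rule eq_matI)
  fix a b assume "a < dim_row (M m k (Y(i := U)) + M m k (Y(i := V)))" "b < dim_col (M m k (Y(i := U)) + M m k (Y(i := V)))"
  then have ab: "a < m * N2" "b < m * N2" by auto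
  obtain q0 q1 where q: "\<And>x. x \<ge> 0 \<Longrightarrow> M m k (Y(i := U + rs x V)) $$ (a, b) = q0 + x *\<^sub>R q1"
    using M_slot_affine[where Y = Y, OF m Y i U V ab] by blast
  obtain p0 p1 where p: "\<And>x. x \<ge> 0 \<Longrightarrow> M m k (Y(i := V + rs x U)) $$ (a, b) = p0 + x *\<^sub>R p1"
    using M_slot_affine[where Y = Y, OF m Y i V U ab] by blast
  note Uc = MUc[OF U] and Vc = MUc[OF V]
  have "q0 + x *\<^sub>R q1 = p1 + x *\<^sub>R p0" if x: "x > 0" for x
  proof -
    have e: "U + rs x V = rs x (V + rs (1 / x) U)" using x Uc Vc by (intro eq_matI) (auto simp: scaleR_add_right)
    have "M m k (Y(i := U + rs x V)) = rs x (M m k (Y(i := V + rs (1 / x) U)))"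
      unfolding e using x by (intro M_slot_rs[where Y = Y] m Y i MU_add[OF s1] V MU_rs[OF s1] U) auto
    then have "q0 + x *\<^sub>R q1 = x *\<^sub>R (p0 + (1 / x) *\<^sub>R p1)" using q[of x] p[of "1 / x"] x ab by simp
    then show ?thesis using x by (simp add: scaleR_add_right)
  qed
  from this[of 1] this[of 2] have "q1 = p0" by (simp add: scaleR_2) (metis add.assoc add.commute add_left_cancel)
  moreover have "q0 = M m k (Y(i := U)) $$ (a, b)" using q[of 0] by (simp add: rs_zero_add[OF Uc Vc])
  moreover have "p0 = M m k (Y(i := V)) $$ (a, b)" using p[of 0] by (simp add: rs_zero_add[OF Vc Uc])
  ultimately show "M m k (Y(i := U + V)) $$ (a, b) = (M m k (Y(i := U)) + M m k (Y(i := V))) $$ (a, b)"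
    using q[of 1] ab by simp
qed auto

lemma M_slot_sum:
  fixes d :: nat
  assumes m: "m \<ge> 1" and Y: "\<And>l. l < k \<Longrightarrow> Y l \<in> MU s1 m" and i: "i < k" and K: "\<And>j. j < d \<Longrightarrow> K j \<in> MU s1 m"
    and ab: "a < m * N2" "b < m * N2"
  shows "msum (m * N1) {..<d} K \<in> MU s1 m"
    and "M m k (Y(i := msum (m * N1) {..<d} K)) $$ (a, b) = (\<Sum>j<d. M m k (Y(i := K j)) $$ (a, b))"
proof -
  have "msum (m * N1) {..<d} K \<in> MU s1 m \<and>
    M m k (Y(i := msum (m * N1) {..<d} K)) $$ (a, b) = (\<Sum>j<d. M m k (Y(i := K j)) $$ (a, b))"
    using K
  proof (induction d)
    case 0
    have z: "msum (m * N1) {..<0} K = 0\<^sub>m (m * N1) (m * N1)" by (rule eq_matI) (auto simp: msum_def)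
    have "(Y(i := 0\<^sub>m (m * N1) (m * N1))) l \<in> MU s1 m" if "l < k" for l using Y that MU_zero[OF s1] by auto
    from M_zero_slot[where i = i, OF m this i _ ab] show ?case using MU_zero[OF s1] unfolding z by simp
  next
    case (Suc d)
    have IH: "msum (m * N1) {..<d} K \<in> MU s1 m"
      "M m k (Y(i := msum (m * N1) {..<d} K)) $$ (a, b) = (\<Sum>j<d. M m k (Y(i := K j)) $$ (a, b))"
      using Suc.IH Suc.prems less_SucI by metis+
    have Kd: "K d \<in> MU s1 m" using Suc by simp
    have e: "msum (m * N1) {..<Suc d} K = msum (m * N1) {..<d} K + K d"
      using MUc[OF Kd] by (intro eq_matI) (auto simp: msum_def)
    have "M m k (Y(i := msum (m * N1) {..<Suc d} K)) $$ (a, b) = (\<Sum>j<d. M m k (Y(i := K j)) $$ (a, b)) + M m k (Y(i := K d)) $$ (a, b)"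
    proof -
      have A: "M m k (Y(i := msum (m * N1) {..<d} K + K d)) = M m k (Y(i := msum (m * N1) {..<d} K)) + M m k (Y(i := K d))"
        by (rule M_slot_add[OF m _ i IH(1) Kd]) (rule Y)
      show ?thesis unfolding e A IH(2)[symmetric] using ab by (intro index_add_mat) auto
    qed
    then show ?case using MU_add[OF s1 IH(1) Kd] unfolding e[symmetric] sum.lessThan_Suc by (rule conjI[rotated])
  qed
  then show "msum (m * N1) {..<d} K \<in> MU s1 m"
    and "M m k (Y(i := msum (m * N1) {..<d} K)) $$ (a, b) = (\<Sum>j<d. M m k (Y(i := K j)) $$ (a, b))" by auto
qed

lemma kron_one_one: "r \<in> sqmat n \<Longrightarrow> kron (1\<^sub>m 1) r = r"
  by (rule kron_eqI[of r 1 n 1 n "1\<^sub>m 1" r, symmetric]) auto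

lemma elems_MU1: "r \<in> elems s1 \<Longrightarrow> r \<in> MU s1 1"
  using kron_MU[OF s1 one_carrier_mat[of 1], of r] kron_one_one[OF elemsD(1)[OF s1]] by simp

text \<open>For unitary \<open>t\<^sub>l\<close> the partial products \<open>S\<^sub>l = t\<^sub>l
  \<dots> t\<^sub>k\<^sub>-\<^sub>1 e\<^sub>q\<close> are columns that intertwine the slots at level
  \<open>m\<close> with those at level \<open>1\<close>.\<close>

lemma M_kron_unitary:
  assumes m: "m \<ge> 1" and t: "\<And>l. l < k \<Longrightarrow> t l \<in> unitaries m" and H: "\<And>l. l < k \<Longrightarrow> H l \<in> elems s1"
  shows "M m k (\<lambda>l. kron (t l) (H l)) = kron (word_pow m t [0..<k]) (M 1 k H)"
proof -
  have tc: "t l \<in> sqmat m" "mstar (t l) * t l = 1\<^sub>m m" if "l < k" for l using t[OF that] by (auto simp: unitaries_def)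
  have Hc: "H l \<in> sqmat N1" "mstar (H l) = H l" if "l < k" for l using elemsD[OF s1 H[OF that]] by auto
  let ?P = "\<lambda>l. word_pow m t [l..<k]"
  have Pc: "?P l \<in> sqmat m" for l using tc by (intro word_pow_carrier) auto
  have P_Suc: "?P l = t l * ?P (Suc l)" if "l < k" for l using that by (simp add: upt_conv_Cons)
  have P_down: "mstar (t l) * ?P l = ?P (Suc l)" if "l < k" for l
  proof -
    have "mstar (t l) * ?P l = (mstar (t l) * t l) * ?P (Suc l)"
      unfolding P_Suc[OF that] by (rule assoc_mult_mat[symmetric, of _ m m _ m _ m]) (use tc[OF that] Pc in auto)
    then show ?thesis using tc[OF that] left_mult_one_mat[OF Pc] by simp
  qed
  have M1c: "M 1 k H \<in> sqmat N2" using M_carrier[of 1 k H] by simp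
  show ?thesis
  proof (rule kron_eqI[of _ m N2 m N2])
    fix x q a b assume xq: "x < m" "q < m" and ab: "a < N2" "b < N2"
    define e :: "complex mat" where "e = mat m 1 (\<lambda>(i, j). if i = q then 1 else 0)"
    have ec: "e \<in> carrier_mat m 1" by (simp add: e_def)
    have ent: "(X * kron e (1\<^sub>m N2)) $$ (x * N2 + a, b) = X $$ (x * N2 + a, q * N2 + b)"
      if X: "X \<in> sqmat (m * N2)" for X :: "'b mat"
    proof -
      have "(X * kron e (1\<^sub>m N2)) $$ (x * N2 + a, b) = (\<Sum>l<m. e $$ (l, 0) *\<^sub>C X $$ (x * N2 + a, l * N2 + b))"
        by (rule kron_column_entry[OF X ec block_index_less[OF xq(1) ab(1)] ab(2)])
      also have "\<dots> = (\<Sum>l<m. if l = q then X $$ (x * N2 + a, q * N2 + b) else 0)"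
        by (intro sum.cong refl) (simp add: e_def)
      finally show ?thesis using xq by simp
    qed
    have "M m k (\<lambda>l. kron (t l) (H l)) * kron (?P k * e) (1\<^sub>m N2) = kron (?P 0 * e) (1\<^sub>m N2) * M 1 k H"
    proof (rule M_inter[where S = "\<lambda>l. ?P l * e"])
      fix l assume l: "l < k"
      show "kron (t l) (H l) \<in> MU s1 m" by (rule kron_MU[OF s1 tc(1)[OF l] H[OF l]])
      show "H l \<in> MU s1 1" by (rule elems_MU1[OF H[OF l]])
      have 1: "kron (?P j * e) (1\<^sub>m N1) * H l = kron (?P j * e) (H l)" for j
        by (rule kron_column_mult[OF mult_carrier_mat[OF Pc ec] Hc(1)[OF l]])
      have 2: "kron T (H l) * kron (?P j * e) (1\<^sub>m N1) = kron (T * ?P j * e) (H l)" if T: "T \<in> sqmat m" for T j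
        using kron_mult[OF T Hc(1)[OF l] mult_carrier_mat[OF Pc[of j] ec] one_carrier_mat[of N1]]
          assoc_mult_mat[OF T Pc[of j] ec] right_mult_one_mat[OF Hc(1)[OF l]] by simp
      show "kron (t l) (H l) * kron (?P (Suc l) * e) (1\<^sub>m N1) = kron (?P l * e) (1\<^sub>m N1) * H l"
        unfolding 1 2[OF tc(1)[OF l]] by (simp only: P_Suc[OF l])
      have ms: "mstar (t l) \<in> sqmat m" using tc(1)[OF l] by simp
      show "mstar (kron (t l) (H l)) * kron (?P l * e) (1\<^sub>m N1) = kron (?P (Suc l) * e) (1\<^sub>m N1) * mstar (H l)"
        unfolding mstar_kron[OF tc(1)[OF l] Hc(1)[OF l]] Hc(2)[OF l] 1 2[OF ms] by (simp only: P_down[OF l])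
    qed (use m mult_carrier_mat[OF Pc ec] in auto)
    also have "?P k * e = e" using left_mult_one_mat[OF ec] by simp
    finally have eq: "M m k (\<lambda>l. kron (t l) (H l)) * kron e (1\<^sub>m N2) = kron (?P 0 * e) (1\<^sub>m N2) * M 1 k H" .
    have "kron (?P 0 * e) (1\<^sub>m N2) * M 1 k H = kron (?P 0 * e) (M 1 k H)"
      by (rule kron_column_mult[OF mult_carrier_mat[OF Pc ec] M1c])
    then have "M m k (\<lambda>l. kron (t l) (H l)) $$ (x * N2 + a, q * N2 + b) = kron (?P 0 * e) (M 1 k H) $$ (x * N2 + a, 0 * N2 + b)"
      using ent[OF M_carrier[of m k "\<lambda>l. kron (t l) (H l)"]] unfolding eq by simp
    also have "\<dots> = (?P 0 * e) $$ (x, 0) *\<^sub>C M 1 k H $$ (a, b)"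
      by (rule kron_entry[OF mult_carrier_mat[OF Pc ec] M1c]) (use xq ab in auto)
    also have "(?P 0 * e) $$ (x, 0) = (\<Sum>l<m. ?P 0 $$ (x, l) * e $$ (l, 0))"
      using xq Pc[of 0] ec by (subst mult_mat_entry) auto
    also have "\<dots> = (\<Sum>l<m. if l = q then ?P 0 $$ (x, q) else 0)"
      by (intro sum.cong refl) (simp add: e_def)
    also have "\<dots> = ?P 0 $$ (x, q)" using xq by simp
    finally show "M m k (\<lambda>l. kron (t l) (H l)) $$ (x * N2 + a, q * N2 + b) = word_pow m t [0..<k] $$ (x, q) *\<^sub>C M 1 k H $$ (a, b)" .
  qed (use Pc M1c in auto)
qed

text \<open>Both sides are linear in each \<open>t\<^sub>l\<close>, and unitary matrices span.\<close>

lemma M_kron: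
  assumes m: "m \<ge> 1" and t: "\<And>l. l < k \<Longrightarrow> t l \<in> sqmat m" and H: "\<And>l. l < k \<Longrightarrow> H l \<in> elems s1"
  shows "M m k (\<lambda>l. kron (t l) (H l)) = kron (word_pow m t [0..<k]) (M 1 k H)"
proof -
  have "M m k (\<lambda>l. kron (t l) (H l)) = kron (word_pow m t [0..<k]) (M 1 k H)"
    if "n \<le> k" "\<And>l. l < n \<Longrightarrow> t l \<in> sqmat m" "\<And>l. n \<le> l \<Longrightarrow> l < k \<Longrightarrow> t l \<in> unitaries m" for n t
    using that
  proof (induction n arbitrary: t)
    case 0
    then show ?case by (intro M_kron_unitary m H) auto
  next
    case (Suc n)
    have n: "n < k" using Suc.prems by simp
    have tc: "t l \<in> sqmat m" if "l < k" for l
      using Suc.prems(2)[of l] Suc.prems(3)[of l] that by (cases "l < Suc n") (auto simp: unitaries_def)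
    have Hc: "H n \<in> sqmat N1" using elemsD[OF s1 H[OF n]] by auto
    have M1c: "M 1 k H \<in> sqmat N2" using M_carrier[of 1 k H] by simp
    let ?A = "word_pow m t [0..<n]" and ?B = "word_pow m t [Suc n..<k]"
    have AB: "?A \<in> sqmat m" "?B \<in> sqmat m" using tc n by (auto intro!: word_pow_carrier)
    let ?Y = "\<lambda>l. kron (t l) (H l)"
    have Y: "?Y l \<in> MU s1 m" if "l < k" for l by (rule kron_MU[OF s1 tc[OF that] H[OF that]])
    let ?Q = "\<lambda>T. M m k (?Y(n := kron T (H n))) = kron (?A * (T * ?B)) (M 1 k H)"
    have "?Q (t n)"
    proof (rule unitaries_span[where Q = ?Q])
      fix U :: "complex mat" and V assume c: "U \<in> sqmat m" "V \<in> sqmat m" and Q: "?Q U" "?Q V"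
      have "M m k (?Y(n := kron (U + V) (H n))) = M m k (?Y(n := kron U (H n))) + M m k (?Y(n := kron V (H n)))"
        unfolding kron_add_left[OF c Hc]
        by (rule M_slot_add[where Y = ?Y, OF m Y n kron_MU[OF s1 c(1) H[OF n]] kron_MU[OF s1 c(2) H[OF n]]])
      also have "\<dots> = kron (?A * (U * ?B) + ?A * (V * ?B)) (M 1 k H)"
        unfolding Q using AB c M1c by (intro kron_add_left[symmetric]) auto
      also have "?A * (U * ?B) + ?A * (V * ?B) = ?A * ((U + V) * ?B)"
        using AB c add_mult_distrib_mat[OF c AB(2)] mult_add_distrib_mat[OF AB(1), of "U * ?B" m "V * ?B"] by simp
      finally show "?Q (U + V)" .
    next
      fix c and U :: "complex mat" assume U: "U \<in> sqmat m" and Q: "?Q U"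
      have "M m k (?Y(n := kron (mscale c U) (H n))) = mscale c (M m k (?Y(n := kron U (H n))))"
        unfolding mscale_kron[OF U Hc, symmetric]
        by (rule M_slot_mscale[where Y = ?Y, OF m Y n kron_MU[OF s1 U H[OF n]]])
      also have "\<dots> = kron (mscale c (?A * (U * ?B))) (M 1 k H)"
        unfolding Q using AB U M1c by (intro mscale_kron) auto
      also have "mscale c (?A * (U * ?B)) = ?A * (mscale c U * ?B)"
        using mscale_mult[OF AB(1) mult_carrier_mat[OF U AB(2)], of 1 c] mscale_mult[OF U AB(2), of c 1] by simp
      finally show "?Q (mscale c U)" .
    next
      fix U assume U: "U \<in> unitaries m"
      then have Uc: "U \<in> sqmat m" by (simp add: unitaries_def)
      have "M m k (\<lambda>l. kron ((t(n := U)) l) (H l)) = kron (word_pow m (t(n := U)) [0..<k]) (M 1 k H)"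
      proof (rule Suc.IH)
        show "n \<le> k" using n by simp
        show "(t(n := U)) l \<in> sqmat m" if "l < n" for l using that tc n by auto
        show "(t(n := U)) l \<in> unitaries m" if "n \<le> l" "l < k" for l using that Suc.prems(3)[of l] U by auto
      qed
      also have "word_pow m (t(n := U)) [0..<k] = ?A * (U * ?B)" by (rule word_pow_slot[OF tc n Uc])
      also have "(\<lambda>l. kron ((t(n := U)) l) (H l)) = ?Y(n := kron U (H n))" by auto
      finally show "?Q U" .
    qed (rule tc[OF n])
    moreover have "?Y(n := kron (t n) (H n)) = ?Y" by auto
    moreover have "?A * (t n * ?B) = word_pow m t [0..<k]" using word_pow_slot[where t = t, OF tc n tc[OF n]] by simp
    ultimately show ?case by simp
  qed
  from this[of k t] show ?thesis using t by simp
qed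

text \<open>Expanding a multilinear form on a finite sum yields one term for each word.\<close>

lemma M_lin_form:
  assumes m: "m \<ge> 1" and t: "\<And>i. i < d \<Longrightarrow> t i \<in> sqmat m" and H: "\<And>i. i < d \<Longrightarrow> H i \<in> elems s1"
  shows "M m k (\<lambda>_. lin_form s1 m d H t) = word_sum s2 m d k (\<lambda>\<alpha>. M 1 k (\<lambda>l. H (\<alpha> ! l))) t"
proof (rule eq_matI)
  fix a b assume "a < dim_row (word_sum s2 m d k (\<lambda>\<alpha>. M 1 k (\<lambda>l. H (\<alpha> ! l))) t)"
    "b < dim_col (word_sum s2 m d k (\<lambda>\<alpha>. M 1 k (\<lambda>l. H (\<alpha> ! l))) t)"
  then have ab: "a < m * N2" "b < m * N2" by (auto simp: word_sum_def msum_def)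
  let ?K = "\<lambda>i. kron (t i) (H i)"
  have K: "?K i \<in> MU s1 m" if "i < d" for i by (rule kron_MU[OF s1 t[OF that] H[OF that]])
  have L: "lin_form s1 m d H t \<in> MU s1 m"
    unfolding lin_form_def
  proof (rule M_slot_sum(1)[where K = ?K and Y = "\<lambda>_. 0\<^sub>m (m * N1) (m * N1)" and k = 1 and i = 0, OF m _ _ K ab])
  qed (use MU_zero[OF s1] in auto)
  have "M m k (\<lambda>l. if l < n then lin_form s1 m d H t else ?K (\<beta> l)) $$ (a, b)
      = (\<Sum>\<alpha>\<in>words d n. M m k (\<lambda>l. if l < n then ?K (\<alpha> ! l) else ?K (\<beta> l)) $$ (a, b))"
    if "n \<le> k" "\<And>l. n \<le> l \<Longrightarrow> l < k \<Longrightarrow> \<beta> l < d" for n \<beta>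
    using that
  proof (induction n arbitrary: \<beta>)
    case 0
    then show ?case by simp
  next
    case (Suc n)
    have n: "n < k" using Suc.prems by simp
    let ?Y = "\<lambda>l. if l < Suc n then lin_form s1 m d H t else ?K (\<beta> l)"
    have Y: "?Y l \<in> MU s1 m" if "l < k" for l using L K Suc.prems(2)[of l] that by auto
    have "?Y = ?Y(n := msum (m * N1) {..<d} ?K)" by (auto simp: lin_form_def)
    then have "M m k ?Y $$ (a, b) = M m k (?Y(n := msum (m * N1) {..<d} ?K)) $$ (a, b)"
      by (rule arg_cong[where f = "\<lambda>Y. M m k Y $$ (a, b)"])
    also have "\<dots> = (\<Sum>j<d. M m k (?Y(n := ?K j)) $$ (a, b))"
      by (rule M_slot_sum(2)[OF m _ n _ ab]; (rule Y K, assumption))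
    also have "\<dots> = (\<Sum>j<d. \<Sum>\<alpha>\<in>words d n. M m k (\<lambda>l. if l < Suc n then ?K ((\<alpha> @ [j]) ! l) else ?K (\<beta> l)) $$ (a, b))"
    proof (intro sum.cong refl)
      fix j assume j: "j \<in> {..<d}"
      have "?Y(n := ?K j) = (\<lambda>l. if l < n then lin_form s1 m d H t else ?K ((\<beta>(n := j)) l))" by auto
      then have "M m k (?Y(n := ?K j)) $$ (a, b) = M m k (\<lambda>l. if l < n then lin_form s1 m d H t else ?K ((\<beta>(n := j)) l)) $$ (a, b)"
        by (rule arg_cong[where f = "\<lambda>Y. M m k Y $$ (a, b)"])
      also have "\<dots> = (\<Sum>\<alpha>\<in>words d n. M m k (\<lambda>l. if l < n then ?K (\<alpha> ! l) else ?K ((\<beta>(n := j)) l)) $$ (a, b))"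
        using n j Suc.prems by (intro Suc.IH) auto
      also have "\<dots> = (\<Sum>\<alpha>\<in>words d n. M m k (\<lambda>l. if l < Suc n then ?K ((\<alpha> @ [j]) ! l) else ?K (\<beta> l)) $$ (a, b))"
      proof (intro sum.cong refl)
        fix \<alpha> assume "\<alpha> \<in> words d n"
        then have "(\<lambda>l. if l < n then ?K (\<alpha> ! l) else ?K ((\<beta>(n := j)) l)) = (\<lambda>l. if l < Suc n then ?K ((\<alpha> @ [j]) ! l) else ?K (\<beta> l))"
          by (auto simp: words_def nth_append)
        then show "M m k (\<lambda>l. if l < n then ?K (\<alpha> ! l) else ?K ((\<beta>(n := j)) l)) $$ (a, b)
            = M m k (\<lambda>l. if l < Suc n then ?K ((\<alpha> @ [j]) ! l) else ?K (\<beta> l)) $$ (a, b)"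
          by (rule arg_cong[where f = "\<lambda>Y. M m k Y $$ (a, b)"])
      qed
      finally show "M m k (?Y(n := ?K j)) $$ (a, b)
          = (\<Sum>\<alpha>\<in>words d n. M m k (\<lambda>l. if l < Suc n then ?K ((\<alpha> @ [j]) ! l) else ?K (\<beta> l)) $$ (a, b))" .
    qed
    also have "\<dots> = (\<Sum>\<alpha>\<in>words d (Suc n). M m k (\<lambda>l. if l < Suc n then ?K (\<alpha> ! l) else ?K (\<beta> l)) $$ (a, b))"
      by (rule sum_words_Suc[symmetric])
    finally show ?case .
  qed
  from this[of k "\<lambda>_. 0"]
  have "M m k (\<lambda>l. if l < k then lin_form s1 m d H t else ?K 0) $$ (a, b)
      = (\<Sum>\<alpha>\<in>words d k. M m k (\<lambda>l. if l < k then ?K (\<alpha> ! l) else ?K 0) $$ (a, b))" by simp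
  also have "M m k (\<lambda>l. if l < k then lin_form s1 m d H t else ?K 0) = M m k (\<lambda>_. lin_form s1 m d H t)"
    by (rule M_cong) simp
  also have "(\<Sum>\<alpha>\<in>words d k. M m k (\<lambda>l. if l < k then ?K (\<alpha> ! l) else ?K 0) $$ (a, b))
      = (\<Sum>\<alpha>\<in>words d k. kron (word_pow m t \<alpha>) (M 1 k (\<lambda>l. H (\<alpha> ! l))) $$ (a, b))"
  proof (intro sum.cong refl)
    fix \<alpha> assume \<alpha>: "\<alpha> \<in> words d k"
    then have lt: "\<alpha> ! l < d" if "l < k" for l
      using that nth_mem[of l \<alpha>] by (auto simp: words_def simp del: nth_mem)
    have len: "length \<alpha> = k" using \<alpha> by (simp add: words_def)
    have "M m k (\<lambda>l. if l < k then ?K (\<alpha> ! l) else ?K 0) = M m k (\<lambda>l. kron (t (\<alpha> ! l)) (H (\<alpha> ! l)))"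
      by (rule M_cong) simp
    also have "\<dots> = kron (word_pow m (\<lambda>l. t (\<alpha> ! l)) [0..<k]) (M 1 k (\<lambda>l. H (\<alpha> ! l)))"
      using lt by (intro M_kron m t H)
    also have "word_pow m (\<lambda>l. t (\<alpha> ! l)) [0..<k] = word_pow m t \<alpha>"
      using word_pow_map[of m t "(!) \<alpha>" "[0..<k]"] map_nth[of \<alpha>] len by simp
    finally show "M m k (\<lambda>l. if l < k then ?K (\<alpha> ! l) else ?K 0) $$ (a, b) = kron (word_pow m t \<alpha>) (M 1 k (\<lambda>l. H (\<alpha> ! l))) $$ (a, b)"
      by simp
  qed
  also have "\<dots> = word_sum s2 m d k (\<lambda>\<alpha>. M 1 k (\<lambda>l. H (\<alpha> ! l))) t $$ (a, b)"
    using ab by (simp add: word_sum_def msum_def)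
  finally show "M m k (\<lambda>_. lin_form s1 m d H t) $$ (a, b) = word_sum s2 m d k (\<lambda>\<alpha>. M 1 k (\<lambda>l. H (\<alpha> ! l))) t $$ (a, b)" .
qed (auto simp: word_sum_def msum_def)

end

section \<open>The path graph\<close>

lemma sum_unit_powers:
  assumes n: "0 < n" "n < (N::nat)"
  shows "(\<Sum>r<N. cis (- 2 * pi * real r / real N) ^ n) = 0"
proof -
  define z where "z = cis (- 2 * pi * real n / real N)"
  have "cis (- 2 * pi * real r / real N) ^ n = z ^ r" for r
    unfolding z_def Complex.DeMoivre by (rule arg_cong[where f = cis]) (simp add: mult_ac)
  moreover have "z \<noteq> 1"
  proof
    assume "z = 1"
    then have "cos (2 * pi * real n / real N) = 1" by (simp add: z_def complex_eq_iff)
    then obtain x :: int where "2 * pi * real n / real N = of_int x * 2 * pi" by (auto simp: cos_one_2pi_int)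
    then have "real n = of_int x * real N" using n by (simp add: field_simps)
    then have "int n = x * int N" by (metis of_int_eq_iff of_int_mult of_int_of_nat_eq)
    then have "int N dvd int n" by simp
    then show False using n by (simp add: nat_dvd_not_less)
  qed
  moreover have "z ^ N = 1"
  proof -
    have "z ^ N = cis (- (2 * pi * real n))" using n by (simp add: z_def Complex.DeMoivre)
    then show ?thesis by (simp add: complex_eq_iff cos_integer_2pi sin_integer_2pi mult_ac) (metis cos_2npi sin_2npi mult.commute mult.assoc)
  qed
  ultimately show ?thesis using geometric_sum[of z N] by simp
qed

text \<open>The eigenvectors of the path with vertices \<open>1, \<dots>, L\<close> are \<open>v j =
  \<omega>\<^sup>j - \<omega>\<^sup>-\<^sup>j\<close> with
  \<open>\<omega>\<^sup>2\<^sup>L\<^sup>+\<^sup>2 = 1\<close>, and the end vertex \<open>L\<close> is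
  the combination of them with weights \<open>w\<close>.  A walk from vertex \<open>L\<close> to vertex
  \<open>1\<close> needs at least \<open>k\<close> steps and there is one walk with \<open>k\<close>
  steps, which gives the moments of \<open>(\<lambda> + 2)/4\<close>.\<close>

lemma path_graph_spectrum:
  assumes k: "L = Suc k"
  obtains N :: nat and \<theta> :: "nat \<Rightarrow> real" and w :: "nat \<Rightarrow> complex" and v :: "nat \<Rightarrow> nat \<Rightarrow> complex"
  where "\<And>r. \<bar>\<theta> r\<bar> \<le> 2" "\<And>r. v r 0 = 0" "\<And>r. v r (Suc L) = 0"
    "\<And>r j. of_real (\<theta> r) * v r (Suc j) = v r j + v r (Suc (Suc j))"
    "\<And>j. j \<le> L \<Longrightarrow> (\<Sum>r<N. w r * v r j) = (if j = L then 1 else 0)"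
    "\<And>i. i \<le> k \<Longrightarrow> (\<Sum>r<N. w r * v r 1 * of_real (((\<theta> r + 2) / 4) ^ i)) = (if i = k then of_real ((1 / 4) ^ k) else 0)"
proof -
  define N where "N = 2 * L + 2"
  define z where "z r = cis (- 2 * pi * real r / real N)" for r
  define v where "v r j = cnj (z r) ^ j - z r ^ j" for r j
  define \<theta> where "\<theta> r = 2 * Re (z r)" for r
  define w where "w r = z r ^ L / of_nat N" for r
  have zz: "z r * cnj (z r) = 1" "cnj (z r) * z r = 1" for r by (simp_all add: z_def cis_cnj cis_mult)
  have \<theta>: "of_real (\<theta> r) = z r + cnj (z r)" for r by (simp add: \<theta>_def complex_add_cnj)
  have lam: "\<bar>\<theta> r\<bar> \<le> 2" for r
    unfolding \<theta>_def z_def using abs_cos_le_one[of "- 2 * pi * real r / real N"] by (simp del: abs_cos_le_one)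
  have v0: "v r 0 = 0" for r by (simp add: v_def)
  have vL: "v r (Suc L) = 0" for r
  proof -
    have "z r ^ Suc L = cis (- (pi * real r))"
    proof -
      have "real (Suc L) * (- 2 * pi * real r / real N) = - (pi * real r)" by (simp add: N_def field_simps)
      then show ?thesis unfolding z_def Complex.DeMoivre by (rule arg_cong)
    qed
    moreover have "cnj (cis (- (pi * real r))) = cis (- (pi * real r))"
      by (simp add: complex_eq_iff sin_npi2)
    moreover have "v r (Suc L) = cnj (z r ^ Suc L) - z r ^ Suc L" by (simp only: v_def complex_cnj_power)
    ultimately show ?thesis by (simp only: diff_self)
  qed
  have rec: "of_real (\<theta> r) * v r (Suc j) = v r j + v r (Suc (Suc j))" for r j
  proof -
    have "of_real (\<theta> r) * v r (Suc j) = cnj (z r) ^ j * (z r * cnj (z r)) + cnj (z r) ^ Suc (Suc j) - z r ^ j * (cnj (z r) * z r) - z r ^ Suc (Suc j)"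
      unfolding \<theta> v_def by (simp add: algebra_simps)
    then show ?thesis unfolding zz v_def by simp
  qed
  have N: "N > 0" by (simp add: N_def)
  then have "of_nat N \<noteq> (0::complex)" by simp
  note N = N this
  have zs: "(\<Sum>r<N. z r ^ n) = (if n = 0 then of_nat N else 0)" if "n < N" for n
    using sum_unit_powers[of n N] that by (auto simp: z_def)
  have ortho: "(\<Sum>r<N. w r * v r j) = (if j = L then 1 else 0)" if j: "j \<le> L" for j
  proof -
    have "w r * v r j = (z r ^ (L - j) - z r ^ (L + j)) / of_nat N" for r
    proof -
      have "z r ^ L * cnj (z r) ^ j = z r ^ (L - j) * (z r * cnj (z r)) ^ j"
        using j by (simp add: power_mult_distrib mult.assoc[symmetric] flip: power_add)
      then show ?thesis by (simp add: w_def v_def zz right_diff_distrib power_add diff_divide_distrib)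
    qed
    then have "(\<Sum>r<N. w r * v r j) = ((\<Sum>r<N. z r ^ (L - j)) - (\<Sum>r<N. z r ^ (L + j))) / of_nat N"
      by (simp add: sum_subtractf flip: sum_divide_distrib)
    also have "\<dots> = (if j = L then 1 else 0)"
      using j k N by (subst (1 2) zs) (auto simp: N_def)
    finally show ?thesis .
  qed
  define u where "u i j = (\<Sum>r<N. w r * v r j * of_real (((\<theta> r + 2) / 4) ^ i))" for i j
  have u0: "u i 0 = 0" for i by (simp add: u_def v0)
  have uS: "4 * u (Suc i) (Suc j) = u i j + 2 * u i (Suc j) + u i (Suc (Suc j))" for i j
  proof -
    have "4 * (w r * v r (Suc j) * of_real (((\<theta> r + 2) / 4) ^ Suc i))
        = w r * v r j * of_real (((\<theta> r + 2) / 4) ^ i) + 2 * (w r * v r (Suc j) * of_real (((\<theta> r + 2) / 4) ^ i))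
          + w r * v r (Suc (Suc j)) * of_real (((\<theta> r + 2) / 4) ^ i)" for r
    proof -
      let ?q = "of_real (((\<theta> r + 2) / 4) ^ i) :: complex"
      have "4 * (w r * v r (Suc j) * of_real (((\<theta> r + 2) / 4) ^ Suc i)) = w r * (of_real (\<theta> r) * v r (Suc j) + 2 * v r (Suc j)) * ?q"
        by (simp add: field_simps)
      also have "\<dots> = w r * v r j * ?q + 2 * (w r * v r (Suc j) * ?q) + w r * v r (Suc (Suc j)) * ?q"
        unfolding rec by (simp add: algebra_simps)
      finally show ?thesis .
    qed
    then show ?thesis unfolding u_def by (simp only: sum_distrib_left sum.distrib)
  qed
  have u: "u i j = (if j + i = L \<and> j \<noteq> 0 then of_real ((1 / 4) ^ i) else 0)" if "j + i \<le> L" for i j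
    using that
  proof (induction i arbitrary: j)
    case 0
    then show ?case using ortho[of j] k by (auto simp: u_def)
  next
    case (Suc i)
    show ?case
    proof (cases j)
      case 0
      then show ?thesis using u0 by simp
    next
      case (Suc j')
      have "4 * u (Suc i) (Suc j') = (if Suc (Suc j') + i = L then of_real ((1 / 4) ^ i) else 0)"
        unfolding uS using Suc.IH[of j'] Suc.IH[of "Suc j'"] Suc.IH[of "Suc (Suc j')"] Suc.prems Suc by auto
      then have "4 * u (Suc i) (Suc j') = 4 * (if Suc (Suc j') + i = L then of_real ((1 / 4) ^ Suc i) else 0)"
        by (cases "Suc (Suc j') + i = L") auto
      then have "u (Suc i) (Suc j') = (if Suc (Suc j') + i = L then of_real ((1 / 4) ^ Suc i) else 0)" by (simp only: mult_cancel_left) simp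
      then show ?thesis using Suc by simp
    qed
  qed
  have mom: "(\<Sum>r<N. w r * v r 1 * of_real (((\<theta> r + 2) / 4) ^ i)) = (if i = k then of_real ((1 / 4) ^ k) else 0)" if "i \<le> k" for i
    using u[of 1 i] that k by (auto simp: u_def)
  from lam v0 vL rec ortho mom show thesis by (rule that)
qed

lemma kron_one_assoc:
  assumes V: "V \<in> carrier_mat n q"
  shows "kron (kron V (1\<^sub>m m)) (1\<^sub>m p) = (kron V (1\<^sub>m (m * p)) :: 'a::cstar_algebra mat)"
proof (rule kron_eqI[of _ "n * m" p "q * m" p, symmetric])
  show "kron V (1\<^sub>m (m * p)) \<in> carrier_mat (n * m * p) (q * m * p)"
    using kron_carrier[OF V one_carrier_mat[of "m * p"]] by (simp only: mult.assoc)
  fix i j a b assume ij: "i < n * m" "j < q * m" "a < p" "b < p"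
  then have m: "m > 0" by (cases m) auto
  define i1 i2 j1 j2 where "i1 = i div m" and "i2 = i mod m" and "j1 = j div m" and "j2 = j mod m"
  have d: "i = i1 * m + i2" "j = j1 * m + j2" "i1 < n" "i2 < m" "j1 < q" "j2 < m"
    using ij m by (auto simp: i1_def i2_def j1_def j2_def less_mult_imp_div_less)
  have "kron V (1\<^sub>m (m * p)) $$ (i * p + a, j * p + b) = (kron V (1\<^sub>m (m * p)) $$ (i1 * (m * p) + (i2 * p + a), j1 * (m * p) + (j2 * p + b)) :: 'a)"
    by (simp add: d algebra_simps)
  also have "\<dots> = V $$ (i1, j1) *\<^sub>C (1\<^sub>m (m * p)) $$ (i2 * p + a, j2 * p + b)"
    by (rule kron_entry[OF V one_carrier_mat]) (use d ij in \<open>auto intro!: block_index_less\<close>)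
  also have "(1\<^sub>m (m * p) :: 'a mat) $$ (i2 * p + a, j2 * p + b) = (1\<^sub>m m) $$ (i2, j2) *\<^sub>C (1\<^sub>m p) $$ (a, b)"
    unfolding kron_one[symmetric] by (rule kron_entry[OF one_carrier_mat one_carrier_mat]) (use d ij in auto)
  also have "V $$ (i1, j1) *\<^sub>C \<dots> = kron V (1\<^sub>m m) $$ (i, j) *\<^sub>C (1\<^sub>m p) $$ (a, b)"
    unfolding d(1,2) by (subst kron_entry[OF V one_carrier_mat d(3,5,4,6)]) (simp add: cscale_cscale cscale_complex_def)
  finally show "kron V (1\<^sub>m (m * p)) $$ (i * p + a, j * p + b) = kron V (1\<^sub>m m) $$ (i, j) *\<^sub>C (1\<^sub>m p :: 'a mat) $$ (a, b)" .
qed (use V in auto)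

section \<open>The diagonal of the multilinear forms\<close>

context germ
begin

text \<open>On the half line \<open>P + xK\<close> the leading coefficient is read off at infinity: by
  homogeneity, reversing the order of the coefficients describes the segment that starts at
  \<open>K\<close>.\<close>

lemma A_top_coefficient:
  assumes m: "m \<ge> 1" and P: "cone m P" and K: "cone m K" and ab: "a < m * N2" "b < m * N2"
  obtains c where "\<And>x. x \<ge> 0 \<Longrightarrow> A m k (P + rs x K) $$ (a, b) = (\<Sum>i\<le>k. x ^ i *\<^sub>R c i)" "c k = A m k K $$ (a, b)"
proof -
  note Pc = cone_carrier[OF P] and Kc = cone_carrier[OF K]
  have PK: "cone m (P + rs x K)" if "x \<ge> 0" for x using that by (intro cone_add P cone_rs K)
  have e1: "rs (1 - s) P + rs s (P + rs R K) = P + rs (R * s) K" for s R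
    using Pc Kc by (intro eq_matI) (auto simp: scaleR_add_right mult.commute simp flip: scaleR_add_left)
  have "poly_on k (\<lambda>u. A m k (P + rs (R * u) K) $$ (a, b))" if "R \<ge> 1" for R
    using A_segment[OF m P PK[of R] ab] that unfolding e1 by simp
  then obtain c where c: "\<And>x. x \<ge> 0 \<Longrightarrow> A m k (P + rs x K) $$ (a, b) = (\<Sum>i\<le>k. x ^ i *\<^sub>R c i)"
    using poly_on_extend[of k "\<lambda>x. A m k (P + rs x K) $$ (a, b)"] by blast
  have e2: "rs (1 - s) K + rs s (K + P) = K + rs s P" for s
    using Pc Kc by (intro eq_matI) (auto simp: scaleR_add_right simp flip: scaleR_add_left)
  obtain d where d: "\<And>t. t \<in> {0..1} \<Longrightarrow> A m k (K + rs t P) $$ (a, b) = (\<Sum>i\<le>k. t ^ i *\<^sub>R d i)"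
    using A_segment[OF m K cone_add[OF K P] ab, of k] unfolding e2 poly_on_def by blast
  have fin: "(\<lambda>i. t ^ i *\<^sub>R (if i \<le> k then x i else 0)) sums (\<Sum>i\<le>k. t ^ i *\<^sub>R x i)" for t :: real and x :: "nat \<Rightarrow> 'b"
    using sums_finite[of "{..k}" "\<lambda>i. t ^ i *\<^sub>R (if i \<le> k then x i else 0)"] by simp
  have "(if 0 \<le> k then c (k - 0) else 0) = (if 0 \<le> k then d 0 else 0)"
  proof (rule power_series_unique[of 1 "\<lambda>i. if i \<le> k then c (k - i) else 0" "\<lambda>t. A m k (K + rs t P) $$ (a, b)" "\<lambda>i. if i \<le> k then d i else 0"])
    fix t :: real assume t: "0 < t" "t < 1"
    show "(\<lambda>i. t ^ i *\<^sub>R (if i \<le> k then d i else 0)) sums A m k (K + rs t P) $$ (a, b)"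
      using fin[of t d] d[of t] t by simp
    have "K + rs t P = rs t (P + rs (1 / t) K)"
      using Pc Kc t by (intro eq_matI) (auto simp: scaleR_add_right)
    then have "A m k (K + rs t P) = rs (t ^ k) (A m k (P + rs (1 / t) K))"
      using A_rs[OF m PK[of "1 / t"], of t] t by simp
    then have "A m k (K + rs t P) $$ (a, b) = t ^ k *\<^sub>R (\<Sum>i\<le>k. (1 / t) ^ i *\<^sub>R c i)" using ab c[of "1 / t"] t by simp
    also have "\<dots> = (\<Sum>i\<le>k. t ^ (k - i) *\<^sub>R c i)"
      unfolding scaleR_sum_right
      by (intro sum.cong refl) (use t in \<open>simp add: power_diff power_one_over\<close>)
    also have "\<dots> = (\<Sum>i\<le>k. t ^ i *\<^sub>R c (k - i))"
      by (rule sum.reindex_bij_witness[of _ "\<lambda>i. k - i" "\<lambda>i. k - i"]) auto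
    finally show "(\<lambda>i. t ^ i *\<^sub>R (if i \<le> k then c (k - i) else 0)) sums A m k (K + rs t P) $$ (a, b)"
      using fin[of t "\<lambda>i. c (k - i)"] by simp
  qed simp
  then have "c k = d 0" by simp
  also have "d 0 = (\<Sum>i\<le>k. if i = 0 then d i else 0)" by simp
  also have "\<dots> = (\<Sum>i\<le>k. 0 ^ i *\<^sub>R d i)" by (intro sum.cong) (auto simp: power_0_left)
  also have "\<dots> = A m k (K + rs 0 P) $$ (a, b)" using d[of 0] by simp
  also have "K + rs 0 P = K" using rs_zero_add[OF Kc Pc] .
  finally show thesis using c that by blast
qed

lemma T_eigenvector:
  assumes L: "L \<ge> 1" and H: "H \<in> SU s1 m" and v: "v 0 = 0" "v (Suc L) = 0" "\<And>j. of_real \<mu> * v (Suc j) = v j + v (Suc (Suc j))"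
    and V: "V = mat L 1 (\<lambda>(i, _). v (Suc i))"
  shows "T L m c (\<lambda>_. H) * kron V (1\<^sub>m (m * N1)) = kron V (1\<^sub>m (m * N1)) * (rs c (1\<^sub>m (m * N1)) + rs \<mu> H)"
proof -
  let ?M = "m * N1"
  have Hc: "H \<in> sqmat ?M" by (rule SU_carrier[OF s1 H])
  have Hs: "mstar H = H" by (rule SU_mstar[OF s1 H])
  have Vc: "V \<in> carrier_mat L 1" by (simp add: V)
  define J1 :: "complex mat" where "J1 = superdiag L 1 (\<lambda>_. 1\<^sub>m 1)"
  have J1c: "J1 \<in> sqmat L" using superdiag_carrier[of L 1 "\<lambda>_. 1\<^sub>m 1 :: complex mat"] by (simp add: J1_def)
  have J1e: "J1 $$ (i, j) = (if j = Suc i then 1 else 0)" if "i < L" "j < L" for i j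
    using superdiag_entry[of i L j 0 1 0 "\<lambda>_. 1\<^sub>m 1 :: complex mat"] that by (simp add: J1_def)
  define J where "J = J1 + mstar J1"
  have Jc: "J \<in> sqmat L" using J1c by (simp add: J_def)
  have Je: "J $$ (i, j) = (if j = Suc i then 1 else 0) + (if i = Suc j then 1 else 0)" if "i < L" "j < L" for i j
    using that J1c by (simp add: J_def J1e star_complex_def)
  have sd: "superdiag L ?M (\<lambda>_. H) = kron J1 H"
    using kron_superdiag[of L "\<lambda>_. 1\<^sub>m 1" 1 H ?M] Hc kron_eqI[of H 1 ?M 1 ?M "1\<^sub>m 1" H] by (simp add: J1_def)
  have sd2: "superdiag L ?M (\<lambda>_. H) + mstar (superdiag L ?M (\<lambda>_. H)) = kron J H"
    unfolding sd mstar_kron[OF J1c Hc] Hs J_def by (rule kron_add_left[symmetric]) (use J1c Hc in auto)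
  have JV: "J * V = mscale (of_real \<mu>) V"
  proof (rule eq_matI)
    fix i j assume "i < dim_row (mscale (of_real \<mu>) V)" "j < dim_col (mscale (of_real \<mu>) V)"
    then have ij: "i < L" "j = 0" using Vc by auto
    have "(J * V) $$ (i, j) = (\<Sum>l<L. J $$ (i, l) * V $$ (l, j))"
      using ij Jc Vc by (subst mult_mat_entry) auto
    also have "\<dots> = (\<Sum>l<L. (if l = Suc i then v (Suc (Suc i)) else 0) + (if Suc l = i then v i else 0))"
      using ij by (intro sum.cong refl) (auto simp: Je V)
    also have "\<dots> = (if Suc i < L then v (Suc (Suc i)) else 0) + (\<Sum>l<L. if Suc l = i then v i else 0)"
      by (simp add: sum.distrib)
    also have "(if Suc i < L then v (Suc (Suc i)) else 0) = v (Suc (Suc i))"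
      using ij v(2) by (cases "Suc i = L") auto
    also have "(\<Sum>l<L. if Suc l = i then v i else 0) = v i"
    proof (cases i)
      case (Suc i')
      then have "(\<Sum>l<L. if Suc l = i then v i else 0) = (\<Sum>l<L. if l = i' then v i else 0)" by (intro sum.cong) auto
      then show ?thesis using ij Suc by simp
    qed (use v in simp)
    also have "v (Suc (Suc i)) + v i = mscale (of_real \<mu>) V $$ (i, j)"
      using ij Vc v(3)[of i] by (simp add: V cscale_complex_def)
    finally show "(J * V) $$ (i, j) = mscale (of_real \<mu>) V $$ (i, j)" .
  qed (use Jc Vc in auto)
  have KV: "kron V (1\<^sub>m ?M) \<in> carrier_mat (L * ?M) ?M" using kron_carrier[OF Vc one_carrier_mat[of ?M]] by simp
  have KJ: "kron J H \<in> sqmat (L * ?M)" using Jc Hc by simp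
  have "T L m c (\<lambda>_. H) * kron V (1\<^sub>m ?M) = rs c (1\<^sub>m (L * ?M)) * kron V (1\<^sub>m ?M) + kron J H * kron V (1\<^sub>m ?M)"
    unfolding T_def sd2 by (rule add_mult_distrib_mat[OF _ KJ KV]) simp
  also have "rs c (1\<^sub>m (L * ?M)) * kron V (1\<^sub>m ?M) = rs c (kron V (1\<^sub>m ?M))"
    unfolding rs_def by (rule mult_mscale_one_left[OF KV])
  also have "kron J H * kron V (1\<^sub>m ?M) = kron (J * V) (H * 1\<^sub>m ?M)" by (rule kron_mult[OF Jc Hc Vc one_carrier_mat])
  also have "\<dots> = rs \<mu> (kron V H)"
    unfolding JV right_mult_one_mat[OF Hc] rs_def by (rule mscale_kron[OF Vc Hc, symmetric])
  also have "rs c (kron V (1\<^sub>m ?M)) + rs \<mu> (kron V H) = kron V (1\<^sub>m ?M) * rs c (1\<^sub>m ?M) + kron V (1\<^sub>m ?M) * rs \<mu> H"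
    unfolding rs_def mult_mscale_one_right[OF KV]
    using rs_mult_right[OF KV Hc, of \<mu>] unfolding kron_column_mult[OF Vc Hc] rs_def by simp
  also have "\<dots> = kron V (1\<^sub>m ?M) * (rs c (1\<^sub>m ?M) + rs \<mu> H)"
    by (rule mult_add_distrib_mat[OF KV, symmetric]) (use Hc in auto)
  finally show ?thesis .
qed

text \<open>With all \<open>Y\<^sub>i\<close> equal to \<open>H\<close>, \<open>T = c + J \<otimes>
  H\<close> for the adjacency matrix \<open>J\<close> of a path.  On an eigenvector of \<open>J\<close>
  with eigenvalue \<open>\<lambda>\<close> it acts as \<open>c + \<lambda>H\<close>, and the moments of
  the spectral decomposition single out the coefficient of highest degree in \<open>\<lambda>\<close>,
  which is the value at \<open>H\<close> itself.\<close>

lemma M_diagonal: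
  assumes m: "m \<ge> 1" and H: "cone m H"
  shows "M m k (\<lambda>_. H) = A m k H"
proof (rule eq_matI)
  fix a b assume "a < dim_row (A m k H)" "b < dim_col (A m k H)"
  then have ab: "a < m * N2" "b < m * N2" by auto
  define L where "L = Suc k"
  have Lm: "L * m \<ge> 1" using m by (simp add: L_def)
  note HS = cone_SU[OF H] and Hc = cone_carrier[OF H]
  define c where "c = 2 * (mnorm H + 1)"
  have val: "valid m k c (\<lambda>_. H)"
    unfolding valid_def c_def using SU_MU[OF s1 HS] mnorm_nonneg[of H] by (intro exI[of _ "mnorm H + 1"]) (auto simp: add_nonneg_pos)
  obtain N :: nat and \<theta> w v where sp: "\<And>r. \<bar>\<theta> r\<bar> \<le> (2::real)" "\<And>r. v r 0 = (0::complex)" "\<And>r. v r (Suc L) = 0"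
    "\<And>r j. of_real (\<theta> r) * v r (Suc j) = v r j + v r (Suc (Suc j))"
    "\<And>j. j \<le> L \<Longrightarrow> (\<Sum>r<N. w r * v r j) = (if j = L then 1 else 0)"
    "\<And>i. i \<le> k \<Longrightarrow> (\<Sum>r<N. w r * v r 1 * of_real (((\<theta> r + 2) / 4) ^ i)) = (if i = k then of_real ((1 / 4) ^ k) else 0)"
    by (rule path_graph_spectrum[OF L_def]) blast
  define X where "X = A (L * m) k (T L m c (\<lambda>_. H))"
  have Xc: "X \<in> sqmat (L * (m * N2))" unfolding X_def using A_carrier[of "L * m"] by (simp only: mult.assoc)
  \<comment> \<open>The eigenvalues lie in \<open>[-2, 2]\<close>, where \<open>c\<close> keeps this matrix in the cone.\<close>
  define Q where "Q \<mu> = rs c (1\<^sub>m (m * N1)) + rs \<mu> H" for \<mu>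
  have Qc: "cone m (Q \<mu>)" if "\<bar>\<mu>\<bar> \<le> 2" for \<mu>
    unfolding Q_def
  proof (rule cone_of_norm[OF SU_rs[OF s1 HS]])
    have "\<bar>\<mu>\<bar> * mnorm H \<le> 2 * mnorm H" using that by (intro mult_right_mono mnorm_nonneg)
    then show "mnorm (rs \<mu> H) \<le> c" unfolding mnorm_rs c_def by simp
  qed
  have eig: "(\<Sum>l<L. v r (Suc l) *\<^sub>C X $$ (a, l * (m * N2) + b)) = v r 1 *\<^sub>C A m k (Q (\<theta> r)) $$ (a, b)" for r
  proof -
    define V where "V = mat L 1 (\<lambda>(i, _). v r (Suc i))"
    have Vc: "V \<in> carrier_mat L 1" by (simp add: V_def)
    have S: "kron V (1\<^sub>m m) \<in> carrier_mat (L * m) m" using kron_carrier[OF Vc one_carrier_mat[of m]] by simp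
    have "X * kron (kron V (1\<^sub>m m)) (1\<^sub>m N2) = kron (kron V (1\<^sub>m m)) (1\<^sub>m N2) * A m k (Q (\<theta> r))"
      unfolding X_def
    proof (rule A_inter[OF Lm m _ Qc[OF sp(1)] S])
      show "cone (L * m) (T L m c (\<lambda>_. H))" using valid_cone[OF val] by (simp only: L_def)
      show "T L m c (\<lambda>_. H) * kron (kron V (1\<^sub>m m)) (1\<^sub>m N1) = kron (kron V (1\<^sub>m m)) (1\<^sub>m N1) * Q (\<theta> r)"
        unfolding kron_one_assoc[OF Vc] Q_def
        by (rule T_eigenvector[OF _ HS sp(2) sp(3) sp(4) V_def]) (simp add: L_def)
    qed
    then have "X * kron V (1\<^sub>m (m * N2)) = kron V (A m k (Q (\<theta> r)))"
      unfolding kron_one_assoc[OF Vc] kron_column_mult[OF Vc A_carrier] .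
    moreover have a: "a < L * (m * N2)" using block_index_less[of 0 L a "m * N2"] ab by (simp add: L_def)
    ultimately have "(\<Sum>l<L. V $$ (l, 0) *\<^sub>C X $$ (a, l * (m * N2) + b)) = kron V (A m k (Q (\<theta> r))) $$ (0 * (m * N2) + a, 0 * (m * N2) + b)"
      using kron_column_entry[OF Xc Vc a ab(2)] by simp
    also have "\<dots> = V $$ (0, 0) *\<^sub>C A m k (Q (\<theta> r)) $$ (a, b)"
      by (rule kron_entry[OF Vc A_carrier]) (use ab in \<open>simp_all add: L_def\<close>)
    finally show ?thesis by (simp add: V_def L_def)
  qed
  have "cone m (rs 4 H)" by (rule cone_rs[OF H]) simp
  from A_top_coefficient[OF m Qc[of "- 2"] this ab, of k]
  obtain d where d: "\<And>x. x \<ge> 0 \<Longrightarrow> A m k (Q (- 2) + rs x (rs 4 H)) $$ (a, b) = (\<Sum>i\<le>k. x ^ i *\<^sub>R d i)" "d k = A m k (rs 4 H) $$ (a, b)"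
    by auto
  have AQ: "A m k (Q \<mu>) $$ (a, b) = (\<Sum>i\<le>k. ((\<mu> + 2) / 4) ^ i *\<^sub>R d i)" if "\<bar>\<mu>\<bar> \<le> 2" for \<mu>
  proof -
    have "Q \<mu> = Q (- 2) + rs ((\<mu> + 2) / 4) (rs 4 H)"
    proof -
      have "rs ((\<mu> + 2) / 4) (rs 4 H) = rs (\<mu> + 2) H" by (simp only: rs_rs) (rule arg_cong[where f = "\<lambda>x. rs x H"], simp add: add_divide_distrib)
      then show ?thesis unfolding Q_def using Hc by (intro eq_matI) (auto simp: scaleR_add_left)
    qed
    then show ?thesis using d(1)[of "(\<mu> + 2) / 4"] that by simp
  qed
  have "M m k (\<lambda>_. H) $$ (a, b) = X $$ (0 * (m * N2) + a, k * (m * N2) + b)"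
    unfolding M_eq[OF m val] Psi_def X_def L_def using ab by (intro blk_index)
  also have "\<dots> = (\<Sum>l<L. (if Suc l = L then 1 else 0) *\<^sub>C X $$ (a, l * (m * N2) + b))"
  proof -
    have "(\<Sum>l<L. (if Suc l = L then 1 else 0) *\<^sub>C X $$ (a, l * (m * N2) + b)) = (\<Sum>l<L. if l = k then X $$ (a, k * (m * N2) + b) else 0)"
      by (intro sum.cong) (auto simp: L_def)
    then show ?thesis by (simp add: L_def)
  qed
  also have "\<dots> = (\<Sum>l<L. (\<Sum>r<N. w r * v r (Suc l)) *\<^sub>C X $$ (a, l * (m * N2) + b))"
    by (intro sum.cong refl) (use sp(5) in simp)
  also have "\<dots> = (\<Sum>r<N. w r *\<^sub>C (\<Sum>l<L. v r (Suc l) *\<^sub>C X $$ (a, l * (m * N2) + b)))"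
    unfolding cscale_sum_left cscale_sum_right cscale_cscale by (rule sum.swap)
  also have "\<dots> = (\<Sum>r<N. (w r * v r 1) *\<^sub>C (\<Sum>i\<le>k. ((\<theta> r + 2) / 4) ^ i *\<^sub>R d i))"
    unfolding eig AQ[OF sp(1)] cscale_cscale ..
  also have "\<dots> = (\<Sum>i\<le>k. (\<Sum>r<N. w r * v r 1 * of_real (((\<theta> r + 2) / 4) ^ i)) *\<^sub>C d i)"
    unfolding cscale_sum_left cscale_sum_right cscale_of_real[symmetric] cscale_cscale by (rule sum.swap)
  also have "\<dots> = (\<Sum>i\<le>k. if i = k then (1 / 4) ^ k *\<^sub>R d k else 0)"
    by (intro sum.cong refl) (use sp(6) in \<open>simp only: cscale_of_real cscale_zero_left atMost_iff split: if_splits\<close>, simp)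
  also have "\<dots> = (1 / 4) ^ k *\<^sub>R A m k (rs 4 H) $$ (a, b)" by (simp add: d(2))
  also have "\<dots> = A m k H $$ (a, b)" using A_rs[OF m H, of 4 k] ab by (simp add: power_one_over)
  finally show "M m k (\<lambda>_. H) $$ (a, b) = A m k H $$ (a, b)" .
qed auto

end

section \<open>Entrywise limits\<close>

lemma mnorm_diff_tendsto:
  fixes L :: "'a::cstar_algebra mat"
  assumes L: "L \<in> sqmat N" and u: "\<And>n. u n \<in> sqmat N"
    and lim: "\<And>i j. i < N \<Longrightarrow> j < N \<Longrightarrow> (\<lambda>n. u n $$ (i, j)) \<longlonglongrightarrow> L $$ (i, j)"
  shows "(\<lambda>n. mnorm (u n - L)) \<longlonglongrightarrow> 0"
proof (rule tendsto_sandwich[OF _ _ tendsto_const])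
  have "(\<lambda>n. \<Sum>i<N. \<Sum>j<N. norm (u n $$ (i, j) - L $$ (i, j))) \<longlonglongrightarrow> (\<Sum>i<N. \<Sum>j<N. norm (L $$ (i, j) - L $$ (i, j)))"
    by (intro tendsto_sum tendsto_norm tendsto_diff lim tendsto_const) auto
  then show "(\<lambda>n. \<Sum>i<N. \<Sum>j<N. norm (u n $$ (i, j) - L $$ (i, j))) \<longlonglongrightarrow> 0" by simp
  have "mnorm (u n - L) \<le> (\<Sum>i<N. \<Sum>j<N. norm (u n $$ (i, j) - L $$ (i, j)))" for n
    using mnorm_le_sum[of "u n - L"] L u[of n] by simp
  then show "\<forall>\<^sub>F n in sequentially. mnorm (u n - L) \<le> (\<Sum>i<N. \<Sum>j<N. norm (u n $$ (i, j) - L $$ (i, j)))" by simp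
qed (simp add: mnorm_nonneg)

lemma mnorm_le_of_limit:
  fixes L :: "'a::cstar_algebra mat"
  assumes L: "L \<in> sqmat N" and u: "\<And>n. u n \<in> sqmat N"
    and lim: "\<And>i j. i < N \<Longrightarrow> j < N \<Longrightarrow> (\<lambda>n. u n $$ (i, j)) \<longlonglongrightarrow> L $$ (i, j)"
    and B: "\<And>n. n \<ge> n0 \<Longrightarrow> mnorm (u n) \<le> B"
  shows "mnorm L \<le> B"
proof -
  have "(\<lambda>n. B + mnorm (u n - L)) \<longlonglongrightarrow> B + 0" by (intro tendsto_add tendsto_const mnorm_diff_tendsto[OF L u lim])
  moreover have "mnorm L \<le> B + mnorm (u n - L)" if "n \<ge> n0" for n
  proof -
    have "L = u n + (L - u n)" using L u[of n] by (intro eq_matI) auto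
    then have "mnorm L \<le> mnorm (u n) + mnorm (L - u n)"
      using mnorm_add[OF u[of n] minus_carrier_mat[OF u[of n]], of L] by simp
    then show ?thesis using B[OF that] mnorm_minus_commute[OF L u[of n]] by simp
  qed
  ultimately show ?thesis using LIMSEQ_le_const[of "\<lambda>n. B + mnorm (u n - L)" B "mnorm L"] by auto
qed

lemma mclosure_limit:
  assumes V: "V \<subseteq> sqmat N" and L: "L \<in> sqmat N" and u: "\<And>n. u n \<in> mclosure N V"
    and lim: "\<And>i j. i < N \<Longrightarrow> j < N \<Longrightarrow> (\<lambda>n. u n $$ (i, j)) \<longlonglongrightarrow> L $$ (i, j)"
  shows "L \<in> mclosure N V"
proof -
  have uc: "u n \<in> sqmat N" for n using u by (simp add: mclosure_def)
  have "\<exists>W\<in>V. mnorm (L - W) < e" if e: "e > 0" for e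
  proof -
    have "\<forall>\<^sub>F n in sequentially. mnorm (u n - L) < e / 2"
      using mnorm_diff_tendsto[OF L uc lim] e by (intro order_tendstoD(2)[of _ 0]) auto
    then obtain n where n: "mnorm (u n - L) < e / 2" by (auto dest: eventually_happens)
    obtain W where W: "W \<in> V" "mnorm (u n - W) < e / 2" 
    proof -
      have "\<forall>e>0. \<exists>W\<in>V. mnorm (u n - W) < e" using u[of n] by (simp add: mclosure_def)
      then have "\<exists>W\<in>V. mnorm (u n - W) < e / 2" using half_gt_zero[OF e] by blast
      then show thesis using that by blast
    qed
    then have Wc: "W \<in> sqmat N" using V by blast
    have "L - W = (L - u n) + (u n - W)" using L uc[of n] Wc by (intro eq_matI) auto
    then have "mnorm (L - W) \<le> mnorm (L - u n) + mnorm (u n - W)"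
      using mnorm_add[OF minus_carrier_mat[OF uc[of n], of L] minus_carrier_mat[OF Wc, of "u n"]] by simp
    then show ?thesis using n W mnorm_minus_commute[OF L uc[of n]] by (intro bexI[of _ W]) auto
  qed
  then show ?thesis using L by (auto simp: mclosure_def)
qed

context
  fixes s :: "'a::cstar_algebra opsys"
  assumes s: "opsys s"
begin

lemma MU_sub: "MU s m \<subseteq> sqmat (m * osize s)" using MU_carrier[OF s] by blast

lemma range_carrier: "X \<in> range_level s m \<Longrightarrow> X \<in> sqmat (m * osize s)"
  by (simp add: range_level_def mclosure_def)

lemma MU_range: "X \<in> MU s m \<Longrightarrow> X \<in> range_level s m"
proof -
  assume X: "X \<in> MU s m"
  then have c: "X \<in> sqmat (m * osize s)" by (rule MU_carrier[OF s])
  then have "mnorm (X - X) = 0" by (simp add: mnorm_zero)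
  then show ?thesis using X c unfolding range_level_def mclosure_def by (auto intro!: bexI[of _ X])
qed

text \<open>The range space is closed for entrywise limits, since a matrix has finitely many
  entries.\<close>

lemma range_limit:
  assumes "L \<in> sqmat (m * osize s)" "\<And>n. u n \<in> range_level s m"
    and "\<And>i j. i < m * osize s \<Longrightarrow> j < m * osize s \<Longrightarrow> (\<lambda>n. u n $$ (i, j)) \<longlonglongrightarrow> L $$ (i, j)"
  shows "L \<in> range_level s m"
  unfolding range_level_def by (rule mclosure_limit[OF MU_sub assms[unfolded range_level_def]])

lemma range_approx:
  assumes "X \<in> range_level s m" "e > 0" obtains W where "W \<in> MU s m" "mnorm (X - W) < e"
  using assms by (auto simp: range_level_def mclosure_def)

lemma range_add:
  assumes X: "X \<in> range_level s m" and Y: "Y \<in> range_level s m" shows "X + Y \<in> range_level s m"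
proof -
  note c = range_carrier[OF X] range_carrier[OF Y]
  have "\<exists>W\<in>MU s m. mnorm (X + Y - W) < e" if e: "e > 0" for e
  proof -
    obtain U where U: "U \<in> MU s m" "mnorm (X - U) < e / 2" by (rule range_approx[OF X, of "e / 2"]) (use e in auto)
    obtain V where V: "V \<in> MU s m" "mnorm (Y - V) < e / 2" by (rule range_approx[OF Y, of "e / 2"]) (use e in auto)
    note uv = MU_carrier[OF s U(1)] MU_carrier[OF s V(1)]
    have "X + Y - (U + V) = (X - U) + (Y - V)" using c uv by (intro eq_matI) auto
    then have "mnorm (X + Y - (U + V)) \<le> mnorm (X - U) + mnorm (Y - V)"
      using mnorm_add[OF minus_carrier_mat[OF uv(1), of X] minus_carrier_mat[OF uv(2), of Y]] by simp
    then show ?thesis using U V MU_add[OF s U(1) V(1)] by (intro bexI[of _ "U + V"]) auto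
  qed
  then show ?thesis using c by (auto simp: range_level_def mclosure_def)
qed

lemma range_mscale:
  assumes X: "X \<in> range_level s m" shows "mscale z X \<in> range_level s m"
proof -
  note c = range_carrier[OF X]
  have "\<exists>W\<in>MU s m. mnorm (mscale z X - W) < e" if e: "e > 0" for e
  proof -
    obtain U where U: "U \<in> MU s m" "mnorm (X - U) < e / (cmod z + 1)"
      by (rule range_approx[OF X, of "e / (cmod z + 1)"]) (use e in \<open>auto simp: add_nonneg_pos\<close>)
    note u = MU_carrier[OF s U(1)]
    have "mscale z X - mscale z U = mscale z (X - U)" using c u by (intro eq_matI) (auto simp: cscale_diff_right)
    then have "mnorm (mscale z X - mscale z U) = cmod z * mnorm (X - U)" by (simp add: mnorm_mscale)
    also have "\<dots> \<le> (cmod z + 1) * mnorm (X - U)" by (intro mult_right_mono mnorm_nonneg) simp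
    also have "\<dots> < e" using U(2) by (simp add: less_divide_eq add_nonneg_pos mult.commute)
    finally show ?thesis using MU_mscale[OF s U(1)] by blast
  qed
  then show ?thesis using c by (auto simp: range_level_def mclosure_def)
qed

lemma range_rs: "X \<in> range_level s m \<Longrightarrow> rs t X \<in> range_level s m"
  unfolding rs_def by (rule range_mscale)

lemma range_zero: "0\<^sub>m (m * osize s) (m * osize s) \<in> range_level s m"
  by (rule MU_range[OF MU_zero[OF s]])

lemma range_blk:
  assumes X: "X \<in> range_level s (L * m)" and ij: "i < L" "j < L"
  shows "blk (m * osize s) (m * osize s) i j X \<in> range_level s m"
proof -
  let ?b = "blk (m * osize s) (m * osize s) i j :: 'a mat \<Rightarrow> _"
  have c: "X \<in> sqmat (L * (m * osize s))" using range_carrier[OF X] by (simp only: mult.assoc)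
  have "\<exists>W\<in>MU s m. mnorm (?b X - W) < e" if e: "e > 0" for e
  proof -
    obtain U where U: "U \<in> MU s (L * m)" "mnorm (X - U) < e" by (rule range_approx[OF X e])
    have u: "U \<in> sqmat (L * (m * osize s))" using MU_carrier[OF s U(1)] by (simp only: mult.assoc)
    have "?b X - ?b U = ?b (X - U)"
    proof (rule eq_matI)
      fix a b assume "a < dim_row (?b (X - U))" "b < dim_col (?b (X - U))"
      then have ab: "a < m * osize s" "b < m * osize s" by auto
      have "i * (m * osize s) + a < L * (m * osize s)" "j * (m * osize s) + b < L * (m * osize s)"
        using ab ij by (auto intro: block_index_less)
      then show "(?b X - ?b U) $$ (a, b) = ?b (X - U) $$ (a, b)" using ab u by simp
    qed auto
    then have "mnorm (?b X - ?b U) \<le> mnorm (X - U)"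
      using mnorm_blk[OF minus_carrier_mat[OF u, of X] ij] by simp
    then show ?thesis using U MU_blk[OF s U(1) ij] by (intro bexI[of _ "?b U"]) auto
  qed
  then show ?thesis using c by (auto simp: range_level_def mclosure_def)
qed

lemma range_msum:
  assumes "finite I" "\<And>i. i \<in> I \<Longrightarrow> u i \<in> range_level s m"
  shows "msum (m * osize s) I u \<in> range_level s m"
  using assms
proof (induction I rule: finite_induct)
  case empty
  have "msum (m * osize s) {} u = 0\<^sub>m (m * osize s) (m * osize s)" by (rule eq_matI) (auto simp: msum_def)
  then show ?case using range_zero by simp
next
  case (insert i I)
  have "msum (m * osize s) (insert i I) u = u i + msum (m * osize s) I u"
    using insert range_carrier[of "u i" m] by (intro eq_matI) (auto simp: msum_def)
  then show ?case using insert by (auto intro: range_add)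
qed

end

section \<open>Direct sums and similarities\<close>

definition incl :: "nat \<Rightarrow> nat \<Rightarrow> nat \<Rightarrow> 'a::cstar_algebra mat" where
  "incl p q d = mat p q (\<lambda>(i, j). if i = j + d then 1 else 0)"

lemma incl_carrier [simp]: "incl p q d \<in> carrier_mat p q" by (simp add: incl_def)

lemma incl_dim [simp]: "dim_row (incl p q d) = p" "dim_col (incl p q d) = q" by (simp_all add: incl_def)

lemma kron_incl: "kron (incl p q d) (1\<^sub>m N) = (incl (p * N) (q * N) (d * N) :: 'a::cstar_algebra mat)"
proof (rule kron_eqI[of _ p N q N, symmetric])
  fix i j a b assume ij: "i < p" "j < q" "a < N" "b < N"
  have "i * N + a = (j * N + b) + d * N \<longleftrightarrow> i = j + d \<and> a = b"
  proof
    assume e: "i * N + a = (j * N + b) + d * N"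
    then have e': "i * N + a = (j + d) * N + b" by (simp add: algebra_simps)
    have "(i * N + a) div N = i" "(i * N + a) mod N = a" "((j + d) * N + b) div N = j + d" "((j + d) * N + b) mod N = b"
      using ij by auto
    then show "i = j + d \<and> a = b" unfolding e' by simp
  qed (simp add: algebra_simps)
  moreover have "i * N + a < p * N" "j * N + b < q * N" using ij by (auto intro: block_index_less)
  ultimately show "(incl (p * N) (q * N) (d * N) :: 'a mat) $$ (i * N + a, j * N + b) = incl p q d $$ (i, j) *\<^sub>C 1\<^sub>m N $$ (a, b)"
    using ij by (simp add: incl_def)
qed auto

lemma mult_incl:
  "X \<in> carrier_mat r p \<Longrightarrow> i < r \<Longrightarrow> j < q \<Longrightarrow> j + d < p \<Longrightarrow> (X * incl p q d) $$ (i, j) = X $$ (i, j + d)"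
proof -
  assume X: "X \<in> carrier_mat r p" and ij: "i < r" "j < q" "j + d < p"
  have "(X * incl p q d) $$ (i, j) = (\<Sum>l<p. X $$ (i, l) * incl p q d $$ (l, j))"
    using X ij by (subst mult_mat_entry) auto
  also have "\<dots> = (\<Sum>l<p. if l = j + d then X $$ (i, j + d) else 0)"
    using ij by (intro sum.cong) (auto simp: incl_def)
  finally show ?thesis using ij by simp
qed

lemma incl_mult:
  "X \<in> carrier_mat q r \<Longrightarrow> i < p \<Longrightarrow> j < r \<Longrightarrow> (incl p q d * X) $$ (i, j) = (if d \<le> i \<and> i < q + d then X $$ (i - d, j) else 0)"
proof -
  assume X: "X \<in> carrier_mat q r" and ij: "i < p" "j < r"
  have "(incl p q d * X) $$ (i, j) = (\<Sum>l<q. incl p q d $$ (i, l) * X $$ (l, j))"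
    using X ij by (subst mult_mat_entry) auto
  also have "\<dots> = (\<Sum>l<q. if l = i - d then if d \<le> i then X $$ (i - d, j) else 0 else 0)"
    using ij by (intro sum.cong) (auto simp: incl_def)
  finally show ?thesis by auto
qed

lemma dsum_carrier: "X \<in> sqmat n \<Longrightarrow> Y \<in> sqmat n' \<Longrightarrow> dsum X Y \<in> sqmat (n + n')"
  by (simp add: dsum_def)

lemma dsum_entry:
  "X \<in> sqmat n \<Longrightarrow> Y \<in> sqmat n' \<Longrightarrow> i < n + n' \<Longrightarrow> j < n + n' \<Longrightarrow>
    dsum X Y $$ (i, j) = (if i < n \<and> j < n then X $$ (i, j) else if n \<le> i \<and> n \<le> j then Y $$ (i - n, j - n) else 0)"
  by (auto simp: dsum_def)

lemma mstar_dsum: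
  assumes X: "X \<in> sqmat n" and Y: "Y \<in> sqmat n'"
  shows "mstar (dsum X Y) = dsum (mstar X) (mstar Y)"
proof -
  have c: "mstar X \<in> sqmat n" "mstar Y \<in> sqmat n'" using X Y by auto
  show ?thesis
  proof (rule eq_matI)
    fix i j assume "i < dim_row (dsum (mstar X) (mstar Y))" "j < dim_col (dsum (mstar X) (mstar Y))"
    then have ij: "i < n + n'" "j < n + n'" using dsum_carrier[OF c] by auto
    then show "mstar (dsum X Y) $$ (i, j) = dsum (mstar X) (mstar Y) $$ (i, j)"
      using dsum_carrier[OF X Y] X Y unfolding dsum_entry[OF c ij]
      by (auto simp: dsum_entry[OF X Y ij(2,1)])
  qed (use dsum_carrier[OF X Y] dsum_carrier[OF c] in auto)
qed

lemma dsum_incl: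
  assumes X: "X \<in> sqmat n" and Y: "Y \<in> sqmat n'"
  shows "dsum X Y * incl (n + n') n 0 = incl (n + n') n 0 * X"
    and "dsum X Y * incl (n + n') n' n = incl (n + n') n' n * Y"
  using dsum_carrier[OF X Y] X Y
  by (auto intro!: eq_matI simp: mult_incl[OF dsum_carrier[OF X Y]] incl_mult[OF X] incl_mult[OF Y] dsum_entry[OF X Y] simp del: index_mult_mat(1))

text \<open>The two inclusions together exhaust the columns.\<close>

lemma eq_dsumI:
  assumes W: "W \<in> sqmat (n + n')" and X: "X \<in> sqmat n" and Y: "Y \<in> sqmat n'"
    and 1: "W * incl (n + n') n 0 = incl (n + n') n 0 * X" and 2: "W * incl (n + n') n' n = incl (n + n') n' n * Y"
  shows "W = dsum X Y"
proof (rule eq_matI)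
  fix i j assume "i < dim_row (dsum X Y)" "j < dim_col (dsum X Y)"
  then have ij: "i < n + n'" "j < n + n'" using dsum_carrier[OF X Y] by auto
  show "W $$ (i, j) = dsum X Y $$ (i, j)"
  proof (cases "j < n")
    case True
    have "W $$ (i, j) = (W * incl (n + n') n 0) $$ (i, j)" using mult_incl[OF W ij(1) True, of 0] ij by simp
    then show ?thesis unfolding 1 incl_mult[OF X ij(1) True] dsum_entry[OF X Y ij] using True by auto
  next
    case False
    then have j': "j - n < n'" "(j - n) + n = j" using ij by auto
    have "W $$ (i, j) = (W * incl (n + n') n' n) $$ (i, j - n)" using mult_incl[OF W ij(1) j'(1), of n] j' ij by simp
    then show ?thesis unfolding 2 incl_mult[OF Y ij(1) j'(1)] dsum_entry[OF X Y ij] using False ij by auto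
  qed
qed (use W dsum_carrier[OF X Y] in auto)

lemma MU_conj:
  assumes s: "opsys s" and X: "X \<in> MU s n" and A: "A \<in> carrier_mat p n" and B: "B \<in> carrier_mat n p"
  shows "kron A (1\<^sub>m (osize s)) * X * kron B (1\<^sub>m (osize s)) \<in> MU s p"
  using X unfolding MU_def
proof (induction rule: tensor_span.induct)
  let ?A = "kron A (1\<^sub>m (osize s)) :: 'a mat" and ?B = "kron B (1\<^sub>m (osize s)) :: 'a mat"
  have Ac: "?A \<in> carrier_mat (p * osize s) (n * osize s)" "?B \<in> carrier_mat (n * osize s) (p * osize s)" using A B by auto
  {
    case zero
    have "?A * 0\<^sub>m (n * osize s) (n * osize s) * ?B = 0\<^sub>m (p * osize s) (p * osize s)"
      unfolding right_mult_zero_mat[OF Ac(1)] by (rule left_mult_zero_mat[OF Ac(2)])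
    then show ?case by (simp add: tensor_span.zero)
  next
    case (add T r X)
    have r: "r \<in> sqmat (osize s)" using elemsD[OF s add(2)] by simp
    have Xc: "X \<in> sqmat (n * osize s)" using span_carrier[OF s order_refl add(3)] .
    have k: "kron T r \<in> sqmat (n * osize s)" using add r by simp
    have "?A * (kron T r + X) * ?B = ?A * kron T r * ?B + ?A * X * ?B"
      using mult_add_distrib_mat[OF Ac(1) k Xc] add_mult_distrib_mat[OF mult_carrier_mat[OF Ac(1) k] mult_carrier_mat[OF Ac(1) Xc] Ac(2)] by simp
    also have "?A * kron T r * ?B = kron (A * T * B) r"
      using kron_mult[OF A one_carrier_mat add(1) r] kron_mult[OF mult_carrier_mat[OF A add(1)] r B one_carrier_mat]
        left_mult_one_mat[OF r] right_mult_one_mat[OF r] by simp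
    finally have e: "?A * (kron T r + X) * ?B = kron (A * T * B) r + ?A * X * ?B" .
    have "A * T * B \<in> sqmat p" using A B add(1) by (intro mult_carrier_mat) auto
    then show ?case unfolding e using add by (intro tensor_span.add) auto
  }
qed

lemma MU_dsum:
  assumes s: "opsys s" and X: "X \<in> MU s n" and Y: "Y \<in> MU s n'"
  shows "dsum X Y \<in> MU s (n + n')"
proof -
  let ?N = "osize s" let ?p = "(n + n') * ?N"
  let ?I = "incl (n + n') n 0 :: complex mat" and ?J = "incl (n + n') n' n :: complex mat"
  let ?K = "incl ?p (n * ?N) 0 :: 'a mat" and ?L = "incl ?p (n' * ?N) (n * ?N) :: 'a mat"
  have Xc: "X \<in> sqmat (n * ?N)" and Yc: "Y \<in> sqmat (n' * ?N)" using MU_carrier[OF s] X Y by auto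
  have K: "kron ?I (1\<^sub>m ?N) = ?K" "kron ?J (1\<^sub>m ?N) = ?L"
    "kron (mstar ?I) (1\<^sub>m ?N) = mstar ?K" "kron (mstar ?J) (1\<^sub>m ?N) = mstar ?L"
    using kron_incl[of "n + n'" n 0 ?N, where 'a='a] kron_incl[of "n + n'" n' n ?N, where 'a='a]
      mstar_kron[of ?I "n + n'" n "1\<^sub>m ?N :: 'a mat" ?N ?N] mstar_kron[of ?J "n + n'" n' "1\<^sub>m ?N :: 'a mat" ?N ?N] by auto
  have right: "(Z * mstar (incl p q d)) $$ (i, j) = (if d \<le> j \<and> j < q + d then Z $$ (i, j - d) else 0)"
    if "Z \<in> carrier_mat p q" "i < p" "j < p" for Z :: "'a mat" and p q d i j
  proof -
    have "(Z * mstar (incl p q d)) $$ (i, j) = (\<Sum>l<q. Z $$ (i, l) * mstar (incl p q d) $$ (l, j))"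
      using that by (subst mult_mat_entry) auto
    also have "\<dots> = (\<Sum>l<q. if l = j - d then if d \<le> j then Z $$ (i, j - d) else 0 else 0)"
      using that by (intro sum.cong) (auto simp: incl_def)
    finally show ?thesis by auto
  qed
  have "dsum X Y = ?K * X * mstar ?K + ?L * Y * mstar ?L"
  proof (rule eq_matI)
    fix i j assume "i < dim_row (?K * X * mstar ?K + ?L * Y * mstar ?L)" "j < dim_col (?K * X * mstar ?K + ?L * Y * mstar ?L)"
    then have ij: "i < ?p" "j < ?p" by auto
    then have ij': "i < n * ?N + n' * ?N" "j < n * ?N + n' * ?N" by (auto simp: algebra_simps)
    have KX: "?K * X \<in> carrier_mat ?p (n * ?N)" "?L * Y \<in> carrier_mat ?p (n' * ?N)" using Xc Yc by auto
    show "dsum X Y $$ (i, j) = (?K * X * mstar ?K + ?L * Y * mstar ?L) $$ (i, j)"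
      unfolding dsum_entry[OF Xc Yc ij'] using ij ij'
      by (auto simp: right[OF KX(1) ij] right[OF KX(2) ij] incl_mult[OF Xc] incl_mult[OF Yc])
  qed (use dsum_carrier[OF Xc Yc] in \<open>auto simp: algebra_simps\<close>)
  moreover have "?K * X * mstar ?K \<in> MU s (n + n')" "?L * Y * mstar ?L \<in> MU s (n + n')"
    using MU_conj[OF s X, of ?I "n + n'" "mstar ?I"] MU_conj[OF s Y, of ?J "n + n'" "mstar ?J"] unfolding K by auto
  ultimately show ?thesis using MU_add[OF s] by simp
qed

lemma conj_msum_kron:
  fixes r :: "'i \<Rightarrow> 'a::cstar_algebra mat"
  assumes I: "finite I" and u: "\<And>i. i \<in> I \<Longrightarrow> u i \<in> sqmat m" and r: "\<And>i. i \<in> I \<Longrightarrow> r i \<in> sqmat N"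
    and S: "S' \<in> sqmat m" "S \<in> sqmat m"
  shows "kron S' (1\<^sub>m N) * msum (m * N) I (\<lambda>i. kron (u i) (r i)) * kron S (1\<^sub>m N)
    = msum (m * N) I (\<lambda>i. kron (S' * u i * S) (r i))"
  using I u r
proof (induction I rule: finite_induct)
  let ?A = "kron S' (1\<^sub>m N) :: 'a mat" and ?B = "kron S (1\<^sub>m N) :: 'a mat"
  have Ac: "?A \<in> sqmat (m * N)" "?B \<in> sqmat (m * N)" using S by auto
  {
    case empty
    have z: "msum (m * N) {} f = 0\<^sub>m (m * N) (m * N)" for f :: "'i \<Rightarrow> 'a mat" by (rule eq_matI) (auto simp: msum_def)
    show ?case unfolding z right_mult_zero_mat[OF Ac(1)] by (rule left_mult_zero_mat[OF Ac(2)])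
  next
    case (insert i I)
    let ?X = "msum (m * N) I (\<lambda>i. kron (u i) (r i))"
    have ui: "u i \<in> sqmat m" and ri: "r i \<in> sqmat N" using insert by auto
    have k: "kron (u i) (r i) \<in> sqmat (m * N)" "?X \<in> sqmat (m * N)" using ui ri by (auto simp: msum_def)
    have e: "msum (m * N) (insert i I) f = f i + msum (m * N) I f" if "f i \<in> sqmat (m * N)" for f :: "'i \<Rightarrow> 'a mat"
      using insert(1,2) that by (intro eq_matI) (auto simp: msum_def)
    have Su: "S' * u i * S \<in> sqmat m" using S ui by auto
    have "?A * (kron (u i) (r i) + ?X) * ?B = ?A * kron (u i) (r i) * ?B + ?A * ?X * ?B"
      using mult_add_distrib_mat[OF Ac(1) k] add_mult_distrib_mat[OF mult_carrier_mat[OF Ac(1) k(1)] mult_carrier_mat[OF Ac(1) k(2)] Ac(2)] by simp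
    also have "?A * kron (u i) (r i) * ?B = kron (S' * u i * S) (r i)"
      using kron_mult[OF S(1) one_carrier_mat ui ri] kron_mult[OF mult_carrier_mat[OF S(1) ui] ri S(2) one_carrier_mat]
        left_mult_one_mat[OF ri] right_mult_one_mat[OF ri] by simp
    also have "?A * ?X * ?B = msum (m * N) I (\<lambda>i. kron (S' * u i * S) (r i))" using insert by simp
    finally show ?case using e[of "\<lambda>i. kron (u i) (r i)"] e[of "\<lambda>i. kron (S' * u i * S) (r i)"] k kron_carrier[OF Su ri] by simp
  }
qed

lemma word_pow_conj:
  assumes S: "S \<in> sqmat m" "S' \<in> sqmat m" "S * S' = 1\<^sub>m m" "S' * S = 1\<^sub>m m"
    and t: "\<And>i. i \<in> set \<alpha> \<Longrightarrow> t i \<in> sqmat m"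
  shows "word_pow m (\<lambda>i. S' * t i * S) \<alpha> = S' * word_pow m t \<alpha> * S"
  using t
proof (induction \<alpha>)
  case Nil
  show ?case using S by simp
next
  case (Cons i \<alpha>)
  let ?w = "word_pow m t \<alpha>"
  have w: "?w \<in> sqmat m" using Cons.prems by (intro word_pow_carrier) auto
  have ti: "t i \<in> sqmat m" using Cons.prems by simp
  have a: "A * B * D = A * (B * D)" if "A \<in> sqmat m" "B \<in> sqmat m" "D \<in> sqmat m" for A B D :: "complex mat"
    using assoc_mult_mat[OF that] .
  have "word_pow m (\<lambda>i. S' * t i * S) (i # \<alpha>) = S' * t i * S * (S' * ?w * S)" using Cons by simp
  also have "\<dots> = S' * (t i * ((S * S') * (?w * S)))"
    using S(1,2) ti w by (simp only: a mult_carrier_mat)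
  also have "\<dots> = S' * (t i * ?w) * S"
    unfolding S(3) left_mult_one_mat[OF mult_carrier_mat[OF w S(1)]] using S(1,2) ti w by (simp only: a mult_carrier_mat)
  finally show ?case by simp
qed

section \<open>The homogeneous parts\<close>

lemma lev_universe:
  assumes s: "opsys s" and n: "n \<ge> 1" and X: "X \<in> lev s (universe (MU s)) n"
  shows "X \<in> MU s n"
proof -
  obtain n' where n': "X \<in> MU s n'" using X by (auto simp: lev_def universe_def)
  have "dim_row X = n * osize s" "dim_row X = n' * osize s" using X MU_carrier[OF s n'] by (auto simp: lev_def)
  then have "n' = n" using s by (auto simp: opsys_def)
  then show ?thesis using n' by simp
qed

context germ
begin

text \<open>Taylor coefficients are limits of difference quotients of values, by induction on the
  degree.\<close>

lemma A_range:
  assumes m: "m \<ge> 1" and P: "cone m P"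
  shows "A m k P \<in> range_level s2 m"
proof -
  have small: "A m k P \<in> range_level s2 m" if P: "cone m P" and n: "mnorm P \<le> p" for P
  proof (induction k rule: less_induct)
    case (less k)
    have CN: "C * (mnorm P / p) ^ j \<le> C" for j
      using n p C_nonneg mnorm_nonneg[of P] by (intro mult_left_le power_le_one) auto
    define t where "t n = 1 / (real n + 2)" for n
    have t: "0 < t n" "t n \<le> 1/2" for n by (auto simp: t_def field_simps)
    have tn: "\<bar>t n\<bar> * mnorm P < p" for n
    proof -
      have "\<bar>t n\<bar> * mnorm P \<le> (1/2) * p" using t[of n] n by (intro mult_mono) (auto simp: mnorm_nonneg)
      then show ?thesis using p by simp
    qed
    \<comment> \<open>The Taylor polynomial of lower degree, already known to lie in the range space.\<close>
    define Z where "Z n = msum (m * N2) {..<k} (\<lambda>j. rs (t n ^ j) (A m j P))" for n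
    define U where "U n = rs (1 / t n ^ k) (g m (rs (t n) P) + rs (-1) (Z n))" for n
    have gr: "g m (rs (t n) P) \<in> range_level s2 m" for n
    proof -
      have "mnorm (rs (t n) P) < 4 * p" using tn[of n] p by (simp add: mnorm_rs)
      then show ?thesis using g_in[OF m SU_rs[OF s1 cone_SU[OF P]]] by (intro MU_range[OF s2] SU_MU[OF s2]) auto
    qed
    have Zr: "Z n \<in> range_level s2 m" for n
      unfolding Z_def by (rule range_msum[OF s2]) (use less range_rs[OF s2] in auto)
    show ?case
    proof (rule range_limit[OF s2 A_carrier])
      show "U n \<in> range_level s2 m" for n unfolding U_def by (intro range_rs[OF s2] range_add[OF s2] gr Zr)
      fix i j assume ij: "i < m * N2" "j < m * N2"
      have b: "norm (U n $$ (i, j) - A m k P $$ (i, j)) \<le> 2 * C * t n" for n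
      proof -
        let ?g = "g m (rs (t n) P) $$ (i, j)"
        have "norm (A m k P $$ (i, j)) \<le> C" for k
          using norm_entry_le_mnorm[of i "A m k P" j] ij A_bound[OF m P, of k] CN[of k] by simp
        from power_tail_bound[OF A_series[OF m P tn[of n] ij] this, of "Suc k"]
        have "norm (?g - (\<Sum>j'<Suc k. t n ^ j' *\<^sub>R A m j' P $$ (i, j))) \<le> 2 * C * \<bar>t n\<bar> ^ Suc k" using t[of n] by simp
        also have "?g - (\<Sum>j'<Suc k. t n ^ j' *\<^sub>R A m j' P $$ (i, j)) = t n ^ k *\<^sub>R (U n $$ (i, j) - A m k P $$ (i, j))"
        proof -
          have "U n $$ (i, j) = (1 / t n ^ k) *\<^sub>R (?g - (\<Sum>j'<k. t n ^ j' *\<^sub>R A m j' P $$ (i, j)))"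
            using ij range_carrier[OF s2 gr[of n]] by (simp add: U_def Z_def msum_def)
          then show ?thesis using t[of n] by (simp add: scaleR_diff_right)
        qed
        finally have "t n ^ k * norm (U n $$ (i, j) - A m k P $$ (i, j)) \<le> t n ^ k * (2 * C * t n)"
          using t[of n] by (simp add: mult_ac)
        then show ?thesis by (rule mult_left_le_imp_le) (use t[of n] in simp)
      qed
      have "(\<lambda>n. 1 / (real (n + 2))) \<longlonglongrightarrow> 0" by (rule LIMSEQ_ignore_initial_segment[OF lim_1_over_n])
      then have "(\<lambda>n. 2 * C * t n) \<longlonglongrightarrow> 2 * C * 0" unfolding t_def by (intro tendsto_mult tendsto_const) (simp add: add.commute)
      then have "(\<lambda>n. 2 * C * t n) \<longlonglongrightarrow> 0" by (simp only: mult_zero_right)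
      moreover have "\<forall>\<^sub>F n in sequentially. norm (U n $$ (i, j) - A m k P $$ (i, j)) \<le> 2 * C * t n"
        by (rule always_eventually) (rule allI, rule b)
      ultimately have "(\<lambda>n. U n $$ (i, j) - A m k P $$ (i, j)) \<longlonglongrightarrow> 0" by (rule Lim_null_comparison[rotated])
      then show "(\<lambda>n. U n $$ (i, j)) \<longlonglongrightarrow> A m k P $$ (i, j)" by (rule LIM_zero_cancel)
    qed
  qed
  define q where "q = p / (mnorm P + 1)"
  have q: "q > 0" using p mnorm_nonneg[of P] by (simp add: q_def add_nonneg_pos)
  have "mnorm (rs q P) \<le> p"
    using p mnorm_nonneg[of P] by (simp add: mnorm_rs q_def abs_of_pos add_nonneg_pos divide_le_eq)
  then have "A m k (rs q P) \<in> range_level s2 m" using q by (intro small cone_rs P) auto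
  then have "rs (1 / q ^ k) (rs (q ^ k) (A m k P)) \<in> range_level s2 m"
    unfolding A_rs[OF m P less_imp_le[OF q], symmetric] by (rule range_rs[OF s2])
  then show ?thesis using q by simp
qed

lemma M_range:
  assumes m: "m \<ge> 1" and Y: "\<And>i. i < k \<Longrightarrow> Y i \<in> MU s1 m"
  shows "M m k Y \<in> range_level s2 m"
  unfolding M_def Psi_def
  by (rule range_blk[OF s2 A_range[OF _ valid_cone[OF valid_default]]]) (use m Y in auto)

text \<open>The level of a point is recovered from its size.\<close>

definition hpart :: "nat \<Rightarrow> 'a mat \<Rightarrow> 'b mat" where
  "hpart k Y = M (dim_row Y div N1) k (\<lambda>_. Y)"

lemma hpart_eq: "Y \<in> MU s1 m \<Longrightarrow> hpart k Y = M m k (\<lambda>_. Y)"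
  using MUc[of Y m] N_pos by (simp add: hpart_def)

lemma hpart_lin_form:
  assumes "m \<ge> 1" "\<And>i. i < d \<Longrightarrow> t i \<in> sqmat m" "\<And>i. i < d \<Longrightarrow> H i \<in> elems s1"
  shows "hpart k (lin_form s1 m d H t) = word_sum s2 m d k (\<lambda>\<alpha>. M 1 k (\<lambda>l. H (\<alpha> ! l))) t"
proof -
  have "dim_row (lin_form s1 m d H t) = m * N1" by (simp add: lin_form_def msum_def)
  then have "hpart k (lin_form s1 m d H t) = M m k (\<lambda>_. lin_form s1 m d H t)"
    using N_pos by (simp add: hpart_def)
  then show ?thesis using M_lin_form[OF assms] by simp
qed

text \<open>The inclusions of the summands are isometries that intertwine both \<open>X \<oplus>
  Y\<close> and its adjoint, as the multilinear forms require.\<close>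

lemma hpart_dsum:
  assumes n: "n \<ge> 1" "n' \<ge> 1" and X: "X \<in> MU s1 n" and Y: "Y \<in> MU s1 n'"
  shows "hpart k (dsum X Y) = dsum (hpart k X) (hpart k Y)"
proof -
  have W: "dsum X Y \<in> MU s1 (n + n')" by (rule MU_dsum[OF s1 X Y])
  note Xc = MUc[OF X] and Yc = MUc[OF Y]
  have Xs: "mstar X \<in> sqmat (n * N1)" and Ys: "mstar Y \<in> sqmat (n' * N1)" using Xc Yc by auto
  have e: "(n + n') * N = n * N + n' * N" for N by (simp add: algebra_simps)
  have 1: "M (n + n') k (\<lambda>_. dsum X Y) * kron (incl (n + n') n 0) (1\<^sub>m N2) = kron (incl (n + n') n 0) (1\<^sub>m N2) * M n k (\<lambda>_. X)"
  proof (rule M_inter[where S = "\<lambda>_. incl (n + n') n 0"])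
    show "dsum X Y * kron (incl (n + n') n 0) (1\<^sub>m N1) = kron (incl (n + n') n 0) (1\<^sub>m N1) * X"
      unfolding kron_incl e using dsum_incl(1)[OF Xc Yc] by simp
    show "mstar (dsum X Y) * kron (incl (n + n') n 0) (1\<^sub>m N1) = kron (incl (n + n') n 0) (1\<^sub>m N1) * mstar X"
      unfolding kron_incl e mstar_dsum[OF Xc Yc] using dsum_incl(1)[OF Xs Ys] by simp
  qed (use n W X in auto)
  have 2: "M (n + n') k (\<lambda>_. dsum X Y) * kron (incl (n + n') n' n) (1\<^sub>m N2) = kron (incl (n + n') n' n) (1\<^sub>m N2) * M n' k (\<lambda>_. Y)"
  proof (rule M_inter[where S = "\<lambda>_. incl (n + n') n' n"])
    show "dsum X Y * kron (incl (n + n') n' n) (1\<^sub>m N1) = kron (incl (n + n') n' n) (1\<^sub>m N1) * Y"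
      unfolding kron_incl e using dsum_incl(2)[OF Xc Yc] by simp
    show "mstar (dsum X Y) * kron (incl (n + n') n' n) (1\<^sub>m N1) = kron (incl (n + n') n' n) (1\<^sub>m N1) * mstar Y"
      unfolding kron_incl e mstar_dsum[OF Xc Yc] using dsum_incl(2)[OF Xs Ys] by simp
  qed (use n W Y in auto)
  show ?thesis
    unfolding hpart_eq[OF W] hpart_eq[OF X] hpart_eq[OF Y]
    by (rule eq_dsumI[OF _ M_carrier M_carrier]) (use 1 2 M_carrier[of "n + n'"] in \<open>auto simp: kron_incl e\<close>)
qed

text \<open>A similarity that is not unitary is not an intertwiner for adjoints, but it passes through
  the word expansion.\<close>

lemma hpart_conj:
  assumes n: "n \<ge> 1" and X: "X \<in> MU s1 n" and S: "S \<in> sqmat n" "S' \<in> sqmat n" "S * S' = 1\<^sub>m n" "S' * S = 1\<^sub>m n"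
  shows "conj_by s2 S' S (hpart k X) = hpart k (conj_by s1 S' S X)"
proof -
  obtain d H t where H: "\<And>i. i < d \<Longrightarrow> H i \<in> elems s1" and t: "\<And>i. i < d \<Longrightarrow> t i \<in> sqmat n" and Xe: "X = lin_form s1 n d H t"
    using MU_lin_form[OF s1 X] by metis
  have Hc: "H i \<in> sqmat N1" if "i < d" for i using elemsD[OF s1 H[OF that]] by simp
  have t': "S' * t i * S \<in> sqmat n" if "i < d" for i using S t[OF that] by auto
  let ?a = "\<lambda>\<alpha>. M 1 k (\<lambda>l. H (\<alpha> ! l))"
  have ac: "?a \<alpha> \<in> sqmat N2" for \<alpha> using M_carrier[of 1] by simp
  have w: "word_pow n t \<alpha> \<in> sqmat n" if "\<alpha> \<in> words d k" for \<alpha>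
    using that t by (intro word_pow_carrier) (auto simp: words_def)
  have hX: "hpart k (lin_form s1 n d H t) = word_sum s2 n d k ?a t" by (rule hpart_lin_form[OF n]; (rule t H; assumption))
  have cX: "conj_by s1 S' S X = lin_form s1 n d H (\<lambda>i. S' * t i * S)"
    unfolding Xe conj_by_def lin_form_def by (rule conj_msum_kron) (use t Hc S in auto)
  have "hpart k (conj_by s1 S' S X) = word_sum s2 n d k ?a (\<lambda>i. S' * t i * S)"
    unfolding cX by (rule hpart_lin_form[OF n]; (rule t' H; assumption))
  also have "\<dots> = msum (n * N2) (words d k) (\<lambda>\<alpha>. kron (S' * word_pow n t \<alpha> * S) (?a \<alpha>))"
  proof -
    have "word_pow n (\<lambda>i. S' * t i * S) \<alpha> = S' * word_pow n t \<alpha> * S" if "\<alpha> \<in> words d k" for \<alpha>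
      using that t by (intro word_pow_conj S) (auto simp: words_def)
    then show ?thesis unfolding word_sum_def msum_def by (intro cong_mat refl) (simp add: case_prod_unfold cong: sum.cong)
  qed
  also have "\<dots> = conj_by s2 S' S (hpart k X)"
    unfolding Xe conj_by_def hX word_sum_def
    by (rule conj_msum_kron[symmetric]) (use w ac S in auto)
  finally show ?thesis ..
qed

lemma hpart_nc_homogeneous: "nc_homogeneous s1 s2 k (hpart k)"
  unfolding nc_homogeneous_def
proof (intro conjI allI impI)
  show "free_map s1 (universe (MU s1)) s2 (range_level s2) (hpart k)"
    unfolding free_map_def
  proof (intro conjI allI impI ballI)
    fix n :: nat and X assume n: "1 \<le> n" and "X \<in> lev s1 (universe (MU s1)) n"
    then have X: "X \<in> MU s1 n" by (intro lev_universe[OF s1])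
    show "hpart k X \<in> range_level s2 n" unfolding hpart_eq[OF X] by (rule M_range[OF n X])
  next
    fix X Y assume "X \<in> universe (MU s1)" "Y \<in> universe (MU s1)"
    then show "hpart k (dsum X Y) = dsum (hpart k X) (hpart k Y)" by (auto simp: universe_def intro: hpart_dsum)
  next
    fix n :: nat and X S S' assume n: "1 \<le> n" and "X \<in> lev s1 (universe (MU s1)) n" and S: "S \<in> sqmat n" "S' \<in> sqmat n"
      and i: "inverts_mat S S' \<and> inverts_mat S' S \<and> conj_by s1 S' S X \<in> universe (MU s1)"
    then have X: "X \<in> MU s1 n" by (intro lev_universe[OF s1])
    show "conj_by s2 S' S (hpart k X) = hpart k (conj_by s1 S' S X)"
      by (rule hpart_conj[OF n X S]) (use i S in \<open>auto simp: inverts_mat_def\<close>)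
  qed
next
  fix d :: nat and H :: "nat \<Rightarrow> 'a mat" assume H: "\<forall>i<d. H i \<in> elems s1"
  define a where "a \<alpha> = (if \<alpha> \<in> words d k then M 1 k (\<lambda>l. H (\<alpha> ! l)) else 0\<^sub>m (1 * N2) (1 * N2))" for \<alpha>
  have "a \<alpha> \<in> range_level s2 1" for \<alpha>
  proof (cases "\<alpha> \<in> words d k")
    case True
    have "H (\<alpha> ! l) \<in> MU s1 1" if "l < k" for l
      using True that H nth_mem[of l \<alpha>] by (intro elems_MU1) (auto simp: words_def simp del: nth_mem)
    then show ?thesis using True M_range[of 1 k "\<lambda>l. H (\<alpha> ! l)"] by (simp add: a_def)
  next
    case False
    then show ?thesis using range_zero[OF s2, of 1] by (simp add: a_def)
  qed
  moreover have "hpart k (lin_form s1 m d H t) = word_sum s2 m d k a t" if "1 \<le> m" "\<forall>i<d. t i \<in> sqmat m" for m t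
  proof -
    have "word_sum s2 m d k (\<lambda>\<alpha>. M 1 k (\<lambda>l. H (\<alpha> ! l))) t = word_sum s2 m d k a t"
      unfolding word_sum_def msum_def by (intro cong_mat refl) (simp add: a_def case_prod_unfold cong: sum.cong)
    then show ?thesis using hpart_lin_form[of m d t H k] that H by simp
  qed
  ultimately show "\<exists>a. (\<forall>\<alpha>. a \<alpha> \<in> range_level s2 1) \<and> (\<forall>m\<ge>1. \<forall>t. (\<forall>i<d. t i \<in> sqmat m) \<longrightarrow>
      hpart k (lin_form s1 m d H t) = word_sum s2 m d k a t)" by blast
qed

end

section \<open>Convergence of the homogeneous expansion\<close>

lemma poly_shift:
  fixes c :: "nat \<Rightarrow> 'b::real_vector"
  shows "\<exists>d. \<forall>u::real. (\<Sum>i\<le>k. (u + 1) ^ i *\<^sub>R c i) = (\<Sum>j\<le>k. u ^ j *\<^sub>R d j)"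
proof (intro exI allI)
  fix u :: real
  have "(\<Sum>i\<le>k. (u + 1) ^ i *\<^sub>R c i) = (\<Sum>i\<le>k. \<Sum>j\<le>k. u ^ j *\<^sub>R (of_nat (i choose j) *\<^sub>R c i))"
  proof (intro sum.cong refl)
    fix i assume i: "i \<in> {..k}"
    have "(u + 1) ^ i = (\<Sum>j\<le>i. of_nat (i choose j) * u ^ j)" by (simp add: binomial_ring)
    also have "\<dots> = (\<Sum>j\<le>k. of_nat (i choose j) * u ^ j)"
      using i by (intro sum.mono_neutral_left) (auto simp: binomial_eq_0)
    finally show "(u + 1) ^ i *\<^sub>R c i = (\<Sum>j\<le>k. u ^ j *\<^sub>R (of_nat (i choose j) *\<^sub>R c i))"
      by (simp add: scaleR_sum_left mult.commute)
  qed
  also have "\<dots> = (\<Sum>j\<le>k. u ^ j *\<^sub>R (\<Sum>i\<le>k. of_nat (i choose j) *\<^sub>R c i))"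
    unfolding scaleR_sum_right by (rule sum.swap)
  finally show "(\<Sum>i\<le>k. (u + 1) ^ i *\<^sub>R c i) = (\<Sum>j\<le>k. u ^ j *\<^sub>R (\<Sum>i\<le>k. of_nat (i choose j) *\<^sub>R c i))" .
qed

lemma mnorm_msum:
  fixes u :: "'i \<Rightarrow> 'a::cstar_algebra mat"
  assumes "finite I" "\<And>i. i \<in> I \<Longrightarrow> u i \<in> sqmat N"
  shows "mnorm (msum N I u) \<le> (\<Sum>i\<in>I. mnorm (u i))"
  using assms
proof (induction I rule: finite_induct)
  case empty
  have "msum N {} u = 0\<^sub>m N N" by (rule eq_matI) (auto simp: msum_def)
  then show ?case by (simp add: mnorm_zero)
next
  case (insert i I)
  have e: "msum N (insert i I) u = u i + msum N I u"
    using insert by (intro eq_matI) (auto simp: msum_def)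
  have "mnorm (u i + msum N I u) \<le> mnorm (u i) + mnorm (msum N I u)"
    using insert by (intro mnorm_add[of _ N N]) (auto simp: msum_def)
  then show ?case unfolding e using insert by simp
qed

lemma geometric_tail: "J \<le> n \<Longrightarrow> (\<Sum>k\<in>{J..<n}. (1/2::real) ^ k) \<le> 2 * (1/2) ^ J"
proof -
  assume "J \<le> n"
  then have "(\<Sum>k\<in>{J..<n}. (1/2::real) ^ k) + 2 * (1/2) ^ n = 2 * (1/2) ^ J"
    by (induction n rule: dec_induct) auto
  then show ?thesis using zero_le_power[of "1/2::real" n] by linarith
qed

context germ
begin

text \<open>Directions of norm up to \<open>4\<delta>\<close> occur below; then the homogeneous part of
  degree \<open>k\<close> is at most
  \<open>(16 \<delta> / p)\<^sup>k = (4 KK)\<^sup>-\<^sup>k\<close>, up to a constant, as the rearrangement of power series requires.\<close>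

definition \<delta> :: real where "\<delta> = p / (64 * KK)"

lemma \<delta>: "\<delta> > 0" "4 * \<delta> < p" "16 * \<delta> / p * KK = 1/4" "4 * \<delta> / p \<le> 1/2"
proof -
  have K: "KK \<ge> 8" by (rule KK_ge)
  show d: "\<delta> > 0" using p K by (simp add: \<delta>_def)
  have "\<delta> * 64 \<le> \<delta> * (64 * KK)" using K d by simp
  also have "\<dots> = p" using K by (simp add: \<delta>_def)
  finally have "\<delta> * 64 \<le> p" .
  then show "4 * \<delta> < p" "4 * \<delta> / p \<le> 1/2" using d p by (auto simp: divide_le_eq)
  show "16 * \<delta> / p * KK = 1/4" using K p by (simp add: \<delta>_def)
qed

lemma hpart_carrier: "Y \<in> MU s1 m \<Longrightarrow> hpart k Y \<in> sqmat (m * N2)"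
  by (simp add: hpart_eq)

lemma hpart_bound:
  assumes m: "m \<ge> 1" and Y: "Y \<in> MU s1 m" "mnorm Y < \<delta>"
  shows "mnorm (hpart k Y) \<le> C * (1/2) ^ k"
proof -
  have "mnorm (hpart k Y) \<le> C * (4 * \<delta> / p) ^ k"
    unfolding hpart_eq[OF Y(1)] by (rule M_bound[OF m \<delta>(1)]) (use Y in auto)
  also have "\<dots> \<le> C * (1/2) ^ k"
    using \<delta> p C_nonneg by (intro mult_left_mono power_mono) auto
  finally show ?thesis .
qed

text \<open>For a Hermitian \<open>Y\<close> of norm less than \<open>\<delta>\<close>, the line
  \<open>P + uQ\<close> with \<open>P = \<delta> + Y\<close> and \<open>Q = 2\<delta>\<close> lies in
  the cone for \<open>u \<ge> 0\<close>, where the Taylor expansion is the sum of the homogeneous parts,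
  and passes through \<open>Y\<close> at \<open>u = -1/2\<close>.  The power series of \<open>g\<close>
  at \<open>P\<close> carries the identity from \<open>u \<ge> 0\<close> to \<open>u =
  -1/2\<close>.\<close>

lemma hpart_sums:
  assumes m: "m \<ge> 1" and Y: "Y \<in> SU s1 m" "mnorm Y < \<delta>" and ij: "i < m * N2" "j < m * N2"
  shows "(\<lambda>k. hpart k Y $$ (i, j)) sums g m Y $$ (i, j)"
proof -
  let ?I = "1\<^sub>m (m * N1) :: 'a mat"
  have Yc: "Y \<in> sqmat (m * N1)" using SU_carrier[OF s1 Y(1)] .
  define P where "P = rs \<delta> ?I + Y"
  define Q where "Q = rs (2 * \<delta>) ?I"
  have P: "cone m P" unfolding P_def using Y by (intro cone_of_norm) auto
  have Q: "cone m Q" unfolding Q_def using \<delta> by (intro cone_one) simp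
  note Pc = cone_carrier[OF P] and Qc = cone_carrier[OF Q]
  have nI: "mnorm ?I \<le> 1" by (rule mnorm_one_le)
  have nQ: "mnorm Q \<le> 2 * \<delta>"
    using \<delta>(1) nI by (simp add: Q_def mnorm_rs)
  have nP: "mnorm P \<le> 2 * \<delta>"
  proof -
    have "mnorm P \<le> mnorm (rs \<delta> ?I) + mnorm Y" unfolding P_def by (rule mnorm_add[of _ "m * N1" "m * N1"]) (use Yc in auto)
    also have "mnorm (rs \<delta> ?I) \<le> \<delta>" using \<delta>(1) nI by (simp add: mnorm_rs)
    finally show ?thesis using Y by simp
  qed
  define W where "W u = P + rs u Q" for u
  have WSU: "W u \<in> SU s1 m" for u unfolding W_def by (intro SU_add[OF s1] SU_rs[OF s1] cone_SU P Q)
  have WMU: "W u \<in> MU s1 m" for u by (rule SU_MU[OF s1 WSU])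
  have Wcone: "cone m (W u)" if "u \<ge> 0" for u unfolding W_def using that by (intro cone_add cone_rs P Q)
  have nW: "mnorm (W u) \<le> 4 * \<delta>" if "0 \<le> u" "u \<le> 1" for u
  proof -
    have "mnorm (W u) \<le> 1 * mnorm P + \<bar>u\<bar> * mnorm Q"
      using mnorm_rs_add_le[OF Pc Qc, of 1 u] by (simp add: W_def)
    also have "\<dots> \<le> 1 * (2 * \<delta>) + 1 * (2 * \<delta>)" using that nP nQ by (intro add_mono mult_mono) (auto simp: mnorm_nonneg)
    finally show ?thesis by simp
  qed
  have WY: "W (- (1/2)) = Y" using Yc by (intro eq_matI) (auto simp: W_def P_def Q_def)
  have "\<exists>d. \<forall>u\<ge>-1. M m k (\<lambda>_. W u) $$ (i, j) = (\<Sum>j\<le>k. u ^ j *\<^sub>R d j)" for k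
  proof -
    have e: "rs (1 - s) (W (-1)) + rs s (W (R - 1)) = W (R * s - 1)" for R s
      using Pc Qc by (intro eq_matI) (auto simp: W_def algebra_simps)
    have "poly_on k (\<lambda>u. M m k (\<lambda>_. W (R * u - 1)) $$ (i, j))" for R
      using M_segment[OF m, of k "\<lambda>_. W (-1)" "\<lambda>_. W (R - 1)" i j] WMU ij unfolding e by blast
    then obtain c where c: "\<And>x. x \<ge> 0 \<Longrightarrow> M m k (\<lambda>_. W (x - 1)) $$ (i, j) = (\<Sum>i\<le>k. x ^ i *\<^sub>R c i)"
      using poly_on_extend[of k "\<lambda>x. M m k (\<lambda>_. W (x - 1)) $$ (i, j)"] by blast
    obtain d where d: "\<And>u::real. (\<Sum>i\<le>k. (u + 1) ^ i *\<^sub>R c i) = (\<Sum>j\<le>k. u ^ j *\<^sub>R d j)"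
      using poly_shift[of c k] by blast
    have "M m k (\<lambda>_. W u) $$ (i, j) = (\<Sum>j\<le>k. u ^ j *\<^sub>R d j)" if "u \<ge> -1" for u
      using c[of "u + 1"] d[of u] that by simp
    then show ?thesis by blast
  qed
  then obtain md where md: "\<And>k u. u \<ge> -1 \<Longrightarrow> M m k (\<lambda>_. W u) $$ (i, j) = (\<Sum>j\<le>k. u ^ j *\<^sub>R md k j)" by metis
  have P2: "mnorm P \<le> 2 * p" "mnorm Q \<le> p" using nP nQ \<delta> by auto
  have "\<exists>a. \<forall>i j. i < m * N2 \<longrightarrow> j < m * N2 \<longrightarrow>
      (\<forall>t. \<bar>t\<bar> < 1 \<longrightarrow> (\<lambda>k. t ^ k *\<^sub>R a k $$ (i, j)) sums g m (P + rs t Q) $$ (i, j))"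
    using expandZ[OF m cone_SU[OF P] P2(1)] Q P2(2) by blast
  then obtain a where a: "\<And>u. \<bar>u\<bar> < 1 \<Longrightarrow> (\<lambda>k. u ^ k *\<^sub>R a k $$ (i, j)) sums g m (P + rs u Q) $$ (i, j)"
    using ij by blast
  have "(\<lambda>k. \<Sum>j\<le>k. (- (1/2)) ^ j *\<^sub>R md k j) sums g m (W (- (1/2))) $$ (i, j)"
  proof (rule sum_of_polys_is_power_series(2)[where C = C and \<theta> = "16 * \<delta> / p" and b = "\<lambda>k. a k $$ (i, j)"
        and \<phi> = "\<lambda>u. g m (W u) $$ (i, j)" and m = md])
    fix k and u :: real assume u: "0 \<le> u" "u \<le> 1"
    have "norm (M m k (\<lambda>_. W u) $$ (i, j)) \<le> mnorm (M m k (\<lambda>_. W u))" using ij by (intro norm_entry_le_mnorm) auto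
    also have "\<dots> \<le> C * (4 * (4 * \<delta>) / p) ^ k" by (rule M_bound[OF m]) (use \<delta> WMU nW[OF u] in auto)
    finally show "norm (\<Sum>j\<le>k. u ^ j *\<^sub>R md k j) \<le> C * (16 * \<delta> / p) ^ k" using md[of u k] u by simp
  next
    fix u :: real assume u: "0 \<le> u" "u < 1"
    have "\<bar>1\<bar> * mnorm (W u) < p" using nW[of u] u \<delta>(2) by simp
    from A_series[OF m Wcone[OF u(1)] this ij]
    have "(\<lambda>k. A m k (W u) $$ (i, j)) sums g m (W u) $$ (i, j)" by simp
    moreover have "A m k (W u) $$ (i, j) = (\<Sum>j\<le>k. u ^ j *\<^sub>R md k j)" for k
      using md[of u k] u M_diagonal[OF m Wcone[OF u(1)], of k] by simp
    ultimately show "(\<lambda>k. \<Sum>j\<le>k. u ^ j *\<^sub>R md k j) sums g m (W u) $$ (i, j)" by simp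
  next
    fix u :: real assume "\<bar>u\<bar> < 1"
    from a[OF this] show "(\<lambda>k. u ^ k *\<^sub>R a k $$ (i, j)) sums g m (W u) $$ (i, j)" unfolding W_def .
  qed (use \<delta> p in auto)
  moreover have "(\<Sum>j\<le>k. (- (1/2)) ^ j *\<^sub>R md k j) = hpart k Y $$ (i, j)" for k
    using md[of "- (1/2)" k] unfolding WY hpart_eq[OF SU_MU[OF s1 Y(1)]] by simp
  ultimately show ?thesis unfolding WY by simp
qed

definition total :: "'a mat \<Rightarrow> 'b mat" where
  "total Y = (let n = dim_row Y div N1 * N2 in mat n n (\<lambda>p. \<Sum>k. hpart k Y $$ p))"

lemma total_carrier: "Y \<in> MU s1 m \<Longrightarrow> total Y \<in> sqmat (m * N2)"
  using MUc[of Y m] N_pos by (simp add: total_def Let_def)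

lemma total_entry: "Y \<in> MU s1 m \<Longrightarrow> i < m * N2 \<Longrightarrow> j < m * N2 \<Longrightarrow> total Y $$ (i, j) = (\<Sum>k. hpart k Y $$ (i, j))"
  using MUc[of Y m] N_pos by (simp add: total_def Let_def)

lemma total_eq:
  assumes m: "m \<ge> 1" and Y: "Y \<in> SU s1 m" "mnorm Y < \<delta>"
  shows "total Y = g m Y"
proof -
  have YM: "Y \<in> MU s1 m" by (rule SU_MU[OF s1 Y(1)])
  have gc: "g m Y \<in> sqmat (m * N2)" using Y \<delta> p by (intro g_carrier m) auto
  show ?thesis
  proof (rule eq_matI)
    fix i j assume "i < dim_row (g m Y)" "j < dim_col (g m Y)"
    then have ij: "i < m * N2" "j < m * N2" using gc by auto
    show "total Y $$ (i, j) = g m Y $$ (i, j)"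
      unfolding total_entry[OF YM ij] by (rule sums_unique[symmetric, OF hpart_sums[OF m Y ij]])
  qed (use gc total_carrier[OF YM] in auto)
qed

text \<open>The bound on the homogeneous parts is geometric and the same at all levels; this gives
  uniformity over the whole complex ball.\<close>

lemma total_tail:
  assumes m: "m \<ge> 1" and Y: "Y \<in> MU s1 m" "mnorm Y < \<delta>"
  shows "mnorm (msum (m * N2) {..<J} (\<lambda>k. hpart k Y) - total Y) \<le> C * (2 * (1/2) ^ J)"
proof -
  let ?S = "\<lambda>J. msum (m * N2) {..<J} (\<lambda>k. hpart k Y)"
  have Sc: "?S J \<in> sqmat (m * N2)" for J by (simp add: msum_def)
  note tc = total_carrier[OF Y(1)] and hc = hpart_carrier[OF Y(1)]
  have sumb: "summable (\<lambda>k. hpart k Y $$ (i, j))" if "i < m * N2" "j < m * N2" for i j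
  proof (rule summable_comparison_test')
    show "summable (\<lambda>k. C * (1/2) ^ k)" by (intro summable_mult summable_geometric) simp
    fix k :: nat
    have "norm (hpart k Y $$ (i, j)) \<le> mnorm (hpart k Y)" using hc[of k] that by (intro norm_entry_le_mnorm) auto
    then show "norm (hpart k Y $$ (i, j)) \<le> C * (1/2) ^ k" using hpart_bound[OF m Y, of k] by simp
  qed
  have "mnorm (total Y - ?S J) \<le> C * (2 * (1/2) ^ J)"
  proof (rule mnorm_le_of_limit[of "total Y - ?S J" "m * N2" "\<lambda>n. ?S n - ?S J" J])
    show "total Y - ?S J \<in> sqmat (m * N2)" using Sc by (rule minus_carrier_mat)
    show "?S n - ?S J \<in> sqmat (m * N2)" for n using Sc by (rule minus_carrier_mat)
    fix i j assume ij: "i < m * N2" "j < m * N2"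
    have "(\<lambda>n. \<Sum>k<n. hpart k Y $$ (i, j)) \<longlonglongrightarrow> total Y $$ (i, j)"
      unfolding total_entry[OF Y(1) ij] by (rule summable_LIMSEQ[OF sumb[OF ij]])
    then have "(\<lambda>n. (\<Sum>k<n. hpart k Y $$ (i, j)) - ?S J $$ (i, j)) \<longlonglongrightarrow> total Y $$ (i, j) - ?S J $$ (i, j)"
      by (intro tendsto_diff tendsto_const)
    then show "(\<lambda>n. (?S n - ?S J) $$ (i, j)) \<longlonglongrightarrow> (total Y - ?S J) $$ (i, j)"
      using ij tc by (simp add: msum_def)
  next
    fix n assume n: "J \<le> n"
    have "?S n - ?S J = msum (m * N2) {J..<n} (\<lambda>k. hpart k Y)"
    proof (rule eq_matI)
      fix i j assume "i < dim_row (msum (m * N2) {J..<n} (\<lambda>k. hpart k Y))" "j < dim_col (msum (m * N2) {J..<n} (\<lambda>k. hpart k Y))"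
      then have ij: "i < m * N2" "j < m * N2" by (auto simp: msum_def)
      have "{..<n} - {..<J} = {J..<n}" by auto
      then show "(?S n - ?S J) $$ (i, j) = msum (m * N2) {J..<n} (\<lambda>k. hpart k Y) $$ (i, j)"
        using ij n sum_diff[of "{..<n}" "{..<J}" "\<lambda>k. hpart k Y $$ (i, j)"] by (simp add: msum_def)
    qed (auto simp: msum_def)
    then have "mnorm (?S n - ?S J) \<le> (\<Sum>k\<in>{J..<n}. mnorm (hpart k Y))"
      using mnorm_msum[of "{J..<n}" "\<lambda>k. hpart k Y" "m * N2"] hc by simp
    also have "\<dots> \<le> (\<Sum>k\<in>{J..<n}. C * (1/2) ^ k)" by (intro sum_mono hpart_bound[OF m Y])
    also have "\<dots> \<le> C * (2 * (1/2) ^ J)"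
      unfolding sum_distrib_left[symmetric] by (intro mult_left_mono geometric_tail n C_nonneg)
    finally show "mnorm (?S n - ?S J) \<le> C * (2 * (1/2) ^ J)" .
  qed
  then show ?thesis using mnorm_minus_commute[OF tc Sc[of J]] by simp
qed

lemma total_uniform:
  assumes e: "e > 0"
  shows "\<exists>J0. \<forall>J\<ge>J0. \<forall>m\<ge>1. \<forall>Y\<in>MU s1 m. mnorm Y < \<delta> \<longrightarrow>
    mnorm (msum (m * N2) {..<J} (\<lambda>k. hpart k Y) - total Y) < e"
proof -
  have "(\<lambda>J. C * (2 * (1/2::real) ^ J)) \<longlonglongrightarrow> C * (2 * 0)"
    by (intro tendsto_mult tendsto_const LIMSEQ_power_zero) simp
  then have "\<forall>\<^sub>F J in sequentially. C * (2 * (1/2) ^ J) < e" using e by (intro order_tendstoD(2)) auto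
  then obtain J0 where J0: "\<And>J. J \<ge> J0 \<Longrightarrow> C * (2 * (1/2) ^ J) < e" by (auto simp: eventually_sequentially)
  show ?thesis
    by (intro exI[of _ J0] allI impI ballI) (use total_tail J0 in \<open>blast intro: le_less_trans\<close>)
qed

end

section \<open>Free functions intertwine\<close>

lemma kron_four_block:
  fixes r :: "'a::cstar_algebra mat"
  assumes A: "A \<in> carrier_mat n m" "B \<in> carrier_mat n m'" "D \<in> carrier_mat n' m" "E \<in> carrier_mat n' m'" and r: "r \<in> carrier_mat p q"
  shows "kron (four_block_mat A B D E) r = four_block_mat (kron A r) (kron B r) (kron D r) (kron E r)"
proof (rule kron_eqI[of _ "n + n'" p "m + m'" q, symmetric])
  have k: "kron A r \<in> carrier_mat (n * p) (m * q)" "kron B r \<in> carrier_mat (n * p) (m' * q)"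
    "kron D r \<in> carrier_mat (n' * p) (m * q)" "kron E r \<in> carrier_mat (n' * p) (m' * q)" using A r by auto
  show "four_block_mat (kron A r) (kron B r) (kron D r) (kron E r) \<in> carrier_mat ((n + n') * p) ((m + m') * q)"
    using four_block_carrier_mat[OF k(1,4)] by (simp add: add_mult_distrib)
  fix i j a b assume ij: "i < n + n'" "j < m + m'" "a < p" "b < q"
  have less: "i * p + a < n * p \<longleftrightarrow> i < n" if "a < p" for i n a p :: nat
  proof
    assume "i * p + a < n * p"
    then have "i * p < n * p" by (rule le_less_trans[OF le_add1])
    then show "i < n" by simp
  qed (use that in \<open>auto intro: block_index_less\<close>)
  have diff: "i * p + a - n * p = (i - n) * p + a" if "n \<le> i" for i n a p :: nat
  proof -
    have "n * p \<le> i * p" using that by simp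
    then show ?thesis by (simp add: diff_mult_distrib)
  qed
  have lt: "i * p + a < n * p + n' * p" "j * q + b < m * q + m' * q"
    using block_index_less[OF ij(1,3)] block_index_less[OF ij(2,4)] by (simp_all add: add_mult_distrib)
  show "four_block_mat (kron A r) (kron B r) (kron D r) (kron E r) $$ (i * p + a, j * q + b) = four_block_mat A B D E $$ (i, j) *\<^sub>C r $$ (a, b)"
    using A k r ij lt
    by (simp add: less diff not_less kron_entry[OF A(1) r] kron_entry[OF A(2) r] kron_entry[OF A(3) r] kron_entry[OF A(4) r])
qed (use A r in auto)

lemma triangular_conj:
  fixes X :: "'a::cstar_algebra mat"
  assumes X: "X \<in> sqmat n" and Z: "Z \<in> sqmat n'" and S: "S \<in> carrier_mat n n'"
  shows "four_block_mat (1\<^sub>m n) (- S) (0\<^sub>m n' n) (1\<^sub>m n') * dsum X Z * four_block_mat (1\<^sub>m n) S (0\<^sub>m n' n) (1\<^sub>m n')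
    = four_block_mat X (X * S - S * Z) (0\<^sub>m n' n) Z"
proof -
  have mS: "- S \<in> carrier_mat n n'" using S by simp
  have SZ: "- S * Z \<in> carrier_mat n n'" using mult_carrier_mat[OF mS Z] .
  have d: "dsum X Z = four_block_mat X (0\<^sub>m n n') (0\<^sub>m n' n) Z" using X Z by (simp add: dsum_def)
  have "four_block_mat (1\<^sub>m n) (- S) (0\<^sub>m n' n) (1\<^sub>m n') * four_block_mat X (0\<^sub>m n n') (0\<^sub>m n' n) Z
    = four_block_mat (1\<^sub>m n * X + (- S) * 0\<^sub>m n' n) (1\<^sub>m n * 0\<^sub>m n n' + (- S) * Z) (0\<^sub>m n' n * X + 1\<^sub>m n' * 0\<^sub>m n' n) (0\<^sub>m n' n * 0\<^sub>m n n' + 1\<^sub>m n' * Z)"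
    by (rule mult_four_block_mat) (use X Z mS in auto)
  also have "\<dots> = four_block_mat X (- S * Z) (0\<^sub>m n' n) Z"
    using left_mult_one_mat[OF X] left_mult_one_mat[OF Z] right_mult_zero_mat[OF mS] left_mult_zero_mat[OF X, of n']
      left_mult_one_mat[OF zero_carrier_mat[of n' n]] right_mult_zero_mat[OF one_carrier_mat[of n], of n'] X Z SZ by simp
  finally have 1: "four_block_mat (1\<^sub>m n) (- S) (0\<^sub>m n' n) (1\<^sub>m n') * dsum X Z = four_block_mat X (- S * Z) (0\<^sub>m n' n) Z"
    unfolding d .
  have "four_block_mat X (- S * Z) (0\<^sub>m n' n) Z * four_block_mat (1\<^sub>m n) S (0\<^sub>m n' n) (1\<^sub>m n')
    = four_block_mat (X * 1\<^sub>m n + (- S * Z) * 0\<^sub>m n' n) (X * S + (- S * Z) * 1\<^sub>m n') (0\<^sub>m n' n * 1\<^sub>m n + Z * 0\<^sub>m n' n) (0\<^sub>m n' n * S + Z * 1\<^sub>m n')"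
    by (rule mult_four_block_mat) (use X Z S SZ in auto)
  also have "\<dots> = four_block_mat X (X * S + (- S * Z)) (0\<^sub>m n' n) Z"
    using right_mult_one_mat[OF X] right_mult_one_mat[OF Z] right_mult_one_mat[OF SZ] right_mult_zero_mat[OF SZ] right_mult_zero_mat[OF Z]
      left_mult_zero_mat[OF S] right_mult_one_mat[OF zero_carrier_mat[of n' n]] X Z by simp
  also have "X * S + (- S * Z) = X * S - S * Z"
    using S Z X mult_carrier_mat[OF S Z] mult_carrier_mat[OF X S] by (simp add: minus_add_uminus_mat[of _ n n'])
  finally show ?thesis unfolding 1 .
qed

text \<open>If \<open>YS = SZ\<close>, then \<open>Y \<oplus> Z\<close> is fixed under conjugation by
  the triangular matrix with off-diagonal block \<open>S\<close>, hence so is \<open>f Y \<oplus> f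
  Z\<close>.\<close>

lemma free_fun_intertwine:
  assumes s1: "opsys s1" and s2: "opsys s2"
    and ds: "\<And>X Y. X \<in> universe (SU s1) \<Longrightarrow> Y \<in> universe (SU s1) \<Longrightarrow> dsum X Y \<in> G \<longleftrightarrow> X \<in> G \<and> Y \<in> G"
    and f: "free_map s1 G s2 (SU s2) f"
    and n: "n \<ge> 1" "n' \<ge> 1" and Y: "Y \<in> SU s1 n" "Y \<in> G" and Z: "Z \<in> SU s1 n'" "Z \<in> G"
    and S: "S \<in> carrier_mat n n'" and e: "Y * kron S (1\<^sub>m (osize s1)) = kron S (1\<^sub>m (osize s1)) * Z"
  shows "f Y * kron S (1\<^sub>m (osize s2)) = kron S (1\<^sub>m (osize s2)) * f Z"
proof -
  let ?N1 = "osize s1" and ?N2 = "osize s2"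
  note Yc = SU_carrier[OF s1 Y(1)] and Zc = SU_carrier[OF s1 Z(1)]
  have YZG: "dsum Y Z \<in> G"
    using ds[of Y Z] Y Z n by (auto simp: universe_def)
  have YZl: "dsum Y Z \<in> lev s1 G (n + n')"
    using YZG dsum_carrier[OF Yc Zc] by (simp add: lev_def add_mult_distrib)
  define T where "T = four_block_mat (1\<^sub>m n) S (0\<^sub>m n' n) (1\<^sub>m n')"
  define T' where "T' = four_block_mat (1\<^sub>m n) (- S) (0\<^sub>m n' n) (1\<^sub>m n')"
  have mS: "- S \<in> carrier_mat n n'" using S by simp
  have Tc: "T \<in> sqmat (n + n')" "T' \<in> sqmat (n + n')"
    unfolding T_def T'_def using four_block_carrier_mat[OF one_carrier_mat[of n] one_carrier_mat[of n']] by auto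
  have inv: "T * T' = 1\<^sub>m (n + n')" "T' * T = 1\<^sub>m (n + n')"
  proof -
    have "four_block_mat (1\<^sub>m n) A (0\<^sub>m n' n) (1\<^sub>m n') * four_block_mat (1\<^sub>m n) B (0\<^sub>m n' n) (1\<^sub>m n')
        = four_block_mat (1\<^sub>m n) (B + A) (0\<^sub>m n' n) (1\<^sub>m n')"
      if A: "A \<in> carrier_mat n n'" and B: "B \<in> carrier_mat n n'" for A B :: "complex mat"
      by (subst mult_four_block_mat[OF one_carrier_mat A zero_carrier_mat one_carrier_mat one_carrier_mat B zero_carrier_mat one_carrier_mat])
        (use A B in \<open>simp add: right_mult_zero_mat[OF A] left_mult_zero_mat[OF B] left_mult_one_mat[OF B] right_mult_one_mat[OF A]\<close>)
    moreover have pm: "- S + S = 0\<^sub>m n n'" "S + - S = 0\<^sub>m n n'" using S by (auto intro!: eq_matI)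
    ultimately have "T * T' = four_block_mat (1\<^sub>m n) (0\<^sub>m n n') (0\<^sub>m n' n) (1\<^sub>m n')"
      "T' * T = four_block_mat (1\<^sub>m n) (0\<^sub>m n n') (0\<^sub>m n' n) (1\<^sub>m n')"
      unfolding T_def T'_def using S mS by simp_all
    then show "T * T' = 1\<^sub>m (n + n')" "T' * T = 1\<^sub>m (n + n')" by simp_all
  qed
  have kz: "kron (0\<^sub>m n' n) (1\<^sub>m N) = (0\<^sub>m (n' * N) (n * N) :: 'c::cstar_algebra mat)" for N
    by (rule kron_zero_left) simp
  have km: "kron (- S) (1\<^sub>m N) = - (kron S (1\<^sub>m N) :: 'c::cstar_algebra mat)" for N
  proof -
    have c: "kron S (1\<^sub>m N :: 'c mat) \<in> carrier_mat (n * N) (n' * N)" using S by simp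
    show ?thesis
      by (rule kron_eqI[OF _ mS one_carrier_mat, symmetric])
        (use S c in \<open>auto simp: kron_entry[OF S one_carrier_mat] block_index_less cscale_minus_left\<close>)
  qed
  have kT: "kron T (1\<^sub>m N) = (four_block_mat (1\<^sub>m (n * N)) (kron S (1\<^sub>m N)) (0\<^sub>m (n' * N) (n * N)) (1\<^sub>m (n' * N)) :: 'c::cstar_algebra mat)"
    "kron T' (1\<^sub>m N) = (four_block_mat (1\<^sub>m (n * N)) (- kron S (1\<^sub>m N)) (0\<^sub>m (n' * N) (n * N)) (1\<^sub>m (n' * N)) :: 'c::cstar_algebra mat)" for N
    unfolding T_def T'_def kron_four_block[OF one_carrier_mat S zero_carrier_mat one_carrier_mat one_carrier_mat]
      kron_four_block[OF one_carrier_mat mS zero_carrier_mat one_carrier_mat one_carrier_mat] kz km kron_one by auto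
  have Sk: "kron S (1\<^sub>m N :: 'c::cstar_algebra mat) \<in> carrier_mat (n * N) (n' * N)" for N using S by simp
  have conj: "conj_by s T' T (dsum X W) = four_block_mat X (X * kron S (1\<^sub>m (osize s)) - kron S (1\<^sub>m (osize s)) * W) (0\<^sub>m (n' * osize s) (n * osize s)) W"
    if "X \<in> sqmat (n * osize s)" "W \<in> sqmat (n' * osize s)" for s :: "'c::cstar_algebra opsys" and X W
    unfolding conj_by_def kT by (rule triangular_conj[OF that Sk])
  have "kron S (1\<^sub>m ?N1) * Z - kron S (1\<^sub>m ?N1) * Z = 0\<^sub>m (n * ?N1) (n' * ?N1)"
    using mult_carrier_mat[OF Sk Zc] by simp
  then have c1: "conj_by s1 T' T (dsum Y Z) = dsum Y Z"
    unfolding conj[OF Yc Zc] e using Yc Zc by (simp add: dsum_def)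
  have fY: "f Y \<in> SU s2 n" "f Z \<in> SU s2 n'"
    using f n Y Z Yc Zc by (auto simp: free_map_def lev_def)
  note fYc = SU_carrier[OF s2 fY(1)] and fZc = SU_carrier[OF s2 fY(2)]
  have nn: "n + n' \<ge> 1" using n by simp
  have iv: "inverts_mat T T' \<and> inverts_mat T' T \<and> conj_by s1 T' T (dsum Y Z) \<in> G"
    unfolding c1 using inv Tc YZG by (auto simp: inverts_mat_def)
  have "conj_by s2 T' T (f (dsum Y Z)) = f (conj_by s1 T' T (dsum Y Z))"
    using f nn YZl Tc iv unfolding free_map_def by blast
  then have "conj_by s2 T' T (dsum (f Y) (f Z)) = dsum (f Y) (f Z)"
    unfolding c1 using f Y Z by (auto simp: free_map_def)
  then have eq: "four_block_mat (f Y) (f Y * kron S (1\<^sub>m ?N2) - kron S (1\<^sub>m ?N2) * f Z) (0\<^sub>m (n' * ?N2) (n * ?N2)) (f Z) = dsum (f Y) (f Z)"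
    unfolding conj[OF fYc fZc] .
  note L = mult_carrier_mat[OF fYc Sk] and R = mult_carrier_mat[OF Sk fZc]
  show ?thesis
  proof (rule eq_matI)
    fix i j assume "i < dim_row (kron S (1\<^sub>m ?N2) * f Z)" "j < dim_col (kron S (1\<^sub>m ?N2) * f Z)"
    then have ij: "i < n * ?N2" "j < n' * ?N2" using S fZc by auto
    have "(f Y * kron S (1\<^sub>m ?N2) - kron S (1\<^sub>m ?N2) * f Z) $$ (i, j)
        = four_block_mat (f Y) (f Y * kron S (1\<^sub>m ?N2) - kron S (1\<^sub>m ?N2) * f Z) (0\<^sub>m (n' * ?N2) (n * ?N2)) (f Z) $$ (i, j + n * ?N2)"
      using ij fYc fZc by simp
    also have "\<dots> = 0" unfolding eq using ij fYc fZc by (simp add: dsum_def)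
    finally have z: "(f Y * kron S (1\<^sub>m ?N2) - kron S (1\<^sub>m ?N2) * f Z) $$ (i, j) = 0" .
    have "(f Y * kron S (1\<^sub>m ?N2) - kron S (1\<^sub>m ?N2) * f Z) $$ (i, j) = (f Y * kron S (1\<^sub>m ?N2)) $$ (i, j) - (kron S (1\<^sub>m ?N2) * f Z) $$ (i, j)"
      by (rule index_minus_mat(1)) (use ij S fZc in auto)
    then show "(f Y * kron S (1\<^sub>m ?N2)) $$ (i, j) = (kron S (1\<^sub>m ?N2) * f Z) $$ (i, j)" using z by simp
  qed (use L R S fYc fZc in auto)
qed

section \<open>Functions in a sovereign class\<close>

lemma SU_1_elems:
  assumes s: "opsys s" and X: "X \<in> SU s 1"
  shows "X \<in> elems s"
  using X unfolding SU_def
proof (induction rule: tensor_span.induct)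
  have add_in: "r + r' \<in> elems s" if "r \<in> elems s" "r' \<in> elems s" for r r'
    using s that by (auto simp: opsys_def)
  have scale_in: "mscale (of_real c) r \<in> elems s" if "r \<in> elems s" for r and c :: real
    using s that by (auto simp: opsys_def)
  have one: "1\<^sub>m (osize s) \<in> elems s" using s by (auto simp: opsys_def)
  {
    case zero
    have "mscale (of_real 0) (1\<^sub>m (osize s)) = (0\<^sub>m (1 * osize s) (1 * osize s) :: 'a mat)" by (rule eq_matI) auto
    then show ?case using scale_in[OF one, of 0] by simp
  next
    case (add T r X)
    have Tc: "T \<in> sqmat 1" and Ts: "mstar T = T" using add(1) by (auto simp: herm_def)
    define c where "c = Re (T $$ (0, 0))"
    have "mstar T $$ (0, 0) = cnj (T $$ (0, 0))" using Tc by (simp add: star_complex_def)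
    then have T00: "T $$ (0, 0) = of_real c" unfolding Ts c_def by (simp add: complex_eq_iff)
    have rc: "r \<in> sqmat (osize s)" using elemsD[OF s add(2)] by simp
    have "kron T r = mscale (of_real c) r"
      by (rule kron_eqI[of _ 1 "osize s" 1 "osize s", symmetric]) (use rc Tc T00 in auto)
    then show ?case using add_in[OF scale_in[OF add(2)]] add by simp
  }
qed

lemma amp_SU: "opsys s \<Longrightarrow> X \<in> elems s \<Longrightarrow> amp m X \<in> SU s m"
  unfolding amp_def by (rule kron_SU) (auto simp: herm_def)

lemma amp_inter:
  assumes X: "X \<in> sqmat N" and S: "S \<in> carrier_mat n n'"
  shows "amp n X * kron S (1\<^sub>m N) = kron S (1\<^sub>m N) * amp n' X"
  unfolding amp_def kron_mult[OF one_carrier_mat X S one_carrier_mat] kron_mult[OF S one_carrier_mat one_carrier_mat X]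
  using left_mult_one_mat[OF S] right_mult_one_mat[OF S] left_mult_one_mat[OF X] right_mult_one_mat[OF X] by simp

lemma mpos_rs: "mpos N P \<Longrightarrow> c \<ge> 0 \<Longrightarrow> mpos N (rs c P)"
proof -
  assume "mpos N P" and c: "c \<ge> 0"
  then obtain Y where Y: "Y \<in> sqmat N" "P = mstar Y * Y" by (auto simp: mpos_def)
  have sY: "mstar Y \<in> sqmat N" using Y by simp
  have "mstar (rs (sqrt c) Y) * rs (sqrt c) Y = rs c P"
    unfolding mstar_rs Y(2) using c Y rs_mult_left[OF sY, of "rs (sqrt c) Y" N "sqrt c"] rs_mult_right[OF sY Y(1), of "sqrt c"] by simp
  then show ?thesis unfolding mpos_def using Y by (intro bexI[of _ "rs (sqrt c) Y"]) auto
qed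

text \<open>For a positive \<open>P\<close> of norm \<open>p\<close> the ordered segment from
  \<open>X\<^sup>\<oplus>\<^sup>m + Z - P\<close> to \<open>X\<^sup>\<oplus>\<^sup>m + Z + P\<close>
  lies in the ball around \<open>X\<close>.  One-variable knowledge expands \<open>f\<close> along it,
  and control bounds the coefficients by \<open>\<gamma>\<close> at the midpoint and the norm
  \<open>2p\<close> of the difference; for \<open>Z = 0\<close> the midpoint is an ampliation of
  \<open>X\<close>, so the bound is independent of \<open>m\<close>.\<close>

lemma sovereign_level_one:
  fixes f :: "('a::cstar_algebra, 'b::cstar_algebra) ffun"
  assumes D: "dominion \<DD>" and S: "sovereign_class \<DD> \<SS>" and f: "f \<in> \<SS>" and X: "X \<in> lev (dsys (fdom f)) (pts (fdom f)) 1"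
  shows "real_analytic_at_1 f X"
proof -
  define s1 where "s1 = dsys (fdom f)"
  define s2 where "s2 = fcod f"
  define G where "G = pts (fdom f)"
  have fd: "fdom f \<in> \<DD>" "free_fun f" using S f by (auto simp: sovereign_class_def)
  have FD: "FDom s1 G \<in> \<DD>" using fd by (simp add: s1_def G_def)
  have dom: "free_domain (fdom f)" using D fd by (auto simp: dominion_def)
  have s1: "opsys s1" and GU: "G \<subseteq> universe (SU s1)"
    and ds: "\<And>X Y. X \<in> universe (SU s1) \<Longrightarrow> Y \<in> universe (SU s1) \<Longrightarrow> dsum X Y \<in> G \<longleftrightarrow> X \<in> G \<and> Y \<in> G"
    using dom by (auto simp: free_domain_def s1_def G_def Let_def)
  have s2: "opsys s2" and fm: "free_map s1 G s2 (SU s2) (fval f)" using fd by (auto simp: free_fun_def s1_def s2_def G_def)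
  let ?N1 = "osize s1" and ?N2 = "osize s2"
  have XG: "X \<in> lev s1 G 1" using X by (simp add: s1_def G_def)
  obtain \<epsilon> where \<epsilon>: "\<epsilon> > 0" "matball (SU s1) 1 X \<epsilon> \<subseteq> G"
  proof -
    have "\<forall>s G. FDom s G \<in> \<DD> \<longrightarrow> (\<forall>X\<in>lev s G 1. \<exists>\<epsilon>>0. matball (SU s) 1 X \<epsilon> \<subseteq> G \<and> FDom s (matball (SU s) 1 X \<epsilon>) \<in> \<DD>)"
      using D unfolding dominion_def by blast
    then show thesis using FD XG that by blast
  qed
  have X1: "X \<in> SU s1 1"
  proof -
    have "X \<in> universe (SU s1)" and Xc: "X \<in> sqmat (1 * ?N1)" using XG GU by (auto simp: lev_def)
    then obtain n where n: "X \<in> SU s1 n" by (auto simp: universe_def)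
    have "dim_row X = n * ?N1" "dim_row X = 1 * ?N1" using SU_carrier[OF s1 n] Xc by auto
    then have "n = 1" using s1 by (auto simp: opsys_def)
    then show ?thesis using n by simp
  qed
  have Xe: "X \<in> elems s1" by (rule SU_1_elems[OF s1 X1])
  have Xc: "X \<in> sqmat ?N1" using elemsD[OF s1 Xe] by simp
  have amp: "amp m X \<in> SU s1 m" for m by (rule amp_SU[OF s1 Xe])
  have ampc: "amp m X \<in> sqmat (m * ?N1)" for m by (rule SU_carrier[OF s1 amp])
  have shift: "amp m X + Y \<in> SU s1 m" "amp m X + Y \<in> G" if m: "m \<ge> 1" and Y: "Y \<in> SU s1 m" "mnorm Y < \<epsilon>" for m Y
  proof -
    show 1: "amp m X + Y \<in> SU s1 m" by (rule SU_add[OF s1 amp Y(1)])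
    have Yc: "Y \<in> sqmat (m * ?N1)" by (rule SU_carrier[OF s1 Y(1)])
    have "amp m X - (amp m X + Y) = rs (-1) Y" using Yc ampc[of m] by (intro eq_matI) auto
    then have "mnorm (amp m X - (amp m X + Y)) < \<epsilon>" using Y by (simp add: mnorm_rs)
    then have "amp m X + Y \<in> matball (SU s1) 1 X \<epsilon>" using m 1 by (auto simp: matball_def)
    then show "amp m X + Y \<in> G" using \<epsilon> by blast
  qed
  obtain \<gamma> c e where ctl: "control \<DD> \<SS> \<gamma> c e" using S by (auto simp: sovereign_class_def)
  have ovk: "one_variable_knowledge f" using S f by (auto simp: sovereign_class_def)
  have ctl2: "mnorm (a k) \<le> \<gamma> (seg A B 0) f * e (mnorm (B - A))"
    if "n \<ge> 1" "ordered_segment (fdom f) n A B" "A \<noteq> B" "disk_series (n * ?N2) (\<lambda>t. fval f (seg A B t)) a" for n A B a k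
    using ctl that f unfolding control_def s2_def by blast
  have ctl4: "\<gamma> (amp N X) f = \<gamma> X f" if "N \<ge> 1" for N
    using ctl f XG that unfolding control_def by (auto simp: lev_def G_def)
  define p where "p = \<epsilon> / 4"
  have p: "p > 0" "\<epsilon> = 4 * p" using \<epsilon> by (auto simp: p_def)
  define g where "g m Y = fval f (amp m X + Y)" for m Y
  have series: "\<exists>a. (\<forall>k. mnorm (a k) \<le> \<gamma> (amp m X + Z) f * e (2 * p)) \<and>
      (\<forall>t. \<bar>t\<bar> < 1 \<longrightarrow> msums (m * ?N2) (\<lambda>k. mscale (of_real t ^ k) (a k)) (g m (Z + rs t P)))"
    if m: "m \<ge> 1" and Z: "Z \<in> SU s1 m" "mnorm Z \<le> 2 * p" and P: "P \<in> SU s1 m" "mpos (m * ?N1) P" "mnorm P = p" for m Z P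
  proof -
    have Zc: "Z \<in> sqmat (m * ?N1)" and Pc: "P \<in> sqmat (m * ?N1)"
      using SU_carrier[OF s1] Z P by auto
    define A where "A = amp m X + (Z + rs (-1) P)"
    define B where "B = amp m X + (Z + rs 1 P)"
    have sg: "seg A B t = amp m X + (Z + rs t P)" for t
      unfolding seg_def rs_def[symmetric] A_def B_def using ampc[of m] Zc Pc
      by (intro eq_matI) (auto simp: algebra_simps simp flip: scaleR_add_left scaleR_diff_left, auto simp: field_simps simp flip: scaleR_add_left)
    have pt: "amp m X + (Z + rs t P) \<in> G" if "\<bar>t\<bar> \<le> 1" for t
    proof (rule shift(2)[OF m])
      show "Z + rs t P \<in> SU s1 m" by (intro SU_add[OF s1] SU_rs[OF s1] Z P)
      have "mnorm (Z + rs t P) \<le> mnorm Z + \<bar>t\<bar> * mnorm P" using mnorm_add[of Z "m * ?N1" "m * ?N1" "rs t P"] Zc Pc by (simp add: mnorm_rs)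
      also have "\<dots> \<le> 2 * p + 1 * p" using Z P that p by (intro add_mono mult_mono) auto
      finally show "mnorm (Z + rs t P) < \<epsilon>" using p by simp
    qed
    have BA: "B - A = rs 2 P"
      unfolding A_def B_def using ampc[of m] Zc Pc by (intro eq_matI) (auto simp: scaleR_2)
    have nBA: "mnorm (B - A) = 2 * p" unfolding BA by (simp add: mnorm_rs P)
    have "ordered_segment (fdom f) m A B"
      unfolding ordered_segment_def s1_def[symmetric] G_def[symmetric] mle_def BA
    proof (intro conjI ballI)
      show "A \<in> lev s1 G m" using pt[of "-1"] ampc[of m] Zc Pc by (simp add: lev_def A_def)
      show "B \<in> lev s1 G m" using pt[of 1] ampc[of m] Zc Pc by (simp add: lev_def B_def)
      show "mpos (m * ?N1) (rs 2 P)" by (rule mpos_rs[OF P(2)]) simp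
      show "seg A B t \<in> G" if "t \<in> {-1..1}" for t unfolding sg using that by (intro pt) auto
    qed
    moreover have "A \<noteq> B"
    proof
      assume "A = B"
      moreover have "B \<in> sqmat (m * ?N1)" using ampc[of m] Zc Pc by (simp add: B_def)
      ultimately have "B - A = 0\<^sub>m (m * ?N1) (m * ?N1)" by simp
      then have "mnorm (B - A) = 0" by (simp add: mnorm_zero)
      then show False using nBA p by simp
    qed
    ultimately obtain a where a: "disk_series (m * ?N2) (\<lambda>t. fval f (seg A B t)) a" and os: "ordered_segment (fdom f) m A B" "A \<noteq> B"
      using ovk m unfolding one_variable_knowledge_def s2_def by blast
    have "Z + rs 0 P = Z" using Zc Pc by (intro eq_matI) auto
    then have "seg A B 0 = amp m X + Z" unfolding sg by simp
    then have "mnorm (a k) \<le> \<gamma> (amp m X + Z) f * e (2 * p)" for k using ctl2[OF m os a, of k] nBA by simp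
    moreover have "msums (m * ?N2) (\<lambda>k. mscale (of_real t ^ k) (a k)) (g m (Z + rs t P))" if "\<bar>t\<bar> < 1" for t
    proof -
      have "t \<in> {-1<..<1}" using that by auto
      then show ?thesis using a unfolding disk_series_def sg g_def by blast
    qed
    ultimately show ?thesis by blast
  qed
  note \<epsilon>_eq = p(2)
  interpret germ s1 s2 g p "\<gamma> X f * e (2 * p)"
  proof
    fix m Y assume m: "1 \<le> m" and Y: "Y \<in> SU s1 m" "mnorm Y < 4 * p"
    then have "amp m X + Y \<in> lev s1 G m" using shift[OF m Y(1)] p SU_carrier[OF s1] by (simp add: lev_def)
    then show "g m Y \<in> SU s2 m" unfolding g_def using fm m by (auto simp: free_map_def)
  next
    fix n n' Y Z and T :: "complex mat"
    assume n: "1 \<le> n" "1 \<le> n'" and Y: "Y \<in> SU s1 n" and Z: "Z \<in> SU s1 n'" and nYZ: "mnorm Y < 4 * p" "mnorm Z < 4 * p"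
      and T: "T \<in> carrier_mat n n'" and eq: "Y * kron T (1\<^sub>m ?N1) = kron T (1\<^sub>m ?N1) * Z"
    have Tk: "kron T (1\<^sub>m ?N1 :: 'a mat) \<in> carrier_mat (n * ?N1) (n' * ?N1)" using T by simp
    note Yc = SU_carrier[OF s1 Y] and Zc = SU_carrier[OF s1 Z]
    have "(amp n X + Y) * kron T (1\<^sub>m ?N1) = kron T (1\<^sub>m ?N1) * (amp n' X + Z)"
      using add_mult_distrib_mat[OF ampc Yc Tk] mult_add_distrib_mat[OF Tk ampc Zc] amp_inter[OF Xc T] eq by simp
    then show "g n Y * kron T (1\<^sub>m ?N2) = kron T (1\<^sub>m ?N2) * g n' Z"
      unfolding g_def using shift[OF n(1) Y] shift[OF n(2) Z] nYZ p
      by (intro free_fun_intertwine[OF s1 s2 ds fm n _ _ _ _ T]) auto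
  next
    fix m Z assume "1 \<le> m" "Z \<in> SU s1 m" "mnorm Z \<le> 2 * p"
    then show "\<exists>N. \<forall>P\<in>SU s1 m. mpos (m * ?N1) P \<longrightarrow> mnorm P = p \<longrightarrow> (\<exists>a. (\<forall>k. mnorm (a k) \<le> N) \<and>
        (\<forall>t. \<bar>t\<bar> < 1 \<longrightarrow> msums (m * ?N2) (\<lambda>k. mscale (of_real t ^ k) (a k)) (g m (Z + rs t P))))"
      by (intro exI[of _ "\<gamma> (amp m X + Z) f * e (2 * p)"] ballI impI series)
  next
    fix m P assume m: "1 \<le> m" and P: "P \<in> SU s1 m" "mpos (m * ?N1) P" "mnorm P = p"
    have Pc: "P \<in> sqmat (m * ?N1)" by (rule SU_carrier[OF s1 P(1)])
    have z: "0\<^sub>m (m * ?N1) (m * ?N1) + rs t P = rs t P" "amp m X + 0\<^sub>m (m * ?N1) (m * ?N1) = amp m X" for t using Pc ampc[of m] by auto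
    have "mnorm (0\<^sub>m (m * ?N1) (m * ?N1) :: 'a mat) \<le> 2 * p" using p by (simp add: mnorm_zero)
    from series[OF m SU_zero[OF s1] this P]
    show "\<exists>a. (\<forall>k. mnorm (a k) \<le> \<gamma> X f * e (2 * p)) \<and>
        (\<forall>t. \<bar>t\<bar> < 1 \<longrightarrow> msums (m * ?N2) (\<lambda>k. mscale (of_real t ^ k) (a k)) (g m (rs t P)))"
      unfolding z ctl4[OF m] .
  qed (use s1 s2 p in auto)
  show ?thesis
    unfolding real_analytic_at_1_def Let_def s1_def[symmetric] s2_def[symmetric] G_def[symmetric]
  proof (intro exI[of _ \<delta>] exI[of _ hpart] exI[of _ total] conjI)
    show "\<delta> > 0" by (rule \<delta>(1))
    show "matball (SU s1) 1 X \<delta> \<subseteq> G"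
    proof (rule subset_trans[OF _ \<epsilon>(2)])
      have "\<delta> \<le> \<epsilon>" using \<delta>(1,2) \<epsilon>_eq by linarith
      then show "matball (SU s1) 1 X \<delta> \<subseteq> matball (SU s1) 1 X \<epsilon>" by (force simp: matball_def)
    qed
    show "\<forall>j. nc_homogeneous s1 s2 j (hpart j)" using hpart_nc_homogeneous by blast
    show "\<forall>m\<ge>1. \<forall>Y\<in>MU s1 m. mnorm Y < \<delta> \<longrightarrow> total Y \<in> sqmat (m * ?N2)" using total_carrier by blast
    show "\<forall>m\<ge>1. \<forall>Y\<in>SU s1 m. mnorm Y < \<delta> \<longrightarrow> total Y = fval f (amp m X + Y)" using total_eq unfolding g_def by blast
    show "\<forall>\<epsilon>>0. \<exists>J\<^sub>0. \<forall>J\<ge>J\<^sub>0. \<forall>m\<ge>1. \<forall>Y\<in>MU s1 m. mnorm Y < \<delta> \<longrightarrow>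
        mnorm (msum (m * ?N2) {..<J} (\<lambda>j. hpart j Y) - total Y) < \<epsilon>" by (intro allI impI total_uniform)
  qed
qed

theorem theorem3p4:
  fixes \<DD> :: "'a::cstar_algebra fdomain set"
    and \<SS> :: "('a, 'b::cstar_algebra) ffun set"
    and R\<^sub>1 :: "'a opsys" and R\<^sub>2 :: "'b opsys"
    and G :: "'a mat set" and f :: "'a mat \<Rightarrow> 'b mat"
  assumes "dominion \<DD>"
    and "sovereign_class \<DD> \<SS>"
    and "opsys R\<^sub>1" and "opsys R\<^sub>2"
    and "FDom R\<^sub>1 G \<in> \<DD>"
    and "FFun (FDom R\<^sub>1 G) R\<^sub>2 f \<in> \<SS>"
  shows "\<forall>n\<ge>1. \<forall>X\<in>lev R\<^sub>1 G n. real_analytic_at n (FFun (FDom R\<^sub>1 G) R\<^sub>2 f) X"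
proof (intro allI impI ballI)
  fix n :: nat and X assume n: "1 \<le> n" and X: "X \<in> lev R\<^sub>1 G n"
  let ?f = "FFun (FDom R\<^sub>1 G) R\<^sub>2 f"
  have c: "coord_fun n ?f \<in> \<SS>" using assms(2,6) n by (auto simp: sovereign_class_def)
  have "X \<in> lev (dsys (fdom (coord_fun n ?f))) (pts (fdom (coord_fun n ?f))) 1"
    using X by (auto simp: coord_fun_def coord_dom_def coord_sys_def lev_def intro!: bexI[of _ 1])
  then show "real_analytic_at n ?f X"
    unfolding real_analytic_at_def by (rule sovereign_level_one[OF assms(1,2) c])
qed

end
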